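(* Fix a constant $K>0$. There exist a function $f$ with $f(n)=o(n)$ and a constant $C$ such that the following holds. Let $m,n,s\ge1$ be integers with $s\le Kn$, and let $S_0,\dots,S_{s-1}\subseteq[m]$ be sets with $|S_i|=n_i$ and $\sum_i n_i=n$. Then this sequence of sets can be represented using at most $\mathcal{B}(n,ms)+f(n)+C\lg\lg m$ bits such that, on the word RAM with word size $\Theta(\lg(ms))$, $\mathrm{rank}(x,S_i)$ and $\mathrm{select}(j,S_i)$ can be computed in constant time for any $x\in[m]$, $i\in[s]$, $j\in\{1,\dots,n_i\}$, and $n_i$ can be found in constant time for each $i$.
   Context: $[m]=\{0,\dots,m-1\}$, $\lg=\log_2$, $\mathcal{B}(n,m)=\lceil\lg\binom{m}{n}\rceil$. $\mathrm{rank}(x,T)$ returns $-1$ if $x\notin T$ and $|\{y\in T:y<x\}|$ otherwise; $\mathrm{select}(j,T)$ returns the $j$-th smallest element of $T$. Word RAM: words of $w$ bits with constant-time arithmetic and bitwise operations; constant time means independent of the input. *)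

theory Defs
  imports Complex_Main "HOL-Library.Landau_Symbols"
begin

unbundle bit_operations_syntax

definition set_rank :: "nat \<Rightarrow> nat set \<Rightarrow> int" where
  "set_rank x T = (if x \<in> T then int (card {y \<in> T. y < x}) else - 1)"

text \<open>Positions are counted from 1; meant for finite sets and \<open>1 \<le> j \<le> card T\<close>.\<close>

definition set_select :: "nat \<Rightarrow> nat set \<Rightarrow> nat" where
  "set_select j T = sorted_list_of_set T ! (j - 1)"

definition info_bound :: "nat \<Rightarrow> nat \<Rightarrow> int" where
  "info_bound n m = \<lceil>log 2 (real (m choose n))\<rceil>"

text \<open>
  The word size \<open>w\<close> is a parameter of the machine, not of the program, so words are naturals
  below \<open>2 ^ w\<close> and every result is truncated to \<open>w\<close> bits.  A program names its registers
  explicitly and therefore uses finitely many of them; memory is addressed indirectly through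
  the contents of a register, hence an address is itself a \<open>w\<close>-bit word.
\<close>

datatype binop = Add | Sub | Mul | Div | Mod | And | Or | Xor | Shl | Shr

datatype instr =
    Const nat nat
  | Arith binop nat nat nat
  | Compl nat nat
  | Load nat nat
  | Store nat nat
  | JumpLess nat nat nat
  | Jump nat

type_synonym program = "instr list"

record config =
  pc :: nat
  regs :: "nat \<Rightarrow> nat"
  mem :: "nat \<Rightarrow> nat"

fun binop_word :: "nat \<Rightarrow> binop \<Rightarrow> nat \<Rightarrow> nat \<Rightarrow> nat" where
  "binop_word w Add a b = take_bit w (a + b)"
| "binop_word w Sub a b = take_bit w (a + 2 ^ w - b)"
| "binop_word w Mul a b = take_bit w (a * b)"
| "binop_word w Div a b = a div b"
| "binop_word w Mod a b = a mod b"
| "binop_word w And a b = a AND b"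
| "binop_word w Or a b = a OR b"
| "binop_word w Xor a b = a XOR b"
| "binop_word w Shl a b = take_bit w (push_bit b a)"
| "binop_word w Shr a b = drop_bit b a"

fun exec_instr :: "nat \<Rightarrow> instr \<Rightarrow> config \<Rightarrow> config" where
  "exec_instr w (Const d k) c =
     c\<lparr>pc := Suc (pc c), regs := (regs c)(d := take_bit w k)\<rparr>"
| "exec_instr w (Arith f d a b) c =
     c\<lparr>pc := Suc (pc c), regs := (regs c)(d := binop_word w f (regs c a) (regs c b))\<rparr>"
| "exec_instr w (Compl d a) c =
     c\<lparr>pc := Suc (pc c), regs := (regs c)(d := regs c a XOR mask w)\<rparr>"
| "exec_instr w (Load d a) c =
     c\<lparr>pc := Suc (pc c), regs := (regs c)(d := mem c (regs c a))\<rparr>"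
| "exec_instr w (Store a b) c =
     c\<lparr>pc := Suc (pc c), mem := (mem c)(regs c a := regs c b)\<rparr>"
| "exec_instr w (JumpLess a b t) c =
     c\<lparr>pc := (if regs c a < regs c b then t else Suc (pc c))\<rparr>"
| "exec_instr w (Jump t) c = c\<lparr>pc := t\<rparr>"

definition halted :: "program \<Rightarrow> config \<Rightarrow> bool" where
  "halted P c \<longleftrightarrow> length P \<le> pc c"

definition step :: "nat \<Rightarrow> program \<Rightarrow> config \<Rightarrow> config" where
  "step w P c = (if halted P c then c else exec_instr w (P ! pc c) c)"

text \<open>
  A program starts with the word size in register 0 and its arguments in registers 1, 2, ...;
  all other registers are 0.
\<close>

definition init_config :: "nat \<Rightarrow> nat list \<Rightarrow> (nat \<Rightarrow> nat) \<Rightarrow> config" where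
  "init_config w args M =
     \<lparr>pc = 0, regs = (\<lambda>r. if r < Suc (length args) then (w # args) ! r else 0), mem = M\<rparr>"

text \<open>
  The bit string is packed into consecutive words from address 0 on, least significant bit first.
  Nothing is said about the memory behind it: its end is not marked, and the remaining bits and
  words may have any content.
\<close>

definition holds_bits :: "nat \<Rightarrow> bool list \<Rightarrow> (nat \<Rightarrow> nat) \<Rightarrow> bool" where
  "holds_bits w bs M \<longleftrightarrow>
     (\<forall>a. M a < 2 ^ w) \<and> (\<forall>k < length bs. bit (M (k div w)) (k mod w) = bs ! k)"

text \<open>
  On the machine with word size \<open>w\<close>, program \<open>P\<close> answers the query \<open>args\<close> with \<open>v\<close> within
  \<open>t\<close> steps, being given only the bit string \<open>bs\<close> in memory, and leaves \<open>bs\<close> intact.  The answer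
  is left in register 0 in two's complement, so that \<open>- 1\<close> is the word \<open>2 ^ w - 1\<close>.
\<close>

definition answers ::
  "nat \<Rightarrow> nat \<Rightarrow> program \<Rightarrow> bool list \<Rightarrow> nat list \<Rightarrow> int \<Rightarrow> bool" where
  "answers w t P bs args v \<longleftrightarrow>
     (\<forall>M. holds_bits w bs M \<longrightarrow>
        (let c = (step w P ^^ t) (init_config w args M)
         in halted P c \<and> int (regs c 0) = v mod 2 ^ w \<and> holds_bits w bs (mem c)))"

text \<open>
  Word size \<open>\<Theta>(lg N)\<close> with upper constant \<open>c\<close>.  The lower bound says that the numbers up to
  \<open>N\<close> fit into one word; the summand 1 only matters for \<open>N = 1\<close>, where \<open>lg N = 0\<close>.
\<close>

definition word_size_ok :: "real \<Rightarrow> nat \<Rightarrow> nat \<Rightarrow> bool" where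
  "word_size_ok c N w \<longleftrightarrow> log 2 (real N) < real w \<and> real w \<le> c * (log 2 (real N) + 1)"

end

theory Submission
  imports Defs
begin

text \<open>
  Laying the sets side by side turns the sequence into a single set of \<open>n\<close> keys below \<open>N = m s\<close>, and
  every query becomes a rank or select query on this set.  Let \<open>g\<close> be a slowly growing function of \<open>n\<close>.

  If \<open>N < 2 n g\<close>, the characteristic bit vector is cut into blocks of about \<open>lg n / 4\<close> bits, each
  coded by its cardinality and its index among the subsets of this cardinality.  By Vandermonde's
  identity the indices take \<open>lg (N choose n) + o(n)\<close> bits; directories and lookup tables take \<open>o(n)\<close>.

  Otherwise a key is a head followed by \<open>d\<close> bits, where \<open>2 ^ d\<close> is about \<open>N / (n g)\<close>, and each key
  owns a slot of \<open>d\<close> bits.  The distinct heads form a sparse bit vector.  If \<open>e\<close> keys repeat the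
  head of their predecessor, its binomial coefficient is smaller by a factor of about \<open>g ^ e\<close>, and
  these savings pay for further regions of the bit vector that split the buckets of equal heads:
  on each of \<open>NF\<close> levels a bucket of \<open>k\<close> keys consumes \<open>lg k + tau\<close> bits of its keys, which are then
  no longer kept in the slots.  A bucket that survives all levels has thereby freed enough room in
  its slots for the description of a perfect hash function, which finds the slot of a queried key.
  Only the parameters in the header, such as \<open>d\<close>, depend on \<open>m\<close>, which costs \<open>O(lg lg m)\<close> bits.
  Instances with bounded \<open>N\<close> are answered by tables inside the programs.
\<close>

subsection \<open>Expressions and their compilation\<close>

text \<open>The error term may depend on \<open>n\<close> only, while keys can be arbitrarily long
  compared with \<open>n\<close>: no bucket can afford a modulus or multiplier of the length of its
  keys. So a chain of ever shorter moduli brings the keys down to the length that the levels have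
  freed. The moduli come from a lower bound on the lcm of 1, ..., Q instead of an estimate on
  primes. Hashing says nothing about absent keys; a comparison with the bits left in the slot
  settles these.

  The constants determine each other. Hash data take \<open>NF\<close> units of
  \<open>lg k + tau\<close> bits in each slot, so \<open>NF\<close> levels are needed. One repeated
  head then costs up to \<open>(8 * NF + 2) * tau = GAM * tau\<close> bits in the regions, so
  \<open>g\<close> must be about \<open>T ^ GAM\<close> with \<open>T = 2 ^ tau\<close>. The
  directories are affordable if \<open>(g * T) ^ 2\<close> is \<open>O(lg n)\<close>, so
  \<open>T\<close> is about the \<open>KAP\<close>-th root of \<open>lg n\<close> with
  \<open>KAP\<close> above \<open>2 * GAM + 2\<close>. What remains is a loss of order
  \<open>n * (tau + 1) / T\<close>.

  Running time needs no analysis: queries are loop-free expressions, whose code has constant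
  length.\<close>

datatype exp =
    Reg nat
  | Lit nat
  | Bin binop exp exp
  | Ld exp
  | IfLess exp exp exp exp

primrec ev :: "nat => (nat => nat) => (nat => nat) => exp => nat" where
  "ev w M R (Reg k) = R k"
| "ev w M R (Lit k) = take_bit w k"
| "ev w M R (Bin f a b) = binop_word w f (ev w M R a) (ev w M R b)"
| "ev w M R (Ld a) = M (ev w M R a)"
| "ev w M R (IfLess a b c d) =
     (if ev w M R a < ev w M R b then ev w M R c else ev w M R d)"

primrec regs_below :: "nat => exp => bool" where
  "regs_below r (Reg k) \<longleftrightarrow> k < r"
| "regs_below r (Lit k) \<longleftrightarrow> True"
| "regs_below r (Bin f a b) \<longleftrightarrow> regs_below r a \<and> regs_below r b"
| "regs_below r (Ld a) \<longleftrightarrow> regs_below r a"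
| "regs_below r (IfLess a b c d) \<longleftrightarrow>
     regs_below r a \<and> regs_below r b \<and> regs_below r c \<and> regs_below r d"

text \<open>
  Jump targets are absolute, so the compiler carries the address \<open>p\<close> of the generated code;
  the value ends up in register \<open>r\<close> and all registers below \<open>r\<close> are preserved.
\<close>

primrec compile :: "nat => nat => exp => program" where
  "compile p r (Reg k) = [Arith Or r k k]"
| "compile p r (Lit k) = [Const r k]"
| "compile p r (Bin f a b) =
     (let ca = compile p r a; cb = compile (p + length ca) (Suc r) b
      in ca @ cb @ [Arith f r r (Suc r)])"
| "compile p r (Ld a) = compile p r a @ [Load r r]"
| "compile p r (IfLess a b c d) =
     (let ca = compile p r a;
          cb = compile (p + length ca) (Suc r) b;
          cd = compile (p + length ca + length cb + 1) r d;
          q = p + length ca + length cb + 1 + length cd + 1;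
          cc = compile q r c
      in ca @ cb @ [JumpLess r (Suc r) q] @ cd @ [Jump (q + length cc)] @ cc)"

definition code_at :: "program => nat => program => bool" where
  "code_at P p c \<longleftrightarrow> p + length c \<le> length P \<and> (\<forall>i < length c. P ! (p + i) = c ! i)"

lemma code_at_append:
  "code_at P p (c @ d) \<longleftrightarrow> code_at P p c \<and> code_at P (p + length c) d"
proof -
  have "(\<forall>i < length (c @ d). P ! (p + i) = (c @ d) ! i) \<longleftrightarrow>
    (\<forall>i < length c. P ! (p + i) = c ! i) \<and> (\<forall>i < length d. P ! (p + length c + i) = d ! i)"
    (is "?L \<longleftrightarrow> ?A \<and> ?B")
  proof (intro iffI conjI)
    assume L: ?L
    show ?A using L by (simp add: nth_append)
    show ?B
    proof (intro allI impI)
      fix i assume "i < length d"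
      then show "P ! (p + length c + i) = d ! i"
        using L[rule_format, of "length c + i"] by (simp add: add.assoc)
    qed
  next
    assume AB: "?A \<and> ?B"
    show ?L
    proof (intro allI impI)
      fix i assume i: "i < length (c @ d)"
      show "P ! (p + i) = (c @ d) ! i"
      proof (cases "i < length c")
        case True
        then show ?thesis using AB by (simp add: nth_append)
      next
        case False
        then obtain j where "i = length c + j" using le_Suc_ex not_less by blast
        then show ?thesis using AB i by (simp add: nth_append add.assoc)
      qed
    qed
  qed
  then show ?thesis unfolding code_at_def by auto
qed

lemma code_at_single: "code_at P p [x] \<longleftrightarrow> p < length P \<and> P ! p = x"
  by (auto simp: code_at_def)

definition runs :: "nat => program => nat => config => config => bool" where
  "runs w P t c c' \<longleftrightarrow> (\<exists>k \<le> t. (step w P ^^ k) c = c')"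

lemma runs_trans: "runs w P s c c' ==> runs w P t c' c'' ==> runs w P (s + t) c c''"
  unfolding runs_def
proof -
  assume "\<exists>k\<le>s. (step w P ^^ k) c = c'" "\<exists>k\<le>t. (step w P ^^ k) c' = c''"
  then obtain k l where "k \<le> s" "(step w P ^^ k) c = c'" "l \<le> t" "(step w P ^^ l) c' = c''"
    by blast
  then have "k + l \<le> s + t" "(step w P ^^ (k + l)) c = c''"
    by (auto simp: add.commute[of k l] funpow_add)
  then show "\<exists>k\<le>s + t. (step w P ^^ k) c = c''" by blast
qed

lemma runs_mono: "runs w P s c c' ==> s \<le> t ==> runs w P t c c'"
  unfolding runs_def using le_trans by blast

lemma runs_step: "pc c < length P ==> P ! pc c = i ==> runs w P 1 c (exec_instr w i c)"
  unfolding runs_def by (rule exI[of _ 1]) (auto simp: step_def halted_def)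

lemma ev_cong: "regs_below r e ==> (\<And>k. k < r ==> R k = R' k) ==> ev w M R e = ev w M R' e"
  by (induction e) auto

lemma regs_below_mono: "regs_below r e ==> r \<le> s ==> regs_below s e"
  by (induction e) auto

definition result_of :: "nat => nat => config => nat => config => bool" where
  "result_of p r c v c' \<longleftrightarrow>
     pc c' = p \<and> mem c' = mem c \<and> (\<forall>k < r. regs c' k = regs c k) \<and> regs c' r = v"

text \<open>All jumps go forward, so the length of the code bounds the number of steps. No
  \<open>Store\<close> is emitted; hence the memory, and with it the stored bit string, is left
  intact.\<close>

lemma compile_correct:
  assumes "code_at P (pc c) (compile (pc c) r e)" "regs_below r e"
  shows "\<exists>c'. runs w P (length (compile (pc c) r e)) c c' \<and>
    result_of (pc c + length (compile (pc c) r e)) r c (ev w (mem c) (regs c) e) c'"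
  using assms
proof (induction e arbitrary: r c)
  case (Reg k)
  then show ?case
    using runs_step[of c P "Arith Or r k k" w]
    by (intro exI[of _ "exec_instr w (Arith Or r k k) c"])
      (auto simp: code_at_single result_of_def)
next
  case (Lit k)
  then show ?case
    using runs_step[of c P "Const r k" w]
    by (intro exI[of _ "exec_instr w (Const r k) c"])
      (auto simp: code_at_single result_of_def)
next
  case (Bin f a b)
  let ?p = "pc c" let ?ca = "compile ?p r a" let ?cb = "compile (?p + length ?ca) (Suc r) b"
  have co: "code_at P ?p ?ca" "code_at P (?p + length ?ca) ?cb"
    "code_at P (?p + length ?ca + length ?cb) [Arith f r r (Suc r)]"
    using Bin.prems(1) by (auto simp: Let_def code_at_append add.assoc)
  obtain c1 where r1: "runs w P (length ?ca) c c1"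
    and s1: "result_of (?p + length ?ca) r c (ev w (mem c) (regs c) a) c1"
    using Bin.IH(1)[OF co(1)] Bin.prems(2) by auto
  then have pc1: "pc c1 = ?p + length ?ca" by (simp add: result_of_def)
  have rb: "regs_below (Suc r) b" using Bin.prems(2) regs_below_mono[of r b "Suc r"] by simp
  obtain c2 where r2: "runs w P (length ?cb) c1 c2"
    and s2: "result_of (?p + length ?ca + length ?cb) (Suc r) c1 (ev w (mem c1) (regs c1) b) c2"
    using Bin.IH(2)[of c1 "Suc r"] co(2) rb pc1 by auto
  have evb: "ev w (mem c1) (regs c1) b = ev w (mem c) (regs c) b"
    using s1 Bin.prems(2) by (auto simp: result_of_def intro!: ev_cong[of r])
  have pc2: "pc c2 = ?p + length ?ca + length ?cb" using s2 by (simp add: result_of_def)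
  have r3: "runs w P 1 c2 (exec_instr w (Arith f r r (Suc r)) c2)"
    using co(3) pc2 by (intro runs_step) (auto simp: code_at_single)
  have "runs w P (length ?ca + length ?cb + 1) c (exec_instr w (Arith f r r (Suc r)) c2)"
    using runs_trans[OF runs_trans[OF r1 r2] r3] .
  then show ?case
    using s1 s2 evb pc2
    by (intro exI[of _ "exec_instr w (Arith f r r (Suc r)) c2"])
      (auto simp: result_of_def Let_def)
next
  case (Ld a)
  let ?p = "pc c" let ?ca = "compile ?p r a"
  have co: "code_at P ?p ?ca" "code_at P (?p + length ?ca) [Load r r]"
    using Ld.prems(1) by (auto simp: code_at_append)
  obtain c1 where r1: "runs w P (length ?ca) c c1"
    and s1: "result_of (?p + length ?ca) r c (ev w (mem c) (regs c) a) c1"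
    using Ld.IH[OF co(1)] Ld.prems(2) by auto
  have r2: "runs w P 1 c1 (exec_instr w (Load r r) c1)"
    using co(2) s1 by (intro runs_step) (auto simp: code_at_single result_of_def)
  show ?case
    using runs_trans[OF r1 r2] s1
    by (intro exI[of _ "exec_instr w (Load r r) c1"]) (auto simp: result_of_def)
next
  case (IfLess a b x y)
  let ?p = "pc c" let ?ca = "compile ?p r a" let ?cb = "compile (?p + length ?ca) (Suc r) b"
  let ?cd = "compile (?p + length ?ca + length ?cb + 1) r y"
  let ?q = "?p + length ?ca + length ?cb + 1 + length ?cd + 1"
  let ?cc = "compile ?q r x"
  have co: "code_at P ?p ?ca" "code_at P (?p + length ?ca) ?cb"
    "code_at P (?p + length ?ca + length ?cb) [JumpLess r (Suc r) ?q]"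
    "code_at P (?p + length ?ca + length ?cb + 1) ?cd"
    "code_at P (?p + length ?ca + length ?cb + 1 + length ?cd) [Jump (?q + length ?cc)]"
    "code_at P ?q ?cc"
    using IfLess.prems(1) unfolding compile.simps Let_def code_at_append
    by (simp_all add: add.assoc)
  have len: "length (compile ?p r (IfLess a b x y)) =
      length ?ca + length ?cb + 1 + length ?cd + 1 + length ?cc"
    by (simp add: Let_def)
  obtain c1 where r1: "runs w P (length ?ca) c c1"
    and s1: "result_of (?p + length ?ca) r c (ev w (mem c) (regs c) a) c1"
    using IfLess.IH(1)[OF co(1)] IfLess.prems(2) by auto
  then have pc1: "pc c1 = ?p + length ?ca" by (simp add: result_of_def)
  have rb: "regs_below (Suc r) b" using IfLess.prems(2) regs_below_mono[of r b "Suc r"] by simp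
  obtain c2 where r2: "runs w P (length ?cb) c1 c2"
    and s2: "result_of (?p + length ?ca + length ?cb) (Suc r) c1 (ev w (mem c1) (regs c1) b) c2"
    using IfLess.IH(2)[of c1 "Suc r"] co(2) rb pc1 by auto
  have evb: "ev w (mem c1) (regs c1) b = ev w (mem c) (regs c) b"
    using s1 IfLess.prems(2) by (auto simp: result_of_def intro!: ev_cong[of r])
  have pc2: "pc c2 = ?p + length ?ca + length ?cb" using s2 by (simp add: result_of_def)
  define c3 where "c3 = exec_instr w (JumpLess r (Suc r) ?q) c2"
  have r3: "runs w P 1 c2 c3"
    unfolding c3_def using co(3) pc2 by (intro runs_step) (auto simp: code_at_single)
  have R3: "runs w P (length ?ca + length ?cb + 1) c c3"
    using runs_trans[OF runs_trans[OF r1 r2] r3] .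
  have m3: "mem c3 = mem c" "\<forall>k<r. regs c3 k = regs c k"
    using s1 s2 by (auto simp: c3_def result_of_def)
  have evx: "ev w (mem c3) (regs c3) x = ev w (mem c) (regs c) x"
    and evy: "ev w (mem c3) (regs c3) y = ev w (mem c) (regs c) y"
    using m3 IfLess.prems(2) by (auto intro!: ev_cong[of r])
  show ?case
  proof (cases "ev w (mem c) (regs c) a < ev w (mem c) (regs c) b")
    case True
    then have pc3: "pc c3 = ?q" using s1 s2 evb by (auto simp: c3_def result_of_def)
    obtain c4 where r4: "runs w P (length ?cc) c3 c4"
      and s4: "result_of (?q + length ?cc) r c3 (ev w (mem c3) (regs c3) x) c4"
      using IfLess.IH(3)[of c3 r] co(6) IfLess.prems(2) pc3 by auto
    have "runs w P (length (compile ?p r (IfLess a b x y))) c c4"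
      unfolding len by (rule runs_mono[OF runs_trans[OF R3 r4]]) simp
    moreover have "result_of (?p + length (compile ?p r (IfLess a b x y))) r c
        (ev w (mem c) (regs c) (IfLess a b x y)) c4"
      using s4 m3 evx True unfolding result_of_def len by auto
    ultimately show ?thesis by blast
  next
    case False
    then have pc3: "pc c3 = ?p + length ?ca + length ?cb + 1"
      using s1 s2 evb by (auto simp: c3_def result_of_def)
    obtain c4 where r4: "runs w P (length ?cd) c3 c4"
      and s4: "result_of (?p + length ?ca + length ?cb + 1 + length ?cd) r c3
        (ev w (mem c3) (regs c3) y) c4"
      using IfLess.IH(4)[of c3 r] co(4) IfLess.prems(2) pc3 by auto
    define c5 where "c5 = exec_instr w (Jump (?q + length ?cc)) c4"
    have r5: "runs w P 1 c4 c5"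
      unfolding c5_def using co(5) s4 by (intro runs_step) (auto simp: code_at_single result_of_def)
    have "runs w P (length (compile ?p r (IfLess a b x y))) c c5"
      unfolding len by (rule runs_mono[OF runs_trans[OF runs_trans[OF R3 r4] r5]]) simp
    moreover have "result_of (?p + length (compile ?p r (IfLess a b x y))) r c
        (ev w (mem c) (regs c) (IfLess a b x y)) c5"
      using s4 m3 evy False unfolding result_of_def len c5_def by auto
    ultimately show ?thesis by blast
  qed
qed

definition query_program :: "exp => program" where
  "query_program e = compile 0 3 e @ [Arith Or 0 3 3]"

definition query_regs :: "nat => nat list => nat => nat" where
  "query_regs w args r = (if r < Suc (length args) then (w # args) ! r else 0)"

lemma halted_funpow: "halted P c ==> (step w P ^^ k) c = c"
  by (induction k) (auto simp: step_def)

text \<open>A halted configuration is a fixed point of \<open>step\<close>, so any \<open>t\<close>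
  not below the program length serves as time bound. Registers 0 to 2 hold the word size and up to
  two arguments; the code works from register 3 upwards.\<close>

lemma answers_query_program:
  assumes "regs_below 3 e" "length (query_program e) \<le> t"
    and "\<And>M. holds_bits w bs M ==> int (ev w M (query_regs w args) e) = v mod 2 ^ w"
  shows "answers w t (query_program e) bs args v"
  unfolding answers_def Let_def
proof (intro allI impI)
  fix M assume M: "holds_bits w bs M"
  let ?P = "query_program e" let ?c = "init_config w args M"
  have rg: "regs ?c = query_regs w args" "mem ?c = M" "pc ?c = 0"
    by (auto simp: init_config_def query_regs_def fun_eq_iff)
  have co: "code_at ?P (pc ?c) (compile (pc ?c) 3 e)"
    by (auto simp: query_program_def rg code_at_def nth_append)
  obtain c1 where r1: "runs w ?P (length (compile 0 3 e)) ?c c1"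
    and s1: "result_of (length (compile 0 3 e)) 3 ?c (ev w M (query_regs w args) e) c1"
    using compile_correct[OF co assms(1), of w] rg by auto
  define c2 where "c2 = exec_instr w (Arith Or 0 3 3) c1"
  have "runs w ?P 1 c1 c2"
    unfolding c2_def using s1
    by (intro runs_step) (auto simp: query_program_def nth_append result_of_def)
  from runs_trans[OF r1 this] obtain k where k: "k \<le> length ?P" "(step w ?P ^^ k) ?c = c2"
    by (auto simp: runs_def query_program_def)
  have h: "halted ?P c2"
    using s1 by (auto simp: c2_def halted_def query_program_def result_of_def)
  have "(step w ?P ^^ t) ?c = (step w ?P ^^ (t - k)) ((step w ?P ^^ k) ?c)"
    using k(1) assms(2) by (metis funpow_add comp_apply le_add_diff_inverse2 le_trans)
  then have fin: "(step w ?P ^^ t) ?c = c2" using k(2) h halted_funpow by simp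
  show "halted ?P ((step w ?P ^^ t) ?c) \<and>
      int (regs ((step w ?P ^^ t) ?c) 0) = v mod 2 ^ w \<and>
      holds_bits w bs (mem ((step w ?P ^^ t) ?c))"
    unfolding fin using h s1 assms(3)[OF M] M rg by (auto simp: c2_def result_of_def)
qed

subsection \<open>Reading bit fields, parameters and arrays\<close>

abbreviation eAdd (infixl "\<oplus>" 65) where "a \<oplus> b \<equiv> Bin Add a b"
abbreviation eSub (infixl "\<ominus>" 65) where "a \<ominus> b \<equiv> Bin Sub a b"
abbreviation eMul (infixl "\<otimes>" 70) where "a \<otimes> b \<equiv> Bin Mul a b"
abbreviation eDiv (infixl "\<oslash>" 70) where "a \<oslash> b \<equiv> Bin Div a b"
abbreviation eMod (infixl "\<odot>" 70) where "a \<odot> b \<equiv> Bin Mod a b"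
abbreviation eShl (infixl "\<lless>" 68) where "a \<lless> b \<equiv> Bin Shl a b"
abbreviation eShr (infixl "\<ggreater>" 68) where "a \<ggreater> b \<equiv> Bin Shr a b"
abbreviation "WS \<equiv> Reg 0"

lemma ev_add: "x + y < 2 ^ w ==> ev w M R a = x ==> ev w M R b = y ==> ev w M R (a \<oplus> b) = x + y"
  by (simp add: take_bit_nat_eq_self)

lemma ev_mul: "x * y < 2 ^ w ==> ev w M R a = x ==> ev w M R b = y ==> ev w M R (a \<otimes> b) = x * y"
  by (simp add: take_bit_nat_eq_self)

lemma ev_sub:
  "y \<le> x ==> x < 2 ^ w ==> ev w M R a = x ==> ev w M R b = y ==> ev w M R (a \<ominus> b) = x - y"
  by (simp add: take_bit_eq_mod) (metis Nat.add_diff_assoc2 add.commute less_imp_diff_less mod_add_self1 mod_less)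

lemma ev_div: "ev w M R a = x ==> ev w M R b = y ==> ev w M R (a \<oslash> b) = x div y"
  by simp

lemma ev_mod: "ev w M R a = x ==> ev w M R b = y ==> ev w M R (a \<odot> b) = x mod y"
  by simp

lemma ev_shr: "ev w M R a = x ==> ev w M R b = y ==> ev w M R (a \<ggreater> b) = x div 2 ^ y"
  by (simp add: drop_bit_eq_div)

lemma ev_shl: "x * 2 ^ y < 2 ^ w ==> ev w M R a = x ==> ev w M R b = y ==> ev w M R (a \<lless> b) = x * 2 ^ y"
  by (simp add: push_bit_eq_mult take_bit_nat_eq_self)

lemma ev_lit: "k < 2 ^ w ==> ev w M R (Lit k) = k"
  by (simp add: take_bit_nat_eq_self)

definition rd_idx :: "exp => exp => exp" where
  "rd_idx b p = b \<oslash> WS \<oplus> p \<oslash> WS \<oplus> (b \<odot> WS \<oplus> p \<odot> WS) \<oslash> WS"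

definition rd_shift :: "exp => exp => exp" where
  "rd_shift b p = (b \<odot> WS \<oplus> p \<odot> WS) \<odot> WS"

definition low_mask :: "exp => exp" where
  "low_mask l = (Lit 1 \<lless> l) \<ominus> Lit 1"

text \<open>
  The field starts at bit \<open>b + p\<close>; this sum may exceed a word, therefore base and offset are
  divided by the word size separately.
\<close>

definition RD :: "exp => exp => exp => exp" where
  "RD b p l = Bin And (Bin Or (Ld (rd_idx b p) \<ggreater> rd_shift b p)
     (Ld (rd_idx b p \<oplus> Lit 1) \<lless> (WS \<ominus> rd_shift b p))) (low_mask l)"

text \<open>For \<open>k = w\<close> the shift yields 0 and the subtraction wraps around to a word
  of ones.\<close>

lemma ev_low_mask:
  assumes "ev w M R l = k" "k \<le> w" "1 \<le> w"
  shows "ev w M R (low_mask l) = mask k"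
proof (cases "k = w")
  case True
  have one: "take_bit w (1::nat) = 1" using assms(3) by (simp add: take_bit_nat_eq_self)
  have e: "ev w M R (low_mask l) = take_bit w (0 + 2 ^ w - 1)"
    using assms True by (simp add: low_mask_def push_bit_eq_mult one take_bit_eq_mod)
  show ?thesis unfolding e True by (simp add: mask_eq_exp_minus_1 take_bit_nat_eq_self)
next
  case False
  then have k: "k < w" using assms by simp
  have one: "take_bit w (1::nat) = 1" using assms(3) by (simp add: take_bit_nat_eq_self)
  have lt: "(2::nat) ^ k < 2 ^ w" using k by simp
  have "ev w M R (Lit 1 \<lless> l) = 1 * 2 ^ k"
    using assms one lt by (intro ev_shl) auto
  then have "ev w M R (low_mask l) = 1 * 2 ^ k - 1"
    unfolding low_mask_def using lt one by (intro ev_sub) auto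
  then show ?thesis by (simp add: mask_eq_exp_minus_1)
qed

lemma two_mul_less_exp: "4 \<le> w ==> 2 * w + 2 < 2 ^ w" for w :: nat
  by (induction w rule: dec_induct) auto

text \<open>Although \<open>x + y\<close> may need \<open>w + 1\<close> bits, its quotient by
  \<open>w \<ge> 4\<close> is at most \<open>2 ^ (w - 1)\<close>, so the word with the start of the
  field and the word behind it are both addressable.\<close>

lemma ev_rd_idx:
  assumes "R 0 = w" "4 \<le> w" "ev w M R b = x" "ev w M R p = y" "x < 2 ^ w" "y < 2 ^ w"
  shows "ev w M R (rd_idx b p) = (x + y) div w" "ev w M R (rd_shift b p) = (x + y) mod w"
    "(x + y) div w + 1 < 2 ^ w"
proof -
  have W: "ev w M R WS = w" by (simp add: assms(1))
  have w2: "2 * w + 2 < 2 ^ w" using two_mul_less_exp[OF assms(2)] .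
  have m: "x mod w + y mod w < 2 ^ w"
  proof -
    have "x mod w < w" "y mod w < w" using assms(2) by simp_all
    then show ?thesis using w2 by linarith
  qed
  have s: "ev w M R (b \<odot> WS \<oplus> p \<odot> WS) = x mod w + y mod w"
    by (rule ev_add[OF m ev_mod[OF assms(3) W] ev_mod[OF assms(4) W]])
  then show "ev w M R (rd_shift b p) = (x + y) mod w"
    unfolding rd_shift_def using ev_mod[OF s W] by (simp only: mod_add_eq)
  have eq: "x div w + y div w + (x mod w + y mod w) div w = (x + y) div w"
    by (rule div_add1_eq[symmetric])
  have "(x + y) div w \<le> (2 * 2 ^ w) div 4"
  proof -
    have "(x + y) div w \<le> (x + y) div 4" using assms(2) by (intro div_le_mono2) auto
    also have "... \<le> (2 * 2 ^ w) div 4" using assms(5,6) by (intro div_le_mono) linarith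
    finally show ?thesis .
  qed
  moreover have "(2 * 2 ^ w) div 4 + 1 < (2::nat) ^ w"
  proof -
    have "(2::nat) * 2 ^ w div 4 = 2 ^ (w - 1)"
      using assms(2) by (cases w) auto
    moreover have "(2::nat) ^ w = 2 * 2 ^ (w - 1)" using assms(2) by (cases w) auto
    moreover have "(8::nat) \<le> 2 ^ (w - 1)"
      using power_increasing[of 3 "w - 1" "2::nat"] assms(2) by simp
    ultimately show ?thesis by linarith
  qed
  ultimately show lt: "(x + y) div w + 1 < 2 ^ w" by linarith
  have "x div w + y div w + (x mod w + y mod w) div w < 2 ^ w" using lt eq by linarith
  then have "ev w M R (rd_idx b p) = x div w + y div w + (x mod w + y mod w) div w"
    unfolding rd_idx_def
    by (intro ev_add[OF _ ev_add[OF _ ev_div[OF assms(3) W] ev_div[OF assms(4) W]] ev_div[OF s W]])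
      auto
  then show "ev w M R (rd_idx b p) = (x + y) div w" using eq by simp
qed

lemma div_mod_add_less: "b < w ==> (a * w + b) div w = a \<and> (a * w + b) mod w = b" for a b w :: nat
  by simp

text \<open>A field touches at most two consecutive words. If it starts at a word boundary, the
  second word is shifted by \<open>w\<close> and truncated to 0, so the program needs no case
  distinction. Whatever is read beyond the field is removed by the mask.\<close>

lemma ev_RD:
  assumes M: "holds_bits w bs M" and R: "R 0 = w" and w: "4 \<le> w"
    and ev: "ev w M R b = x" "ev w M R p = y" "ev w M R l = n"
    and lt: "x < 2 ^ w" "y < 2 ^ w" and n: "n \<le> w" and len: "x + y + n \<le> length bs"
    and v: "v < 2 ^ n" "\<And>k. k < n ==> bit v k = bs ! (x + y + k)"
  shows "ev w M R (RD b p l) = v"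
proof (rule bit_eqI)
  fix k
  define i r where "i = (x + y) div w" and "r = (x + y) mod w"
  have r: "r < w" using w by (simp add: r_def)
  have w0: "0 < w" using w by simp
  note id = ev_rd_idx[OF R w ev(1,2) lt, folded i_def r_def]
  have i1: "ev w M R (rd_idx b p \<oplus> Lit 1) = i + 1"
    using id w by (intro ev_add) (auto simp: take_bit_nat_eq_self)
  have sr: "ev w M R (WS \<ominus> rd_shift b p) = w - r"
    using id r R less_exp[of w] by (intro ev_sub) auto
  have e: "ev w M R (RD b p l) = ((drop_bit r (M i)) OR take_bit w (push_bit (w - r) (M (i + 1))))
      AND mask n"
    unfolding RD_def using id(1,2) i1 sr ev_low_mask[OF ev(3) n] w by simp
  have bM: "\<not> bit (M a) j" if "w \<le> j" for a j
  proof -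
    have "M a < 2 ^ w" using M by (simp add: holds_bits_def)
    then have "take_bit w (M a) = M a" by (simp add: take_bit_nat_eq_self)
    then show ?thesis using that by (metis bit_take_bit_iff not_less)
  qed
  show "bit (ev w M R (RD b p l)) k = bit v k"
  proof (cases "k < n")
    case False
    then have "\<not> bit v k" using v(1) by (metis bit_take_bit_iff take_bit_nat_eq_self)
    then show ?thesis unfolding e using False by (simp add: bit_simps)
  next
    case True
    have hb: "bit (M ((x + y + k) div w)) ((x + y + k) mod w) = bs ! (x + y + k)"
      using M True len by (simp add: holds_bits_def)
    have xy: "x + y = i * w + r" by (simp add: i_def r_def)
    show ?thesis
    proof (cases "r + k < w")
      case rk: True
      have "(x + y + k) div w = i" "(x + y + k) mod w = r + k"
        using rk w0 by (auto simp: xy add.assoc)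
      then have "bit (M i) (r + k) = bs ! (x + y + k)" using hb by simp
      then show ?thesis unfolding e using True rk v(2)[OF True] n
        by (auto simp: bit_simps)
    next
      case rk: False
      then have xk: "x + y + k = (i + 1) * w + (r + k - w)" by (simp add: xy)
      have lt: "r + k - w < w" using r True n by linarith
      have "(x + y + k) div w = i + 1" "(x + y + k) mod w = r + k - w"
        unfolding xk using div_mod_add_less[OF lt] by blast+
      then have "bit (M (i + 1)) (r + k - w) = bs ! (x + y + k)" using hb by simp
      moreover have "k - (w - r) = r + k - w" using r rk by linarith
      moreover have "\<not> bit (M i) (r + k)" using bM rk by simp
      moreover have "w - r \<le> k" "k < w" using rk True n by linarith+
      ultimately show ?thesis unfolding e using True v(2)[OF True]
        by (auto simp: bit_simps)
    qed
  qed
qed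

section \<open>Bit strings composed of a header with parameters and of packed arrays\<close>

definition nat_bits :: "nat => nat => bool list" where
  "nat_bits l x = map (bit x) [0..<l]"

lemma length_nat_bits [simp]: "length (nat_bits l x) = l"
  by (simp add: nat_bits_def)

text \<open>Width of an entry in bits, number of entries, and the entries themselves.\<close>

type_synonym arr = "nat \<times> nat \<times> (nat => nat)"

definition arr_size :: "arr => nat" where
  "arr_size A = (case A of (v, l, f) => l * v)"

definition arr_bits :: "arr => bool list" where
  "arr_bits A = (case A of (v, l, f) => map (\<lambda>j. bit (f (j div v)) (j mod v)) [0..<l * v])"

definition arr_offs :: "arr list => nat => nat" where
  "arr_offs As k = sum_list (map arr_size (take k As))"

definition NPAR :: nat where "NPAR = 64"

definition all_params :: "arr list => nat list => nat list" where
  "all_params As ps =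
     (let xs = concat (map (\<lambda>k. [arr_offs As k, fst (As ! k)]) [0..<length As]) @ ps
      in xs @ replicate (NPAR - length xs) 0)"

definition header_size :: "nat => nat" where
  "header_size q = q * (2 + 4 * NPAR) + 2"

text \<open>The leading \<open>True\<close> tells this format from that of
  \<open>small_bits\<close>. Parameters get \<open>4 * q\<close> bits because the prefix that
  announces \<open>q\<close> and \<open>q\<close> itself, \<open>2 * q + 2\<close> bits in all, must
  lie in the first word, while a parameter may be as long as a word.\<close>

definition mk_bits :: "nat => nat list => arr list => bool list" where
  "mk_bits q ps As = [True] @ replicate q True @ [False] @ nat_bits q q @
     concat (map (nat_bits (4 * q)) (all_params As ps)) @ concat (map arr_bits As)"

lemma length_arr_bits: "length (arr_bits A) = arr_size A"
  by (cases A) (simp add: arr_bits_def arr_size_def)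

lemma length_all_params:
  "2 * length As + length ps \<le> NPAR ==> length (all_params As ps) = NPAR"
  by (simp add: all_params_def Let_def length_concat comp_def sum_list_triv)

lemma concat_pairs_nth:
  "k < n ==> concat (map (\<lambda>k. [f k, g k]) [0..<n]) ! (2 * k) = f k"
  "k < n ==> concat (map (\<lambda>k. [f k, g k]) [0..<n]) ! (2 * k + 1) = g k"
  by (induction n) (auto simp: nth_append length_concat comp_def sum_list_triv less_Suc_eq)

lemma all_params_nth:
  assumes "k < length As"
  shows "all_params As ps ! (2 * k) = arr_offs As k" "all_params As ps ! (2 * k + 1) = fst (As ! k)"
  using assms concat_pairs_nth[of k "length As" "arr_offs As" "\<lambda>k. fst (As ! k)"]
  by (auto simp: all_params_def Let_def nth_append length_concat comp_def sum_list_triv)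

lemma all_params_nth_own:
  assumes "j < length ps"
  shows "all_params As ps ! (2 * length As + j) = ps ! j"
  using assms
  by (auto simp: all_params_def Let_def nth_append length_concat comp_def sum_list_triv)

lemma nth_concat:
  "k < length xss ==> i < length (xss ! k) ==>
    sum_list (map length (take k xss)) + i < length (concat xss) \<and>
    concat xss ! (sum_list (map length (take k xss)) + i) = xss ! k ! i"
proof (induction xss arbitrary: k)
  case (Cons xs xss)
  then show ?case by (cases k) (auto simp: nth_append add.assoc)
qed simp

lemma length_mk_bits:
  assumes "2 * length As + length ps \<le> NPAR"
  shows "length (mk_bits q ps As) = header_size q + arr_offs As (length As)"
  using length_all_params[OF assms]
  by (simp add: mk_bits_def header_size_def arr_offs_def length_concat comp_def length_arr_bits
      sum_list_triv algebra_simps)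

text \<open>
  The unary prefix yields \<open>2 ^ q\<close> as the lowest zero bit; the field width \<open>q\<close> itself is stored
  in the \<open>q\<close> bits behind it.
\<close>

definition HV :: exp where "HV = Ld (Lit 0) \<ggreater> Lit 1"
definition HQ2 :: exp where "HQ2 = Bin And (HV \<oplus> Lit 1) (Bin Xor HV (Lit 0 \<ominus> Lit 1))"
definition HQ :: exp where "HQ = (HV \<oslash> (HQ2 \<oplus> HQ2)) \<odot> HQ2"
definition HE :: exp where "HE = HQ \<otimes> Lit (2 + 4 * NPAR) \<oplus> Lit 2"

text \<open>A field of \<open>4 * q\<close> bits may exceed a word, so it is read in two
  halves.\<close>

definition PAR :: "nat => exp" where
  "PAR j = RD (Lit 0) (HQ \<otimes> Lit (2 + 4 * j) \<oplus> Lit 2) (HQ \<oplus> HQ) \<oplus>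
     (RD (Lit 0) (HQ \<otimes> Lit (2 + 4 * j + 2) \<oplus> Lit 2) (HQ \<oplus> HQ) \<lless> (HQ \<oplus> HQ))"

definition RDK :: "nat => exp => exp => exp" where
  "RDK k p l = RD (HE \<oplus> PAR (2 * k)) p l"

definition ARR :: "nat => exp => exp" where
  "ARR k e = RDK k (e \<otimes> PAR (2 * k + 1)) (PAR (2 * k + 1))"

locale stored =
  fixes w :: nat and M R :: "nat => nat" and q :: nat and ps :: "nat list" and As :: "arr list"
  assumes holds: "holds_bits w (mk_bits q ps As) M"
    and R0: "R 0 = w"
    and np: "2 * length As + length ps \<le> NPAR"
    and w16: "16 \<le> w" and q0: "0 < q" and qw: "2 * q + 2 \<le> w"
    and par: "\<And>x. x \<in> set (all_params As ps) ==> x < 2 ^ (4 * q) \<and> x < 2 ^ w"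
    and arrs: "\<And>k. k < length As ==>
      header_size q + arr_offs As k < 2 ^ w \<and> arr_size (As ! k) < 2 ^ w \<and> fst (As ! k) \<le> w"
begin

abbreviation "bs \<equiv> mk_bits q ps As"
abbreviation "E \<equiv> ev w M R"

lemma exp_bound: "300 * w + 2 < 2 ^ w"
  using w16 by (induction w rule: dec_induct) auto

lemma len_ge: "header_size q \<le> length bs"
  using np by (simp add: length_mk_bits)

lemma bs_prefix: "bs ! 0" "\<And>k. k < q ==> bs ! (1 + k)" "\<not> bs ! (1 + q)"
  "\<And>k. k < q ==> bs ! (2 + q + k) = bit q k"
  by (auto simp: mk_bits_def nth_append nat_bits_def)

lemma E_HV: "E HV = M 0 div 2"
proof -
  have "take_bit w 1 = (1::nat)" using w16 by (simp add: take_bit_nat_eq_self)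
  then show ?thesis by (simp add: HV_def drop_bit_eq_div)
qed

lemma bit_M0: "k < length bs ==> k < w ==> bit (M 0) k = bs ! k"
  using holds by (auto simp: holds_bits_def dest!: spec[of _ k])

lemma header_size_ge: "2 * q + 2 \<le> header_size q"
  by (simp add: header_size_def NPAR_def)

lemma HV_form: "\<exists>r. M 0 div 2 = 2 ^ (q + 1) * r + (2 ^ q - 1) \<and> r mod 2 ^ q = q"
proof -
  let ?v = "M 0 div 2"
  have b: "bit ?v k = bs ! (1 + k)" if "k < 2 * q + 1" for k
  proof -
    have "bit ?v k = bit (M 0) (1 + k)" by (simp add: bit_Suc)
    also have "... = bs ! (1 + k)"
      using that qw len_ge header_size_ge by (intro bit_M0) linarith+
    finally show ?thesis .
  qed
  have 1: "take_bit (q + 1) ?v = mask q"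
  proof (rule bit_eqI)
    fix k
    show "bit (take_bit (q + 1) ?v) k = bit (mask q :: nat) k"
    proof (cases "k < q + 1")
      case True
      then have "bit ?v k = (k < q)"
        using b[of k] bs_prefix(2)[of k] bs_prefix(3) by (cases "k = q") auto
      then show ?thesis using True by (auto simp: bit_simps)
    qed (simp add: bit_simps)
  qed
  have 2: "take_bit q (?v div 2 ^ (q + 1)) = q"
  proof (rule bit_eqI)
    fix k
    show "bit (take_bit q (?v div 2 ^ (q + 1))) k = bit q k"
    proof (cases "k < q")
      case True
      have "bit (?v div 2 ^ (q + 1)) k = bit ?v (q + 1 + k)"
        by (simp only: drop_bit_eq_div[symmetric] bit_drop_bit_eq comp_apply)
      also have "... = bs ! (2 + q + k)" using b[of "q + 1 + k"] True by (simp add: add.commute)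
      also have "... = bit q k" using bs_prefix(4)[OF True] .
      finally show ?thesis using True by (simp add: bit_simps)
    next
      case False
      have "q < 2 ^ q" by simp
      then have "take_bit q q = q" by (rule take_bit_nat_eq_self)
      then have "\<not> bit q k" using False by (metis bit_take_bit_iff)
      then show ?thesis using False by (simp add: bit_simps)
    qed
  qed
  have "?v = 2 ^ (q + 1) * (?v div 2 ^ (q + 1)) + take_bit (q + 1) ?v"
    unfolding take_bit_eq_mod using mult_div_mod_eq[of "2 ^ (q + 1)" ?v] by simp
  then have "?v = 2 ^ (q + 1) * (?v div 2 ^ (q + 1)) + (2 ^ q - 1)"
    unfolding 1 by (simp add: mask_eq_exp_minus_1)
  then show ?thesis using 2 by (auto simp: take_bit_eq_mod)
qed

lemma M_less: "M a < 2 ^ w"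
  using holds by (simp add: holds_bits_def)

lemma q_exp: "2 * 2 ^ q < (2::nat) ^ w"
proof -
  have "(2::nat) ^ (q + 1) < 2 ^ w" using qw q0 by (intro power_strict_increasing) auto
  then show ?thesis by simp
qed

text \<open>Adding 1 to a number that ends in a zero followed by \<open>q\<close> ones carries into
  that zero and leaves all higher bits alone. The sum and the complement of the number therefore
  share bit \<open>q\<close> only.\<close>

lemma E_HQ2: "E HQ2 = 2 ^ q"
proof -
  obtain r where v: "M 0 div 2 = 2 ^ (q + 1) * r + (2 ^ q - 1)" using HV_form by blast
  let ?v = "M 0 div 2"
  have "?v * 2 \<le> M 0" by simp
  moreover have "(1::nat) \<le> 2 ^ q" by simp
  ultimately have v1: "?v + 1 < 2 ^ w" using M_less[of 0] q_exp by linarith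
  have L: "E (Lit 1) = 1" using w16 by (simp add: take_bit_nat_eq_self)
  have a: "E (HV \<oplus> Lit 1) = ?v + 1" using v1 E_HV L by (intro ev_add) auto
  have m: "E (Lit 0 \<ominus> Lit 1) = mask w"
    using w16 by (simp add: take_bit_nat_eq_self mask_eq_exp_minus_1)
  have e: "E HQ2 = (?v + 1) AND (?v XOR mask w)"
    unfolding HQ2_def using a m E_HV by simp
  have vv: "?v + 1 = push_bit q (2 * r + 1)"
    unfolding v push_bit_eq_mult by (simp add: algebra_simps)
  have v': "?v = push_bit (q + 1) r + mask q"
    unfolding v push_bit_eq_mult by (simp add: mask_eq_exp_minus_1 algebra_simps)
  have v'': "?v = push_bit (q + 1) r OR mask q"
    unfolding v' by (rule disjunctive_add_eq_or) (auto simp: bit_eq_iff bit_simps)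
  show ?thesis
  proof (rule bit_eqI)
    fix k
    have "bit (2 ^ q :: nat) k = (k = q)" by (auto simp: bit_exp_iff)
    moreover have "bit (E HQ2) k = (k = q)"
    proof (cases "k < q")
      case True
      then show ?thesis unfolding e vv by (simp add: bit_simps)
    next
      case False
      show ?thesis
      proof (cases "k = q")
        case True
        have "q < w" using qw by simp
        then have "bit (?v XOR mask w) q" 
          unfolding v'' bit_xor_iff bit_or_iff bit_push_bit_iff_nat bit_mask_iff by simp
        moreover have "bit (?v + 1) q" unfolding vv by (simp add: bit_simps bit_0)
        ultimately show ?thesis unfolding e using True by (simp add: bit_and_iff)
      next
        case kq: False
        then have k: "q < k" using False by simp
        have 1: "bit ?v k = bit r (k - (q + 1))" 
          unfolding v'' bit_or_iff bit_push_bit_iff_nat bit_mask_iff using k by auto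
        have 2: "bit (?v + 1) k = bit r (k - (q + 1))"
        proof -
          have "bit (?v + 1) k = bit (2 * r + 1) (k - q)"
            unfolding vv using k by (simp add: bit_simps)
          also have "k - q = Suc (k - (q + 1))" using k by simp
          finally show ?thesis by (simp add: bit_Suc)
        qed
        have 3: "bit (?v + 1) k ==> k < w"
          using v1 by (metis bit_take_bit_iff take_bit_nat_eq_self)
        show ?thesis unfolding e using 1 2 3 kq by (auto simp: bit_simps)
      qed
    qed
    ultimately show "bit (E HQ2) k = bit (2 ^ q :: nat) k" by simp
  qed
qed

lemma E_HQ: "E HQ = q"
proof -
  obtain r where v: "M 0 div 2 = 2 ^ (q + 1) * r + (2 ^ q - 1)" and r: "r mod 2 ^ q = q"
    using HV_form by blast
  have 2: "E (HQ2 \<oplus> HQ2) = 2 ^ q + 2 ^ q" using q_exp E_HQ2 by (intro ev_add) auto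
  have "(M 0 div 2) div (2 ^ q + 2 ^ q) = r"
  proof -
    have lt: "(2::nat) ^ q - 1 < 2 ^ (q + 1)" by (simp add: less_imp_diff_less)
    have "(2::nat) ^ q + 2 ^ q = 2 ^ (q + 1)" by simp
    then show ?thesis using div_mod_add_less[OF lt, of r] v by (simp only: mult.commute)
  qed
  then show ?thesis unfolding HQ_def using 2 E_HV E_HQ2 r by simp
qed

lemma E_lit: "k < 4000 ==> E (Lit k) = k"
  using exp_bound w16 by (intro ev_lit) linarith

lemma q_mult_bound: "k \<le> 2 + 4 * NPAR ==> q * k + 2 < 2 ^ w"
proof -
  assume k: "k \<le> 2 + 4 * NPAR"
  have "q * k \<le> w * 300" using k qw by (intro mult_mono) (auto simp: NPAR_def)
  then show ?thesis using exp_bound by linarith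
qed

lemma E_QM: "k \<le> 2 + 4 * NPAR ==> E (HQ \<otimes> Lit k \<oplus> Lit 2) = q * k + 2"
  using q_mult_bound[of k] by (intro ev_add ev_mul E_HQ E_lit) (auto simp: NPAR_def)

lemma E_HE: "E HE = header_size q"
  unfolding HE_def header_size_def by (rule E_QM) simp

lemma E_PAR:
  assumes "j < NPAR"
  shows "E (PAR j) = all_params As ps ! j"
proof -
  let ?ps = "all_params As ps"
  let ?x = "?ps ! j"
  have len: "length ?ps = NPAR" using length_all_params[OF np] .
  have x: "?x < 2 ^ (4 * q)" "?x < 2 ^ w"
    using par[of ?x] assms len nth_mem by metis+
  have bx: "bs ! (q * (2 + 4 * j) + 2 + k) = bit ?x k" if "k < 4 * q" for k
  proof -
    let ?ys = "concat (map (nat_bits (4 * q)) ?ps)"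
    have st: "sum_list (map length (take j (map (nat_bits (4 * q)) ?ps))) = j * (4 * q)"
      using assms len by (simp add: take_map comp_def sum_list_triv)
    have c: "j * (4 * q) + k < length ?ys \<and> ?ys ! (j * (4 * q) + k) = bit ?x k"
      using nth_concat[of j "map (nat_bits (4 * q)) ?ps" k] assms len that
      unfolding st by (simp add: nat_bits_def)
    have "bs = ([True] @ replicate q True @ [False] @ nat_bits q q) @ ?ys @ concat (map arr_bits As)"
      by (simp add: mk_bits_def)
    moreover have "q * (2 + 4 * j) + 2 + k = (2 * q + 2) + (j * (4 * q) + k)"
      by (simp add: algebra_simps)
    moreover have "length ([True] @ replicate q True @ [False] @ nat_bits q q) = 2 * q + 2"
      by simp
    moreover have "(?ys @ concat (map arr_bits As)) ! (j * (4 * q) + k) = bit ?x k"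
      using c by (simp only: nth_append if_True)
    ultimately show ?thesis by (metis nth_append_length_plus)
  qed
  have hs: "q * (2 + 4 * j) + 2 + 4 * q \<le> header_size q"
  proof -
    have "q * (2 + 4 * j + 4) \<le> q * (2 + 4 * NPAR)" using assms by (intro mult_le_mono) auto
    then show ?thesis unfolding header_size_def by (simp add: algebra_simps)
  qed
  have z: "E (Lit 0) = 0" by simp
  have qq: "E (HQ \<oplus> HQ) = q + q"
    using q_mult_bound[of 2] E_HQ by (intro ev_add) (auto simp: NPAR_def)
  have A: "E (RD (Lit 0) (HQ \<otimes> Lit (2 + 4 * j) \<oplus> Lit 2) (HQ \<oplus> HQ)) = take_bit (2 * q) ?x"
  proof (rule ev_RD[OF holds R0 _ z E_QM qq])
    show "2 + 4 * j \<le> 2 + 4 * NPAR" using assms by simp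
    show "q * (2 + 4 * j) + 2 < 2 ^ w" using assms by (intro q_mult_bound) simp
    show "0 + (q * (2 + 4 * j) + 2) + (q + q) \<le> length bs" using hs len_ge by linarith
    show "take_bit (2 * q) ?x < 2 ^ (q + q)" by (simp flip: mult_2)
    show "bit (take_bit (2 * q) ?x) k = bs ! (0 + (q * (2 + 4 * j) + 2) + k)" if "k < q + q" for k
      using bx[of k] that by (simp add: bit_simps)
  qed (use w16 qw in auto)
  have B: "E (RD (Lit 0) (HQ \<otimes> Lit (2 + 4 * j + 2) \<oplus> Lit 2) (HQ \<oplus> HQ)) = drop_bit (2 * q) ?x"
  proof (rule ev_RD[OF holds R0 _ z E_QM qq])
    show "2 + 4 * j + 2 \<le> 2 + 4 * NPAR" using assms by simp
    show "q * (2 + 4 * j + 2) + 2 < 2 ^ w" using assms by (intro q_mult_bound) simp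
    show "0 + (q * (2 + 4 * j + 2) + 2) + (q + q) \<le> length bs"
      using hs len_ge by (simp add: algebra_simps)
    show "drop_bit (2 * q) ?x < 2 ^ (q + q)"
      using x(1) by (simp add: drop_bit_eq_div less_mult_imp_div_less flip: power_add mult_2)
    show "bit (drop_bit (2 * q) ?x) k = bs ! (0 + (q * (2 + 4 * j + 2) + 2) + k)"
      if "k < q + q" for k
      using bx[of "2 * q + k"] that by (simp add: bit_simps algebra_simps)
  qed (use w16 qw in auto)
  have eq: "take_bit (2 * q) ?x + drop_bit (2 * q) ?x * 2 ^ (q + q) = ?x"
    by (simp add: take_bit_eq_mod drop_bit_eq_div mod_div_mult_eq flip: mult_2)
  have "E (PAR j) = take_bit (2 * q) ?x + drop_bit (2 * q) ?x * 2 ^ (q + q)"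
    unfolding PAR_def
  proof (rule ev_add)
    show "take_bit (2 * q) ?x + drop_bit (2 * q) ?x * 2 ^ (q + q) < 2 ^ w" using eq x by simp
    then have "drop_bit (2 * q) ?x * 2 ^ (q + q) < 2 ^ w" by linarith
    then show "E (RD (Lit 0) (HQ \<otimes> Lit (2 + 4 * j + 2) \<oplus> Lit 2) (HQ \<oplus> HQ) \<lless> (HQ \<oplus> HQ)) =
      drop_bit (2 * q) ?x * 2 ^ (q + q)" using B qq by (rule ev_shl)
  qed (use A in simp_all)
  then show ?thesis using eq by simp
qed

lemma bs_arr:
  assumes "k < length As" "i < arr_size (As ! k)"
  shows "bs ! (header_size q + arr_offs As k + i) = arr_bits (As ! k) ! i"
    "header_size q + arr_offs As k + i < length bs"
proof -
  let ?ys = "concat (map arr_bits As)"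
  let ?h = "[True] @ replicate q True @ [False] @ nat_bits q q @
      concat (map (nat_bits (4 * q)) (all_params As ps))"
  have st: "sum_list (map length (take k (map arr_bits As))) = arr_offs As k"
    by (simp add: arr_offs_def comp_def length_arr_bits take_map)
  have c: "arr_offs As k + i < length ?ys \<and> ?ys ! (arr_offs As k + i) = arr_bits (As ! k) ! i"
    using nth_concat[of k "map arr_bits As" i] assms unfolding st by (simp add: length_arr_bits)
  have bs: "bs = ?h @ ?ys" by (simp add: mk_bits_def)
  have h: "length ?h = header_size q"
    using length_all_params[OF np]
    by (simp add: header_size_def length_concat comp_def sum_list_triv algebra_simps)
  show "bs ! (header_size q + arr_offs As k + i) = arr_bits (As ! k) ! i"
    unfolding bs using c h by (metis add.assoc nth_append_length_plus)
  show "header_size q + arr_offs As k + i < length bs"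
    using c h unfolding bs by (simp only: length_append[of ?h ?ys] add.assoc) simp
qed

lemma As_le: "k < length As ==> 2 * k + 1 < NPAR"
  using np by linarith

lemma E_RDK:
  assumes k: "k < length As" and p: "E p = y" and l: "E l = n" "n \<le> w"
    and len: "y + n \<le> arr_size (As ! k)"
    and v: "v < 2 ^ n" "\<And>i. i < n ==> bit v i = arr_bits (As ! k) ! (y + i)"
  shows "E (RDK k p l) = v"
\<comment> \<open>An empty field may start at the very end of the array; the zero mask gives its
  value without any statement about the address.\<close>
proof (cases "n = 0")
  case True
  have "E (low_mask l) = mask n" using l w16 by (intro ev_low_mask) auto
  then show ?thesis using v True by (simp add: RDK_def RD_def)
next
  case False
  have b: "E (HE \<oplus> PAR (2 * k)) = header_size q + arr_offs As k"
    using arrs[OF k] E_HE E_PAR[of "2 * k"] As_le[OF k] all_params_nth[OF k]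
    by (intro ev_add) auto
  show ?thesis unfolding RDK_def
  proof (rule ev_RD[OF holds R0 _ b p l(1)])
    show "header_size q + arr_offs As k < 2 ^ w" "y < 2 ^ w"
      using arrs[OF k] len by auto
    have "y + n - 1 < arr_size (As ! k)" using len False by linarith
    from bs_arr(2)[OF k this]
    show "header_size q + arr_offs As k + y + n \<le> length bs" using False by linarith
    show "bit v i = bs ! (header_size q + arr_offs As k + y + i)" if "i < n" for i
      using v(2)[OF that] bs_arr(1)[OF k, of "y + i"] len that by (simp add: add.assoc)
  qed (use w16 l v in auto)
qed

lemma E_ARR:
  assumes k: "k < length As" "As ! k = (v, l, f)" and e: "E e = i" "i < l" and f: "f i < 2 ^ v"
  shows "E (ARR k e) = f i"
proof -
  have w: "E (PAR (2 * k + 1)) = v"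
    using E_PAR[of "2 * k + 1"] As_le[OF k(1)] all_params_nth[OF k(1)] k(2) by auto
  have sz: "arr_size (As ! k) = l * v" using k by (simp add: arr_size_def)
  have il: "i * v + v \<le> l * v"
    using e(2) by (metis Suc_leI add.commute mult_Suc mult_le_mono1)
  have m: "E (e \<otimes> PAR (2 * k + 1)) = i * v"
  proof (rule ev_mul[OF _ e(1) w])
    show "i * v < 2 ^ w" using il sz arrs[OF k(1)] by linarith
  qed
  show ?thesis unfolding ARR_def
  proof (rule E_RDK[OF k(1) m w _ _ f])
    show "v \<le> w" using arrs[OF k(1)] k(2) by simp
    show "i * v + v \<le> arr_size (As ! k)" using il sz by simp
    fix t assume t: "t < v"
    then have "i * v + t < l * v" using il by linarith
    moreover have "(i * v + t) div v = i" "(i * v + t) mod v = t" using t by auto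
    ultimately show "bit (f i) t = arr_bits (As ! k) ! (i * v + t)"
      by (simp add: arr_bits_def k(2))
  qed
qed

lemma E_own: "j < length ps ==> E (PAR (2 * length As + j)) = ps ! j"
  using E_PAR[of "2 * length As + j"] all_params_nth_own[of j ps As] np by auto

end

subsection \<open>Bit lengths\<close>

definition blen :: "nat => nat" where
  "blen x = (LEAST k. x < 2 ^ k)"

lemma less_exp_blen: "x < 2 ^ blen x"
  unfolding blen_def by (rule LeastI[of "\<lambda>k. x < 2 ^ k" x]) (rule less_exp)

lemma blen_le: "x < 2 ^ k ==> blen x \<le> k"
  unfolding blen_def by (rule Least_le)

lemma blen_le_iff: "blen x \<le> k \<longleftrightarrow> x < 2 ^ k"
proof
  assume "blen x \<le> k"
  then have "(2::nat) ^ blen x \<le> 2 ^ k" by (rule power_increasing) simp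
  then show "x < 2 ^ k" using less_exp_blen[of x] by linarith
qed (rule blen_le)

lemma exp_blen_le: "0 < x ==> 2 ^ blen x \<le> 2 * x"
proof -
  assume "0 < x"
  then have "blen x \<noteq> 0" using less_exp_blen[of x] by (cases "blen x") auto
  then obtain k where k: "blen x = Suc k" by (cases "blen x") auto
  then have "\<not> x < 2 ^ k" using blen_le[of x k] by linarith
  then show ?thesis by (simp add: k)
qed

lemma blen_0 [simp]: "blen 0 = 0"
  using blen_le[of 0 0] by simp

lemma blen_pos: "0 < x ==> 0 < blen x"
  using less_exp_blen[of x] by (cases "blen x") auto

lemma blen_mono: "x \<le> y ==> blen x \<le> blen y"
  using less_exp_blen[of y] by (intro blen_le) linarith

lemma blen_le_self: "blen x \<le> x"
  by (intro blen_le less_exp)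

lemma blen_mult: "blen (x * y) \<le> blen x + blen y"
proof (intro blen_le)
  show "x * y < 2 ^ (blen x + blen y)"
    unfolding power_add using less_exp_blen[of x] less_exp_blen[of y]
    by (intro mult_strict_mono) auto
qed

lemma blen_add: "blen (x + y) \<le> Suc (max (blen x) (blen y))"
proof (intro blen_le)
  have "x < 2 ^ max (blen x) (blen y)" "y < 2 ^ max (blen x) (blen y)"
    by (simp_all flip: blen_le_iff)
  then show "x + y < 2 ^ Suc (max (blen x) (blen y))" by simp
qed

subsection \<open>Small separating moduli\<close>

text \<open>
  The entries of the Leibniz harmonic triangle become integers when multiplied by
  \<open>lcm(1, \<dots>, n)\<close>.
\<close>

lemma Lcm_leibniz: "k < n ==> n * ((n - 1) choose k) dvd Lcm {1..n}"
proof (induction k arbitrary: n)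
  case 0
  then show ?case by (auto intro: dvd_Lcm)
next
  case (Suc k)
  define L where "L = int (Lcm {1..n})"
  define m where "m = n - 2"
  have n: "n = Suc (Suc m)" using Suc.prems by (simp add: m_def)
  have km: "k \<le> m" using Suc.prems n by simp
  define a b c where "a = int (n * (Suc m choose k))" and "b = int (Suc m * (m choose k))"
    and "c = int (n * (Suc m choose Suc k))"
  have "Lcm {1..Suc m} dvd Lcm {1..n}"
    by (intro Lcm_least) (auto simp: n intro!: dvd_Lcm)
  moreover have "Suc m * (m choose k) dvd Lcm {1..Suc m}" using Suc.IH[of "Suc m"] km by simp
  ultimately have "b dvd L" unfolding b_def L_def by (simp only: int_dvd_int_iff dvd_trans)
  moreover have "a dvd L"
    using Suc.IH[of n] Suc.prems n unfolding a_def L_def by (simp only: int_dvd_int_iff) simp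
  ultimately obtain z1 z2 where z: "L = a * z1" "L = b * z2" by (auto elim!: dvdE)
  have A: "(Suc m - k) * (Suc m choose k) = Suc m * (m choose k)"
    using binomial_absorb_comp[of "Suc m" k] by simp
  have B: "Suc k * (Suc m choose Suc k) = Suc m * (m choose k)"
    by (rule Suc_times_binomial)
  have mk: "int (Suc m - k) = int (Suc m) - int k" using km by simp
  have A': "(int (Suc m) - int k) * int (Suc m choose k) = b"
    unfolding b_def A[symmetric] of_nat_mult mk ..
  have B': "(int k + 1) * int (Suc m choose Suc k) = b"
    unfolding b_def B[symmetric] of_nat_mult of_nat_Suc by (simp only: add.commute)
  \<comment> \<open>The two equations say that \<open>1 / b = 1 / a + 1 / c\<close>, the recurrence
    of the triangle; hence \<open>L / c = z2 - z1\<close> is an integer.\<close>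
  have ab: "a * (int (Suc m) - int k) = int n * b"
    unfolding a_def of_nat_mult A'[symmetric] by (simp only: mult_ac)
  have cb: "c * (int k + 1) = int n * b"
    unfolding c_def of_nat_mult B'[symmetric] by (simp only: mult_ac)
  have "int n = int (Suc m) + 1" by (simp add: n)
  then have "((z2 - z1) * c) * (int k + 1) = L * (int k + 1)"
    using ab cb z by algebra
  moreover have "int k + 1 \<noteq> 0" by simp
  ultimately have "(z2 - z1) * c = L" using mult_right_cancel by blast
  then have "c dvd L" by (metis dvd_triv_right)
  then show ?case unfolding c_def L_def by (simp only: int_dvd_int_iff n diff_Suc_1)
qed

text \<open>Each of the \<open>n\<close> denominators in row \<open>n\<close> of the triangle is
  bounded by the lcm, and the binomial coefficients in them sum to
  \<open>2 ^ (n - 1)\<close>.\<close>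

lemma exp_le_Lcm: "2 ^ n \<le> 2 * n * Lcm {1..n}" if "0 < n" for n :: nat
proof -
  have "Lcm {1..n} \<noteq> 0" by (subst Lcm_0_iff) auto
  then have bin: "n * ((n - 1) choose k) \<le> Lcm {1..n}" if "k < n" for k
    using Lcm_leibniz[OF that] by (intro dvd_imp_le) (simp_all only: neq0_conv)
  have "(\<Sum>k<n. (n - 1) choose k) = 2 ^ (n - 1)"
    using choose_row_sum[of "n - 1"] that by (cases n) (auto simp: lessThan_Suc_atMost)
  moreover have "(\<Sum>k<n. (n - 1) choose k) \<le> (\<Sum>k<n. Lcm {1..n})"
  proof (intro sum_mono)
    fix k assume "k \<in> {..<n}"
    then have "n * ((n - 1) choose k) \<le> Lcm {1..n}" by (intro bin) auto
    moreover have "(n - 1) choose k \<le> n * ((n - 1) choose k)" using that by (cases n) auto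
    ultimately show "(n - 1) choose k \<le> Lcm {1..n}" by linarith
  qed
  ultimately have "2 ^ (n - 1) \<le> n * Lcm {1..n}" by simp
  then have "2 * 2 ^ (n - 1) \<le> 2 * (n * Lcm {1..n})" by simp
  then show ?thesis using that by (cases n) auto
qed

text \<open>If every number up to the bound divided some element of \<open>D\<close>, their lcm
  would divide the product of \<open>D\<close> and be at most \<open>2 ^ (z * c)\<close>, which
  contradicts \<open>exp_le_Lcm\<close>. The modulus need not be prime. The second bound
  \<open>2 ^ z\<close> keeps it about as short as the numbers that it separates.\<close>

lemma separating_modulus:
  assumes "finite D" "card D \<le> c" "\<And>x. x \<in> D ==> 0 < x \<and> x < 2 ^ z"
  shows "\<exists>p>0. p \<le> 2 * (z * c) + 8 \<and> p \<le> 2 ^ z \<and> (\<forall>x\<in>D. \<not> p dvd x)"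
\<comment> \<open>In the first case \<open>2 ^ z\<close> itself will do: it exceeds all elements of
  \<open>D\<close> and divides none.\<close>
proof (cases "2 ^ z \<le> 2 * (z * c) + 8")
  case True
  then show ?thesis using assms(3)
    by (intro exI[of _ "2 ^ z"]) (auto dest!: dvd_imp_le, meson not_less)
next
  case False
  let ?Q = "2 * (z * c) + 8"
  have "\<exists>p\<in>{1..?Q}. \<forall>x\<in>D. \<not> p dvd x"
  proof (rule ccontr)
    assume "\<not> ?thesis"
    then have "\<forall>p\<in>{1..?Q}. \<exists>x\<in>D. p dvd x" by blast
    then have "\<forall>p\<in>{1..?Q}. p dvd \<Prod>D" using assms(1) by (meson dvd_prodI dvd_trans)
    then have "Lcm {1..?Q} dvd \<Prod>D" by (intro Lcm_least) auto
    moreover have "0 < \<Prod>D" using assms by (intro prod_pos) auto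
    ultimately have "Lcm {1..?Q} \<le> \<Prod>D" by (intro dvd_imp_le)
    also have "... \<le> (\<Prod>x\<in>D. 2 ^ z)" using assms by (intro prod_mono) (auto intro: less_imp_le)
    also have "... = 2 ^ (z * card D)" by (simp add: power_mult)
    also have "... \<le> 2 ^ (z * c)" using assms by (intro power_increasing) auto
    finally have le: "Lcm {1..?Q} \<le> 2 ^ (z * c)" .
    have "(2::nat) ^ ?Q \<le> 2 * ?Q * Lcm {1..?Q}" by (rule exp_le_Lcm) simp
    also have "... \<le> 2 * ?Q * 2 ^ (z * c)" using le by (intro mult_left_mono) auto
    finally have "(2::nat) ^ ?Q \<le> 2 * ?Q * 2 ^ (z * c)" .
    then have "(2 ^ (z * c) * 2 ^ 8) * 2 ^ (z * c) \<le> 2 * ?Q * 2 ^ (z * c)"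
    proof -
      have "(2::nat) ^ ?Q = (2 ^ (z * c) * 2 ^ 8) * 2 ^ (z * c)"
        by (simp only: mult_2 power_add mult.assoc mult.commute[of "2 ^ 8"])
      then show ?thesis using \<open>2 ^ ?Q \<le> 2 * ?Q * 2 ^ (z * c)\<close> by (simp only:)
    qed
    then have "2 ^ (z * c) * 2 ^ 8 \<le> 2 * ?Q" by (rule mult_right_le_imp_le) simp
    moreover have "z * c < 2 ^ (z * c)" by simp
    moreover have "1 \<le> (2::nat) ^ (z * c)" by simp
    ultimately show False by simp
  qed
  then obtain p where "0 < p" "p \<le> ?Q" "\<forall>x\<in>D. \<not> p dvd x" by (auto simp: Suc_le_eq)
  then show ?thesis using False by (intro exI[of _ p]) auto
qed

definition absdiff :: "nat => nat => nat" where
  "absdiff x y = (if x < y then y - x else x - y)"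

lemma mod_eq_iff_dvd_absdiff: "x mod p = y mod p \<longleftrightarrow> p dvd absdiff x y"
proof (cases "x < y")
  case True
  then show ?thesis using mod_eq_dvd_iff_nat[of x y p] unfolding absdiff_def by auto
next
  case False
  then show ?thesis using mod_eq_dvd_iff_nat[of y x p] unfolding absdiff_def by auto
qed

lemma separating_modulus_pairs:
  assumes "finite P" "card P \<le> c" "\<And>i j. (i, j) \<in> P ==> f i < 2 ^ z \<and> f j < 2 ^ z \<and> f i \<noteq> f j"
  shows "\<exists>p>0. p \<le> 2 * (z * c) + 8 \<and> p \<le> 2 ^ z \<and> (\<forall>(i, j)\<in>P. f i mod p \<noteq> f j mod p)"
proof -
  let ?D = "(\<lambda>(i, j). absdiff (f i) (f j)) ` P"
  have "\<exists>p>0. p \<le> 2 * (z * c) + 8 \<and> p \<le> 2 ^ z \<and> (\<forall>x\<in>?D. \<not> p dvd x)"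
  proof (rule separating_modulus)
    show "card ?D \<le> c" using card_image_le[OF assms(1)] assms(2) le_trans by blast
  qed (use assms in \<open>auto simp: absdiff_def\<close>, fastforce+)
  then show ?thesis by (auto simp: mod_eq_iff_dvd_absdiff)
qed

subsection \<open>Multiply-shift hashing and perfect hash tables\<close>

definition mshift :: "nat => nat => nat => nat => nat" where
  "mshift c l a v = (a * v mod 2 ^ c) div 2 ^ (c - l)"

lemma mshift_less: "l \<le> c ==> mshift c l a v < 2 ^ l"
  unfolding mshift_def
  by (rule less_mult_imp_div_less) (simp flip: power_add)

lemma odd_inverse_exp:
  assumes "odd (x::nat)"
  shows "\<exists>t. x * t mod 2 ^ c = 1 mod 2 ^ c"
proof -
  have "x \<noteq> 0" using assms by (cases x) auto
  then obtain s y where "x * s = 2 ^ c * y + gcd x (2 ^ c)" using bezout_nat by blast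
  moreover have "gcd x (2 ^ c) = 1"
    using assms by (simp add: coprime_power_right_iff flip: coprime_iff_gcd_eq_1)
  ultimately have "x * s = 1 + 2 ^ c * y" by simp
  then have "x * s mod 2 ^ c = 1 mod 2 ^ c" by (simp only: mod_mult_self2)
  then show ?thesis by blast
qed

lemma exp_odd_decompose: "0 < d ==> \<exists>s x. d = 2 ^ s * x \<and> odd x" for d :: nat
proof (induction d rule: less_induct)
  case (less d)
  show ?case
  proof (cases "odd d")
    case True
    then show ?thesis by (intro exI[of _ 0] exI[of _ d]) simp
  next
    case False
    then obtain e where e: "d = 2 * e" by (auto elim: evenE)
    then obtain s x where "e = 2 ^ s * x" "odd x" using less.IH[of e] less.prems by auto
    then show ?thesis using e by (intro exI[of _ "Suc s"] exI[of _ x]) simp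
  qed
qed

lemma mod_add_cancel: "(a + k) mod n = (b + k) mod n \<longleftrightarrow> a mod n = b mod n" for a b k n :: nat
  unfolding mod_eq_iff_dvd_absdiff by (simp add: absdiff_def)

lemma card_odd_below:
  assumes "0 < c"
  shows "card {a::nat. odd a \<and> a < 2 ^ c} = 2 ^ (c - 1)"
proof -
  obtain e where c: "c = Suc e" using assms by (cases c) auto
  have "{a::nat. odd a \<and> a < 2 ^ c} = (\<lambda>i. 2 * i + 1) ` {..<2 ^ e}"
    by (auto simp: c elim!: oddE)
  then show ?thesis by (simp add: card_image inj_on_def c)
qed

text \<open>
  If \<open>t * d \<equiv> 2 ^ (c - l)\<close> with \<open>t\<close> even, the translates by multiples of \<open>t\<close> of the set in question
  are disjoint, because they are told apart by \<open>a * d div 2 ^ (c - l)\<close>.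
\<close>

lemma card_mult_mod_small:
  assumes d: "0 < d" "d < 2 ^ c" and l: "l \<le> c"
  shows "card {a::nat. odd a \<and> a < 2 ^ c \<and> a * d mod 2 ^ c < 2 ^ (c - l)} * 2 ^ l \<le> 2 ^ (c - 1)"
    (is "card ?A * _ \<le> _")
proof -
  have c: "0 < c" using d by (cases c) auto
  obtain s x where sx: "d = 2 ^ s * x" "odd x"
    using exp_odd_decompose[OF d(1)] by blast
  have s: "s < c"
  proof (rule ccontr)
    assume "\<not> s < c"
    then have "(2::nat) ^ c \<le> 2 ^ s" by (simp add: power_increasing)
    moreover have "2 ^ s \<le> d" using sx by (cases x) auto
    ultimately show False using d by linarith
  qed
  show ?thesis
  proof (cases "c - l \<le> s")
    case True
    \<comment> \<open>For odd \<open>a\<close> the product \<open>a * d\<close> is an odd multiple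
      of \<open>2 ^ s\<close> with \<open>s < c\<close>. Its residue is thus a non-zero multiple of
      \<open>2 ^ s\<close> and cannot be below \<open>2 ^ (c - l)\<close>.\<close>
    have "?A = {}"
    proof (rule ccontr)
      assume "?A \<noteq> {}"
      then obtain a where a: "odd a" "a * d mod 2 ^ c < 2 ^ (c - l)" by blast
      have "(2::nat) ^ s dvd 2 ^ c" using s by (simp add: le_imp_power_dvd)
      then have "2 ^ s dvd a * d mod 2 ^ c" using sx by (simp add: dvd_mod)
      moreover have "a * d mod 2 ^ c < 2 ^ s"
        using a(2) True power_increasing[of "c - l" s "2::nat"] by linarith
      ultimately have "a * d mod 2 ^ c = 0" using nat_dvd_not_less by blast
      then have "2 ^ c dvd 2 ^ s * (a * x)" unfolding sx by (simp add: mod_0_imp_dvd mult_ac)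
      moreover have "(2::nat) ^ c = 2 ^ s * 2 ^ (c - s)" using s by (simp flip: power_add)
      ultimately have "2 ^ (c - s) dvd a * x" by simp
      moreover have "(2::nat) dvd 2 ^ (c - s)" using s by simp
      ultimately have "2 dvd a * x" by (rule dvd_trans[rotated])
      then show False using a sx by simp
    qed
    then show ?thesis by (simp only: card.empty)
  next
    case False
    define I :: nat where "I = 2 ^ (c - l)"
    have Ic: "2 ^ c = I * 2 ^ l" using l by (simp add: I_def flip: power_add)
    obtain y where y: "x * y mod 2 ^ c = 1 mod 2 ^ c" using odd_inverse_exp[OF sx(2)] by blast
    define t where "t = 2 ^ (c - l - s) * y"
    have "0 < c - l - s" using False by linarith
    \<comment> \<open>Evenness of \<open>t\<close> makes the translates of odd multipliers odd
      again, so all translates lie among the \<open>2 ^ (c - 1)\<close> odd residues.\<close>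
    then have ev: "even t" unfolding t_def by (simp only: even_mult_iff even_power even_numeral simp_thms)
    have td: "t * d mod 2 ^ c = I mod 2 ^ c"
    proof -
      have "t * d = 2 ^ (c - l - s + s) * (x * y)"
        unfolding t_def sx by (simp add: power_add mult_ac)
      also have "c - l - s + s = c - l" using False by simp
      finally have "t * d mod 2 ^ c = I * (x * y mod 2 ^ c) mod 2 ^ c"
        by (simp add: I_def mod_mult_right_eq)
      then show ?thesis unfolding y by (simp add: mod_mult_right_eq)
    qed
    let ?f = "\<lambda>(a, i). (a + t * i) mod 2 ^ c"
    have fd: "?f (a, i) * d mod 2 ^ c = a * d mod 2 ^ c + i * I"
      if "a \<in> ?A" "i < 2 ^ l" for a i
    proof -
      have "?f (a, i) * d mod 2 ^ c = (a * d + i * (t * d)) mod 2 ^ c"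
        by (simp only: split mod_mult_left_eq) (simp add: algebra_simps)
      also have "... = (a * d mod 2 ^ c + i * I) mod 2 ^ c"
        by (rule mod_add_cong) (simp, metis td mod_mult_right_eq)
      also have "... = a * d mod 2 ^ c + i * I"
      proof (rule mod_less)
        have "i * I + I \<le> 2 ^ c"
          unfolding Ic using that(2) by (metis Suc_leI add.commute mult.commute mult_Suc_right mult_le_mono2)
        moreover have "a * d mod 2 ^ c < I" using that(1) by (simp add: I_def)
        ultimately show "a * d mod 2 ^ c + i * I < 2 ^ c" by linarith
      qed
      finally show ?thesis .
    qed
    have I0: "0 < I" by (simp add: I_def)
    have inj: "inj_on ?f (?A \<times> {..<2 ^ l})"
    proof (rule inj_onI)
      fix p r assume pr: "p \<in> ?A \<times> {..<2 ^ l}" "r \<in> ?A \<times> {..<2 ^ l}" "?f p = ?f r"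
      obtain a i b j where p: "p = (a, i)" and r: "r = (b, j)" by (metis surj_pair)
      have a: "odd a" "a < 2 ^ c" "a * d mod 2 ^ c < 2 ^ (c - l)" and i: "i < 2 ^ l"
        and b: "odd b" "b < 2 ^ c" "b * d mod 2 ^ c < 2 ^ (c - l)" and j: "j < 2 ^ l"
        and eq: "(a + t * i) mod 2 ^ c = (b + t * j) mod 2 ^ c"
        using pr p r by auto
      have "a * d mod 2 ^ c + i * I = b * d mod 2 ^ c + j * I"
        using fd[of a i] fd[of b j] a b i j eq by simp
      then have "(i * I + a * d mod 2 ^ c) div I = (j * I + b * d mod 2 ^ c) div I"
        by (simp add: add.commute)
      then have ij: "i = j" using a(3) b(3) div_mod_add_less unfolding I_def by metis
      then have "a mod 2 ^ c = b mod 2 ^ c" using eq by (simp only: mod_add_cancel)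
      then show "p = r" using a(2) b(2) ij p r by simp
    qed
    have sub: "?f ` (?A \<times> {..<2 ^ l}) \<subseteq> {a. odd a \<and> a < 2 ^ c}"
    proof -
      have "odd ((a + t * i) mod 2 ^ c)" if "odd a" for a i
      proof -
        have "(2::nat) dvd 2 ^ c" using c by simp
        then show ?thesis using that ev by (simp add: dvd_mod_iff)
      qed
      then show ?thesis by auto
    qed
    have "card ?A * 2 ^ l = card (?A \<times> {..<(2::nat) ^ l})" by (simp add: card_cartesian_product)
    also have "... = card (?f ` (?A \<times> {..<2 ^ l}))" using card_image[OF inj] by simp
    also have "... \<le> card {a::nat. odd a \<and> a < 2 ^ c}" using sub by (intro card_mono) auto
    also have "... = 2 ^ (c - 1)" using card_odd_below[OF c] .
    finally show ?thesis .
  qed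
qed

text \<open>On a collision \<open>a * u\<close> and \<open>a * v\<close> have residues less than
  \<open>2 ^ (c - l)\<close> apart, so \<open>a * (u - v)\<close> is close to 0 modulo
  \<open>2 ^ c\<close>, from above or from below. The reflection of \<open>a\<close> to
  \<open>2 ^ c - a\<close> exchanges the two cases, which gives twice the bound of
  \<open>card_mult_mod_small\<close>.\<close>

lemma card_mshift_collision:
  assumes uv: "u < 2 ^ c" "v < 2 ^ c" "u \<noteq> v" and l: "l \<le> c"
  shows "card {a. odd a \<and> a < 2 ^ c \<and> mshift c l a u = mshift c l a v} * 2 ^ l \<le> 2 ^ c"
proof -
  have main: "card {a. odd a \<and> a < 2 ^ c \<and> mshift c l a u = mshift c l a v} * 2 ^ l \<le> 2 ^ c"
    if uv: "v < u" "u < 2 ^ c" for u v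
  proof -
    define d where "d = u - v"
    have d: "0 < d" "d < 2 ^ c" using uv by (auto simp: d_def)
    have c: "0 < c" using d by (cases c) auto
    define I :: nat where "I = 2 ^ (c - l)"
    let ?A = "{a::nat. odd a \<and> a < 2 ^ c \<and> a * d mod 2 ^ c < 2 ^ (c - l)}"
    let ?g = "\<lambda>a. 2 ^ c - a :: nat"
    have "{a. odd a \<and> a < 2 ^ c \<and> mshift c l a u = mshift c l a v} \<subseteq> ?A \<union> ?g ` ?A"
    proof
      fix a assume "a \<in> {a. odd a \<and> a < 2 ^ c \<and> mshift c l a u = mshift c l a v}"
      then have a: "odd a" "a < 2 ^ c" and eq: "mshift c l a u = mshift c l a v" by auto
      define x y where "x = a * u mod 2 ^ c" and "y = a * v mod 2 ^ c"
      have q: "x div I = y div I" using eq by (simp add: mshift_def x_def y_def I_def)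
      have I0: "0 < I" by (simp add: I_def)
      have xy: "x < y + I" "y < x + I"
      proof -
        have "x div I * I + x mod I = x" "x div I * I + y mod I = y" unfolding q by simp_all
           (metis q div_mult_mod_eq)
        moreover have "x mod I < I" "y mod I < I" using I0 by simp_all
        ultimately show "x < y + I" "y < x + I" by linarith+
      qed
      have x: "x < 2 ^ c" and y: "y < 2 ^ c" by (simp_all add: x_def y_def)
      have uvd: "u = v + d" using uv by (simp add: d_def)
      have dx: "(a * d + y) mod 2 ^ c = x"
        unfolding x_def y_def uvd by (simp add: mod_add_right_eq algebra_simps)
      show "a \<in> ?A \<union> ?g ` ?A"
      proof (cases "y \<le> x")
        case True
        have "a * d mod 2 ^ c = x - y"
        proof -
          have "(a * d + y) mod 2 ^ c = (x - y + y) mod 2 ^ c" using dx x True by simp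
          then have "a * d mod 2 ^ c = (x - y) mod 2 ^ c" by (simp only: mod_add_cancel)
          then show ?thesis using x by (simp add: less_imp_diff_less)
        qed
        then show ?thesis using a xy True I_def by auto
      next
        case False
        have e: "a * d mod 2 ^ c = 2 ^ c - (y - x)"
        proof -
          have "(a * d + y) mod 2 ^ c = (2 ^ c - (y - x) + y) mod 2 ^ c" using dx x y False by simp
          then have "a * d mod 2 ^ c = (2 ^ c - (y - x)) mod 2 ^ c" by (simp only: mod_add_cancel)
          then show ?thesis using y False by simp
        qed
        have "(2 ^ c - a) * d mod 2 ^ c = y - x"
        proof -
          have "((2 ^ c - a) * d + a * d) mod 2 ^ c = 0"
            using a(2) by (simp flip: add_mult_distrib)
          then have "((2 ^ c - a) * d mod 2 ^ c + (2 ^ c - (y - x))) mod 2 ^ c = 0"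
            unfolding e[symmetric] by (simp only: mod_add_eq)
          then have "2 ^ c dvd (2 ^ c - a) * d mod 2 ^ c + (2 ^ c - (y - x))" by (rule mod_0_imp_dvd)
          then obtain r where r: "(2 ^ c - a) * d mod 2 ^ c + (2 ^ c - (y - x)) = 2 ^ c * r"
            by (auto elim: dvdE)
          have lt: "(2 ^ c - a) * d mod 2 ^ c < 2 ^ c" by simp
          have "r = 1"
          proof -
            have "0 < 2 ^ c * r" using r y False by (metis add_gr_0 less_imp_diff_less zero_less_diff)
            then have "r \<ge> 1" by (cases r) auto
            moreover have "2 ^ c * r < 2 ^ c * 2" using r lt False by linarith
            then have "r < 2" using mult_less_cancel1 by blast
            ultimately show ?thesis by simp
          qed
          then show ?thesis using r y False by simp
        qed
        moreover have "odd (2 ^ c - a)" using a c by simp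
        moreover have "a = ?g (2 ^ c - a)" using a(2) by simp
        moreover have "2 ^ c - a < 2 ^ c" using a(1) by (cases a) auto
        moreover have "y - x < I" using xy False by linarith
        ultimately have "2 ^ c - a \<in> ?A" by (simp add: I_def)
        then show ?thesis using \<open>a = ?g (2 ^ c - a)\<close> by blast
      qed
    qed
    then have "card {a. odd a \<and> a < 2 ^ c \<and> mshift c l a u = mshift c l a v} \<le> card (?A \<union> ?g ` ?A)"
      by (intro card_mono) auto
    also have "... \<le> card ?A + card (?g ` ?A)" by (rule card_Un_le)
    also have "... \<le> card ?A + card ?A" by (intro add_left_mono card_image_le) auto
    finally have "card {a. odd a \<and> a < 2 ^ c \<and> mshift c l a u = mshift c l a v} * 2 ^ l
        \<le> (card ?A + card ?A) * 2 ^ l" by (rule mult_right_mono) simp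
    also have "... \<le> 2 ^ (c - 1) + 2 ^ (c - 1)"
      unfolding add_mult_distrib using card_mult_mod_small[OF d l] by (intro add_mono) auto
    also have "... = 2 ^ c" using c by (cases c) auto
    finally show ?thesis .
  qed
  show ?thesis
  proof (cases "v < u")
    case True
    then show ?thesis using main[of v u] uv by simp
  next
    case False
    then show ?thesis using main[of u v] uv by (simp add: eq_commute)
  qed
qed

definition collisions :: "nat => nat => nat => nat set => (nat \<times> nat) set" where
  "collisions c l a Y = {(u, v). u \<in> Y \<and> v \<in> Y \<and> u \<noteq> v \<and> mshift c l a u = mshift c l a v}"

lemma finite_collisions: "finite Y ==> finite (collisions c l a Y)"
  by (rule finite_subset[of _ "Y \<times> Y"]) (auto simp: collisions_def)

text \<open>Averaging: for a random odd multiplier a given pair collides with probability at most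
  \<open>2 / 2 ^ l\<close>.\<close>

lemma mshift_few_collisions:
  assumes Y: "finite Y" "Y \<subseteq> {..<2 ^ c}" and l: "l \<le> c" and c: "0 < c"
  shows "\<exists>a<2 ^ c. card (collisions c l a Y) * 2 ^ l \<le> 2 * (card Y)\<^sup>2"
proof (rule ccontr)
  assume neg: "\<not> ?thesis"
  let ?O = "{a::nat. odd a \<and> a < 2 ^ c}"
  let ?P = "{(u, v). u \<in> Y \<and> v \<in> Y \<and> u \<noteq> v}"
  have fP: "finite ?P" by (rule finite_subset[of _ "Y \<times> Y"]) (use Y in auto)
  have cP: "card ?P \<le> (card Y)\<^sup>2"
    using card_mono[of "Y \<times> Y" ?P] Y by (auto simp: card_cartesian_product power2_eq_square)
  have fO: "finite ?O" by simp
  have cO: "card ?O = 2 ^ (c - 1)" by (rule card_odd_below[OF c])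
  have cc: "card (collisions c l a Y) = (\<Sum>p\<in>?P. if mshift c l a (fst p) = mshift c l a (snd p) then 1 else 0)" for a
  proof -
    have "collisions c l a Y = {p\<in>?P. mshift c l a (fst p) = mshift c l a (snd p)}"
      by (auto simp: collisions_def)
    then show ?thesis using fP by (simp add: sum.If_cases Int_def)
  qed
  have "(\<Sum>a\<in>?O. card (collisions c l a Y)) * 2 ^ l =
      (\<Sum>p\<in>?P. (\<Sum>a\<in>?O. if mshift c l a (fst p) = mshift c l a (snd p) then 1 else 0) * 2 ^ l)"
    unfolding cc by (subst sum.swap) (simp add: sum_distrib_right)
  also have "... \<le> (\<Sum>p\<in>?P. 2 ^ c)"
  proof (rule sum_mono)
    fix p assume "p \<in> ?P"
    then have p: "fst p < 2 ^ c" "snd p < 2 ^ c" "fst p \<noteq> snd p" using Y by auto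
    have "(\<Sum>a\<in>?O. if mshift c l a (fst p) = mshift c l a (snd p) then 1 else 0) =
       card {a. odd a \<and> a < 2 ^ c \<and> mshift c l a (fst p) = mshift c l a (snd p)}"
      by (simp add: sum.If_cases Int_def conj_ac)
    then show "(\<Sum>a\<in>?O. if mshift c l a (fst p) = mshift c l a (snd p) then 1 else 0) * 2 ^ l \<le> (2::nat) ^ c"
      using card_mshift_collision[OF p l] by simp
  qed
  also have "... \<le> (card Y)\<^sup>2 * 2 ^ c" using cP by simp
  finally have up: "(\<Sum>a\<in>?O. card (collisions c l a Y)) * 2 ^ l \<le> (card Y)\<^sup>2 * 2 ^ c" .
  have "(\<Sum>a\<in>?O. 2 * (card Y)\<^sup>2) < (\<Sum>a\<in>?O. card (collisions c l a Y) * 2 ^ l)"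
  proof (rule sum_strict_mono)
    show "?O \<noteq> {}" using cO by (metis card.empty power_not_zero zero_neq_numeral)
  qed (use neg in \<open>auto simp: not_le\<close>)
  moreover have "(\<Sum>a\<in>?O. 2 * (card Y)\<^sup>2) = (card Y)\<^sup>2 * 2 ^ c"
    unfolding sum_constant cO using c by (cases c) auto
  moreover have "(\<Sum>a\<in>?O. card (collisions c l a Y) * 2 ^ l) =
      (\<Sum>a\<in>?O. card (collisions c l a Y)) * 2 ^ l"
    by (simp only: sum_distrib_right)
  ultimately show False using up by linarith
qed

text \<open>
  The two-level scheme of Fredman, Komlos and Szemeredi: the cells of the first level have
  quadratic total size, and each cell gets an injective second-level function.
\<close>

lemma fks_exists:
  fixes Y :: "nat => nat"
  assumes k: "2 \<le> k" "k \<le> 2 ^ L" "2 ^ L < 2 * k" and c: "2 * L + 3 \<le> c"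
    and inj: "inj_on Y {..<k}" and Y: "\<And>j. j < k ==> Y j < 2 ^ c"
  shows "\<exists>a A P l tab. a < 2 ^ c \<and>
    (\<forall>z. A z < 2 ^ c \<and> P z \<le> 21 * k \<and> l z \<le> 2 * L + 2) \<and> (\<forall>t. tab t < k) \<and>
    (\<forall>j<k. P (mshift c (L - 1) a (Y j)) +
        mshift c (l (mshift c (L - 1) a (Y j))) (A (mshift c (L - 1) a (Y j))) (Y j) < 21 * k \<and>
      tab (P (mshift c (L - 1) a (Y j)) +
        mshift c (l (mshift c (L - 1) a (Y j))) (A (mshift c (L - 1) a (Y j))) (Y j)) = j)"
proof -
  let ?Y = "Y ` {..<k}"
  have L: "1 \<le> L" using k by (cases L) auto
  have cY: "card ?Y = k" using inj by (simp add: card_image)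
  have Ysub: "?Y \<subseteq> {..<2 ^ c}" using Y by auto
  have c0: "0 < c" using c by simp
  \<comment> \<open>The first level has \<open>2 ^ (L - 1) < k\<close> cells. Having fewer cells
    than keys matters later, when the data of cell \<open>z\<close> are kept in the slot of the key
    with index \<open>z\<close>.\<close>
  obtain a where a: "a < 2 ^ c" "card (collisions c (L - 1) a ?Y) * 2 ^ (L - 1) \<le> 2 * k\<^sup>2"
  proof -
    have "L - 1 \<le> c" using c by linarith
    then show ?thesis using mshift_few_collisions[of ?Y c "L - 1"] Ysub c0 cY that by auto
  qed
  have eL: "(2::nat) ^ L = 2 * 2 ^ (L - 1)" using L by (cases L) auto
  have coll: "card (collisions c (L - 1) a ?Y) \<le> 4 * k"
  proof -
    have "card (collisions c (L - 1) a ?Y) * 2 ^ L \<le> 4 * k * k"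
      using a(2) unfolding eL power2_eq_square by (simp add: algebra_simps)
    also have "... \<le> 4 * k * 2 ^ L" using k by (intro mult_left_mono) auto
    finally show ?thesis by simp
  qed
  define h where "h = mshift c (L - 1) a"
  define Z where "Z z = {v\<in>?Y. h v = z}" for z
  define b where "b z = card (Z z)" for z
  have fZ: "finite (Z z)" for z by (simp add: Z_def)
  have hl: "h v < 2 ^ (L - 1)" for v unfolding h_def using c by (intro mshift_less) auto
  have sumb: "(\<Sum>z<2 ^ (L - 1). b z * b z) \<le> 5 * k"
  proof -
    let ?D = "(\<lambda>v. (v, v)) ` ?Y"
    have "(\<Sum>z<2 ^ (L - 1). b z * b z) = (\<Sum>z<(2::nat) ^ (L - 1). card (Z z \<times> Z z))"
      by (simp add: b_def card_cartesian_product)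
    also have "... = card (\<Union>z<(2::nat) ^ (L - 1). Z z \<times> Z z)"
      by (subst card_UN_disjoint) (auto simp: fZ, auto simp: Z_def)
    also have "(\<Union>z<(2::nat) ^ (L - 1). Z z \<times> Z z) = ?D \<union> collisions c (L - 1) a ?Y"
      using hl by (auto simp: Z_def collisions_def h_def)
    also have "card \<dots> \<le> card ?D + card (collisions c (L - 1) a ?Y)" by (rule card_Un_le)
    also have "card ?D = k" using cY by (simp add: card_image inj_on_def)
    finally show ?thesis using coll by simp
  qed
  define l where "l z = blen (2 * (b z * b z))" for z
  have bk: "b z \<le> k" for z using card_mono[of ?Y "Z z"] cY by (auto simp: b_def Z_def)
  have lz: "l z \<le> 2 * L + 2" for z
    unfolding l_def
  proof (rule blen_le)
    have "b z * b z \<le> 2 ^ L * 2 ^ L" using bk[of z] k by (intro mult_mono) auto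
    also have "... = 2 ^ (2 * L)" by (simp add: mult_2 power_add)
    finally have "2 * (b z * b z) \<le> 2 * 2 ^ (2 * L)" by simp
    also have "... < 2 ^ (2 * L + 2)" by simp
    finally show "2 * (b z * b z) < 2 ^ (2 * L + 2)" .
  qed
  have szl: "2 ^ l z \<le> 4 * (b z * b z) + 1" for z
    using exp_blen_le[of "2 * (b z * b z)"] by (cases "b z = 0") (auto simp: l_def)
  \<comment> \<open>The cell gets more than \<open>2 * b ^ 2\<close> positions, so the guaranteed
    number of collisions is below 1 and hence 0.\<close>
  have "\<exists>x<2 ^ c. inj_on (mshift c (l z) x) (Z z)" for z
  proof -
    obtain x where x: "x < 2 ^ c" "card (collisions c (l z) x (Z z)) * 2 ^ l z \<le> 2 * (b z)\<^sup>2"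
      using mshift_few_collisions[of "Z z" c "l z"] Ysub c lz[of z] fZ[of z]
      by (auto simp: b_def Z_def)
    have "2 * (b z)\<^sup>2 < 2 ^ l z" using less_exp_blen[of "2 * (b z * b z)"]
      by (simp add: l_def power2_eq_square)
    then have "card (collisions c (l z) x (Z z)) * 2 ^ l z < 1 * 2 ^ l z" using x by linarith
    then have "card (collisions c (l z) x (Z z)) = 0" by (simp del: card_eq_0_iff card_0_eq)
    then have "collisions c (l z) x (Z z) = {}" using finite_collisions[OF fZ] by simp
    then have "inj_on (mshift c (l z) x) (Z z)" by (auto simp: collisions_def inj_on_def)
    then show ?thesis using x by blast
  qed
  then obtain A where A: "\<And>z. A z < 2 ^ c" "\<And>z. inj_on (mshift c (l z) (A z)) (Z z)" by metis
  define P where "P z = (\<Sum>i<min z (2 ^ (L - 1)). 2 ^ l i :: nat)" for z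
  \<comment> \<open>A cell with \<open>b\<close> keys takes at most \<open>4 * b ^ 2 + 1\<close>
    positions. The squares sum to at most \<open>5 * k\<close>, namely \<open>k\<close> equal pairs
    and \<open>4 * k\<close> collisions, and there are at most \<open>k\<close> cells: 4 * 5 + 1 =
    21.\<close>
  have tot: "(\<Sum>i<2 ^ (L - 1). 2 ^ l i :: nat) \<le> 21 * k"
  proof -
    have "(\<Sum>i<2 ^ (L - 1). 2 ^ l i :: nat) \<le> (\<Sum>i<2 ^ (L - 1). 4 * (b i * b i) + 1)"
      by (intro sum_mono szl)
    also have "... = 4 * (\<Sum>i<2 ^ (L - 1). b i * b i) + 2 ^ (L - 1)"
      by (simp only: sum.distrib sum_distrib_left[symmetric]) simp
    also have "... \<le> 4 * (5 * k) + k" using sumb k eL by (intro add_mono mult_left_mono) auto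
    finally show ?thesis by simp
  qed
  have Ple: "P z \<le> 21 * k" for z
  proof -
    have "P z \<le> (\<Sum>i<2 ^ (L - 1). 2 ^ l i)" unfolding P_def by (intro sum_mono2) auto
    then show ?thesis using tot by linarith
  qed
  have Pstep: "P z + 2 ^ l z \<le> P z'" if "z < z'" "z < 2 ^ (L - 1)" for z z'
  proof -
    have "P z + 2 ^ l z = (\<Sum>i<Suc z. 2 ^ l i)" unfolding P_def using that by simp
    also have "... \<le> P z'" unfolding P_def using that by (intro sum_mono2) auto
    finally show ?thesis .
  qed
  define T where "T j = P (h (Y j)) + mshift c (l (h (Y j))) (A (h (Y j))) (Y j)" for j
  have msl: "mshift c (l z) x v < 2 ^ l z" for z x v
    using lz[of z] c by (intro mshift_less) auto
  have Tl: "T j < 21 * k" for j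
    using Pstep[of "h (Y j)" "Suc (h (Y j))"] hl[of "Y j"] Ple[of "Suc (h (Y j))"]
      msl[of "h (Y j)" "A (h (Y j))" "Y j"] unfolding T_def by simp
  have Tinj: "inj_on T {..<k}"
  proof (rule inj_onI)
    fix i j assume ij: "i \<in> {..<k}" "j \<in> {..<k}" "T i = T j"
    have ne: "\<not> h (Y i) < h (Y j)" if "T i = T j" for i j
    proof
      assume "h (Y i) < h (Y j)"
      then have "P (h (Y i)) + 2 ^ l (h (Y i)) \<le> P (h (Y j))" using hl by (intro Pstep)
      then show False using that msl[of "h (Y i)" "A (h (Y i))" "Y i"] unfolding T_def by linarith
    qed
    then have h: "h (Y i) = h (Y j)" using ij(3) by (metis linorder_neqE_nat)
    then have "mshift c (l (h (Y i))) (A (h (Y i))) (Y i) = mshift c (l (h (Y i))) (A (h (Y i))) (Y j)"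
      using ij(3) by (simp add: T_def)
    moreover have "Y i \<in> Z (h (Y i))" "Y j \<in> Z (h (Y i))" using ij h by (auto simp: Z_def)
    ultimately have "Y i = Y j" using A(2)[of "h (Y i)"] by (auto dest: inj_onD)
    then show "i = j" using inj ij by (auto dest: inj_onD)
  qed
  define tab where "tab t = (if t \<in> T ` {..<k} then the_inv_into {..<k} T t else 0)" for t
  have "tab t < k" for t
    using the_inv_into_into[OF Tinj, of t "{..<k}"] k by (auto simp: tab_def)
  moreover have "tab (T j) = j" if "j < k" for j
    using that the_inv_into_f_f[OF Tinj, of j] by (auto simp: tab_def)
  ultimately show ?thesis
    using a(1) A(1) Ple lz Tl unfolding T_def h_def by blast
qed

subsection \<open>Counting and selecting in sets of naturals\<close>

definition cnt :: "nat set => nat => nat" where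
  "cnt X q = card {x \<in> X. x < q}"

definition sel :: "nat set => nat => nat" where
  "sel X r = sorted_list_of_set X ! r"

lemma cnt_mono: "finite X ==> p \<le> q ==> cnt X p \<le> cnt X q"
  unfolding cnt_def by (intro card_mono) auto

lemma cnt_0 [simp]: "cnt X 0 = 0"
  by (simp add: cnt_def)

lemma cnt_le_card: "finite X ==> cnt X q \<le> card X"
  unfolding cnt_def by (intro card_mono) auto

lemma cnt_le: "cnt X q \<le> q"
proof -
  have "card {x \<in> X. x < q} \<le> card {..<q}" by (intro card_mono) auto
  then show ?thesis by (simp add: cnt_def)
qed

lemma cnt_Suc: "finite X ==> cnt X (Suc q) = cnt X q + (if q \<in> X then 1 else 0)"
proof -
  assume f: "finite X"
  have "{x \<in> X. x < Suc q} = (if q \<in> X then insert q {x \<in> X. x < q} else {x \<in> X. x < q})"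
    by (auto simp: less_Suc_eq)
  then show ?thesis using f by (auto simp: cnt_def)
qed

lemma cnt_diff: "finite X ==> p \<le> q ==> cnt X q = cnt X p + card {x \<in> X. p \<le> x \<and> x < q}"
proof -
  assume f: "finite X" "p \<le> q"
  have "{x \<in> X. x < q} = {x \<in> X. x < p} \<union> {x \<in> X. p \<le> x \<and> x < q}" using f by auto
  then show ?thesis unfolding cnt_def using f by (auto simp: card_Un_disjoint disjoint_iff)
qed

lemma cnt_diff_le: "finite X ==> p \<le> q ==> cnt X q \<le> cnt X p + (q - p)"
proof -
  assume f: "finite X" "p \<le> q"
  have "card {x \<in> X. p \<le> x \<and> x < q} \<le> card {p..<q}" by (intro card_mono) auto
  then show ?thesis using cnt_diff[OF f] by simp
qed

lemma cnt_bounded: "X \<subseteq> {..<U} ==> U \<le> q ==> cnt X q = card X"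
  unfolding cnt_def by (rule arg_cong[of _ _ card]) auto

lemma cnt_less_card: "finite X ==> x \<in> X ==> cnt X x < card X"
  unfolding cnt_def by (intro psubset_card_mono) auto

lemma sel_in: "finite X ==> r < card X ==> sel X r \<in> X"
  unfolding sel_def using nth_mem[of r "sorted_list_of_set X"] by simp

lemma sel_surj: "finite X ==> x \<in> X ==> \<exists>i<card X. sel X i = x"
  unfolding sel_def using in_set_conv_nth[of x "sorted_list_of_set X"] by auto

lemma sel_mono_strict: "finite X ==> r < s ==> s < card X ==> sel X r < sel X s"
  unfolding sel_def
  by (metis length_sorted_list_of_set sorted_wrt_nth_less strict_sorted_list_of_set)

lemma sel_mono: "finite X ==> r \<le> s ==> s < card X ==> sel X r \<le> sel X s"
  using sel_mono_strict[of X r s] by (cases "r = s") auto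

lemma cnt_sel: "finite X ==> r < card X ==> cnt X (sel X r) = r"
proof -
  assume f: "finite X" and r: "r < card X"
  have "{x \<in> X. x < sel X r} = sel X ` {..<r}"
  proof
    show "sel X ` {..<r} \<subseteq> {x \<in> X. x < sel X r}"
      using sel_in[OF f] sel_mono_strict[OF f _ r] r by auto
    show "{x \<in> X. x < sel X r} \<subseteq> sel X ` {..<r}"
    proof
      fix x assume x: "x \<in> {x \<in> X. x < sel X r}"
      then obtain i where i: "i < card X" "sel X i = x"
        using f sel_surj[OF f] by blast
      then have "i < r" using sel_mono[OF f, of r i] x by (cases "i < r") auto
      then show "x \<in> sel X ` {..<r}" using i by auto
    qed
  qed
  moreover have "inj_on (sel X) {..<r}"
    using sel_mono_strict[OF f] r by (intro linorder_inj_onI) (auto, metis less_irrefl order.strict_trans)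
  ultimately show ?thesis by (simp add: cnt_def card_image)
qed

lemma sel_cnt: "finite X ==> x \<in> X ==> sel X (cnt X x) = x"
proof -
  assume f: "finite X" and x: "x \<in> X"
  obtain i where "i < card X" "sel X i = x"
    using sel_surj[OF f x] by blast
  then show ?thesis using cnt_sel[OF f] by metis
qed

lemma sel_eqI: "finite X ==> x \<in> X ==> cnt X x = r ==> sel X r = x"
  using sel_cnt by blast

lemma sel_less_iff: "finite X ==> r < card X ==> sel X r < q \<longleftrightarrow> r < cnt X q"
proof
  assume f: "finite X" and r: "r < card X" and lt: "sel X r < q"
  have "cnt X (Suc (sel X r)) \<le> cnt X q" using f lt by (intro cnt_mono) auto
  then show "r < cnt X q" using cnt_Suc[OF f] sel_in[OF f r] cnt_sel[OF f r] by simp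
next
  assume f: "finite X" and r: "r < card X" and lt: "r < cnt X q"
  show "sel X r < q"
  proof (rule ccontr)
    assume "\<not> sel X r < q"
    then have "cnt X q \<le> cnt X (sel X r)" using f by (intro cnt_mono) auto
    then show False using cnt_sel[OF f r] lt by simp
  qed
qed

subsection \<open>Monotone functions with few values\<close>

text \<open>
  Only the values at multiples of \<open>b\<close> are tabulated.  A chunk on which the function is not
  constant is the last one that starts with its value, so the value serves as the index of an
  explicit table for that chunk.
\<close>

definition mf_base :: "(nat => nat => nat) => nat => nat => nat => nat" where
  "mf_base f b cB i = f (i div cB) (i mod cB * b)"

definition mf_expl :: "(nat => nat => nat) => nat => nat => nat => nat => nat" where
  "mf_expl f b cB Q i =
     (let t = i div b div Q; v = i div b mod Q
      in f t (Max {c. c < cB \<and> f t (c * b) = v} * b + i mod b))"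

definition MF :: "nat => nat => exp => exp => exp => exp => exp => exp" where
  "MF kB kE t cB Q b j =
     IfLess (ARR kB (t \<otimes> cB \<oplus> j \<oslash> b)) (ARR kB (t \<otimes> cB \<oplus> j \<oslash> b \<oplus> Lit 1))
       (ARR kE ((t \<otimes> Q \<oplus> ARR kB (t \<otimes> cB \<oplus> j \<oslash> b)) \<otimes> b \<oplus> j \<odot> b))
       (ARR kB (t \<otimes> cB \<oplus> j \<oslash> b))"

text \<open>The alternatives in the hypotheses on \<open>cBe\<close> and \<open>Qe\<close> serve a
  single function: the family index is then the literal 0, which cancels the strides, so that they
  need not be stored.\<close>

lemma (in stored) E_MF:
  assumes kB: "kB < length As" "As ! kB = (v, n * cB, mf_base f b cB)"
    and kE: "kE < length As" "As ! kE = (v, n * (Q * b), mf_expl f b cB Q)"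
    and ev: "E te = t" "E cBe = cB \<or> t = 0 \<and> te = Lit 0" "E Qe = Q \<or> t = 0 \<and> te = Lit 0"
      "E be = b" "E je = j"
    and t: "t < n" and b: "0 < b" and v: "0 < v" and j: "j div b + 1 < cB"
    and f: "mono (f t)" "\<And>j. f t j < Q" "\<And>j. f t j < 2 ^ v"
  shows "E (MF kB kE te cBe Qe be je) = f t j"
proof -
  have sz: "n * cB < 2 ^ w" "n * (Q * b) < 2 ^ w"
  proof -
    have "n * cB * v < 2 ^ w" "n * (Q * b) * v < 2 ^ w"
      using arrs[OF kB(1)] arrs[OF kE(1)] kB(2) kE(2) by (auto simp: arr_size_def)
    moreover have "n * cB * 1 \<le> n * cB * v" "n * (Q * b) * 1 \<le> n * (Q * b) * v"
      using v by (intro mult_le_mono2; simp)+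
    ultimately show "n * cB < 2 ^ w" "n * (Q * b) < 2 ^ w" by linarith+
  qed
  define c where "c = j div b"
  have i1: "t * cB + c + 1 < n * cB"
  proof -
    have "t * cB + cB \<le> n * cB" using t by (metis Suc_leI add.commute mult_Suc mult_le_mono1)
    then show ?thesis using j c_def by linarith
  qed
  have tc: "E (te \<otimes> cBe) = t * cB"
  proof (cases "E cBe = cB")
    case True
    then show ?thesis using ev i1 sz by (intro ev_mul) auto
  qed (use ev in auto)
  have e0: "E (te \<otimes> cBe \<oplus> je \<oslash> be) = t * cB + c"
    unfolding c_def using i1 sz c_def by (intro ev_add[OF _ tc ev_div[OF ev(5,4)]]) auto
  have e1: "E (te \<otimes> cBe \<oplus> je \<oslash> be \<oplus> Lit 1) = t * cB + c + 1"
    using i1 sz E_lit[of 1] by (intro ev_add[OF _ e0]) auto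
  have base: "mf_base f b cB (t * cB + x) = f t (x * b)" if "x < cB" for x
    using that by (simp add: mf_base_def)
  have B0: "E (ARR kB (te \<otimes> cBe \<oplus> je \<oslash> be)) = f t (c * b)"
    using E_ARR[OF kB e0] i1 base[of c] f j c_def by simp
  have B1: "E (ARR kB (te \<otimes> cBe \<oplus> je \<oslash> be \<oplus> Lit 1)) = f t ((c + 1) * b)"
    using E_ARR[OF kB e1] i1 base[of "c + 1"] f(3)[of "(c + 1) * b"] j c_def by (simp add: add.assoc)
  have jb: "c * b \<le> j" "j < (c + 1) * b" "j = c * b + j mod b"
    using b by (simp_all add: c_def) (metis add.commute dividend_less_div_times mult.commute mult_Suc)
  have m: "f t (c * b) \<le> f t j" "f t j \<le> f t ((c + 1) * b)"
    using jb f(1) by (auto intro: monoD)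
  show ?thesis
  proof (cases "f t (c * b) < f t ((c + 1) * b)")
    case False
    then show ?thesis unfolding MF_def using B0 B1 m by simp
  next
    case True
    define x where "x = f t (c * b)"
    have xQ: "x < Q" using f(2) by (simp add: x_def)
    have i2: "(t * Q + x) * b + j mod b < n * (Q * b)"
    proof -
      have "(t + 1) * Q \<le> n * Q" using t by (intro mult_le_mono1) simp
      then have "t * Q + x + 1 \<le> n * Q" using xQ by simp
      then have "(t * Q + x + 1) * b \<le> n * Q * b" by (rule mult_right_mono) simp
      moreover have "j mod b < b" using b by simp
      ultimately show ?thesis by (simp add: algebra_simps)
    qed
    define r where "r = t * Q + x"
    have "r * 1 \<le> r * b" using b by (intro mult_le_mono2) simp
    moreover have "r * b + j mod b < n * (Q * b)" using i2 by (simp add: r_def)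
    ultimately have s0: "r < 2 ^ w" and s2: "r * b < 2 ^ w" and s3: "r * b + j mod b < 2 ^ w"
      using sz by linarith+
    then have s1: "t * Q + x < 2 ^ w" "(t * Q + x) * b < 2 ^ w" "(t * Q + x) * b + j mod b < 2 ^ w"
      by (simp_all only: r_def)
    have tq: "E (te \<otimes> Qe) = t * Q"
    proof (cases "E Qe = Q")
      case True
      then show ?thesis using ev s1(1) by (intro ev_mul) auto
    qed (use ev in auto)
    have e2: "E ((te \<otimes> Qe \<oplus> ARR kB (te \<otimes> cBe \<oplus> je \<oslash> be)) \<otimes> be \<oplus> je \<odot> be)
        = (t * Q + x) * b + j mod b"
      by (intro ev_add[OF s1(3)] ev_mul[OF s1(2)] ev_add[OF s1(1)] ev_mod)
        (use tq B0 x_def ev in auto)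
    have jm: "j mod b < b" using b by simp
    have dv: "((t * Q + x) * b + j mod b) div b = t * Q + x" "((t * Q + x) * b + j mod b) mod b = j mod b"
      using div_mod_add_less[OF jm] by blast+
    have mx: "Max {c. c < cB \<and> f t (c * b) = x} = c"
    proof (rule Max_eqI)
      show "finite {c. c < cB \<and> f t (c * b) = x}" by simp
      show "c \<in> {c. c < cB \<and> f t (c * b) = x}" using j by (simp add: x_def c_def)
      fix y assume "y \<in> {c. c < cB \<and> f t (c * b) = x}"
      then have y: "f t (y * b) = x" by simp
      show "y \<le> c"
      proof (rule ccontr)
        assume "\<not> y \<le> c"
        then have "(c + 1) * b \<le> y * b" by (intro mult_right_mono) auto
        then have "f t ((c + 1) * b) \<le> x" using f(1) y by (metis monoD)
        then show False using True by (simp add: x_def)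
      qed
    qed
    have "mf_expl f b cB Q ((t * Q + x) * b + j mod b) = f t (c * b + j mod b)"
      unfolding mf_expl_def dv Let_def using xQ mx by (simp add: add.commute)
    then have val: "mf_expl f b cB Q ((t * Q + x) * b + j mod b) = f t j" using jb(3) by simp
    have "E (ARR kE ((te \<otimes> Qe \<oplus> ARR kB (te \<otimes> cBe \<oplus> je \<oslash> be)) \<otimes> be \<oplus> je \<odot> be)) = f t j"
      using E_ARR[OF kE e2 i2] val f(3) by simp
    then show ?thesis unfolding MF_def using B0 B1 True by simp
  qed
qed

subsection \<open>Compressed bit vectors with rank and select\<close>

text \<open>Any enumeration will do, since no program computes it: decoding goes through the stored
  tables \<open>trank\<close> and \<open>tsel\<close>, which are derived from the same
  enumeration.\<close>

definition subset_at :: "nat => nat => nat => nat set" where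
  "subset_at u c = (SOME e. bij_betw e {..<u choose c} {A. A \<subseteq> {..<u} \<and> card A = c})"

lemma subset_at_bij: "bij_betw (subset_at u c) {..<u choose c} {A. A \<subseteq> {..<u} \<and> card A = c}"
proof -
  have "card {A. A \<subseteq> {..<u} \<and> card A = c} = u choose c"
    using n_subsets[of "{..<u}" c] by simp
  moreover have "finite {A. A \<subseteq> {..<u} \<and> card A = c}"
    by (rule finite_subset[of _ "Pow {..<u}"]) auto
  ultimately have "\<exists>e. bij_betw e {..<u choose c} {A. A \<subseteq> {..<u} \<and> card A = c}"
    using ex_bij_betw_nat_finite by (metis atLeast0LessThan)
  then show ?thesis unfolding subset_at_def by (rule someI_ex)
qed

definition bclass :: "nat set => nat => nat => nat" where
  "bclass X u t = cnt X ((t + 1) * u) - cnt X (t * u)"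

definition bpat :: "nat set => nat => nat => nat set" where
  "bpat X u t = {p. p < u \<and> t * u + p \<in> X}"

definition bidx :: "nat set => nat => nat => nat" where
  "bidx X u t = (SOME i. i < (u choose bclass X u t) \<and> subset_at u (bclass X u t) i = bpat X u t)"

definition clen :: "nat => nat => nat" where
  "clen u c = blen ((u choose c) - 1)"

definition bptr :: "nat set => nat => nat => nat" where
  "bptr X u t = (\<Sum>i<t. clen u (bclass X u i))"

lemma cnt_block:
  assumes "finite X" "p \<le> u"
  shows "cnt X (t * u + p) = cnt X (t * u) + card (bpat X u t \<inter> {..<p})"
proof -
  have "bij_betw (\<lambda>x. t * u + x) (bpat X u t \<inter> {..<p}) {x \<in> X. t * u \<le> x \<and> x < t * u + p}"
    by (rule bij_betw_byWitness[where f' = "\<lambda>x. x - t * u"]) (use assms(2) in \<open>auto simp: bpat_def\<close>)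
  then have "card (bpat X u t \<inter> {..<p}) = card {x \<in> X. t * u \<le> x \<and> x < t * u + p}"
    by (rule bij_betw_same_card)
  then show ?thesis using cnt_diff[of X "t * u" "t * u + p"] assms by simp
qed

lemma bpat_sub: "bpat X u t \<subseteq> {..<u}"
  by (auto simp: bpat_def)

lemma finite_bpat [simp]: "finite (bpat X u t)"
  using finite_subset[OF bpat_sub] by blast

lemma card_bpat: "finite X ==> card (bpat X u t) = bclass X u t"
proof -
  assume "finite X"
  from cnt_block[OF this, of u u t] bpat_sub[of X u t]
  show ?thesis by (simp add: bclass_def Int_absorb2 add.commute)
qed

lemma bclass_le: "finite X ==> bclass X u t \<le> u"
  using card_mono[OF _ bpat_sub[of X u t]] card_bpat[of X u t] by simp

lemma cnt_step: "finite X ==> cnt X ((t + 1) * u) = cnt X (t * u) + bclass X u t"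
  unfolding bclass_def using cnt_mono[of X "t * u" "(t + 1) * u"] by simp

lemma bidx: "finite X ==> bidx X u t < (u choose bclass X u t) \<and>
    subset_at u (bclass X u t) (bidx X u t) = bpat X u t"
  unfolding bidx_def
proof (rule someI_ex)
  assume "finite X"
  then have "bpat X u t \<in> {A. A \<subseteq> {..<u} \<and> card A = bclass X u t}"
    using bpat_sub card_bpat by auto
  then have "bpat X u t \<in> subset_at u (bclass X u t) ` {..<u choose bclass X u t}"
    using subset_at_bij[of u "bclass X u t"] by (simp add: bij_betw_def)
  then show "\<exists>i<u choose bclass X u t. subset_at u (bclass X u t) i = bpat X u t" by auto
qed

lemma choose_le_exp: "n choose k \<le> 2 ^ n"
proof (cases "k \<le> n")
  case True
  then have "n choose k \<le> (\<Sum>k\<le>n. n choose k)" by (intro member_le_sum) auto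
  then show ?thesis by (simp add: choose_row_sum)
qed (simp add: binomial_eq_0)

lemma choose_le_exp': "0 < n ==> n choose k \<le> 2 ^ (n - 1)"
proof -
  assume "0 < n"
  then obtain m where n: "n = Suc m" by (cases n) auto
  show ?thesis
  proof (cases k)
    case (Suc j)
    show ?thesis
    proof (cases "j < m")
      case True
      have "(m choose j) + (m choose Suc j) = sum ((choose) m) {j, Suc j}" by simp
      also have "... \<le> (\<Sum>k\<le>m. m choose k)" using True by (intro sum_mono2) auto
      finally show ?thesis using n Suc by (simp add: choose_row_sum)
    next
      case False
      then show ?thesis using n Suc choose_le_exp[of m j] by (simp add: binomial_eq_0)
    qed
  qed (simp add: n)
qed

text \<open>The saving of one bit per block matters: it keeps the array of codes within the length
  \<open>U\<close> of the uncompressed vector, even with the additional last block of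
  \<open>nblocks\<close>, so pointers into it are no longer than positions.\<close>

lemma clen_le: "0 < u ==> clen u c \<le> u - 1"
proof -
  assume "0 < u"
  from choose_le_exp'[OF this, of c] have "(u choose c) - 1 < 2 ^ (u - 1)"
    by (metis diff_le_self diff_less le_less_trans less_le_trans order_le_less zero_less_one
        not_gr_zero zero_less_numeral zero_less_power diff_0_eq_0 neq0_conv)
  then show ?thesis unfolding clen_def by (rule blen_le)
qed

lemma bidx_less: "finite X ==> bidx X u t < 2 ^ clen u (bclass X u t)"
  using bidx[of X u t] less_exp_blen[of "(u choose bclass X u t) - 1"] by (auto simp: clen_def)

lemma bidx_less_exp: "finite X ==> bidx X u t < 2 ^ u"
  using bidx[of X u t] choose_le_exp[of u "bclass X u t"] by auto

lemma bptr_mono: "s \<le> t ==> bptr X u s \<le> bptr X u t"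
  unfolding bptr_def by (intro sum_mono2) auto

lemma bptr_add_le: "0 < u ==> s \<le> t ==> bptr X u t \<le> bptr X u s + (t - s) * (u - 1)"
proof -
  assume u: "0 < u" and st: "s \<le> t"
  have "bptr X u t = bptr X u s + (\<Sum>i=s..<t. clen u (bclass X u i))"
    unfolding bptr_def using st
    by (metis atLeast0LessThan sum.atLeastLessThan_concat zero_le)
  also have "(\<Sum>i=s..<t. clen u (bclass X u i)) \<le> (\<Sum>i=s..<t. u - 1)"
    using clen_le[OF u] by (intro sum_mono) auto
  finally show ?thesis by simp
qed

definition code_bits :: "nat set => nat => nat => bool list" where
  "code_bits X u Q = concat (map (\<lambda>t. nat_bits (clen u (bclass X u t)) (bidx X u t)) [0..<Q])"

lemma code_bits_nth:
  assumes "t < Q" "i < clen u (bclass X u t)"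
  shows "code_bits X u Q ! (bptr X u t + i) = bit (bidx X u t) i"
proof -
  let ?xs = "map (\<lambda>t. nat_bits (clen u (bclass X u t)) (bidx X u t)) [0..<Q]"
  have "sum_list (map length (take t ?xs)) = bptr X u t"
    using assms(1)
    by (simp add: take_map comp_def bptr_def interv_sum_list_conv_sum_set_nat atLeast0LessThan)
  then show ?thesis using nth_concat[of t ?xs i] assms
    unfolding code_bits_def by (simp add: nat_bits_def)
qed

text \<open>The argument packs class, index and position of a block query in mixed radix, with bases
  \<open>2 ^ u\<close> and \<open>u + 1\<close>. The base \<open>u + 1\<close> admits every position
  from 0 to \<open>u\<close>.\<close>

definition trank :: "nat => nat => nat" where
  "trank u x = card (subset_at u (x div (u + 1) div 2 ^ u) (x div (u + 1) mod 2 ^ u)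
     \<inter> {..<x mod (u + 1)})"

definition tsel :: "nat => nat => nat" where
  "tsel u x = sel (subset_at u (x div (u + 1) div 2 ^ u) (x div (u + 1) mod 2 ^ u)) (x mod (u + 1))"

definition tsize :: "nat => nat" where
  "tsize u = (u + 1) * 2 ^ u * (u + 1)"

text \<open>The additional block, possibly partial or empty, makes \<open>U\<close> itself a legal
  argument of rank.\<close>

definition nblocks :: "nat => nat => nat" where "nblocks U u = U div u + 1"
definition nsuper :: "nat => nat => nat => nat" where "nsuper U u sg = nblocks U u div sg + 1"

text \<open>The index \<open>t\<close> is there because \<open>MF\<close> expects a family of
  functions. Beyond the last element the value is the largest possible one, here and in
  \<open>block_in\<close>, so that the function is monotone on all arguments.\<close>

definition super_of :: "nat set => nat => nat => nat => nat => nat => nat" where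
  "super_of X U u sg t r = (if r < card X then sel X r div u div sg else nsuper U u sg - 1)"

definition block_in :: "nat set => nat => nat => nat => nat => nat" where
  "block_in X u sg s r =
     (if r < cnt X ((s + 1) * sg * u) - cnt X (s * sg * u)
      then sel X (cnt X (s * sg * u) + r) div u - s * sg else sg - 1)"

definition base2 :: "nat => nat => nat => nat" where "base2 u sg b2 = sg * u div b2 + 2"

text \<open>Entries 0 and 1 give the rank at a block boundary as an absolute value per superblock
  plus a short offset per block, entries 2 and 3 do the same for the start of its code. The pairs 7,
  8 and 9, 10 are monotone maps for select: the first leads from a rank to its superblock, the
  second from a rank within a superblock to the block.\<close>

definition fid_arrays :: "nat set => nat => nat => nat => nat => nat => arr list" where
  "fid_arrays X U u sg b1 b2 =
    (let Q = nblocks U u; S = nsuper U u sg; c1 = card X div b1 + 2; c2 = base2 u sg b2 in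
     [(blen U, S, \<lambda>s. cnt X (s * sg * u)),
      (blen (sg * u), Q + 1, \<lambda>t. cnt X (t * u) - cnt X (t div sg * sg * u)),
      (blen U, S, \<lambda>s. bptr X u (s * sg)),
      (blen (sg * u), Q + 1, \<lambda>t. bptr X u t - bptr X u (t div sg * sg)),
      (1, bptr X u Q, \<lambda>j. of_bool (code_bits X u Q ! j)),
      (blen u, tsize u, trank u),
      (blen u, tsize u, tsel u),
      (blen S, 1 * c1, mf_base (super_of X U u sg) b1 c1),
      (blen S, 1 * (S * b1), mf_expl (super_of X U u sg) b1 c1 S),
      (blen sg, S * c2, mf_base (block_in X u sg) b2 c2),
      (blen sg, S * (sg * b2), mf_expl (block_in X u sg) b2 c2 sg)])"

text \<open>The 15 arrays occupy parameters 0 to 29 with their offsets and widths; the remaining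
  ones start at 30.\<close>

definition PN :: "nat => exp" where "PN j = PAR (30 + j)"

definition eRk :: "exp => exp" where "eRk t = ARR 0 (t \<oslash> PN 4) \<oplus> ARR 1 t"
definition ePt :: "exp => exp" where "ePt t = ARR 2 (t \<oslash> PN 4) \<oplus> ARR 3 t"
definition eCI :: "exp => exp" where
  "eCI t = ((eRk (t \<oplus> Lit 1) \<ominus> eRk t) \<lless> PN 3) \<oplus> RDK 14 (ePt t) (ePt (t \<oplus> Lit 1) \<ominus> ePt t)"
definition RANK :: "exp => exp" where
  "RANK x = eRk (x \<oslash> PN 3) \<oplus> ARR 5 (eCI (x \<oslash> PN 3) \<otimes> (PN 3 \<oplus> Lit 1) \<oplus> x \<odot> PN 3)"
definition eSB :: "exp => exp" where
  "eSB r = MF 7 8 (Lit 0) (Lit 0) (Lit 0) (PN 5) r"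
definition eBK :: "exp => exp" where
  "eBK r = eSB r \<otimes> PN 4 \<oplus> MF 9 10 (eSB r) (PN 7) (PN 4) (PN 6) (r \<ominus> ARR 0 (eSB r))"
definition SEL :: "exp => exp" where
  "SEL r = eBK r \<otimes> PN 3 \<oplus> ARR 6 (eCI (eBK r) \<otimes> (PN 3 \<oplus> Lit 1) \<oplus> (r \<ominus> eRk (eBK r)))"

locale fid = stored +
  fixes X :: "nat set" and U u sg b1 b2 :: nat
  assumes lenAs: "length As = 15"
    and As_nth: "\<And>k. k < 11 ==> k \<noteq> 4 ==> As ! k = fid_arrays X U u sg b1 b2 ! k"
    and As_code: "As ! 14 = fid_arrays X U u sg b1 b2 ! 4"
    and ptrU: "bptr X u (nblocks U u) \<le> U"
    and lenps: "16 \<le> length ps"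
    and pars: "ps ! 3 = u" "ps ! 4 = sg" "ps ! 5 = b1" "ps ! 6 = b2" "ps ! 7 = base2 u sg b2"
    and XU: "X \<subseteq> {..<U}" and Uw: "U < 2 ^ w" and u2: "2 \<le> u" and uw: "u \<le> w"
    and sg: "0 < sg" and b1: "0 < b1" and b2: "0 < b2"
begin

lemma finX: "finite X"
  using XU finite_subset by blast

lemma PN: "j < 16 ==> E (PN j) = ps ! j"
  unfolding PN_def using E_own[of j] lenAs lenps by simp

abbreviation "Q \<equiv> nblocks U u"
abbreviation "S \<equiv> nsuper U u sg"

lemma arrays:
  "As ! 0 = (blen U, S, \<lambda>s. cnt X (s * sg * u))"
  "As ! 1 = (blen (sg * u), Q + 1, \<lambda>t. cnt X (t * u) - cnt X (t div sg * sg * u))"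
  "As ! 2 = (blen U, S, \<lambda>s. bptr X u (s * sg))"
  "As ! 3 = (blen (sg * u), Q + 1, \<lambda>t. bptr X u t - bptr X u (t div sg * sg))"
  "As ! 14 = (1, bptr X u Q, \<lambda>j. of_bool (code_bits X u Q ! j))"
  "As ! 5 = (blen u, tsize u, trank u)"
  "As ! 6 = (blen u, tsize u, tsel u)"
  "As ! 7 = (blen S, 1 * (card X div b1 + 2), mf_base (super_of X U u sg) b1 (card X div b1 + 2))"
  "As ! 8 = (blen S, 1 * (S * b1), mf_expl (super_of X U u sg) b1 (card X div b1 + 2) S)"
  "As ! 9 = (blen sg, S * base2 u sg b2, mf_base (block_in X u sg) b2 (base2 u sg b2))"
  "As ! 10 = (blen sg, S * (sg * b2), mf_expl (block_in X u sg) b2 (base2 u sg b2) sg)"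
  by (simp_all add: As_nth As_code fid_arrays_def Let_def)

lemma Q_less: "Q + 1 < 2 ^ w"
proof -
  have "U div u \<le> U div 2" using u2 by (intro div_le_mono2) auto
  moreover have "U div 2 * 2 \<le> U" by simp
  moreover have "(16::nat) < 2 ^ w" using exp_bound w16 by linarith
  ultimately show ?thesis unfolding nblocks_def using Uw by linarith
qed

lemma cnt_U: "cnt X y \<le> U"
  using cnt_le_card[OF finX] card_mono[OF _ XU] by (metis card_lessThan finite_lessThan le_trans)

lemma E_eRk:
  assumes t: "E te = t" "t \<le> Q"
  shows "E (eRk te) = cnt X (t * u)"
proof -
  have d: "E (te \<oslash> PN 4) = t div sg" using t PN[of 4] pars by simp
  have dS: "t div sg < S"
    unfolding nsuper_def using t(2) div_le_mono[of t Q sg] by simp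
  have 0: "E (ARR 0 (te \<oslash> PN 4)) = cnt X (t div sg * sg * u)"
    by (rule E_ARR[OF _ arrays(1) d dS])
      (use lenAs cnt_U[THEN le_less_trans, OF less_exp_blen] in auto)
  have le: "t div sg * sg * u \<le> t * u" by (intro mult_le_mono1) simp
  have df: "t * u - t div sg * sg * u < sg * u"
  proof -
    have "t * u = t div sg * sg * u + t mod sg * u" by (simp flip: add_mult_distrib)
    moreover have "t mod sg * u < sg * u" using sg u2 by (intro mult_strict_right_mono) auto
    ultimately show ?thesis by linarith
  qed
  have "cnt X (t * u) - cnt X (t div sg * sg * u) < sg * u"
    using cnt_diff_le[OF finX le] df by linarith
  then have 1: "E (ARR 1 te) = cnt X (t * u) - cnt X (t div sg * sg * u)"
    by (intro E_ARR[OF _ arrays(2) t(1)])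
      (use lenAs t(2) less_exp_blen[of "sg * u"] in auto)
  have eq: "cnt X (t div sg * sg * u) + (cnt X (t * u) - cnt X (t div sg * sg * u)) = cnt X (t * u)"
    using cnt_mono[OF finX le] by simp
  have "E (eRk te) = cnt X (t div sg * sg * u) + (cnt X (t * u) - cnt X (t div sg * sg * u))"
    unfolding eRk_def using cnt_U[of "t * u"] Uw by (intro ev_add[OF _ 0 1]) (simp add: eq)
  then show ?thesis using eq by simp
qed

lemma bptr_Q: "t \<le> Q ==> bptr X u t \<le> U"
  using bptr_mono ptrU le_trans by blast

lemma bptr_Q_less: "bptr X u Q < 2 ^ w"
  using arrs[of 14] lenAs arrays(5) by (simp add: arr_size_def)

lemma E_ePt:
  assumes t: "E te = t" "t \<le> Q"
  shows "E (ePt te) = bptr X u t"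
proof -
  have d: "E (te \<oslash> PN 4) = t div sg" using t PN[of 4] pars by simp
  have dS: "t div sg < S"
    unfolding nsuper_def using t(2) div_le_mono[of t Q sg] by simp
  have le: "t div sg * sg \<le> t" by simp
  have 0: "E (ARR 2 (te \<oslash> PN 4)) = bptr X u (t div sg * sg)"
    by (rule E_ARR[OF _ arrays(3) d dS])
      (use lenAs le_trans[OF le t(2)] bptr_Q[THEN le_less_trans, OF _ less_exp_blen] in auto)
  have "bptr X u t - bptr X u (t div sg * sg) \<le> (t - t div sg * sg) * (u - 1)"
    using bptr_add_le[OF _ le, of u X] u2 by simp
  also have "... \<le> (t - t div sg * sg) * u" by simp
  also have "t - t div sg * sg = t mod sg" by (simp add: minus_div_mult_eq_mod)
  also have "t mod sg * u < sg * u" using sg u2 by (intro mult_strict_right_mono) auto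
  finally have 1: "E (ARR 3 te) = bptr X u t - bptr X u (t div sg * sg)"
    by (intro E_ARR[OF _ arrays(4) t(1)])
      (use lenAs t(2) less_exp_blen[of "sg * u"] in auto)
  have eq: "bptr X u (t div sg * sg) + (bptr X u t - bptr X u (t div sg * sg)) = bptr X u t"
    using bptr_mono[OF le] by simp
  have "bptr X u t < 2 ^ w" using bptr_mono[OF t(2)] bptr_Q_less by (rule le_less_trans)
  then have "E (ePt te) = bptr X u (t div sg * sg) + (bptr X u t - bptr X u (t div sg * sg))"
    unfolding ePt_def by (intro ev_add[OF _ 0 1]) (simp add: eq)
  then show ?thesis using eq by simp
qed

definition ci :: "nat => nat" where "ci t = bclass X u t * 2 ^ u + bidx X u t"

lemma ci_bound: "p \<le> u ==> ci t * (u + 1) + p < tsize u"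
proof -
  assume p: "p \<le> u"
  have "ci t + 1 \<le> u * 2 ^ u + 2 ^ u"
    unfolding ci_def using bidx_less_exp[OF finX, of u t] bclass_le[OF finX, of u t]
    by (metis Suc_eq_plus1 add.assoc add_mono_thms_linordered_semiring(1) mult_le_mono1 Suc_leI)
  then have "(ci t + 1) * (u + 1) \<le> (u * 2 ^ u + 2 ^ u) * (u + 1)" by (rule mult_le_mono1)
  also have "... = tsize u" by (simp add: tsize_def algebra_simps)
  finally show ?thesis using p by simp
qed

lemma tsize_less: "tsize u < 2 ^ w"
proof -
  have "tsize u * blen u < 2 ^ w" using arrs[of 5] lenAs arrays(6) by (simp add: arr_size_def)
  moreover have "tsize u * 1 \<le> tsize u * blen u" using blen_pos[of u] u2 by (intro mult_le_mono2) auto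
  ultimately show ?thesis by linarith
qed

lemma E_eCI:
  assumes t: "E te = t" "t < Q"
  shows "E (eCI te) = ci t"
proof -
  have t1: "E (te \<oplus> Lit 1) = t + 1"
    using t Q_less E_lit[of 1] by (intro ev_add) auto
  have c: "E (eRk (te \<oplus> Lit 1) \<ominus> eRk te) = bclass X u t"
    unfolding bclass_def using E_eRk[OF t1] E_eRk[OF t(1)] t(2) cnt_mono[OF finX, of "t * u" "(t + 1) * u"]
      cnt_U[of "(t + 1) * u"] Uw
    by (intro ev_sub) auto
  have cib: "ci t < 2 ^ w"
  proof -
    have "ci t \<le> ci t * (u + 1) + 0" by simp
    then show ?thesis using ci_bound[of 0 t] tsize_less by linarith
  qed
  have s: "E ((eRk (te \<oplus> Lit 1) \<ominus> eRk te) \<lless> PN 3) = bclass X u t * 2 ^ u"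
    using cib PN[of 3] pars by (intro ev_shl[OF _ c]) (auto simp: ci_def)
  have l: "E (ePt (te \<oplus> Lit 1) \<ominus> ePt te) = clen u (bclass X u t)"
  proof -
    have "bptr X u (t + 1) = bptr X u t + clen u (bclass X u t)" by (simp add: bptr_def)
    moreover have "bptr X u (t + 1) \<le> bptr X u Q" using t by (intro bptr_mono) simp
    ultimately have "E (ePt (te \<oplus> Lit 1) \<ominus> ePt te) = bptr X u (t + 1) - bptr X u t"
      using E_ePt[OF t1] E_ePt[OF t(1)] t(2) bptr_Q_less by (intro ev_sub) auto
    then show ?thesis by (simp add: bptr_def)
  qed
  have r: "E (RDK 14 (ePt te) (ePt (te \<oplus> Lit 1) \<ominus> ePt te)) = bidx X u t"
  proof (rule E_RDK[OF _ E_ePt[OF t(1)] l _ _ bidx_less[OF finX]])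
    show "14 < length As" using lenAs by simp
    show "t \<le> Q" using t by simp
    show "clen u (bclass X u t) \<le> w" using clen_le[of u] u2 uw by (meson le_trans diff_le_self le_less_trans less_le_trans pos2)
    have "bptr X u t + clen u (bclass X u t) = bptr X u (t + 1)" by (simp add: bptr_def)
    also have "... \<le> bptr X u Q" using t by (intro bptr_mono) simp
    finally have le: "bptr X u t + clen u (bclass X u t) \<le> bptr X u Q" .
    show "bptr X u t + clen u (bclass X u t) \<le> arr_size (As ! 14)"
      using le by (simp add: arrays(5) arr_size_def)
    fix i assume i: "i < clen u (bclass X u t)"
    have "arr_bits (As ! 14) ! (bptr X u t + i) = code_bits X u Q ! (bptr X u t + i)"
      using i le unfolding arrays(5) arr_bits_def by (auto simp: bit_0)
    then show "bit (bidx X u t) i = arr_bits (As ! 14) ! (bptr X u t + i)"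
      using code_bits_nth[OF t(2) i] by simp
  qed
  show ?thesis unfolding eCI_def ci_def using cib by (intro ev_add[OF _ s r]) (simp add: ci_def)
qed

lemma ci_dec: "ci t div 2 ^ u = bclass X u t" "ci t mod 2 ^ u = bidx X u t"
  using bidx_less_exp[OF finX, of u t] by (auto simp: ci_def)

lemma ci_dec': "p \<le> u ==> (ci t * (u + 1) + p) div (u + 1) = ci t"
  "p \<le> u ==> (ci t * (u + 1) + p) mod (u + 1) = p"
  using div_mod_add_less[of p "u + 1" "ci t"] by auto

lemma E_tab_index:
  assumes t: "E te = t" "t < Q" and p: "E pe = p" "p \<le> u"
  shows "E (eCI te \<otimes> (PN 3 \<oplus> Lit 1) \<oplus> pe) = ci t * (u + 1) + p"
proof -
  have b: "ci t * (u + 1) + p < 2 ^ w" using ci_bound[OF p(2), of t] tsize_less by linarith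
  have "u + 1 < 2 ^ w" using uw exp_bound w16 by linarith
  then have "E (PN 3 \<oplus> Lit 1) = u + 1" using PN[of 3] pars E_lit[of 1] by (intro ev_add) auto
  then show ?thesis using b by (intro ev_add[OF b ev_mul[OF _ E_eCI[OF t]] p(1)]) auto
qed

lemma E_RANK:
  assumes x: "E xe = x" "x \<le> U"
  shows "E (RANK xe) = cnt X x"
proof -
  define t p where "t = x div u" and "p = x mod u"
  have p: "p \<le> u" using u2 mod_less_divisor[of u x] by (simp add: p_def less_imp_le)
  have t: "t < Q" unfolding t_def nblocks_def using div_le_mono[OF x(2), of u] by simp
  have e: "E (xe \<oslash> PN 3) = t" "E (xe \<odot> PN 3) = p" using x PN[of 3] pars by (auto simp: t_def p_def)
  have v: "trank u (ci t * (u + 1) + p) = card (bpat X u t \<inter> {..<p})"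
    unfolding trank_def ci_dec'[OF p] ci_dec using bidx[OF finX] by simp
  have vl: "card (bpat X u t \<inter> {..<p}) < 2 ^ blen u"
  proof -
    have "card (bpat X u t \<inter> {..<p}) \<le> card {..<p}" by (intro card_mono) auto
    then show ?thesis using p less_exp_blen[of u] by simp
  qed
  have a: "E (ARR 5 (eCI (xe \<oslash> PN 3) \<otimes> (PN 3 \<oplus> Lit 1) \<oplus> xe \<odot> PN 3)) = card (bpat X u t \<inter> {..<p})"
    using E_ARR[OF _ arrays(6) E_tab_index[OF e(1) t e(2) p] ci_bound[OF p]] lenAs v vl by simp
  have eq: "cnt X x = cnt X (t * u) + card (bpat X u t \<inter> {..<p})"
    using cnt_block[OF finX p, of t] by (simp add: t_def p_def)
  show ?thesis unfolding RANK_def eq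
    using E_eRk[OF e(1)] t a eq cnt_U[of x] Uw by (intro ev_add) auto
qed

lemma super_of_less: "super_of X U u sg t r < S"
proof (cases "r < card X")
  case True
  then have "sel X r < U" using sel_in[OF finX] XU by blast
  then have "sel X r div u div sg \<le> Q div sg"
    unfolding nblocks_def by (intro div_le_mono) (simp add: div_le_mono le_SucI less_imp_le)
  then show ?thesis using True by (simp add: super_of_def nsuper_def)
qed (simp add: super_of_def nsuper_def)

lemma mono_super_of: "mono (super_of X U u sg t)"
proof (rule monoI)
  fix x y :: nat assume xy: "x \<le> y"
  show "super_of X U u sg t x \<le> super_of X U u sg t y"
  proof (cases "y < card X")
    case True
    then show ?thesis using xy sel_mono[OF finX xy True] by (simp add: super_of_def div_le_mono)
  next
    case False
    have "super_of X U u sg t x \<le> S - 1"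
      using super_of_less[of t x] by linarith
    then show ?thesis using False by (simp add: super_of_def)
  qed
qed

lemma sel_block:
  assumes "cnt X (s * c) \<le> r" "r < cnt X ((s + 1) * c)" "0 < c"
  shows "sel X r div c = s" "r < card X"
proof -
  show r: "r < card X" using assms(2) cnt_le_card[OF finX] less_le_trans by blast
  have "sel X r < (s + 1) * c" using sel_less_iff[OF finX r] assms(2) by blast
  moreover have "s * c \<le> sel X r" using sel_less_iff[OF finX r] assms(1) by (meson not_less)
  ultimately show "sel X r div c = s" using assms(3) by (simp add: div_nat_eqI mult.commute)
qed

lemma block_in_props:
  "mono (block_in X u sg s)" "block_in X u sg s r < sg"
proof -
  let ?c = "sg * u"
  have c: "0 < ?c" using sg u2 by simp
  have blk: "sel X (cnt X (s * sg * u) + r) div u - s * sg < sg \<and>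
      s * sg \<le> sel X (cnt X (s * sg * u) + r) div u \<and> cnt X (s * sg * u) + r < card X"
    if r: "r < cnt X ((s + 1) * sg * u) - cnt X (s * sg * u)" for r
  proof -
    have 1: "cnt X (s * ?c) \<le> cnt X (s * sg * u) + r" "cnt X (s * sg * u) + r < cnt X ((s + 1) * ?c)"
      using r unfolding mult.assoc by linarith+
    have "sel X (cnt X (s * sg * u) + r) div ?c = s" using sel_block(1)[OF 1 c] .
    then have "sel X (cnt X (s * sg * u) + r) div u div sg = s"
      by (simp add: div_mult2_eq mult.commute[of sg])
    then have "s * sg \<le> sel X (cnt X (s * sg * u) + r) div u"
      "sel X (cnt X (s * sg * u) + r) div u < s * sg + sg"
      using sg div_times_less_eq_dividend[of "sel X (cnt X (s * sg * u) + r) div u" sg]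
        dividend_less_div_times[of sg "sel X (cnt X (s * sg * u) + r) div u"] by simp_all
    then show ?thesis using sel_block(2)[OF 1 c] by simp
  qed
  show bl: "block_in X u sg s r < sg" for r using blk sg by (auto simp: block_in_def)
  show "mono (block_in X u sg s)"
  proof (rule monoI)
    fix x y :: nat assume xy: "x \<le> y"
    show "block_in X u sg s x \<le> block_in X u sg s y"
    proof (cases "y < cnt X ((s + 1) * sg * u) - cnt X (s * sg * u)")
      case True
      have "sel X (cnt X (s * sg * u) + x) \<le> sel X (cnt X (s * sg * u) + y)"
        using xy blk[OF True] by (intro sel_mono finX) auto
      then show ?thesis using True xy by (simp add: block_in_def div_le_mono diff_le_mono)
    next
      case False
      then have "block_in X u sg s y = sg - 1" by (simp add: block_in_def)
      then show ?thesis using bl[of x] by linarith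
    qed
  qed
qed

lemma E_eSB:
  assumes r: "E re = r" "r < card X"
  shows "E (eSB re) = sel X r div u div sg"
proof -
  have "E (eSB re) = super_of X U u sg 0 r"
    unfolding eSB_def
  proof (rule E_MF[OF _ arrays(8) _ arrays(9)])
    show "E (Lit 0) = 0" by simp
    show "r div b1 + 1 < card X div b1 + 2" using r div_le_mono[of r "card X" b1] by simp
    show "super_of X U u sg 0 j < 2 ^ blen S" for j
      using super_of_less[of 0 j] less_exp_blen[of S] by linarith
    show "0 < blen S" by (simp add: blen_pos nsuper_def)
  qed (use lenAs PN[of 5] pars r b1 mono_super_of super_of_less in auto)
  then show ?thesis using r by (simp add: super_of_def)
qed

lemma E_eBK:
  assumes r: "E re = r" "r < card X"
  shows "E (eBK re) = sel X r div u"
proof -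
  define s where "s = sel X r div u div sg"
  have es: "E (eSB re) = s" using E_eSB[OF r] by (simp add: s_def)
  have sS: "s < S" using super_of_less[of 0 r] r by (simp add: super_of_def s_def)
  have selU: "sel X r < U" using sel_in[OF finX r(2)] XU by blast
  have s': "sel X r div (sg * u) = s" by (simp add: s_def div_mult2_eq mult.commute[of sg])
  have c: "0 < sg * u" using sg u2 by simp
  have lo: "s * (sg * u) \<le> sel X r" using s' by (metis div_times_less_eq_dividend)
  have hi: "sel X r < (s + 1) * (sg * u)"
    using s' dividend_less_div_times[OF c, of "sel X r"] by simp
  have clo: "cnt X (s * sg * u) \<le> r"
    using sel_less_iff[OF finX r(2), of "s * sg * u"] lo unfolding mult.assoc by linarith
  have chi: "r < cnt X ((s + 1) * sg * u)"
    using sel_less_iff[OF finX r(2), of "(s + 1) * sg * u"] hi unfolding mult.assoc by linarith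
  have a0: "E (ARR 0 (eSB re)) = cnt X (s * sg * u)"
    by (rule E_ARR[OF _ arrays(1) es sS])
      (use lenAs cnt_U[THEN le_less_trans, OF less_exp_blen] in auto)
  have rw: "r < 2 ^ w" using r(2) cnt_bounded[OF XU order_refl] cnt_U[of U] Uw by linarith
  have d: "E (re \<ominus> ARR 0 (eSB re)) = r - cnt X (s * sg * u)"
    by (rule ev_sub[OF clo rw r(1) a0])
  have dl: "r - cnt X (s * sg * u) < sg * u"
  proof -
    have "cnt X ((s + 1) * sg * u) \<le> cnt X (s * sg * u) + ((s + 1) * sg * u - s * sg * u)"
      by (intro cnt_diff_le finX mult_le_mono1) simp
    also have "(s + 1) * sg * u - s * sg * u = sg * u" by (simp add: algebra_simps)
    finally show ?thesis using chi clo by linarith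
  qed
  have m: "E (MF 9 10 (eSB re) (PN 7) (PN 4) (PN 6) (re \<ominus> ARR 0 (eSB re)))
      = block_in X u sg s (r - cnt X (s * sg * u))"
  proof (rule E_MF[OF _ arrays(10) _ arrays(11) es _ _ _ d sS b2])
    show "(r - cnt X (s * sg * u)) div b2 + 1 < base2 u sg b2"
      unfolding base2_def using dl div_le_mono[of "r - cnt X (s * sg * u)" "sg * u" b2] by simp
    show "block_in X u sg s j < 2 ^ blen sg" for j
      using block_in_props(2)[of s j] less_exp_blen[of sg] by linarith
    show "0 < blen sg" using sg by (rule blen_pos)
  qed (use lenAs PN pars block_in_props in auto)
  have v: "block_in X u sg s (r - cnt X (s * sg * u)) = sel X r div u - s * sg"
    using clo chi by (simp add: block_in_def)
  have le: "s * sg \<le> sel X r div u" by (simp add: s_def)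
  have bl: "sel X r div u < 2 ^ w" using selU Uw div_le_dividend[of "sel X r" u] by linarith
  have "E (eBK re) = s * sg + (sel X r div u - s * sg)"
    unfolding eBK_def
  proof (rule ev_add[OF _ ev_mul[OF _ es]])
    show "E (PN 4) = sg" using PN[of 4] pars by simp
    show "s * sg < 2 ^ w" using le bl by linarith
    show "s * sg + (sel X r div u - s * sg) < 2 ^ w" using le bl by linarith
  qed (use m v in simp)
  then show ?thesis using le by simp
qed

lemma E_SEL:
  assumes r: "E re = r" "r < card X"
  shows "E (SEL re) = sel X r"
proof -
  define t where "t = sel X r div u"
  have et: "E (eBK re) = t" using E_eBK[OF r] by (simp add: t_def)
  have selX: "sel X r \<in> X" "sel X r < U" using sel_in[OF finX r(2)] XU by blast+
  have t: "t < Q" unfolding t_def nblocks_def using div_le_mono[of "sel X r" U u] selX by simp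
  define p where "p = sel X r mod u"
  have p: "p < u" using u2 by (simp add: p_def)
  have sx: "sel X r = t * u + p" by (simp add: t_def p_def)
  have pb: "p \<in> bpat X u t" using selX(1) p by (simp add: bpat_def flip: sx)
  have cr: "r = cnt X (t * u) + card (bpat X u t \<inter> {..<p})"
    using cnt_block[OF finX, of p u t] p cnt_sel[OF finX r(2)] sx by simp
  have rw: "r < 2 ^ w" using r(2) cnt_bounded[OF XU order_refl] cnt_U[of U] Uw by linarith
  define j where "j = card (bpat X u t \<inter> {..<p})"
  have j: "j \<le> u"
    using card_mono[of "{..<p}" "bpat X u t \<inter> {..<p}"] p by (simp add: j_def)
  have ej: "E (re \<ominus> eRk (eBK re)) = j"
    using ev_sub[OF _ rw r(1) E_eRk[OF et]] t cr by (simp add: j_def)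
  have v: "tsel u (ci t * (u + 1) + j) = p"
    unfolding tsel_def ci_dec'[OF j] ci_dec using bidx[OF finX, of u t]
    by (simp, intro sel_eqI) (use pb in \<open>auto simp: j_def cnt_def intro: arg_cong[of _ _ card]\<close>)
  have "p < 2 ^ blen u" using p less_exp_blen[of u] by linarith
  then have a: "E (ARR 6 (eCI (eBK re) \<otimes> (PN 3 \<oplus> Lit 1) \<oplus> (re \<ominus> eRk (eBK re)))) = p"
    using E_ARR[OF _ arrays(7) E_tab_index[OF et t ej j] ci_bound[OF j]] lenAs v by simp
  show ?thesis unfolding SEL_def sx
  proof (rule ev_add[OF _ ev_mul[OF _ et] a])
    show "E (PN 3) = u" using PN[of 3] pars by simp
  qed (use selX(2) Uw sx in linarith)+
qed

end

subsection \<open>Classes of a monotone map\<close>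

definition starts :: "nat set => (nat => nat) => nat set" where
  "starts A f = {j \<in> A. \<forall>i\<in>A. i < j \<longrightarrow> f i < f j}"

text \<open>A monotone sequence on the positions \<open>A\<close> falls into runs of equal values.
  It is represented by two sets, the image of \<open>f\<close> and the first positions of the runs.
  The sentinel \<open>n\<close> in \<open>W\<close> answers searches without result; what
  \<open>W\<close> contains above \<open>n\<close> is left open.\<close>

locale classes =
  fixes n :: nat and A :: "nat set" and f :: "nat => nat" and W :: "nat set"
  assumes A: "A \<subseteq> {..<n}" and mono: "\<And>i j. i \<in> A ==> j \<in> A ==> i \<le> j ==> f i \<le> f j"
    and W: "\<And>j. j \<le> n ==> j \<in> W \<longleftrightarrow> j = n \<or> j \<in> starts A f" and finW: "finite W"
begin

lemma finA: "finite A"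
  using A finite_subset by blast

lemma start_exists: "j \<in> A ==> \<exists>s\<in>starts A f. s \<le> j \<and> f s = f j"
proof -
  assume j: "j \<in> A"
  let ?s = "Min {i \<in> A. f i = f j}"
  have fin: "finite {i \<in> A. f i = f j}" "{i \<in> A. f i = f j} \<noteq> {}" using finA j by auto
  have s: "?s \<in> A" "f ?s = f j" using Min_in[OF fin] by auto
  have "?s \<in> starts A f" unfolding starts_def
  proof (intro CollectI conjI ballI impI)
    fix i assume i: "i \<in> A" "i < ?s"
    then have "f i \<noteq> f j" using Min_le[OF fin(1), of i] by auto
    moreover have "f i \<le> f j" using mono[of i ?s] i s by auto
    ultimately show "f i < f ?s" using s by simp
  qed (rule s)
  moreover have "?s \<le> j" using fin j by (intro Min_le) auto
  ultimately show ?thesis using s by blast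
qed

lemma inj_starts: "inj_on f (starts A f)"
proof (rule inj_onI)
  fix i j assume ij: "i \<in> starts A f" "j \<in> starts A f" "f i = f j"
  have i: "i \<in> A \<and> (\<forall>x\<in>A. x < i \<longrightarrow> f x < f i)"
    using ij(1) unfolding starts_def mem_Collect_eq .
  have j: "j \<in> A \<and> (\<forall>x\<in>A. x < j \<longrightarrow> f x < f j)"
    using ij(2) unfolding starts_def mem_Collect_eq .
  have "i < j \<longrightarrow> f i < f j" using i j by blast
  moreover have "j < i \<longrightarrow> f j < f i" using i j by blast
  ultimately show "i = j" using ij(3) by linarith
qed

lemma image_starts: "f ` starts A f = f ` A"
proof
  show "f ` starts A f \<subseteq> f ` A" by (intro image_mono) (auto simp: starts_def)
  show "f ` A \<subseteq> f ` starts A f"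
  proof
    fix y assume "y \<in> f ` A"
    then obtain j where j: "j \<in> A" "y = f j" by blast
    obtain s where "s \<in> starts A f" "f s = f j" using start_exists[OF j(1)] by blast
    then show "y \<in> f ` starts A f" using j(2) by (metis imageI)
  qed
qed

lemma cnt_image: "cnt (f ` A) q = card {s \<in> starts A f. f s < q}"
proof -
  have "{x \<in> f ` A. x < q} = f ` {s \<in> starts A f. f s < q}"
    unfolding image_starts[symmetric] by auto
  then show ?thesis unfolding cnt_def
    using card_image[OF inj_on_subset[OF inj_starts, of "{s \<in> starts A f. f s < q}"]] by auto
qed

lemma starts_less: "j \<in> starts A f ==> j < n"
  using A by (auto simp: starts_def)

text \<open>The rank of \<open>q\<close> in the image is the number of runs with values below
  \<open>q\<close>; the next run starts at the position sought.\<close>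

lemma sel_cnt_image: "sel W (cnt (f ` A) q) = Min (insert n {j \<in> A. q \<le> f j})"
proof -
  define p where "p = Min (insert n {j \<in> A. q \<le> f j})"
  have fin: "finite (insert n {j \<in> A. q \<le> f j})" using finA by simp
  have pin: "p = n \<or> p \<in> A \<and> q \<le> f p" using Min_in[OF fin] unfolding p_def by auto
  have pmin: "j \<in> A ==> q \<le> f j ==> p \<le> j" for j using Min_le[OF fin] unfolding p_def by auto
  have pn: "p \<le> n" unfolding p_def using fin by (intro Min_le) auto
  have pW: "p \<in> W"
  proof (cases "p = n")
    case False
    then have p: "p \<in> A" "q \<le> f p" using pin by auto
    have "f i < f p" if "i \<in> A" "i < p" for i using pmin[of i] that p by (cases "q \<le> f i") auto
    then have "p \<in> starts A f" unfolding starts_def using p by auto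
    then show ?thesis using W pn by blast
  qed (use W in simp)
  have "{x \<in> W. x < p} = {s \<in> starts A f. f s < q}"
  proof safe
    fix x assume x: "x \<in> W" "x < p"
    then show s: "x \<in> starts A f" using W[of x] pn by auto
    then have "x \<in> A" by (simp add: starts_def)
    then show "f x < q" using pmin[of x] x by (cases "f x < q") auto
  next
    fix s assume s: "s \<in> starts A f" "f s < q"
    then have sn: "s < n" "s \<in> A" using starts_less by (auto simp: starts_def)
    then show "s \<in> W" using W[of s] s by auto
    show "s < p"
    proof (cases "p = n")
      case False
      then have "p \<in> A" "q \<le> f p" using pin by auto
      then show ?thesis using mono[of p s] s sn by (cases "s < p") auto
    qed (use sn in simp)
  qed
  then have "cnt W p = cnt (f ` A) q" unfolding cnt_image cnt_def[of W] by simp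
  then show ?thesis using sel_cnt[OF finW pW] unfolding p_def[symmetric] by simp
qed

lemma index_less: "cnt (f ` A) q < card W"
proof -
  have "cnt (f ` A) q \<le> card (starts A f)"
    unfolding cnt_image using finA by (intro card_mono) (auto simp: starts_def)
  also have "... < card W"
  proof (rule psubset_card_mono[OF finW])
    show "starts A f \<subset> W" using W starts_less by (auto dest: less_imp_le)
  qed
  finally show ?thesis .
qed

text \<open>The converse direction: the rank in \<open>W\<close> tells the number of the run that
  contains \<open>j\<close>, and select in the image returns its value. The subtraction of 1 turns
  the count, which includes the run of \<open>j\<close>, into an index from 0.\<close>

lemma sel_image_cnt:
  assumes j: "j \<in> A"
  shows "1 \<le> cnt W (j + 1)" "cnt W (j + 1) - 1 < card (f ` A)" "sel (f ` A) (cnt W (j + 1) - 1) = f j"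
proof -
  obtain s where s: "s \<in> starts A f" "s \<le> j" "f s = f j" using start_exists[OF j] by blast
  have jn: "j < n" using j A by auto
  have "{x \<in> W. x < j + 1} = insert s {s \<in> starts A f. f s < f j}"
  proof safe
    fix x assume x: "x \<in> W" "x < j + 1" "x \<noteq> s"
    then show xs: "x \<in> starts A f" using W[of x] jn by auto
    then have "f x \<le> f j" using mono[of x j] j x by (auto simp: starts_def)
    moreover have "f x \<noteq> f j" using inj_onD[OF inj_starts, of x s] xs s x by auto
    ultimately show "f x < f j" by simp
  next
    show "s \<in> W" using W[of s] s jn by auto
    show "s < j + 1" using s by simp
  next
    fix x assume x: "x \<in> starts A f" "f x < f j"
    then have "x < n" "x \<in> A" using starts_less by (auto simp: starts_def)
    then show "x \<in> W" using W[of x] x by auto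
    show "x < j + 1" using mono[of j x] j x \<open>x \<in> A\<close> by (cases "x \<le> j") auto
  qed
  moreover have "s \<notin> {s \<in> starts A f. f s < f j}" using s by simp
  moreover have "finite {s \<in> starts A f. f s < f j}" using finA by (simp add: starts_def)
  ultimately have c: "cnt W (j + 1) = Suc (cnt (f ` A) (f j))" unfolding cnt_image cnt_def[of W] by simp
  then show "1 \<le> cnt W (j + 1)" by simp
  show "cnt W (j + 1) - 1 < card (f ` A)" using c cnt_less_card[of "f ` A" "f j"] finA j by simp
  show "sel (f ` A) (cnt W (j + 1) - 1) = f j" using c sel_cnt[of "f ` A" "f j"] finA j by simp
qed

end

subsection \<open>Levels of buckets\<close>

text \<open>For positive \<open>k\<close> this is the ceiling of \<open>lg k\<close>.\<close>

definition clg :: "nat => nat" where "clg k = blen (k - 1)"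

lemma clg: "2 \<le> k ==> k \<le> 2 ^ clg k \<and> 2 ^ clg k < 2 * k \<and> 1 \<le> clg k"
  unfolding clg_def using less_exp_blen[of "k - 1"] exp_blen_le[of "k - 1"] blen_pos[of "k - 1"] by auto

lemma clg_mono: "j \<le> k ==> clg j \<le> clg k"
  unfolding clg_def by (intro blen_mono) simp

lemma initial_segment:
  assumes "\<And>i j. i < j ==> j < n ==> P j ==> P i"
  shows "{j. j < n \<and> P j} = {..<card {j. j < n \<and> P j}}"
proof -
  let ?S = "{j. j < n \<and> P j}"
  have fin: "finite ?S" by simp
  have "\<exists>c. ?S = {..<c}"
  proof (cases "?S = {}")
    case True
    then show ?thesis by (intro exI[of _ 0]) auto
  next
    case False
    have m: "Max ?S \<in> ?S" using Max_in[OF fin False] .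
    have "?S = {..<Suc (Max ?S)}"
    proof
      show "?S \<subseteq> {..<Suc (Max ?S)}" using Max_ge[OF fin] by (auto simp: less_Suc_eq_le)
      show "{..<Suc (Max ?S)} \<subseteq> ?S"
      proof
        fix x assume "x \<in> {..<Suc (Max ?S)}"
        then have "x = Max ?S \<or> x < Max ?S" by auto
        then show "x \<in> ?S" using m assms[of x "Max ?S"] by auto
      qed
    qed
    then show ?thesis by blast
  qed
  then show ?thesis by (metis card_lessThan)
qed

locale keys =
  fixes n d tau :: nat and K :: "nat => nat"
  assumes K: "\<And>i j. i < j ==> j < n ==> K i < K j"
begin

text \<open>
  The bucket of \<open>x\<close> at resolution \<open>e\<close> consists of the positions \<open>lo e x, \<dots>, hi e x - 1\<close> of the keys
  that agree with \<open>x\<close> in all but the last \<open>e\<close> bits.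
\<close>

definition lo :: "nat => nat => nat" where
  "lo e x = card {j. j < n \<and> K j div 2 ^ e < x div 2 ^ e}"

definition hi :: "nat => nat => nat" where
  "hi e x = card {j. j < n \<and> K j div 2 ^ e \<le> x div 2 ^ e}"

lemma K_mono: "i \<le> j ==> j < n ==> K i \<le> K j"
  using K[of i j] by (cases "i = j") auto

lemma less_lo: "j < n ==> j < lo e x \<longleftrightarrow> K j div 2 ^ e < x div 2 ^ e"
proof -
  assume j: "j < n"
  have "{j. j < n \<and> K j div 2 ^ e < x div 2 ^ e} = {..<lo e x}"
    unfolding lo_def
    by (rule initial_segment) (meson K_mono div_le_mono le_less_trans less_imp_le)
  then show ?thesis using j by blast
qed

lemma less_hi: "j < n ==> j < hi e x \<longleftrightarrow> K j div 2 ^ e \<le> x div 2 ^ e"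
proof -
  assume j: "j < n"
  have "{j. j < n \<and> K j div 2 ^ e \<le> x div 2 ^ e} = {..<hi e x}"
    unfolding hi_def
    by (rule initial_segment) (meson K_mono div_le_mono le_trans less_imp_le)
  then show ?thesis using j by blast
qed

lemma hi_le: "hi e x \<le> n"
proof -
  have "hi e x \<le> card {..<n}" unfolding hi_def by (intro card_mono) auto
  then show ?thesis by simp
qed

lemma lo_le_hi: "lo e x \<le> hi e x"
  unfolding lo_def hi_def by (intro card_mono) auto

lemma in_bucket: "j < n ==> lo e x \<le> j \<and> j < hi e x \<longleftrightarrow> K j div 2 ^ e = x div 2 ^ e"
  using less_lo[of j e x] less_hi[of j e x] by linarith

lemma lo_cong: "x div 2 ^ e = y div 2 ^ e ==> lo e x = lo e y"
  by (simp add: lo_def)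

lemma hi_cong: "x div 2 ^ e = y div 2 ^ e ==> hi e x = hi e y"
  by (simp add: hi_def)

lemma div_exp_refine: "e' \<le> e ==> x div 2 ^ e' = y div 2 ^ e' ==> x div 2 ^ e = y div (2::nat) ^ e"
proof -
  assume a: "e' \<le> e" "x div 2 ^ e' = y div 2 ^ e'"
  have "x div 2 ^ e = x div 2 ^ e' div 2 ^ (e - e')" for x :: nat
    using a(1) by (simp flip: div_mult2_eq power_add)
  then show ?thesis using a(2) by simp
qed

lemma div_exp_mono_less: "e' \<le> e ==> x div 2 ^ e < y div (2::nat) ^ e ==> x div 2 ^ e' < y div 2 ^ e'"
  using div_exp_refine by (metis div_le_mono less_le_not_le linorder_not_less nle_le)

lemma lo_refine: "e' \<le> e ==> lo e x \<le> lo e' x"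
  unfolding lo_def by (intro card_mono) (auto intro: div_exp_mono_less)

lemma hi_refine: "e' \<le> e ==> hi e' x \<le> hi e x"
  unfolding hi_def using div_exp_mono_less by (intro card_mono) (auto simp: not_less[symmetric])

definition siz :: "nat => nat => nat" where "siz e x = hi e x - lo e x"

lemma siz_refine: "e' \<le> e ==> siz e' x \<le> siz e x"
  unfolding siz_def using lo_refine hi_refine by (meson diff_le_mono2 diff_le_mono le_trans)

lemma siz_0: "siz 0 x \<le> 1"
proof (rule ccontr)
  assume "\<not> siz 0 x \<le> 1"
  then have a: "lo 0 x + 1 < hi 0 x" unfolding siz_def by linarith
  then have "lo 0 x + 1 < n" using hi_le less_le_trans by blast
  then show False
    using in_bucket[of "lo 0 x" 0 x] in_bucket[of "lo 0 x + 1" 0 x] a K[of "lo 0 x" "lo 0 x + 1"] by auto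
qed

text \<open>The number of low bits of \<open>x\<close> that are left after \<open>l\<close> levels.
  Queries follow the same path as keys, so it is defined for every \<open>x\<close>; it depends only
  on the bucket that \<open>x\<close> falls into (\<open>rem_cong\<close>). When too few bits are
  left, the subtraction stops at 0.\<close>

fun rem :: "nat => nat => nat" where
  "rem 0 x = d"
| "rem (Suc l) x = (if siz (rem l x) x < 2 then rem l x
     else rem l x - (clg (siz (rem l x) x) + tau))"

abbreviation "LO l x \<equiv> lo (rem l x) x"
abbreviation "HI l x \<equiv> hi (rem l x) x"
abbreviation "SZ l x \<equiv> siz (rem l x) x"

lemma rem_Suc_le: "rem (Suc l) x \<le> rem l x"
  by simp

lemma rem_le: "rem l x \<le> d"
  by (induction l) (auto intro: le_trans)

lemma rem_cong: "x div 2 ^ rem l x = y div 2 ^ rem l x ==> rem l y = rem l x"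
proof (induction l)
  case (Suc l)
  have 1: "x div 2 ^ rem l x = y div 2 ^ rem l x"
    using div_exp_refine[OF rem_Suc_le Suc.prems] .
  have r: "rem l y = rem l x" using Suc.IH[OF 1] .
  have "siz (rem l y) y = siz (rem l x) x"
    unfolding siz_def r using lo_cong[OF 1] hi_cong[OF 1] by simp
  then show ?case using r by simp
qed simp

lemma level_cong:
  assumes "x div 2 ^ rem l x = y div 2 ^ rem l x"
  shows "rem l y = rem l x" "LO l y = LO l x" "HI l y = HI l x" "SZ l y = SZ l x"
  using rem_cong[OF assms] lo_cong[OF assms] hi_cong[OF assms] by (auto simp: siz_def)

definition A :: "nat => nat set" where
  "A l = {j. j < n \<and> 2 \<le> SZ l (K j)}"

definition dig :: "nat => nat => nat" where
  "dig l x = x div 2 ^ rem (Suc l) x mod 2 ^ (rem l x - rem (Suc l) x)"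

text \<open>The digit consumed in a bucket of \<open>k\<close> keys is below
  \<open>k * 2 ^ (tau + 1)\<close>. The bucket at the positions from \<open>LO\<close> to
  \<open>HI\<close> can therefore own the codes from \<open>LO * 2 ^ (tau + 1)\<close> to
  \<open>HI * 2 ^ (tau + 1)\<close>. This makes codes of different buckets comparable, keeps them in
  the order of the keys, and fits all of them into a universe of size
  \<open>n * 2 ^ (tau + 1)\<close>.\<close>

definition code :: "nat => nat => nat" where
  "code l x = LO l x * 2 ^ (tau + 1) + dig l x"

lemma div_split: "e' \<le> e ==> (x::nat) div 2 ^ e' = x div 2 ^ e * 2 ^ (e - e') + x div 2 ^ e' mod 2 ^ (e - e')"
proof -
  assume e: "e' \<le> e"
  have "x div 2 ^ e = x div 2 ^ e' div 2 ^ (e - e')"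
    using e by (simp flip: div_mult2_eq power_add)
  then show ?thesis using div_mult_mod_eq[of "x div 2 ^ e'" "2 ^ (e - e')"] by (simp only:)
qed

lemma dig_bound: "2 \<le> SZ l x ==> dig l x < SZ l x * 2 ^ (tau + 1)"
proof -
  assume k: "2 \<le> SZ l x"
  have "dig l x < 2 ^ (rem l x - rem (Suc l) x)" by (simp add: dig_def)
  also have "... \<le> 2 ^ (clg (SZ l x) + tau)" using k by (intro power_increasing) auto
  also have "... \<le> (2 * SZ l x) * 2 ^ tau"
    unfolding power_add using clg[OF k] by (intro mult_le_mono1) simp
  finally show ?thesis by (simp add: mult_ac)
qed

lemma code_bounds:
  assumes "2 \<le> SZ l x"
  shows "LO l x * 2 ^ (tau + 1) \<le> code l x" "code l x + 1 \<le> HI l x * 2 ^ (tau + 1)"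
proof -
  have "HI l x = LO l x + SZ l x" using lo_le_hi by (simp add: siz_def)
  then show "code l x + 1 \<le> HI l x * 2 ^ (tau + 1)"
    using dig_bound[OF assms] unfolding code_def by (simp add: add_mult_distrib)
qed (simp add: code_def)

lemma code_in_bucket:
  assumes j: "j < n" "LO l x \<le> j" "j < HI l x" and k: "2 \<le> SZ l x"
  shows "j \<in> A l"
    "code l (K j) < code l x \<longleftrightarrow> K j div 2 ^ rem (Suc l) x < x div 2 ^ rem (Suc l) x"
    "code l (K j) \<le> code l x \<longleftrightarrow> K j div 2 ^ rem (Suc l) x \<le> x div 2 ^ rem (Suc l) x"
proof -
  have eq: "x div 2 ^ rem l x = K j div 2 ^ rem l x" using in_bucket[OF j(1)] j by metis
  note c = level_cong[OF eq]
  show "j \<in> A l" using j k c by (simp add: A_def)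
  have rs: "rem (Suc l) (K j) = rem (Suc l) x" using c by simp
  have s: "K j div 2 ^ rem (Suc l) x = x div 2 ^ rem l x * 2 ^ (rem l x - rem (Suc l) x) + dig l (K j)"
    "x div 2 ^ rem (Suc l) x = x div 2 ^ rem l x * 2 ^ (rem l x - rem (Suc l) x) + dig l x"
    using div_split[OF rem_Suc_le, of "K j" l x] div_split[OF rem_Suc_le, of x l x] eq
    unfolding dig_def rs c(1) by simp_all
  show "code l (K j) < code l x \<longleftrightarrow> K j div 2 ^ rem (Suc l) x < x div 2 ^ rem (Suc l) x"
    unfolding s code_def c(2) by simp
  show "code l (K j) \<le> code l x \<longleftrightarrow> K j div 2 ^ rem (Suc l) x \<le> x div 2 ^ rem (Suc l) x"
    unfolding s code_def c(2) by simp
qed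

lemma pos_in_bucket: "j < n ==> lo e (K j) \<le> j \<and> j < hi e (K j)"
  using in_bucket[of j e "K j"] by simp

text \<open>The intervals of \<open>x\<close> and of \<open>K j\<close> may have different lengths,
  and the bucket of \<open>x\<close> may be empty of keys up to \<open>LO l x\<close>. If the bucket
  of \<open>j\<close> reached beyond \<open>LO l x\<close>, the key at that position would lie in
  the interval of \<open>K j\<close>, which starts before that of \<open>x\<close>, and yet not
  precede the interval of \<open>x\<close>. Comparing at the coarser of the two resolutions refutes
  this.\<close>

lemma code_below:
  assumes "j \<in> A l" "j < LO l x"
  shows "code l (K j) < LO l x * 2 ^ (tau + 1)"
proof -
  have j: "j < n" "2 \<le> SZ l (K j)" using assms(1) by (auto simp: A_def)
  have "HI l (K j) \<le> LO l x"
  proof (rule ccontr)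
    assume a: "\<not> HI l (K j) \<le> LO l x"
    let ?p = "LO l x"
    have pn: "?p < n" using a hi_le[of "rem l (K j)" "K j"] by linarith
    have "LO l (K j) \<le> ?p" using pos_in_bucket[OF j(1)] assms(2) by (meson le_trans less_imp_le)
    then have e1: "K ?p div 2 ^ rem l (K j) = K j div 2 ^ rem l (K j)"
      using in_bucket[OF pn] a by (metis not_le)
    have e2: "\<not> K ?p div 2 ^ rem l x < x div 2 ^ rem l x" using less_lo[OF pn, of "rem l x" x] by simp
    have e3: "K j div 2 ^ rem l x < x div 2 ^ rem l x" using less_lo[OF j(1)] assms(2) by blast
    show False
    proof (cases "rem l (K j) \<le> rem l x")
      case True
      then have "K ?p div 2 ^ rem l x = K j div 2 ^ rem l x" using div_exp_refine[OF True e1] by simp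
      then show False using e2 e3 by simp
    next
      case False
      have "rem l (K ?p) = rem l (K j)" using rem_cong[OF e1[symmetric]] .
      show False
      proof (cases "x div 2 ^ rem l (K j) = K j div 2 ^ rem l (K j)")
        case True
        then have "rem l x = rem l (K j)" using rem_cong[of "K j" l x] by simp
        then show False using False by simp
      next
        case F: False
        have "K j div 2 ^ rem l (K j) \<le> x div 2 ^ rem l (K j)"
        proof (rule ccontr)
          assume "\<not> ?thesis"
          then have "x div 2 ^ rem l x < K j div 2 ^ rem l x"
            using False by (intro div_exp_mono_less[of "rem l x" "rem l (K j)"]) auto
          then show False using e3 by simp
        qed
        then have "K ?p div 2 ^ rem l (K j) < x div 2 ^ rem l (K j)" using F e1 by simp
        then have "K ?p div 2 ^ rem l x < x div 2 ^ rem l x"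
          using False by (intro div_exp_mono_less[of "rem l x" "rem l (K j)"]) auto
        then show False using e2 by simp
      qed
    qed
  qed
  then have "HI l (K j) * 2 ^ (tau + 1) \<le> LO l x * 2 ^ (tau + 1)" by (rule mult_le_mono1)
  then show ?thesis using code_bounds(2)[OF j(2)] by linarith
qed

lemma code_mono:
  assumes "i \<in> A l" "j \<in> A l" "i \<le> j"
  shows "code l (K i) \<le> code l (K j)"
proof -
  have i: "i < n" and j: "j < n" "2 \<le> SZ l (K j)" using assms by (auto simp: A_def)
  show ?thesis
  proof (cases "i < LO l (K j)")
    case True
    then show ?thesis using code_below[OF assms(1) True] code_bounds(1)[OF j(2)] by linarith
  next
    case False
    have "i < HI l (K j)" using pos_in_bucket[OF j(1), of "rem l (K j)"] assms(3) by linarith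
    then show ?thesis
      using code_in_bucket(3)[OF i _ _ j(2)] False K_mono[OF assms(3) j(1)]
      by (simp add: div_le_mono)
  qed
qed

text \<open>The new bounds are the first positions whose code reaches \<open>code l x\<close> and
  \<open>code l x + 1\<close>. Only positions in \<open>A l\<close> are marked in \<open>W\<close>,
  so the search may run past the bucket into a later one; the minimum with \<open>HI l x\<close>
  corrects this.\<close>

lemma next_level:
  assumes k: "2 \<le> SZ l x" and fin: "finite W"
    and W: "\<And>j. j \<le> n ==> j \<in> W \<longleftrightarrow> j = n \<or> j \<in> starts (A l) (\<lambda>j. code l (K j))"
  shows "LO (Suc l) x = min (HI l x) (sel W (cnt ((\<lambda>j. code l (K j)) ` A l) (code l x)))"
    "HI (Suc l) x = min (HI l x) (sel W (cnt ((\<lambda>j. code l (K j)) ` A l) (code l x + 1)))"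
proof -
  let ?f = "\<lambda>j. code l (K j)"
  interpret classes n "A l" ?f W
    by unfold_locales (use W fin code_mono in \<open>auto simp: A_def\<close>)
  have gen: "c = min (HI l x) (Min (insert n {j \<in> A l. q \<le> ?f j}))"
    if c: "LO l x \<le> c" "c \<le> HI l x" and q: "LO l x * 2 ^ (tau + 1) \<le> q"
      and ch: "\<And>j. LO l x \<le> j ==> j < HI l x ==> c \<le> j \<longleftrightarrow> q \<le> ?f j" for c q
  proof -
    let ?S = "insert n {j \<in> A l. q \<le> ?f j}"
    have fS: "finite ?S" using finA by simp
    have inn: "j < n" if "j < HI l x" for j using that hi_le less_le_trans by blast
    have "c \<le> s" if s: "s \<in> ?S" "s < HI l x" for s
    proof -
      have "s \<in> A l" "q \<le> ?f s" using s inn[of s] by auto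
      then have "LO l x \<le> s" using code_below[of s l x] q by (meson leI le_trans not_less)
      then show ?thesis using ch s \<open>q \<le> ?f s\<close> by blast
    qed
    then have le: "c \<le> min (HI l x) (Min ?S)"
    proof (cases "Min ?S < HI l x")
      case True
      have "Min ?S \<in> ?S" using fS by (intro Min_in) auto
      then show ?thesis using \<open>\<And>s. s \<in> ?S ==> s < HI l x ==> c \<le> s\<close> True c(2) by simp
    next
      case False
      then show ?thesis using c(2) by simp
    qed
    have "min (HI l x) (Min ?S) \<le> c"
    proof (cases "c = HI l x")
      case False
      then have cl: "c < HI l x" using c by simp
      then have "c \<in> A l" "q \<le> ?f c" using code_in_bucket(1)[OF inn[OF cl] c(1) cl k] ch[OF c(1) cl] by auto
      then have "Min ?S \<le> c" using fS by (intro Min_le) auto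
      then show ?thesis by simp
    qed simp
    then show ?thesis using le by simp
  qed
  show "LO (Suc l) x = min (HI l x) (sel W (cnt (?f ` A l) (code l x)))"
    unfolding sel_cnt_image
  proof (rule gen)
    show "LO l x \<le> LO (Suc l) x" by (rule lo_refine[OF rem_Suc_le])
    show "LO (Suc l) x \<le> HI l x" using lo_le_hi hi_refine[OF rem_Suc_le] le_trans by blast
    show "LO l x * 2 ^ (tau + 1) \<le> code l x" by (rule code_bounds(1)[OF k])
    fix j assume j: "LO l x \<le> j" "j < HI l x"
    then have jn: "j < n" using hi_le less_le_trans by blast
    show "LO (Suc l) x \<le> j \<longleftrightarrow> code l x \<le> code l (K j)"
      using less_lo[OF jn, of "rem (Suc l) x" x] code_in_bucket(2)[OF jn j k] by (meson not_less)
  qed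
  show "HI (Suc l) x = min (HI l x) (sel W (cnt (?f ` A l) (code l x + 1)))"
    unfolding sel_cnt_image
  proof (rule gen)
    show "LO l x \<le> HI (Suc l) x" using lo_refine[OF rem_Suc_le] lo_le_hi le_trans by blast
    show "HI (Suc l) x \<le> HI l x" by (rule hi_refine[OF rem_Suc_le])
    show "LO l x * 2 ^ (tau + 1) \<le> code l x + 1" using code_bounds(1)[OF k] by simp
    fix j assume j: "LO l x \<le> j" "j < HI l x"
    then have jn: "j < n" using hi_le less_le_trans by blast
    show "HI (Suc l) x \<le> j \<longleftrightarrow> code l x + 1 \<le> code l (K j)"
      using less_hi[OF jn, of "rem (Suc l) x" x] code_in_bucket(3)[OF jn j k] by (metis Suc_eq_plus1 not_less not_less_eq_eq)
  qed
qed

lemma first_level: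
  assumes fin: "finite W" and W: "\<And>j. j \<le> n ==> j \<in> W \<longleftrightarrow> j = n \<or> j \<in> starts {..<n} (\<lambda>j. K j div 2 ^ d)"
  shows "lo d (q * 2 ^ d) = sel W (cnt ((\<lambda>j. K j div 2 ^ d) ` {..<n}) q)"
    "hi d (q * 2 ^ d) = sel W (cnt ((\<lambda>j. K j div 2 ^ d) ` {..<n}) (q + 1))"
proof -
  let ?f = "\<lambda>j. K j div 2 ^ d"
  interpret classes n "{..<n}" ?f W
    by unfold_locales (use W fin in \<open>auto intro!: div_le_mono K_mono\<close>)
  have gen: "c = Min (insert n {j \<in> {..<n}. q \<le> ?f j})"
    if "c \<le> n" "\<And>j. j < n ==> c \<le> j \<longleftrightarrow> q \<le> ?f j" for c q
  proof (rule sym, rule Min_eqI)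
    show "c \<in> insert n {j \<in> {..<n}. q \<le> ?f j}" using that(1) that(2)[of c] by (cases "c = n") auto
  qed (use that in auto)
  have lon: "lo d x \<le> n" for x using lo_le_hi hi_le le_trans by blast
  show "lo d (q * 2 ^ d) = sel W (cnt (?f ` {..<n}) q)"
    unfolding sel_cnt_image
    by (rule gen[OF lon]) (use less_lo[of _ d "q * 2 ^ d"] in \<open>auto simp: not_less[symmetric]\<close>)
  show "hi d (q * 2 ^ d) = sel W (cnt (?f ` {..<n}) (q + 1))"
    unfolding sel_cnt_image
    by (rule gen[OF hi_le]) (use less_hi[of _ d "q * 2 ^ d"] in \<open>auto simp: not_less[symmetric] less_Suc_eq_le\<close>)
qed

text \<open>
  A bucket that survives \<open>l\<close> levels has consumed the full number of bits at each of them: a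
  truncated step would have separated all its keys.
\<close>

lemma consumed: "2 \<le> SZ l x ==> rem l x + l * (clg (SZ l x) + tau) \<le> d"
proof (induction l)
  case (Suc l)
  have k: "2 \<le> SZ l x" using Suc.prems siz_refine[OF rem_Suc_le] le_trans by blast
  have c: "clg (SZ (Suc l) x) \<le> clg (SZ l x)" by (intro clg_mono siz_refine rem_Suc_le)
  have r: "rem (Suc l) x = rem l x - (clg (SZ l x) + tau)" using k by simp
  have "rem (Suc l) x \<noteq> 0" using Suc.prems siz_0[of x] by (metis Suc_1 not_less_eq_eq)
  then have "rem l x = rem (Suc l) x + (clg (SZ l x) + tau)" using r by linarith
  then have "rem (Suc l) x + (clg (SZ l x) + tau) + l * (clg (SZ l x) + tau) \<le> d"
    using Suc.IH[OF k] by simp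
  moreover have "(Suc l) * (clg (SZ (Suc l) x) + tau) \<le> (Suc l) * (clg (SZ l x) + tau)"
    using c by (intro mult_le_mono2) simp
  ultimately show ?case by simp
qed simp

end

subsection \<open>Hash data in the free bits of the slots\<close>

text \<open>A slot is divided into units of \<open>D = lg k + tau\<close> bits, the amount that one
  level frees. Six fields of \<open>NX\<close> units hold two moduli, the multiplier of the first
  hashing level, and multiplier, offset and length of one cell; 21 single units hold table entries.
  The value 40 leaves ample room for numbers polynomial in \<open>k\<close> and
  \<open>2 ^ tau\<close>.\<close>

definition NX :: nat where "NX = 40"
definition NF :: nat where "NF = 261"

lemma NF_NX: "NF = 6 * NX + 21" by (simp add: NF_def NX_def)

definition field :: "nat => nat => nat => nat => nat" where
  "field x s l D = x div 2 ^ (s * D) mod 2 ^ (l * D)"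

lemma field_less: "field x s l D < 2 ^ (l * D)"
  by (simp add: field_def)

lemma field_eqI:
  assumes "v < 2 ^ (l * D)" "\<And>t. t < l * D ==> bit x (s * D + t) = bit v t"
  shows "field x s l D = v"
proof (rule bit_eqI)
  fix t
  have "\<not> bit v t" if "l * D \<le> t"
    using assms(1) that by (metis bit_take_bit_iff not_less take_bit_nat_eq_self)
  moreover have "bit (field x s l D) t = (t < l * D \<and> bit x (s * D + t))"
    unfolding field_def by (simp add: bit_take_bit_iff bit_drop_bit_eq flip: take_bit_eq_mod drop_bit_eq_div)
  ultimately show "bit (field x s l D) t = bit v t" using assms(2)[of t] by (cases "t < l * D") auto
qed

lemma bits_exist: "\<exists>x<2 ^ m. \<forall>t<m. bit (x::nat) t = b t"
proof (intro exI conjI allI impI)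
  let ?x = "horner_sum of_bool 2 (map b [0..<m]) :: nat"
  show "bit ?x t = b t" if "t < m" for t using that by (simp add: bit_horner_sum_bit_iff)
  have "take_bit m ?x = ?x"
    by (rule bit_eqI) (auto simp: bit_take_bit_iff bit_horner_sum_bit_iff)
  then show "?x < 2 ^ m" by (metis take_bit_nat_less_exp)
qed

definition key2 :: "(nat => nat) => nat => nat => nat => nat" where
  "key2 dat D p v = v mod p mod field (dat 0) NX NX D"

definition hcell :: "(nat => nat) => nat => nat => nat => nat" where
  "hcell dat L D v = mshift (NX * D) (L - 1) (field (dat 0) (2 * NX) NX D) v"

definition hslot :: "(nat => nat) => nat => nat => nat => nat" where
  "hslot dat L D v = (let z = hcell dat L D v in field (dat z) (4 * NX) NX D +
     mshift (NX * D) (field (dat z) (5 * NX) NX D) (field (dat z) (3 * NX) NX D) v)"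

text \<open>The last two conjuncts keep the word arithmetic of the lookup within range.\<close>

definition finds :: "(nat => nat) => nat => nat => nat => nat => nat => nat => bool" where
  "finds dat k L D p v i \<longleftrightarrow>
     (let u = key2 dat D p v; t = hslot dat L D u in
      field (dat (t mod k)) (6 * NX + t div k) 1 D = i \<and> u < 2 ^ (NX * D) \<and> t < 21 * k \<and>
      hcell dat L D u < k \<and> field (dat (hcell dat L D u)) (5 * NX) NX D \<le> NX * D)"

text \<open>A second modulus of about \<open>k ^ 2\<close> times the length of \<open>p\<close>
  shortens the keys to \<open>NX * D\<close> bits, where the two-level scheme applies. Its table of
  \<open>21 * k\<close> entries is dealt out to the \<open>k\<close> slots, 21 entries to each. The
  modulus \<open>p\<close> is kept among the data whenever it fits; otherwise the caller must supply
  it.\<close>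

lemma fks_data:
  fixes v :: "nat => nat"
  assumes k: "2 \<le> k" and L: "L = clg k" and D: "D = L + tau"
    and p: "0 < p" "inj_on (\<lambda>i. v i mod p) {..<k}" "2 * (blen p * k\<^sup>2) + 8 < 2 ^ (NX * D)"
  shows "\<exists>dat. (\<forall>i. dat i < 2 ^ (NF * D)) \<and> (p < 2 ^ (NX * D) \<longrightarrow> field (dat 0) 0 NX D = p) \<and>
    (\<forall>i<k. finds dat k L D p (v i) i)"
proof -
  let ?c = "NX * D"
  note cl = clg[OF k, folded L]
  let ?P = "{(i, j). i < k \<and> j < k \<and> i \<noteq> j}"
  have "card ?P \<le> card ({..<k} \<times> {..<k})" by (intro card_mono) auto
  then have cP: "card ?P \<le> k\<^sup>2" by (simp add: card_cartesian_product power2_eq_square)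
  have fP: "finite ?P" by (rule finite_subset[of _ "{..<k} \<times> {..<k}"]) auto
  have "\<exists>p2>0. p2 \<le> 2 * (blen p * k\<^sup>2) + 8 \<and> p2 \<le> 2 ^ blen p \<and>
      (\<forall>(i, j)\<in>?P. v i mod p mod p2 \<noteq> v j mod p mod p2)"
  proof (rule separating_modulus_pairs[OF fP cP])
    fix i j assume "(i, j) \<in> ?P"
    then have ij: "i < k" "j < k" "i \<noteq> j" by auto
    have "x mod p < 2 ^ blen p" for x using p(1) less_exp_blen[of p] mod_less_divisor less_trans by blast
    then show "v i mod p < 2 ^ blen p \<and> v j mod p < 2 ^ blen p \<and> v i mod p \<noteq> v j mod p"
      using ij inj_onD[OF p(2), of i j] by auto
  qed
  then obtain p2 where p2: "0 < p2" "p2 \<le> 2 * (blen p * k\<^sup>2) + 8"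
    "\<And>i j. i < k ==> j < k ==> i \<noteq> j ==> v i mod p mod p2 \<noteq> v j mod p mod p2"
    by auto
  have p2c: "p2 < 2 ^ ?c" using p2(2) p(3) by linarith
  define Y where "Y i = v i mod p mod p2" for i
  have Yinj: "inj_on Y {..<k}" unfolding Y_def inj_on_def using p2(3) by auto
  have Yl: "Y j < 2 ^ ?c" for j unfolding Y_def using p2(1) p2c mod_less_divisor less_trans by blast
  have D1: "1 \<le> D" "L \<le> D" using cl D by auto
  have c3: "2 * L + 3 \<le> ?c" using D1 by (simp add: NX_def)
  have kL: "k \<le> 2 ^ L" "2 ^ L < 2 * k" using cl by auto
  obtain a A P l tab where fks: "a < 2 ^ ?c \<and>
    (\<forall>z. A z < 2 ^ ?c \<and> P z \<le> 21 * k \<and> l z \<le> 2 * L + 2) \<and> (\<forall>t. tab t < k) \<and>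
    (\<forall>j<k. P (mshift ?c (L - 1) a (Y j)) +
        mshift ?c (l (mshift ?c (L - 1) a (Y j))) (A (mshift ?c (L - 1) a (Y j))) (Y j) < 21 * k \<and>
      tab (P (mshift ?c (L - 1) a (Y j)) +
        mshift ?c (l (mshift ?c (L - 1) a (Y j))) (A (mshift ?c (L - 1) a (Y j))) (Y j)) = j)"
    using fks_exists[OF k kL c3 Yinj Yl] by blast
  then have f: "a < 2 ^ ?c" "\<And>z. A z < 2 ^ ?c" "\<And>z. P z \<le> 21 * k"
    "\<And>z. l z \<le> 2 * L + 2" "\<And>t. tab t < k"
    "\<And>j. j < k ==> P (mshift ?c (L - 1) a (Y j)) +
        mshift ?c (l (mshift ?c (L - 1) a (Y j))) (A (mshift ?c (L - 1) a (Y j))) (Y j) < 21 * k \<and>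
      tab (P (mshift ?c (L - 1) a (Y j)) +
        mshift ?c (l (mshift ?c (L - 1) a (Y j))) (A (mshift ?c (L - 1) a (Y j))) (Y j)) = j"
    by blast+
  \<comment> \<open>\<open>b z t\<close> is bit \<open>t\<close> of the data in slot
    \<open>z\<close>. The first three fields describe the whole bucket and are read from slot 0; the
    others belong to cell \<open>z\<close>, and the units behind them to the table entries congruent
    to \<open>z\<close> modulo \<open>k\<close>.\<close>
  define b where "b z t = (let q = t div D in
     if q < NX then bit p t else if q < 2 * NX then bit p2 (t - NX * D)
     else if q < 3 * NX then bit a (t - 2 * NX * D) else if q < 4 * NX then bit (A z) (t - 3 * NX * D)
     else if q < 5 * NX then bit (P z) (t - 4 * NX * D) else if q < 6 * NX then bit (l z) (t - 5 * NX * D)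
     else bit (tab ((q - 6 * NX) * k + z)) (t mod D))" for z t
  have "\<forall>z. \<exists>x<2 ^ (NF * D). \<forall>t<NF * D. bit (x::nat) t = b z t" using bits_exist by blast
  then obtain dat :: "nat => nat" where dat: "\<And>z. dat z < 2 ^ (NF * D)" "\<And>z t. t < NF * D ==> bit (dat z) t = b z t" by metis
  have dv: "(m * NX * D + t) div D = m * NX + t div D" for m t
    using D1 by simp
  have tq: "t div D < NX" if "t < NX * D" for t using that D1 by (simp add: less_mult_imp_div_less)
  have F: "field (dat z) (m * NX) NX D = w"
    if "m < 6" "w < 2 ^ (NX * D)" "\<And>t. t < NX * D ==> b z (m * NX * D + t) = bit w t" for z m w
  proof (rule field_eqI[OF that(2)])
    fix t assume t: "t < NX * D"
    have "m * NX * D + t < (m + 1) * NX * D" using t by (simp add: add_mult_distrib)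
    also have "... \<le> NF * D" using that(1) by (intro mult_le_mono1) (simp add: NF_def NX_def)
    finally show "bit (dat z) (m * NX * D + t) = bit w t" using dat(2) that(3)[OF t] by simp
  qed
  have qs: "\<not> m * NX + t div D < m' * NX" if "m' \<le> m" for m m' t
    using that mult_le_mono1[of m' m NX] by linarith
  have ql: "m * NX + t div D < (m + 1) * NX" if "t < NX * D" for m t using tq[OF that] by simp
  have f1: "field (dat z) NX NX D = p2" for z
    using F[of 1 p2 z] p2c ql[of _ 1] qs[of 1 1] by (simp add: b_def dv[of 1, simplified])
  have f2: "field (dat z) (2 * NX) NX D = a" for z
    using f(1) by (intro F) (use ql[of _ 2] qs[of _ 2] in \<open>auto simp: b_def Let_def dv not_less NX_def\<close>)
  have f3: "field (dat z) (3 * NX) NX D = A z" for z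
    using f(2) by (intro F) (use ql[of _ 3] qs[of _ 3] in \<open>auto simp: b_def Let_def dv not_less NX_def\<close>)
  have k2: "21 * k < 2 ^ (NX * D)"
  proof -
    have "21 * k \<le> 21 * 2 ^ L" using cl by simp
    also have "... < 2 ^ 5 * 2 ^ L" by simp
    also have "... = 2 ^ (5 + L)" by (simp add: power_add)
    also have "... \<le> 2 ^ (NX * D)" using D1 by (intro power_increasing) (auto simp: NX_def)
    finally show ?thesis .
  qed
  have f4: "field (dat z) (4 * NX) NX D = P z" for z
    using f(3)[of z] k2 by (intro F) (use ql[of _ 4] qs[of _ 4] in \<open>auto simp: b_def Let_def dv not_less NX_def\<close>)
  have l2: "l z \<le> NX * D" for z using f(4)[of z] c3 by linarith
  have f5: "field (dat z) (5 * NX) NX D = l z" for z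
    using le_less_trans[OF l2[of z] less_exp] by (intro F) (use ql[of _ 5] qs[of _ 5] in \<open>auto simp: b_def Let_def dv not_less NX_def\<close>)
  have f6: "field (dat z) (6 * NX + e) 1 D = tab (e * k + z)" if e: "e < 21" for z e
  proof (rule field_eqI)
    have "tab (e * k + z) < k" by (rule f(5))
    also have "... \<le> 2 ^ L" using cl by simp
    also have "... \<le> 2 ^ (1 * D)" using D1 by (intro power_increasing) auto
    finally show "tab (e * k + z) < 2 ^ (1 * D)" .
    fix t assume t: "t < 1 * D"
    have "(6 * NX + e) * D + t < (6 * NX + e + 1) * D" using t by simp
    also have "... \<le> NF * D" using e by (intro mult_le_mono1) (simp add: NF_NX)
    finally have lt: "(6 * NX + e) * D + t < NF * D" .
    have "((6 * NX + e) * D + t) div D = 6 * NX + e" "((6 * NX + e) * D + t) mod D = t"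
      using div_mod_add_less[of t D "6 * NX + e"] t by auto
    then have "b z ((6 * NX + e) * D + t) = bit (tab (e * k + z)) t"
      unfolding b_def Let_def by (simp add: NX_def)
    then show "bit (dat z) ((6 * NX + e) * D + t) = bit (tab (e * k + z)) t" using dat(2)[OF lt] by simp
  qed
  have f0: "field (dat z) 0 NX D = p" if "p < 2 ^ (NX * D)" for z
    using F[of 0 p z] that tq by (simp add: b_def Let_def)
  have fin: "finds dat k L D p (v i) i" if i: "i < k" for i
  proof -
    have u: "key2 dat D p (v i) = Y i" unfolding key2_def f1 Y_def ..
    have z: "hcell dat L D (Y i) = mshift ?c (L - 1) a (Y i)" unfolding hcell_def f2 ..
    have zl: "hcell dat L D (Y i) < k"
    proof -
      have "hcell dat L D (Y i) < 2 ^ (L - 1)" unfolding z using c3 by (intro mshift_less) simp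
      moreover have "2 * 2 ^ (L - 1) = (2::nat) ^ L" using cl by (cases L) auto
      ultimately show ?thesis using cl by linarith
    qed
    define t where "t = hslot dat L D (Y i)"
    have t: "t < 21 * k" "tab t = i"
      using f(6)[OF i] unfolding t_def hslot_def Let_def f3 f4 f5 z by auto
    have "t div k < 21" using t(1) k by (simp add: less_mult_imp_div_less)
    then have "field (dat (t mod k)) (6 * NX + t div k) 1 D = tab (t div k * k + t mod k)" by (rule f6)
    then have "field (dat (t mod k)) (6 * NX + t div k) 1 D = i" using t(2) by simp
    then show ?thesis unfolding finds_def Let_def u t_def[symmetric] f5
      using Yl zl t(1) l2 by simp
  qed
  show ?thesis using dat(1) f0 fin by blast
qed

section \<open>Moduli and hash data for the buckets that survive all levels\<close>

context keys
begin

definition yk :: "nat => nat" where "yk j = K j mod 2 ^ d"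

lemma yk_distinct:
  assumes "i < n" "j < n" "i \<noteq> j" "K i div 2 ^ d = K j div 2 ^ d"
  shows "yk i \<noteq> yk j"
proof -
  have "K i \<noteq> K j" using K[of i j] K[of j i] assms by (metis linorder_neqE_nat less_irrefl)
  then show ?thesis unfolding yk_def using assms(4) by (metis div_mult_mod_eq)
qed

lemma bucket_same_high:
  assumes "K i div 2 ^ rem l x = x div 2 ^ rem l x"
  shows "K i div 2 ^ d = x div 2 ^ d"
  using div_exp_refine[OF rem_le assms] .

definition slot_found :: "nat => nat => nat => nat => (nat => nat) => (nat => nat) => nat => bool" where
  "slot_found Th T p0 p0q p1 free j \<longleftrightarrow>
     finds (\<lambda>i. free (LO NF (K j) + i)) (SZ NF (K j)) (clg (SZ NF (K j))) (clg (SZ NF (K j)) + tau)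
          (if SZ NF (K j) < Th then p1 (LO NF (K j) div T)
           else field (free (LO NF (K j))) 0 NX (clg (SZ NF (K j)) + tau))
          (yk j mod p0 mod p0q) (j - LO NF (K j))"

text \<open>The keys of a bucket are told apart by a chain of moduli. The global moduli
  \<open>p0\<close> and \<open>p0q\<close> cut the \<open>d\<close> bits in the slots down to
  \<open>Th\<close> bits. A bucket of at least \<open>Th\<close> keys has room for a modulus of its
  own. The slots of a smaller bucket may be too short for that, so all small buckets that start in
  the same chunk of \<open>T\<close> positions share a modulus from the table \<open>p1\<close>; one
  entry per \<open>T\<close> positions is cheap enough.\<close>

lemma survivors_data:
  assumes num0: "2 * (blen (2 * (d * n\<^sup>2) + 8) * n\<^sup>2) + 8 < 2 ^ Th"
    and num1: "\<And>k. 2 \<le> k ==> k < Th ==>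
      2 * (blen (2 * (Th * (T * Th\<^sup>2)) + 8) * k\<^sup>2) + 8 < 2 ^ (NX * (clg k + tau))"
    and T: "0 < T"
  shows "\<exists>p0 p0q p1 free. 0 < p0 \<and> p0 \<le> 2 ^ d \<and> p0 \<le> 2 * (d * n\<^sup>2) + 8 \<and> 0 < p0q \<and>
    p0q \<le> 2 ^ blen p0 \<and> p0q \<le> 2 * (blen p0 * n\<^sup>2) + 8 \<and>
    (\<forall>c. p1 c \<le> 2 * (Th * (T * Th\<^sup>2)) + 8 \<and> p1 c \<le> 2 ^ Th) \<and>
    (\<forall>j<n. free j < 2 ^ (d - rem NF (K j)) \<and>
      (2 \<le> SZ NF (K j) \<longrightarrow> slot_found Th T p0 p0q p1 free j))"
proof -
  let ?P = "{(i, j). i < n \<and> j < n \<and> i \<noteq> j \<and> K i div 2 ^ d = K j div 2 ^ d}"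
  have fP: "finite ?P" by (rule finite_subset[of _ "{..<n} \<times> {..<n}"]) auto
  have "card ?P \<le> card ({..<n} \<times> {..<n})" by (intro card_mono) auto
  then have cP: "card ?P \<le> n\<^sup>2" by (simp add: card_cartesian_product power2_eq_square)
  have "\<exists>p>0. p \<le> 2 * (d * n\<^sup>2) + 8 \<and> p \<le> 2 ^ d \<and> (\<forall>(i, j)\<in>?P. yk i mod p \<noteq> yk j mod p)"
    by (rule separating_modulus_pairs[OF fP cP]) (use yk_distinct in \<open>auto simp: yk_def\<close>)
  then obtain p0 where p0: "0 < p0" "p0 \<le> 2 * (d * n\<^sup>2) + 8" "p0 \<le> 2 ^ d"
    "\<And>i j. (i, j) \<in> ?P ==> yk i mod p0 \<noteq> yk j mod p0" by auto
  have "\<exists>p>0. p \<le> 2 * (blen p0 * n\<^sup>2) + 8 \<and> p \<le> 2 ^ blen p0 \<and>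
      (\<forall>(i, j)\<in>?P. yk i mod p0 mod p \<noteq> yk j mod p0 mod p)"
  proof (rule separating_modulus_pairs[OF fP cP])
    fix i j assume "(i, j) \<in> ?P"
    moreover have "x mod p0 < 2 ^ blen p0" for x
      using p0(1) less_exp_blen[of p0] mod_less_divisor less_trans by blast
    ultimately show "yk i mod p0 < 2 ^ blen p0 \<and> yk j mod p0 < 2 ^ blen p0 \<and> yk i mod p0 \<noteq> yk j mod p0"
      using p0(4) by blast
  qed
  then obtain q0 where q0: "0 < q0" "q0 \<le> 2 * (blen p0 * n\<^sup>2) + 8" "q0 \<le> 2 ^ blen p0"
    "\<And>i j. (i, j) \<in> ?P ==> yk i mod p0 mod q0 \<noteq> yk j mod p0 mod q0" by auto
  define v where "v j = yk j mod p0 mod q0" for j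
  have q0Th: "q0 < 2 ^ Th"
  proof -
    have "q0 \<le> 2 * (blen (2 * (d * n\<^sup>2) + 8) * n\<^sup>2) + 8"
      using q0(2) blen_mono[OF p0(2)] by (meson add_le_mono1 le_trans mult_le_mono1 mult_le_mono2)
    then show ?thesis using num0 by linarith
  qed
  have vTh: "v j < 2 ^ Th" for j unfolding v_def using q0(1) q0Th mod_less_divisor less_trans by blast
  define B where "B i j \<longleftrightarrow> i < n \<and> j < n \<and> i \<noteq> j \<and> K i div 2 ^ rem NF (K j) = K j div 2 ^ rem NF (K j)" for i j
  have Bv: "v i \<noteq> v j" if "B i j" for i j
    unfolding v_def using that bucket_same_high[of i NF "K j"] by (intro q0(4)) (auto simp: B_def)
  let ?PC = "\<lambda>c. {(i, j). B i j \<and> LO NF (K j) div T = c \<and> SZ NF (K j) < Th}"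
  have inB: "LO NF (K j) \<le> i \<and> i < LO NF (K j) + SZ NF (K j)" if "B i j \<or> i = j \<and> j < n" for i j
  proof -
    have "K i div 2 ^ rem NF (K j) = K j div 2 ^ rem NF (K j)" "i < n" using that by (auto simp: B_def)
    then have "LO NF (K j) \<le> i \<and> i < HI NF (K j)" using in_bucket by blast
    then show ?thesis by (simp add: siz_def)
  qed
  have fPC: "finite (?PC c)" for c
    by (rule finite_subset[of _ "{..<n} \<times> {..<n}"]) (auto simp: B_def)
  \<comment> \<open>Both positions of a pair lie less than \<open>Th\<close> behind the common start
    of their bucket, and the chunk offers \<open>T\<close> such starts.\<close>
  have cPC: "card (?PC c) \<le> T * Th\<^sup>2" for c
  proof -
    have "?PC c \<subseteq> (\<Union>q\<in>{c * T..<c * T + T}. {q..<q + Th} \<times> {q..<q + Th})"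
    proof
      fix x assume "x \<in> ?PC c"
      then obtain i j where x: "x = (i, j)" and ij: "B i j" "LO NF (K j) div T = c" "SZ NF (K j) < Th" by auto
      have jn: "j < n" using ij by (simp add: B_def)
      have 1: "LO NF (K j) \<in> {c * T..<c * T + T}"
        using ij(2) T div_times_less_eq_dividend[of "LO NF (K j)" T] dividend_less_div_times[of T "LO NF (K j)"]
        by auto
      have 2: "i \<in> {LO NF (K j)..<LO NF (K j) + Th}" using inB[of i j] ij by auto
      have 3: "j \<in> {LO NF (K j)..<LO NF (K j) + Th}" using inB[of j j] jn ij by auto
      show "x \<in> (\<Union>q\<in>{c * T..<c * T + T}. {q..<q + Th} \<times> {q..<q + Th})" using 1 2 3 x by blast
    qed
    then have "card (?PC c) \<le> card (\<Union>q\<in>{c * T..<c * T + T}. {q..<q + Th} \<times> {q..<q + Th})"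
      by (intro card_mono) auto
    also have "... \<le> (\<Sum>q\<in>{c * T..<c * T + T}. card ({q..<q + Th} \<times> {q..<q + Th}))"
      by (rule card_UN_le) simp
    also have "... = T * Th\<^sup>2" by (simp add: card_cartesian_product power2_eq_square)
    finally show ?thesis .
  qed
  have "\<exists>p>0. p \<le> 2 * (Th * (T * Th\<^sup>2)) + 8 \<and> p \<le> 2 ^ Th \<and> (\<forall>(i, j)\<in>?PC c. v i mod p \<noteq> v j mod p)" for c
    by (rule separating_modulus_pairs[OF fPC cPC]) (use vTh Bv in auto)
  then obtain p1 where p1: "\<And>c. 0 < p1 c" "\<And>c. p1 c \<le> 2 * (Th * (T * Th\<^sup>2)) + 8" "\<And>c. p1 c \<le> 2 ^ Th"
    "\<And>c i j. B i j ==> LO NF (K j) div T = c ==> SZ NF (K j) < Th ==> v i mod p1 c \<noteq> v j mod p1 c"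
    by (metis (mono_tags, lifting) case_prodI mem_Collect_eq case_prod_conv)
  have "\<exists>dat. \<forall>j<n. LO NF (K j) = P \<longrightarrow> 2 \<le> SZ NF (K j) \<longrightarrow>
      (let k = SZ NF (K j); D = clg k + tau in
       (\<forall>i. dat i < 2 ^ (NF * D)) \<and>
       finds dat k (clg k) D (if k < Th then p1 (P div T) else field (dat 0) 0 NX D) (v j) (j - P))" for P
  proof (cases "\<exists>j<n. LO NF (K j) = P \<and> 2 \<le> SZ NF (K j)")
    case True
    then obtain j0 where j0: "j0 < n" "LO NF (K j0) = P" "2 \<le> SZ NF (K j0)" by blast
    define k where "k = SZ NF (K j0)"
    define D where "D = clg k + tau"
    have kn: "P + k \<le> n" using j0 hi_le[of "rem NF (K j0)" "K j0"] lo_le_hi[of "rem NF (K j0)" "K j0"]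
      by (simp add: k_def siz_def)
    have mem: "K (P + i) div 2 ^ rem NF (K j0) = K j0 div 2 ^ rem NF (K j0)" if "i < k" for i
    proof -
      have "P + i < n" "P \<le> P + i" "P + i < HI NF (K j0)"
        using that kn j0 by (auto simp: k_def siz_def)
      then show ?thesis using in_bucket[of "P + i" "rem NF (K j0)" "K j0"] j0(2) by simp
    qed
    have BB: "B (P + i) (P + i')" "LO NF (K (P + i')) = P" "SZ NF (K (P + i')) = k"
      if "i < k" "i' < k" "i \<noteq> i'" for i i'
    proof -
      have r: "rem NF (K (P + i')) = rem NF (K j0)" "LO NF (K (P + i')) = P" "SZ NF (K (P + i')) = k"
        using level_cong[of "K j0" NF "K (P + i')"] mem[OF that(2)] j0 by (auto simp: k_def)
      then show "B (P + i) (P + i')" unfolding B_def using mem that kn by auto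
      show "LO NF (K (P + i')) = P" "SZ NF (K (P + i')) = k" using r by auto
    qed
    have k2: "2 \<le> k" using j0 by (simp add: k_def)
    note cl = clg[OF k2]
    have eq: "SZ NF (K j) = k \<and> (j - P < k \<and> P \<le> j)" if j: "j < n" "LO NF (K j) = P" "2 \<le> SZ NF (K j)" for j
    proof -
      have "P < HI NF (K j)" using j by (simp add: siz_def)
      then have Pn: "P < n" using hi_le less_le_trans by blast
      have "K P div 2 ^ rem NF (K j) = K j div 2 ^ rem NF (K j)"
        using in_bucket[OF Pn, of "rem NF (K j)" "K j"] j \<open>P < HI NF (K j)\<close> by simp
      then have "SZ NF (K P) = SZ NF (K j)" using level_cong[of "K j" NF "K P"] by simp
      moreover have "SZ NF (K P) = k" using level_cong[of "K j0" NF "K P"] mem[of 0] k2 by (simp add: k_def)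
      ultimately show ?thesis using inB[of j j] j by auto
    qed
    show ?thesis
    proof (cases "k < Th")
      case True
      define p where "p = p1 (P div T)"
      have "inj_on (\<lambda>i. v (P + i) mod p) {..<k}"
      proof (rule inj_onI, rule ccontr)
        fix i i' assume "i \<in> {..<k}" "i' \<in> {..<k}" "v (P + i) mod p = v (P + i') mod p" "i \<noteq> i'"
        then show False using p1(4)[of "P + i" "P + i'" "P div T"] BB[of i i'] True by (auto simp: p_def)
      qed
      moreover have "2 * (blen p * k\<^sup>2) + 8 < 2 ^ (NX * D)"
      proof -
        have "blen p \<le> blen (2 * (Th * (T * Th\<^sup>2)) + 8)" unfolding p_def by (intro blen_mono p1(2))
        then have "2 * (blen p * k\<^sup>2) + 8 \<le> 2 * (blen (2 * (Th * (T * Th\<^sup>2)) + 8) * k\<^sup>2) + 8" by simp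
        then show ?thesis using num1[OF k2 True] unfolding D_def by linarith
      qed
      ultimately obtain dat where "\<forall>i. dat i < 2 ^ (NF * D)" "\<forall>i<k. finds dat k (clg k) D p (v (P + i)) i"
        using fks_data[OF k2 refl D_def p1(1)[of "P div T", folded p_def], of "\<lambda>i. v (P + i)"] by auto
      then show ?thesis
      proof (intro exI[of _ dat] allI impI)
        fix j assume d: "\<forall>i. dat i < 2 ^ (NF * D)" "\<forall>i<k. finds dat k (clg k) D p (v (P + i)) i"
          and j: "j < n" "LO NF (K j) = P" "2 \<le> SZ NF (K j)"
        then have e: "SZ NF (K j) = k" "j - P < k" "P \<le> j" using eq by auto
        then show "let k = SZ NF (K j); D = clg k + tau in (\<forall>i. dat i < 2 ^ (NF * D)) \<and>
            finds dat k (clg k) D (if k < Th then p1 (P div T) else field (dat 0) 0 NX D) (v j) (j - P)"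
          using d(1) d(2)[rule_format, OF e(2)] True unfolding e(1) Let_def
          by (simp add: p_def D_def)
      qed
    next
      case False
      let ?PB = "{(i, j). i < k \<and> j < k \<and> i \<noteq> j}"
      have fPB: "finite ?PB" by (rule finite_subset[of _ "{..<k} \<times> {..<k}"]) auto
      have "card ?PB \<le> card ({..<k} \<times> {..<k})" by (intro card_mono) auto
      then have cPB: "card ?PB \<le> k\<^sup>2" by (simp add: card_cartesian_product power2_eq_square)
      have "\<exists>p>0. p \<le> 2 * (Th * k\<^sup>2) + 8 \<and> p \<le> 2 ^ Th \<and>
          (\<forall>(i, j)\<in>?PB. v (P + i) mod p \<noteq> v (P + j) mod p)"
        by (rule separating_modulus_pairs[OF fPB cPB]) (use vTh Bv[OF BB(1)] in auto)
      then obtain p where p: "0 < p" "p \<le> 2 * (Th * k\<^sup>2) + 8"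
        "\<And>i j. (i, j) \<in> ?PB ==> v (P + i) mod p \<noteq> v (P + j) mod p" by auto
      have pinj: "inj_on (\<lambda>i. v (P + i) mod p) {..<k}" using p(3) by (auto simp: inj_on_def)
      let ?L = "clg k"
      have kL: "k * k \<le> 2 ^ ?L * 2 ^ ?L" using cl by (intro mult_mono) auto
      \<comment> \<open>For \<open>k \<ge> Th\<close> everything is polynomial in \<open>k\<close>:
        the modulus takes at most \<open>3 * L + 4\<close> bits and the second modulus at most
        \<open>5 * L + 6\<close>, where \<open>L = clg k\<close>. Both fit into
        \<open>NX * D\<close> bits.\<close>
      have ThL: "Th \<le> 2 ^ ?L" using False cl by linarith
      have "Th * k\<^sup>2 \<le> 2 ^ ?L * (2 ^ ?L * 2 ^ ?L)"
        unfolding power2_eq_square using ThL kL by (rule mult_le_mono)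
      moreover have "(2::nat) ^ ?L * (2 ^ ?L * 2 ^ ?L) = 2 ^ (3 * ?L)" by (simp flip: power_add)
      ultimately have p3: "p \<le> 2 * 2 ^ (3 * ?L) + 8" using p(2) by linarith
      have e1: "(8::nat) \<le> 8 * 2 ^ (3 * ?L)" by simp
      have "2 * 2 ^ (3 * ?L) + 8 < 16 * (2::nat) ^ (3 * ?L)" using e1 by linarith
      also have "... = 2 ^ (3 * ?L + 4)" by (simp add: power_add)
      finally have p4: "p < 2 ^ (3 * ?L + 4)" using p3 by linarith
      have DL: "?L \<le> D" "1 \<le> D" using cl by (auto simp: D_def)
      have "(2::nat) ^ (3 * ?L + 4) \<le> 2 ^ (NX * D)" using DL by (intro power_increasing) (auto simp: NX_def)
      then have pc: "p < 2 ^ (NX * D)" using p4 by linarith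
      have "2 * (blen p * k\<^sup>2) + 8 < 2 ^ (NX * D)"
      proof -
        have "blen p \<le> 3 * ?L + 4" by (rule blen_le[OF p4])
        also have "... < 2 ^ (3 * ?L + 4)" by (rule less_exp)
        finally have bl: "blen p < 2 ^ (3 * ?L + 4)" .
        have "blen p * k\<^sup>2 \<le> 2 ^ (3 * ?L + 4) * (2 ^ ?L * 2 ^ ?L)"
          unfolding power2_eq_square by (rule mult_le_mono[OF less_imp_le[OF bl] kL])
        also have "... = 2 ^ (5 * ?L + 4)" by (simp flip: power_add)
        finally have "2 * (blen p * k\<^sup>2) + 8 \<le> 2 * 2 ^ (5 * ?L + 4) + 8" by simp
        also have "... < 2 ^ (5 * ?L + 6)"
        proof -
          have "(16::nat) \<le> 2 ^ (5 * ?L + 4)" using power_increasing[of 4 "5 * ?L + 4" "2::nat"] by simp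
          moreover have "(2::nat) ^ (5 * ?L + 6) = 4 * 2 ^ (5 * ?L + 4)" by (simp add: power_add)
          ultimately show ?thesis by linarith
        qed
        also have "... \<le> 2 ^ (NX * D)" using DL by (intro power_increasing) (auto simp: NX_def)
        finally show ?thesis .
      qed
      then obtain dat where "\<forall>i. dat i < 2 ^ (NF * D)" "field (dat 0) 0 NX D = p"
        "\<forall>i<k. finds dat k (clg k) D p (v (P + i)) i"
        using fks_data[OF k2 refl D_def p(1) pinj] pc by auto
      then show ?thesis
      proof (intro exI[of _ dat] allI impI)
        fix j assume d: "\<forall>i. dat i < 2 ^ (NF * D)" "field (dat 0) 0 NX D = p"
            "\<forall>i<k. finds dat k (clg k) D p (v (P + i)) i"
          and j: "j < n" "LO NF (K j) = P" "2 \<le> SZ NF (K j)"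
        then have e: "SZ NF (K j) = k" "j - P < k" "P \<le> j" using eq by auto
        then show "let k = SZ NF (K j); D = clg k + tau in (\<forall>i. dat i < 2 ^ (NF * D)) \<and>
            finds dat k (clg k) D (if k < Th then p1 (P div T) else field (dat 0) 0 NX D) (v j) (j - P)"
          using d(1,2) d(3)[rule_format, OF e(2)] False unfolding e(1) Let_def
          by (simp add: D_def)
      qed
    qed
  qed blast
  then obtain dat where dat: "\<And>P j. j < n ==> LO NF (K j) = P ==> 2 \<le> SZ NF (K j) ==>
      (let k = SZ NF (K j); D = clg k + tau in
       (\<forall>i. dat P i < 2 ^ (NF * D)) \<and>
       finds (dat P) k (clg k) D (if k < Th then p1 (P div T) else field (dat P 0) 0 NX D) (v j) (j - P))"
    by metis
  define free where "free j = (if 2 \<le> SZ NF (K j) then dat (LO NF (K j)) (j - LO NF (K j)) else 0)" for j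
  have fr: "free j < 2 ^ (d - rem NF (K j))" if j: "j < n" for j
  proof (cases "2 \<le> SZ NF (K j)")
    case True
    have "free j < 2 ^ (NF * (clg (SZ NF (K j)) + tau))"
      using dat[OF j refl True] True by (simp add: free_def Let_def)
    also have "... \<le> 2 ^ (d - rem NF (K j))" using consumed[OF True] by (intro power_increasing) auto
    finally show ?thesis .
  qed (simp add: free_def)
  have fd: "finds (\<lambda>i. free (LO NF (K j) + i)) (SZ NF (K j)) (clg (SZ NF (K j))) (clg (SZ NF (K j)) + tau)
          (if SZ NF (K j) < Th then p1 (LO NF (K j) div T)
           else field (free (LO NF (K j))) 0 NX (clg (SZ NF (K j)) + tau)) (v j) (j - LO NF (K j))"
    if j: "j < n" "2 \<le> SZ NF (K j)" for j
  proof -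
    let ?P = "LO NF (K j)" let ?k = "SZ NF (K j)"
    have fe: "free (?P + i) = dat ?P i" if i: "i < ?k" for i
    proof -
      have Hn: "?P + i < n" "?P + i < HI NF (K j)"
        using i hi_le[of "rem NF (K j)" "K j"] by (auto simp: siz_def)
      then have "K j div 2 ^ rem NF (K j) = K (?P + i) div 2 ^ rem NF (K j)"
        using in_bucket[OF Hn(1), of "rem NF (K j)" "K j"] by simp
      from level_cong[OF this] show ?thesis using j by (simp add: free_def)
    qed
    have f: "finds (dat ?P) ?k (clg ?k) (clg ?k + tau)
       (if ?k < Th then p1 (?P div T) else field (dat ?P 0) 0 NX (clg ?k + tau)) (v j) (j - ?P)"
      using dat[OF j(1) refl j(2)] by (simp add: Let_def)
    have f0: "free ?P = dat ?P 0" using fe[of 0] j(2) by simp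
    let ?D = "clg ?k + tau" let ?d' = "\<lambda>i. free (?P + i)"
    let ?p = "if ?k < Th then p1 (?P div T) else field (dat ?P 0) 0 NX ?D"
    have u: "key2 ?d' D p x = key2 (dat ?P) D p x" for D p x unfolding key2_def using f0 by simp
    have z: "hcell ?d' L D x = hcell (dat ?P) L D x" for L D x unfolding hcell_def using f0 by simp
    have zl: "hcell (dat ?P) (clg ?k) ?D (key2 (dat ?P) ?D ?p (v j)) < ?k"
      using f unfolding finds_def Let_def by blast
    have t: "hslot ?d' (clg ?k) ?D (key2 (dat ?P) ?D ?p (v j)) =
        hslot (dat ?P) (clg ?k) ?D (key2 (dat ?P) ?D ?p (v j))"
      unfolding hslot_def Let_def z fe[OF zl] ..
    have tk: "x mod ?k < ?k" for x using j(2) by simp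
    show ?thesis
      using f unfolding finds_def Let_def f0 u t z fe[OF zl] fe[OF tk] .
  qed
  show ?thesis
    using p0(1-3) q0(1-3) p1(2,3) fr fd unfolding v_def slot_found_def
    by (intro exI[of _ p0] exI[of _ q0] exI[of _ p1] exI[of _ free]) auto
qed

end

subsection \<open>The query programs for sparse instances\<close>

text \<open>The bit vector begins with \<open>PN 8\<close> positions for the heads. Regions of
  \<open>PN 9\<close> positions follow: region \<open>2 * l\<close> holds the codes of level
  \<open>l\<close>, region \<open>2 * l + 1\<close> the starts of their runs, and region
  \<open>2 * NF\<close> the starts of the runs of equal heads.\<close>

definition ORG :: "nat => exp" where "ORG r = PN 8 \<oplus> Lit r \<otimes> PN 9"
definition RKr :: "nat => exp => exp" where "RKr r x = RANK (ORG r \<oplus> x) \<ominus> RANK (ORG r)"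
definition SLr :: "nat => exp => exp" where "SLr r i = SEL (RANK (ORG r) \<oplus> i) \<ominus> ORG r"
definition eMin :: "exp => exp => exp" where "eMin a b = IfLess a b a b"
definition LGk :: "exp => exp" where "LGk k = MF 11 12 (Lit 0) (Lit 0) (Lit 0) (PN 15) k"
definition STA :: "exp => exp" where "STA h = SLr (2 * NF) (RANK h)"

definition nxD :: "exp => exp => exp" where
  "nxD k D = IfLess (LGk k \<oplus> PN 10) D (D \<ominus> (LGk k \<oplus> PN 10)) (Lit 0)"

text \<open>A state consists of the start and end of the current bucket and the number of remaining
  bits. Buckets with fewer than two keys are left alone, in accordance with
  \<open>rem\<close>.\<close>

definition stp :: "nat => exp => exp => exp => exp => exp \<times> exp \<times> exp" where
  "stp l P B D x =
     (IfLess (B \<ominus> P) (Lit 2) P (eMin B (SLr (2 * l + 1) (RKr (2 * l) x))),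
      IfLess (B \<ominus> P) (Lit 2) B (eMin B (SLr (2 * l + 1) (RKr (2 * l) (x \<oplus> Lit 1)))),
      IfLess (B \<ominus> P) (Lit 2) D (nxD (B \<ominus> P) D))"

definition qR :: "exp => exp => exp => exp => exp" where
  "qR y P B D = (P \<lless> (PN 10 \<oplus> Lit 1)) \<oplus>
     ((y \<ggreater> nxD (B \<ominus> P) D) \<odot> (Lit 1 \<lless> (D \<ominus> nxD (B \<ominus> P) D)))"

text \<open>Expressions have no sharing, so their size grows exponentially with the level. As
  \<open>NF\<close> is a constant, so is the size.\<close>

primrec stR :: "nat => exp => exp => exp \<times> exp \<times> exp" where
  "stR 0 h y = (STA h, STA (h \<oplus> Lit 1), PN 2)"
| "stR (Suc l) h y = (case stR l h y of (P, B, D) => stp l P B D (qR y P B D))"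

definition hS :: "exp => exp" where "hS j = SEL (RKr (2 * NF) (j \<oplus> Lit 1) \<ominus> Lit 1)"
definition qS :: "nat => exp => exp" where
  "qS l j = SLr (2 * l) (RKr (2 * l + 1) (j \<oplus> Lit 1) \<ominus> Lit 1)"

text \<open>The descent for select starts from a position instead of a key: \<open>qS\<close>
  recovers the code of the key at this position from the two regions of the level, and the last
  component collects the bits that the codes reveal.\<close>

primrec stS :: "nat => exp => (exp \<times> exp \<times> exp) \<times> exp" where
  "stS 0 j = ((STA (hS j), STA (hS j \<oplus> Lit 1), PN 2), Lit 0)"
| "stS (Suc l) j = (case stS l j of ((P, B, D), Y) =>
     (stp l P B D (qS l j),
      IfLess (B \<ominus> P) (Lit 2) Y
        ((Y \<lless> (D \<ominus> nxD (B \<ominus> P) D)) \<oplus> (qS l j \<ominus> (P \<lless> (PN 10 \<oplus> Lit 1))))))"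

definition SLOT :: "exp => exp" where "SLOT j = ARR 4 j"

definition FLD :: "exp => exp => exp => exp => exp" where
  "FLD s p l D = (s \<ggreater> (p \<otimes> D)) \<odot> (Lit 1 \<lless> (l \<otimes> D))"

definition MSH :: "exp => exp => exp => exp => exp" where
  "MSH c l a v = ((a \<otimes> v) \<odot> (Lit 1 \<lless> c)) \<ggreater> (c \<ominus> l)"

definition FKEY :: "exp => exp => exp => exp => exp" where
  "FKEY y P k D = ((y \<odot> PN 11) \<odot> PN 12) \<odot>
     IfLess k (PN 14) (ARR 13 (P \<oslash> PN 13)) (FLD (SLOT P) (Lit 0) (Lit NX) D) \<odot>
     FLD (SLOT P) (Lit NX) (Lit NX) D"

definition FCEL :: "exp => exp => exp => exp => exp" where
  "FCEL v P L D = MSH (Lit NX \<otimes> D) (L \<ominus> Lit 1) (FLD (SLOT P) (Lit (2 * NX)) (Lit NX) D) v"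

definition FSLT :: "exp => exp => exp => exp => exp" where
  "FSLT v P L D =
     FLD (SLOT (P \<oplus> FCEL v P L D)) (Lit (4 * NX)) (Lit NX) D \<oplus>
     MSH (Lit NX \<otimes> D) (FLD (SLOT (P \<oplus> FCEL v P L D)) (Lit (5 * NX)) (Lit NX) D)
       (FLD (SLOT (P \<oplus> FCEL v P L D)) (Lit (3 * NX)) (Lit NX) D) v"

definition FCND :: "exp => exp => exp => exp => exp => exp" where
  "FCND v P k L D = FLD (SLOT (P \<oplus> FSLT v P L D \<odot> k))
     (Lit (6 * NX) \<oplus> FSLT v P L D \<oslash> k) (Lit 1) D"

definition FKS :: "exp => exp => exp => exp" where
  "FKS y P k = FCND (FKEY y P k (LGk k \<oplus> PN 10)) P k (LGk k) (LGk k \<oplus> PN 10)"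

definition CND :: "exp => exp => exp => exp" where
  "CND y P k = IfLess k (Lit 2) (Lit 0) (FKS y P k)"

definition MINUS1 :: exp where "MINUS1 = Lit 0 \<ominus> Lit 1"

text \<open>For an absent key the hash lookup may return anything. The result is accepted only if it
  is an index within the bucket and the bits left in that slot agree with the query; as the slot
  belongs to the bucket of the query, the higher bits agree already. Equality is tested by two
  strict comparisons.\<close>

definition fin_rank :: "exp => exp => exp \<times> exp \<times> exp => exp" where
  "fin_rank y s S = (case S of (P, B, D) =>
     IfLess (CND y P (B \<ominus> P)) (B \<ominus> P)
       (IfLess (SLOT (P \<oplus> CND y P (B \<ominus> P)) \<ggreater> (PN 2 \<ominus> D)) (y \<odot> (Lit 1 \<lless> D)) MINUS1
         (IfLess (y \<odot> (Lit 1 \<lless> D)) (SLOT (P \<oplus> CND y P (B \<ominus> P)) \<ggreater> (PN 2 \<ominus> D)) MINUS1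
           (P \<oplus> CND y P (B \<ominus> P) \<ominus> s))) MINUS1)"

abbreviation "eST i \<equiv> STA (i \<otimes> PN 1)"

definition sparse_rank :: exp where
  "sparse_rank = fin_rank (Reg 1 \<odot> (Lit 1 \<lless> PN 2)) (eST (Reg 2))
     (stR NF (Reg 2 \<otimes> PN 1 \<oplus> (Reg 1 \<ggreater> PN 2)) (Reg 1 \<odot> (Lit 1 \<lless> PN 2)))"

definition sparse_size :: exp where
  "sparse_size = eST (Reg 1 \<oplus> Lit 1) \<ominus> eST (Reg 1)"

definition fin_select :: "exp => exp => (exp \<times> exp \<times> exp) \<times> exp => exp" where
  "fin_select j i S = (case S of ((P, B, D), Y) =>
     ((hS j \<ominus> i \<otimes> PN 1) \<lless> PN 2) \<oplus> ((Y \<lless> D) \<oplus> (SLOT j \<ggreater> (PN 2 \<ominus> D))))"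

definition sparse_select :: exp where
  "sparse_select = fin_select (eST (Reg 2) \<oplus> (Reg 1 \<ominus> Lit 1)) (Reg 2)
     (stS NF (eST (Reg 2) \<oplus> (Reg 1 \<ominus> Lit 1)))"

section \<open>Correctness of the programs for sparse instances\<close>

lemma cnt_region:
  assumes "finite X" "q \<le> G"
  shows "cnt X (a + q) = cnt X a + cnt {y. y < G \<and> a + y \<in> X} q"
proof -
  let ?Y = "{y. y < G \<and> a + y \<in> X}"
  have "bij_betw (\<lambda>x. a + x) {y \<in> ?Y. y < q} {x \<in> X. a \<le> x \<and> x < a + q}"
    by (rule bij_betw_byWitness[where f' = "\<lambda>x. x - a"]) (use assms(2) in auto)
  then have "cnt ?Y q = card {x \<in> X. a \<le> x \<and> x < a + q}"
    unfolding cnt_def by (rule bij_betw_same_card)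
  then show ?thesis using cnt_diff[of X a "a + q"] assms by simp
qed

lemma sel_region:
  assumes "finite X" "i < card {y. y < G \<and> a + y \<in> X}"
  shows "sel X (cnt X a + i) = a + sel {y. y < G \<and> a + y \<in> X} i" "cnt X a + i < card X"
proof -
  let ?Y = "{y. y < G \<and> a + y \<in> X}"
  have f: "finite ?Y" by simp
  have s: "sel ?Y i \<in> ?Y" using sel_in[OF f assms(2)] .
  then have "cnt X (a + sel ?Y i) = cnt X a + i"
    using cnt_region[OF assms(1), of "sel ?Y i" G a] cnt_sel[OF f assms(2)] by auto
  then show "sel X (cnt X a + i) = a + sel ?Y i" "cnt X a + i < card X"
    using s sel_eqI[OF assms(1), of "a + sel ?Y i"] cnt_less_card[OF assms(1), of "a + sel ?Y i"] by auto
qed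

text \<open>Hash data occupy the low bits of a slot, below the remaining bits of the key, so a field
  can be read without removing the key first.\<close>

lemma field_slot:
  assumes "(s + l) * D \<le> m"
  shows "field (a * 2 ^ m + x) s l D = field x s l D"
proof -
  have "m = (s * D + l * D) + (m - (s + l) * D)" using assms by (simp add: add_mult_distrib)
  then have m: "(2::nat) ^ m = 2 ^ (s * D) * 2 ^ (l * D) * 2 ^ (m - (s + l) * D)"
    by (metis power_add)
  have "a * 2 ^ m + x = 2 ^ (s * D) * (2 ^ (l * D) * (a * 2 ^ (m - (s + l) * D))) + x"
    unfolding m by (simp only: mult_ac)
  then have "(a * 2 ^ m + x) div 2 ^ (s * D) = 2 ^ (l * D) * (a * 2 ^ (m - (s + l) * D)) + x div 2 ^ (s * D)"
    by (simp only: div_mult_self4[OF power_not_zero[OF zero_neq_numeral[symmetric]]])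
  then show ?thesis unfolding field_def by simp
qed

locale sparse = fid + keys +
  fixes Hp G Th T lgb m1 p0 p0q :: nat and p1 free :: "nat => nat" and reg :: "nat => nat set"
  assumes XR: "X = {x. x < U \<and> (if x < Hp then x \<in> (\<lambda>j. K j div 2 ^ d) ` {..<n}
      else (x - Hp) mod G \<in> reg ((x - Hp) div G))}"
    and UH: "U = Hp + (2 * NF + 1) * G" and G: "n * 2 ^ (tau + 1) + 1 \<le> G"
    and regV: "\<And>l. l < NF ==> reg (2 * l) = (\<lambda>j. code l (K j)) ` A l"
    and regW: "\<And>l. l < NF ==> reg (2 * l + 1) = insert n (starts (A l) (\<lambda>j. code l (K j)))"
    and regW0: "reg (2 * NF) = {n..<G} \<union> starts {..<n} (\<lambda>j. K j div 2 ^ d)"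
    and KH: "\<And>j. j < n ==> K j div 2 ^ d < Hp"
    and pars2: "ps ! 0 = n" "ps ! 1 = m1" "ps ! 2 = d" "ps ! 8 = Hp" "ps ! 9 = G" "ps ! 10 = tau"
      "ps ! 11 = p0" "ps ! 12 = p0q" "ps ! 13 = T" "ps ! 14 = Th" "ps ! 15 = lgb"
    and As2: "As ! 11 = (blen (clg n + 1), 1 * (n div lgb + 2), mf_base (\<lambda>_ k. clg (min k n)) lgb (n div lgb + 2))"
      "As ! 12 = (blen (clg n + 1), 1 * ((clg n + 1) * lgb), mf_expl (\<lambda>_ k. clg (min k n)) lgb (n div lgb + 2) (clg n + 1))"
      "As ! 13 = (blen (2 * (Th * (T * Th\<^sup>2)) + 8), n div T + 1, p1)"
      "As ! 4 = (d, n, \<lambda>j. K j mod 2 ^ rem NF (K j) * 2 ^ (d - rem NF (K j)) + free j)"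
    and dw: "d < w" and lgb: "0 < lgb" and n0: "0 < n" and T0: "0 < T"
    and pw: "p0 < 2 ^ w" "0 < p0" "0 < p0q"
    and p1: "\<And>c. p1 c \<le> 2 * (Th * (T * Th\<^sup>2)) + 8"
    and free: "\<And>j. j < n ==> free j < 2 ^ (d - rem NF (K j))"
    and finds: "\<And>j. j < n ==> 2 \<le> SZ NF (K j) ==>
        slot_found Th T p0 p0q p1 free j"
begin

abbreviation "V0 \<equiv> (\<lambda>j. K j div 2 ^ d) ` {..<n}"

lemma PN2: "E (PN 0) = n" "E (PN 1) = m1" "E (PN 2) = d" "E (PN 8) = Hp" "E (PN 9) = G"
  "E (PN 10) = tau" "E (PN 11) = p0" "E (PN 12) = p0q" "E (PN 13) = T" "E (PN 14) = Th"
  "E (PN 15) = lgb"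
  using PN pars2 by simp_all

lemma org_le: "r \<le> 2 * NF ==> Hp + r * G + G \<le> U"
proof -
  assume "r \<le> 2 * NF"
  then have "(r + 1) * G \<le> (2 * NF + 1) * G" by (intro mult_le_mono1) simp
  then show ?thesis unfolding UH by simp
qed

lemma E_ORG: "r \<le> 2 * NF ==> E (ORG r) = Hp + r * G"
proof -
  assume r: "r \<le> 2 * NF"
  have "Hp + r * G < 2 ^ w" using org_le[OF r] Uw by linarith
  moreover have "E (Lit r) = r" using r by (intro E_lit) (simp add: NF_def)
  ultimately show ?thesis unfolding ORG_def using PN2 by (intro ev_add ev_mul) auto
qed

lemma nG: "n < G"
proof -
  have "n * 1 \<le> n * 2 ^ (tau + 1)" by (intro mult_le_mono2) simp
  then show ?thesis using G by linarith
qed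

lemma reg_sub: "r \<le> 2 * NF ==> reg r \<subseteq> {..<G}"
proof -
  assume r: "r \<le> 2 * NF"
  have st: "starts B f \<subseteq> B" for B f by (auto simp: starts_def)
  show ?thesis
  proof (cases "r = 2 * NF")
    case True
    then show ?thesis using regW0 nG st[of "{..<n}"] by fastforce
  next
    case False
    show ?thesis
    proof (cases "even r")
      case True
      then obtain l where l: "r = 2 * l" by (auto elim: evenE)
      then have lF: "l < NF" using r False by simp
      show ?thesis unfolding l regV[OF lF]
      proof
        fix c assume "c \<in> (\<lambda>j. code l (K j)) ` A l"
        then obtain j where j: "j < n" "2 \<le> SZ l (K j)" "c = code l (K j)" by (auto simp: A_def)
        have "c + 1 \<le> HI l (K j) * 2 ^ (tau + 1)" using code_bounds(2)[OF j(2)] j(3) by simp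
        also have "... \<le> n * 2 ^ (tau + 1)" by (intro mult_le_mono1 hi_le)
        finally show "c \<in> {..<G}" using G by simp
      qed
    next
      case False
      then obtain l where l: "r = 2 * l + 1" by (auto elim: oddE)
      then have lF: "l < NF" using r by simp
      show ?thesis unfolding l regW[OF lF]
      proof -
        have "starts (A l) (\<lambda>j. code l (K j)) \<subseteq> {..<n}"
          using st[of "A l"] by (auto simp: A_def dest!: subsetD)
        then show "insert n (starts (A l) (\<lambda>j. code l (K j))) \<subseteq> {..<G}" using nG by fastforce
      qed
    qed
  qed
qed

lemma region: "r \<le> 2 * NF ==> {y. y < G \<and> (Hp + r * G) + y \<in> X} = reg r"
proof -
  assume r: "r \<le> 2 * NF"
  have "(Hp + r * G + y \<in> X) = (y \<in> reg r)" if y: "y < G" for y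
  proof -
    have "Hp + r * G + y < U" using org_le[OF r] y by linarith
    moreover have "(r * G + y) mod G = y" "(r * G + y) div G = r"
      using div_mod_add_less[OF y, of r] by auto
    ultimately show ?thesis unfolding XR by (simp add: add.assoc)
  qed
  then show ?thesis using reg_sub[OF r] by auto
qed

lemma region0: "{y. y < Hp \<and> 0 + y \<in> X} = V0"
  unfolding XR using KH UH by auto

lemma finreg: "r \<le> 2 * NF ==> finite (reg r)"
  using reg_sub finite_subset by blast

lemma E_RANK0: "E xe = x ==> x \<le> Hp ==> E (RANK xe) = cnt V0 x"
  using E_RANK[of xe x] cnt_region[OF finX, of x Hp 0] region0 UH by simp

lemma E_SEL0: "E xe = x ==> x < card V0 ==> E (SEL xe) = sel V0 x"
  using E_SEL[of xe x] sel_region[OF finX, of x Hp 0] region0 by simp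

lemma E_RKr: "r \<le> 2 * NF ==> E xe = x ==> x \<le> G ==> E (RKr r xe) = cnt (reg r) x"
proof -
  assume r: "r \<le> 2 * NF" and x: "E xe = x" "x \<le> G"
  have le: "Hp + r * G + x \<le> U" using org_le[OF r] x by linarith
  have o: "E (ORG r \<oplus> xe) = Hp + r * G + x"
    using le Uw by (intro ev_add[OF _ E_ORG[OF r] x(1)]) simp
  have c: "cnt X (Hp + r * G + x) = cnt X (Hp + r * G) + cnt (reg r) x"
    using cnt_region[OF finX x(2), of "Hp + r * G"] region[OF r] by simp
  have "E (RKr r xe) = cnt X (Hp + r * G + x) - cnt X (Hp + r * G)"
    unfolding RKr_def using c cnt_U[of "Hp + r * G + x"] Uw le
    by (intro ev_sub E_RANK o E_ORG[OF r]) auto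
  then show ?thesis using c by simp
qed

lemma E_SLr: "r \<le> 2 * NF ==> E xe = x ==> x < card (reg r) ==> E (SLr r xe) = sel (reg r) x"
proof -
  assume r: "r \<le> 2 * NF" and x: "E xe = x" "x < card (reg r)"
  note sr = sel_region[OF finX, of x G "Hp + r * G", unfolded region[OF r], OF x(2)]
  have Xw: "card X < 2 ^ w" using cnt_bounded[OF XU order_refl] cnt_U[of U] Uw by linarith
  have a: "E (RANK (ORG r) \<oplus> xe) = cnt X (Hp + r * G) + x"
    using sr(2) Xw org_le[OF r] by (intro ev_add E_RANK E_ORG[OF r] x(1)) auto
  have s: "E (SEL (RANK (ORG r) \<oplus> xe)) = Hp + r * G + sel (reg r) x"
    using E_SEL[OF a sr(2)] sr(1) by simp
  have "sel (reg r) x < G" using sel_in[OF finreg[OF r] x(2)] reg_sub[OF r] by auto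
  then have "E (SLr r xe) = Hp + r * G + sel (reg r) x - (Hp + r * G)"
    unfolding SLr_def using s org_le[OF r] Uw by (intro ev_sub E_ORG[OF r]) auto
  then show ?thesis by simp
qed

lemma nw: "n < 2 ^ w" "G < 2 ^ w"
  using nG org_le[of 0] Uw by auto

interpretation c0: classes n "{..<n}" "\<lambda>j. K j div 2 ^ d" "reg (2 * NF)"
  by unfold_locales (use finreg[of "2 * NF"] nG regW0 in \<open>auto intro!: div_le_mono K_mono simp: starts_def\<close>)

lemma cl: "l < NF ==> classes n (A l) (\<lambda>j. code l (K j)) (reg (2 * l + 1))"
  by unfold_locales (use finreg[of "2 * l + 1"] regW[of l] code_mono in \<open>auto simp: A_def\<close>)

lemma E_STA: "E he = h ==> h \<le> Hp ==> E (STA he) = lo d (h * 2 ^ d)"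
proof -
  assume h: "E he = h" "h \<le> Hp"
  have "lo d (h * 2 ^ d) = sel (reg (2 * NF)) (cnt V0 h)"
    using finreg[of "2 * NF"] regW0 nG by (intro first_level(1)) (auto simp: starts_def)
  then show ?thesis unfolding STA_def
    using E_SLr[OF _ E_RANK0[OF h] c0.index_less] by simp
qed

lemma lo_Suc: "lo d ((h + 1) * 2 ^ d) = hi d (h * 2 ^ d)"
  unfolding lo_def hi_def by (simp add: less_Suc_eq_le)

lemma E_LGk: "E ke = k ==> k \<le> n ==> E (LGk ke) = clg k"
proof -
  assume k: "E ke = k" "k \<le> n"
  have "E (LGk ke) = (\<lambda>_ k. clg (min k n)) (0::nat) k"
    unfolding LGk_def
  proof (rule E_MF[OF _ As2(1) _ As2(2)])
    show "E (Lit 0) = 0" by simp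
    show "k div lgb + 1 < n div lgb + 2" using k div_le_mono[of k n lgb] by simp
    show "mono (\<lambda>k. clg (min k n))" by (intro monoI clg_mono) simp
    show l: "clg (min j n) < clg n + 1" for j using clg_mono[of "min j n" n] by simp
    show "clg (min j n) < 2 ^ blen (clg n + 1)" for j using l[of j] less_exp_blen[of "clg n + 1"] by linarith
    show "0 < blen (clg n + 1)" by (simp add: blen_pos)
  qed (use lenAs PN2 k lgb in auto)
  then show ?thesis using k by simp
qed

lemma clg_n: "clg k + tau < 2 ^ w" if "k \<le> n"
proof -
  have "clg k \<le> k" unfolding clg_def using blen_le_self[of "k - 1"] by linarith
  moreover have "tau < 2 ^ tau" by simp
  moreover have "n + 2 ^ tau \<le> n * 2 ^ (tau + 1)"
  proof -
    have "n * 1 \<le> n * 2 ^ tau" by (intro mult_le_mono2) simp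
    moreover have "1 * 2 ^ tau \<le> n * 2 ^ tau" using n0 by (intro mult_le_mono1) simp
    moreover have "n * 2 ^ (tau + 1) = n * 2 ^ tau + n * 2 ^ tau" by simp
    ultimately show ?thesis by linarith
  qed
  ultimately show ?thesis using that G nw(2) by linarith
qed

lemma E_lam: "E ke = k ==> k \<le> n ==> E (LGk ke \<oplus> PN 10) = clg k + tau"
  by (intro ev_add E_LGk PN2(6) clg_n)

lemma E_nxD:
  assumes "E ke = k" "k \<le> n" "E De = D" "D \<le> d"
  shows "E (nxD ke De) = D - (clg k + tau)"
proof -
  note lam = E_lam[OF assms(1,2)]
  have "D < 2 ^ w" using assms(4) dw less_exp[of w] by linarith
  then have "clg k + tau < D ==> E (De \<ominus> (LGk ke \<oplus> PN 10)) = D - (clg k + tau)"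
    using assms(3) by (intro ev_sub lam) auto
  then show ?thesis unfolding nxD_def using lam assms(3) by (auto simp: E_lit)
qed

lemma HI_n: "HI l x \<le> n" by (rule hi_le)

definition level_state :: "nat => nat => exp \<times> exp \<times> exp => bool" where
  "level_state l x Z \<longleftrightarrow> (case Z of (P, B, D) => E P = LO l x \<and> E B = HI l x \<and> E D = rem l x)"

lemma E_k: "level_state l x (P, B, D) ==> E (B \<ominus> P) = SZ l x"
  unfolding siz_def level_state_def using lo_le_hi HI_n[of l x] nw by (intro ev_sub) auto

lemma SZ_n: "SZ l x \<le> n" using HI_n[of l x] by (simp add: siz_def)

lemma E2: "E (Lit 2) = 2" "E (Lit 1) = 1" "E (Lit 0) = 0"
  using E_lit[of 2] E_lit[of 1] by simp_all

lemma rem_less: "rem l x < 2 ^ w"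
  using rem_le[of l x] dw less_exp[of w] by linarith

lemma E_stp:
  assumes S: "level_state l x (P, B, D)" and l: "l < NF" and q: "2 \<le> SZ l x ==> E qe = code l x"
  shows "level_state (Suc l) x (stp l P B D qe)"
proof (cases "2 \<le> SZ l x")
  case False
  then show ?thesis using S E_k[OF S] E2 unfolding level_state_def stp_def by auto
next
  case True
  have k: "E (B \<ominus> P) = SZ l x" using E_k[OF S] .
  have s: "E P = LO l x" "E B = HI l x" "E D = rem l x" using S by (auto simp: level_state_def)
  interpret c: classes n "A l" "\<lambda>j. code l (K j)" "reg (2 * l + 1)" by (rule cl[OF l])
  have cb: "code l x + 1 \<le> G"
    using code_bounds(2)[OF True] mult_le_mono1[OF HI_n[of l x], of "2 ^ (tau + 1)"] G by linarith
  have r: "2 * l \<le> 2 * NF" "2 * l + 1 \<le> 2 * NF" using l by auto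
  have q1: "E (qe \<oplus> Lit 1) = code l x + 1"
    using q[OF True] cb nw E2 by (intro ev_add) auto
  have v: "E (RKr (2 * l) qe) = cnt ((\<lambda>j. code l (K j)) ` A l) (code l x)"
    "E (RKr (2 * l) (qe \<oplus> Lit 1)) = cnt ((\<lambda>j. code l (K j)) ` A l) (code l x + 1)"
    using E_RKr[OF r(1) q[OF True]] E_RKr[OF r(1) q1] cb regV[OF l] by simp_all
  note w = E_SLr[OF r(2) v(1) c.index_less] E_SLr[OF r(2) v(2) c.index_less]
  have n: "LO (Suc l) x = min (HI l x) (sel (reg (2 * l + 1)) (cnt ((\<lambda>j. code l (K j)) ` A l) (code l x)))"
    "HI (Suc l) x = min (HI l x) (sel (reg (2 * l + 1)) (cnt ((\<lambda>j. code l (K j)) ` A l) (code l x + 1)))"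
    using c.W by (intro next_level[OF True c.finW]; blast)+
  have D': "E (nxD (B \<ominus> P) D) = rem (Suc l) x"
    using E_nxD[OF k SZ_n s(3) rem_le] True by simp
  show ?thesis
    unfolding level_state_def stp_def split n using k True s w D' E2 by (simp add: eMin_def min_def)
qed

lemma E_shift1: "E (PN 10 \<oplus> Lit 1) = tau + 1"
proof -
  have "1 * 2 ^ (tau + 1) \<le> n * 2 ^ (tau + 1)" using n0 by (intro mult_le_mono1) simp
  then have "tau + 1 < 2 ^ w" using less_exp[of "tau + 1"] G nw by linarith
  then show ?thesis using PN2 E2 by (intro ev_add) auto
qed

lemma dig_mod: "(x mod 2 ^ d) div 2 ^ rem (Suc l) x mod 2 ^ (rem l x - rem (Suc l) x) = dig l x"
proof -
  define e where "e = rem (Suc l) x"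
  define f where "f = rem l x"
  have ef: "e \<le> f" "f \<le> d" using rem_Suc_le rem_le by (auto simp: e_def f_def simp del: rem.simps)
  have "take_bit (f - e) (drop_bit e (take_bit d x)) = take_bit (f - e) (drop_bit e x)"
    using ef by (intro bit_eqI) (auto simp: bit_simps)
  then show ?thesis unfolding dig_def e_def[symmetric] f_def[symmetric]
    by (simp add: take_bit_eq_mod drop_bit_eq_div)
qed

lemma E_qR:
  assumes S: "level_state l x (P, B, D)" and k: "2 \<le> SZ l x" and y: "E ye = x mod 2 ^ d"
  shows "E (qR ye P B D) = code l x"
proof -
  have s: "E P = LO l x" "E B = HI l x" "E D = rem l x" using S by (auto simp: level_state_def)
  have D': "E (nxD (B \<ominus> P) D) = rem (Suc l) x"
    using E_nxD[OF E_k[OF S] SZ_n s(3) rem_le] k by simp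
  have cw: "code l x < 2 ^ w"
    using code_bounds(2)[OF k] mult_le_mono1[OF HI_n[of l x], of "2 ^ (tau + 1)"] G nw by linarith
  have a: "E (P \<lless> (PN 10 \<oplus> Lit 1)) = LO l x * 2 ^ (tau + 1)"
    using cw by (intro ev_shl s(1) E_shift1) (simp add: code_def)
  have dd: "E (D \<ominus> nxD (B \<ominus> P) D) = rem l x - rem (Suc l) x"
    by (rule ev_sub[OF rem_Suc_le rem_less s(3) D'])
  have e: "E (Lit 1 \<lless> (D \<ominus> nxD (B \<ominus> P) D)) = 1 * 2 ^ (rem l x - rem (Suc l) x)"
  proof (rule ev_shl[OF _ E2(2) dd])
    have "rem l x - rem (Suc l) x < w" using rem_le[of l x] dw by linarith
    then show "1 * 2 ^ (rem l x - rem (Suc l) x) < (2::nat) ^ w" by simp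
  qed
  note eq = dig_mod[of x l]
  have b: "E ((ye \<ggreater> nxD (B \<ominus> P) D) \<odot> (Lit 1 \<lless> (D \<ominus> nxD (B \<ominus> P) D))) = dig l x"
    using ev_mod[OF ev_shr[OF y D'] e] eq by (simp only: mult_1)
  show ?thesis unfolding qR_def code_def using cw by (intro ev_add[OF _ a b]) (simp add: code_def)
qed

lemma level0:
  assumes "E he = x div 2 ^ d" "x div 2 ^ d < Hp"
  shows "level_state 0 x (STA he, STA (he \<oplus> Lit 1), PN 2)"
proof -
  have h1: "E (he \<oplus> Lit 1) = x div 2 ^ d + 1"
    using assms org_le[of 0] Uw E2 by (intro ev_add) auto
  have "E (STA he) = lo d (x div 2 ^ d * 2 ^ d)" using E_STA[OF assms(1)] assms(2) by simp
  moreover have "E (STA (he \<oplus> Lit 1)) = hi d (x div 2 ^ d * 2 ^ d)"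
    using E_STA[OF h1] assms(2) lo_Suc by simp
  moreover have "lo d (x div 2 ^ d * 2 ^ d) = lo d x" "hi d (x div 2 ^ d * 2 ^ d) = hi d x"
    by (intro lo_cong hi_cong; simp)+
  ultimately show ?thesis using PN2 by (simp add: level_state_def)
qed

lemma E_stR:
  assumes "E he = x div 2 ^ d" "x div 2 ^ d < Hp" "E ye = x mod 2 ^ d"
  shows "l \<le> NF ==> level_state l x (stR l he ye)"
proof (induction l)
  case 0
  then show ?case using level0[OF assms(1,2)] by simp
next
  case (Suc l)
  obtain P B D where S: "stR l he ye = (P, B, D)" by (metis prod_cases3)
  have "level_state l x (P, B, D)" using Suc S by simp
  moreover have "l < NF" using Suc.prems by simp
  ultimately have "level_state (Suc l) x (stp l P B D (qR ye P B D))"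
    using E_qR[OF _ _ assms(3)] by (intro E_stp) blast+
  then show ?case unfolding stR.simps S split .
qed

lemma E_FLD:
  assumes "E se = x" "E pe = a" "E le = b" "E De = D" "a * D < 2 ^ w" "b * D < w"
  shows "E (FLD se pe le De) = field x a b D"
proof -
  have "b * D < 2 ^ w" using assms(6) less_exp[of w] by linarith
  then have l: "E (Lit 1 \<lless> (le \<otimes> De)) = 1 * 2 ^ (b * D)"
    using assms E2 by (intro ev_shl ev_mul) auto
  have "E (se \<ggreater> (pe \<otimes> De)) = x div 2 ^ (a * D)" using assms by (intro ev_shr ev_mul)
  then show ?thesis unfolding FLD_def field_def using l by simp
qed

lemma E_MSH:
  assumes "E ce = c" "E le = l" "E ae = a" "E ve = v" "2 * c < w" "l \<le> c" "a < 2 ^ c" "v < 2 ^ c"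
  shows "E (MSH ce le ae ve) = mshift c l a v"
proof -
  have cw: "c < 2 ^ w" using assms(5) less_exp[of w] by linarith
  have "a * v < 2 ^ c * 2 ^ c" using assms(7,8) by (intro mult_strict_mono) auto
  also have "... = 2 ^ (2 * c)" by (simp add: mult_2 power_add)
  also have "... < 2 ^ w" using assms(5) by simp
  finally have av: "E (ae \<otimes> ve) = a * v" using assms by (intro ev_mul)
  have "(2::nat) ^ c < 2 ^ w" using assms(5) by simp
  then have p: "E (Lit 1 \<lless> ce) = 1 * 2 ^ c" using assms E2 by (intro ev_shl) auto
  have s: "E (ce \<ominus> le) = c - l" using assms cw by (intro ev_sub)
  show ?thesis unfolding MSH_def mshift_def using ev_shr[OF ev_mod[OF av p] s] by simp
qed

definition slot :: "nat => nat" where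
  "slot j = K j mod 2 ^ rem NF (K j) * 2 ^ (d - rem NF (K j)) + free j"

lemma slot_less: "j < n ==> slot j < 2 ^ d"
proof -
  assume j: "j < n"
  let ?r = "rem NF (K j)"
  have "(K j mod 2 ^ ?r + 1) * 2 ^ (d - ?r) \<le> 2 ^ ?r * 2 ^ (d - ?r)"
    by (intro mult_le_mono1) (simp add: Suc_leI)
  also have "... = 2 ^ d" using rem_le[of NF "K j"] by (simp flip: power_add)
  finally show ?thesis using free[OF j] by (simp add: slot_def)
qed

lemma E_SLOT: "E je = j ==> j < n ==> E (SLOT je) = slot j"
  unfolding SLOT_def slot_def
  using E_ARR[OF _ As2(4), of je j] slot_less[of j] lenAs by (simp add: slot_def)

lemma slot_high: "j < n ==> slot j div 2 ^ (d - rem NF (K j)) = K j mod 2 ^ rem NF (K j)"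
  unfolding slot_def using free[of j] by (simp add: div_mult_self3)

text \<open>By \<open>consumed\<close>, \<open>NF * D \<le> d < w\<close>. All hash arithmetic
  concerns numbers of \<open>NX * D\<close> bits, and \<open>NF\<close> exceeds
  \<open>2 * NX\<close>, so not even the products overflow a word.\<close>

lemma E_FKS:
  assumes j: "j < n" "2 \<le> SZ NF (K j)" and y: "E ye = yk j"
    and P: "E Pe = LO NF (K j)" and k: "E ke = SZ NF (K j)"
  shows "E (FKS ye Pe ke) = j - LO NF (K j)"
proof -
  define P k L D where "P = LO NF (K j)" and "k = SZ NF (K j)" and "L = clg k" and "D = L + tau"
  define dat where "dat i = free (P + i)" for i
  define p where "p = (if k < Th then p1 (P div T) else field (dat 0) 0 NX D)"
  have fi: "finds dat k L D p (yk j mod p0 mod p0q) (j - P)"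
    using finds[OF j] unfolding slot_found_def dat_def p_def L_def D_def k_def P_def by (simp only: add_0_right)
  define v where "v = yk j mod p0 mod p0q"
  define u where "u = key2 dat D p v"
  define z where "z = hcell dat L D u"
  define t where "t = hslot dat L D u"
  have ff: "field (dat (t mod k)) (6 * NX + t div k) 1 D = j - P" "u < 2 ^ (NX * D)" "t < 21 * k"
    "z < k" "field (dat z) (5 * NX) NX D \<le> NX * D"
    using fi unfolding finds_def Let_def u_def z_def t_def v_def by auto
  have k2: "2 \<le> k" using j by (simp add: k_def)
  note cg = clg[OF k2, folded L_def]
  have kn: "k \<le> n" using SZ_n by (simp add: k_def)
  have Pk: "P + k \<le> n" using HI_n[of NF "K j"] lo_le_hi[of "rem NF (K j)" "K j"]
    by (simp add: P_def k_def siz_def)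
  have cons: "rem NF (K j) + NF * D \<le> d"
    using consumed[OF j(2)] by (simp add: D_def L_def k_def)
  have eL: "E (LGk ke) = L" using E_LGk[of ke k] k kn by (simp add: k_def L_def)
  have eD: "E (LGk ke \<oplus> PN 10) = D" using E_lam[of ke k] k kn by (simp add: k_def L_def D_def)
  have FD: "NF * D < w" using cons dw by linarith
  have lt: "a * D < w" if "a \<le> NF" for a using mult_le_mono1[OF that, of D] FD by linarith
  have ltw: "a * D < 2 ^ w" if "a \<le> NF" for a using lt[OF that] less_exp[of w] by linarith
  have sf: "field (slot (P + i)) s l D = field (dat i) s l D" if "i < k" "s + l \<le> NF" for i s l
  proof -
    have Hn: "P + i < n" "P + i < HI NF (K j)" using that Pk by (simp_all add: P_def k_def siz_def)
    then have "K j div 2 ^ rem NF (K j) = K (P + i) div 2 ^ rem NF (K j)"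
      using in_bucket[OF Hn(1), of "rem NF (K j)" "K j"] by (simp add: P_def)
    from level_cong(1)[OF this] have r: "rem NF (K (P + i)) = rem NF (K j)" .
    have "(s + l) * D \<le> d - rem NF (K j)" using mult_le_mono1[OF that(2), of D] cons by linarith
    then show ?thesis unfolding slot_def r dat_def by (rule field_slot)
  qed
  have eS: "E (SLOT xe) = slot (P + i)" if "E xe = P + i" "i < k" for xe i
    using that Pk by (intro E_SLOT) auto
  have eSP: "E (SLOT Pe) = slot (P + 0)" using P k2 by (intro eS) (auto simp: P_def)
  have F0: "E (FLD (SLOT Pe) (Lit a) (Lit b) (LGk ke \<oplus> PN 10)) = field (dat 0) a b D"
    if "a + b \<le> NF" for a b
  proof -
    have "a < 4000" "b < 4000" using that by (auto simp: NF_def)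
    then have "E (FLD (SLOT Pe) (Lit a) (Lit b) (LGk ke \<oplus> PN 10)) = field (slot (P + 0)) a b D"
      using that by (intro E_FLD eSP eD E_lit lt ltw) auto
    then show ?thesis using sf[of 0 a b] that k2 by simp
  qed
  have Pn: "P < n" using Pk k2 by linarith
  have ep: "E (IfLess ke (PN 14) (ARR 13 (Pe \<oslash> PN 13)) (FLD (SLOT Pe) (Lit 0) (Lit NX) (LGk ke \<oplus> PN 10))) = p"
  proof (cases "k < Th")
    case True
    have ePT: "E (Pe \<oslash> PN 13) = P div T" using P PN2 by (simp add: P_def)
    have "E (ARR 13 (Pe \<oslash> PN 13)) = p1 (P div T)"
    proof (rule E_ARR[OF _ As2(3) ePT])
      show "P div T < n div T + 1" using div_le_mono[of P n T] Pn by simp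
      show "p1 (P div T) < 2 ^ blen (2 * (Th * (T * Th\<^sup>2)) + 8)"
        using p1[of "P div T"] less_exp_blen[of "2 * (Th * (T * Th\<^sup>2)) + 8"] by linarith
    qed (use lenAs in simp)
    then show ?thesis using True k PN2 by (simp add: p_def k_def)
  next
    case False
    then show ?thesis using F0[of 0 NX] k PN2 by (simp add: p_def k_def NF_def NX_def)
  qed
  have eu: "E (FKEY ye Pe ke (LGk ke \<oplus> PN 10)) = u"
    unfolding FKEY_def u_def key2_def v_def
    by (intro ev_mod y PN2 ep F0) (simp add: NF_def NX_def)
  let ?v = "FKEY ye Pe ke (LGk ke \<oplus> PN 10)"
  let ?c = "Lit NX \<otimes> (LGk ke \<oplus> PN 10)"
  have ec: "E ?c = NX * D"
    using ltw[of NX] by (intro ev_mul eD E_lit) (auto simp: NX_def NF_def)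
  have c2: "2 * (NX * D) < w" using lt[of "2 * NX"] by (simp add: NX_def NF_def)
  have eL1: "E (LGk ke \<ominus> Lit 1) = L - 1"
  proof (rule ev_sub[OF _ _ eL E2(2)])
    have "L \<le> D" "1 * D \<le> NF * D" by (auto simp: D_def NF_def)
    then show "L < 2 ^ w" using FD less_exp[of w] by linarith
  qed (use cg in auto)
  have LD: "L - 1 \<le> NX * D" by (simp add: D_def NX_def)
  have ez: "E (FCEL ?v Pe (LGk ke) (LGk ke \<oplus> PN 10)) = z"
    unfolding FCEL_def z_def hcell_def
    by (rule E_MSH[OF ec eL1 F0 eu c2 LD field_less ff(2)]) (simp add: NF_def NX_def)
  have ePz: "E (Pe \<oplus> FCEL ?v Pe (LGk ke) (LGk ke \<oplus> PN 10)) = P + z"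
    using ff(4) Pk nw by (intro ev_add ez) (auto simp: P P_def)
  have Fz: "E (FLD (SLOT (Pe \<oplus> FCEL ?v Pe (LGk ke) (LGk ke \<oplus> PN 10))) (Lit a) (Lit b) (LGk ke \<oplus> PN 10))
      = field (dat z) a b D" if "a + b \<le> NF" for a b
  proof -
    have "a < 4000" "b < 4000" using that by (auto simp: NF_def)
    then have "E (FLD (SLOT (Pe \<oplus> FCEL ?v Pe (LGk ke) (LGk ke \<oplus> PN 10))) (Lit a) (Lit b) (LGk ke \<oplus> PN 10))
        = field (slot (P + z)) a b D"
      using that by (intro E_FLD eS[OF ePz ff(4)] eD E_lit lt ltw) auto
    then show ?thesis using sf[of z a b] that ff(4) by simp
  qed
  have m: "E (MSH ?c (FLD (SLOT (Pe \<oplus> FCEL ?v Pe (LGk ke) (LGk ke \<oplus> PN 10))) (Lit (5 * NX)) (Lit NX) (LGk ke \<oplus> PN 10))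
       (FLD (SLOT (Pe \<oplus> FCEL ?v Pe (LGk ke) (LGk ke \<oplus> PN 10))) (Lit (3 * NX)) (Lit NX) (LGk ke \<oplus> PN 10)) ?v)
     = mshift (NX * D) (field (dat z) (5 * NX) NX D) (field (dat z) (3 * NX) NX D) u"
    by (rule E_MSH[OF ec Fz Fz eu c2 ff(5) field_less ff(2)]) (auto simp: NF_def NX_def)
  have tw: "t < 2 ^ w"
  proof -
    have "21 * k \<le> 21 * n" using kn by simp
    moreover have "21 * n \<le> (2 * NF + 1) * G" using nG by (intro mult_mono) (auto simp: NF_def)
    ultimately show ?thesis using ff(3) UH Uw by linarith
  qed
  have t: "t = field (dat z) (4 * NX) NX D +
     mshift (NX * D) (field (dat z) (5 * NX) NX D) (field (dat z) (3 * NX) NX D) u"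
    by (simp add: t_def hslot_def Let_def z_def)
  have et: "E (FSLT ?v Pe (LGk ke) (LGk ke \<oplus> PN 10)) = t"
    unfolding FSLT_def t using tw t by (intro ev_add Fz m) (auto simp: NF_def NX_def)
  have tk: "t mod k < k" "t div k < 21" using k2 ff(3) by (auto simp: less_mult_imp_div_less)
  have ePt: "E (Pe \<oplus> FSLT ?v Pe (LGk ke) (LGk ke \<oplus> PN 10) \<odot> ke) = P + t mod k"
    using tk Pk nw k by (intro ev_add ev_mod et) (auto simp: P P_def k_def)
  have eo: "E (Lit (6 * NX) \<oplus> FSLT ?v Pe (LGk ke) (LGk ke \<oplus> PN 10) \<oslash> ke) = 6 * NX + t div k"
  proof (rule ev_add[OF _ E_lit ev_div[OF et]])
    show "6 * NX + t div k < 2 ^ w" using tk(2) exp_bound w16 by (simp add: NX_def)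
  qed (use k in \<open>auto simp: NX_def k_def\<close>)
  have "6 * NX + t div k + 1 \<le> NF" using tk(2) by (simp add: NF_def NX_def)
  then have "E (FCND ?v Pe ke (LGk ke) (LGk ke \<oplus> PN 10)) = field (slot (P + t mod k)) (6 * NX + t div k) 1 D"
    unfolding FCND_def using lt[of 1] ltw[of "6 * NX + t div k"]
    by (intro E_FLD eS[OF ePt tk(1)] eo E2 eD) (auto simp: NF_def)
  also have "... = j - P" using sf[OF tk(1)] tk(2) ff(1) by (simp add: NF_def NX_def)
  finally show ?thesis unfolding FKS_def P_def .
qed

lemma E_MINUS1: "E MINUS1 = 2 ^ w - 1"
  unfolding MINUS1_def using w16 by (simp add: take_bit_nat_eq_self)

lemma E_fin_rank:
  assumes Z: "level_state NF x Z" and y: "E ye = x mod 2 ^ d" and s: "E se = s" "s \<le> LO NF x"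
  shows "j < n ==> K j = x ==> E (fin_rank ye se Z) = j - s"
    "x \<notin> K ` {..<n} ==> E (fin_rank ye se Z) = 2 ^ w - 1"
proof -
  obtain P B D where Zd: "Z = (P, B, D)" by (metis prod_cases3)
  note Z = Z[unfolded Zd]
  have e: "E P = LO NF x" "E B = HI NF x" "E D = rem NF x" using Z by (auto simp: level_state_def)
  have k: "E (B \<ominus> P) = SZ NF x" using E_k[OF Z] .
  let ?c = "CND ye P (B \<ominus> P)"
  have "(2::nat) ^ rem NF x < 2 ^ w" using rem_le[of NF x] dw by simp
  then have pD: "E (Lit 1 \<lless> D) = 1 * 2 ^ rem NF x" using e E2 by (intro ev_shl) auto
  have yD: "E (ye \<odot> (Lit 1 \<lless> D)) = x mod 2 ^ rem NF x"
  proof -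
    have "x mod 2 ^ d mod 2 ^ rem NF x = x mod 2 ^ rem NF x"
      using rem_le[of NF x] by (intro mod_mod_cancel le_imp_power_dvd)
    then show ?thesis using ev_mod[OF y pD] by simp
  qed
  have "d < 2 ^ w" using dw less_exp[of w] by linarith
  then have dD: "E (PN 2 \<ominus> D) = d - rem NF x" using e PN2 rem_le by (intro ev_sub) auto
  have slotE: "E (P \<oplus> ?c) = LO NF x + c \<and> E (SLOT (P \<oplus> ?c) \<ggreater> (PN 2 \<ominus> D)) = K (LO NF x + c) mod 2 ^ rem NF x \<and>
      K (LO NF x + c) div 2 ^ rem NF x = x div 2 ^ rem NF x \<and> LO NF x + c < n"
    if c: "E ?c = c" "c < SZ NF x" for c
  proof -
    have Hn: "LO NF x + c < n" "LO NF x + c < HI NF x" using c HI_n[of NF x] by (auto simp: siz_def)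
    have eq: "x div 2 ^ rem NF x = K (LO NF x + c) div 2 ^ rem NF x"
      using in_bucket[OF Hn(1), of "rem NF x" x] Hn by simp
    have r: "rem NF (K (LO NF x + c)) = rem NF x" using level_cong(1)[OF eq] .
    have p: "E (P \<oplus> ?c) = LO NF x + c" using e c Hn nw by (intro ev_add) auto
    have "E (SLOT (P \<oplus> ?c) \<ggreater> (PN 2 \<ominus> D)) = slot (LO NF x + c) div 2 ^ (d - rem NF x)"
      by (intro ev_shr E_SLOT p dD Hn)
    also have "... = K (LO NF x + c) mod 2 ^ rem NF x" using slot_high[OF Hn(1)] r by simp
    finally show ?thesis using p eq Hn by simp
  qed
  {
    assume j: "j < n" "K j = x"
    have b: "LO NF x \<le> j" "j < HI NF x" using pos_in_bucket[OF j(1)] j(2) by auto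
    have c: "E ?c = j - LO NF x"
    proof (cases "SZ NF x < 2")
      case True
      then have "j = LO NF x" using b by (auto simp: siz_def)
      then show ?thesis unfolding CND_def using True k E2 by simp
    next
      case False
      then have "E (FKS ye P (B \<ominus> P)) = j - LO NF (K j)"
        using j y e k by (intro E_FKS) (auto simp: yk_def)
      then show ?thesis unfolding CND_def using False k E2 j by simp
    qed
    have cl: "j - LO NF x < SZ NF x" using b by (auto simp: siz_def)
    have Pj: "LO NF x + (j - LO NF x) = j" using b by simp
    note sl = slotE[OF c cl, unfolded Pj j(2)]
    have "E (P \<oplus> ?c \<ominus> se) = j - s" using sl s b j nw by (intro ev_sub) auto
    then show "E (fin_rank ye se Z) = j - s"
      unfolding Zd fin_rank_def split using c cl k sl yD by simp
  }
  {
    assume no: "x \<notin> K ` {..<n}"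
    show "E (fin_rank ye se Z) = 2 ^ w - 1"
    proof (cases "E ?c < SZ NF x")
      case False
      then show ?thesis unfolding Zd fin_rank_def split using k E_MINUS1 by simp
    next
      case True
      define c where "c = E ?c"
      note sl = slotE[OF c_def[symmetric] True[folded c_def]]
      have "K (LO NF x + c) mod 2 ^ rem NF x \<noteq> x mod 2 ^ rem NF x"
      proof
        assume "K (LO NF x + c) mod 2 ^ rem NF x = x mod 2 ^ rem NF x"
        then have "K (LO NF x + c) = x" using sl by (metis div_mult_mod_eq)
        moreover have "LO NF x + c < n" using sl by simp
        ultimately show False using no by (metis imageI lessThan_iff)
      qed
      then show ?thesis unfolding Zd fin_rank_def split using k True sl yD E_MINUS1 by auto
    qed
  }
qed

lemma E_hS: "E je = j ==> j < n ==> E (hS je) = K j div 2 ^ d"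
proof -
  assume j: "E je = j" "j < n"
  note s = c0.sel_image_cnt[of j]
  have j1: "E (je \<oplus> Lit 1) = j + 1" using j nw E2 by (intro ev_add) auto
  have r: "E (RKr (2 * NF) (je \<oplus> Lit 1)) = cnt (reg (2 * NF)) (j + 1)"
    using j nG by (intro E_RKr j1) auto
  have "E (RKr (2 * NF) (je \<oplus> Lit 1) \<ominus> Lit 1) = cnt (reg (2 * NF)) (j + 1) - 1"
    using s(1) j nw cnt_le[of "reg (2 * NF)" "j + 1"] by (intro ev_sub r E2) auto
  then show ?thesis unfolding hS_def using s j by (subst E_SEL0) auto
qed

lemma E_qS: "l < NF ==> E je = j ==> j \<in> A l ==> E (qS l je) = code l (K j)"
proof -
  assume l: "l < NF" and j: "E je = j" "j \<in> A l"
  interpret c: classes n "A l" "\<lambda>j. code l (K j)" "reg (2 * l + 1)" by (rule cl[OF l])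
  have jn: "j < n" using j by (simp add: A_def)
  note s = c.sel_image_cnt[OF j(2)]
  have j1: "E (je \<oplus> Lit 1) = j + 1" using j jn nw E2 by (intro ev_add) auto
  have r: "E (RKr (2 * l + 1) (je \<oplus> Lit 1)) = cnt (reg (2 * l + 1)) (j + 1)"
    using l jn nG by (intro E_RKr j1) auto
  have i: "E (RKr (2 * l + 1) (je \<oplus> Lit 1) \<ominus> Lit 1) = cnt (reg (2 * l + 1)) (j + 1) - 1"
    using s(1) jn nw cnt_le[of "reg (2 * l + 1)" "j + 1"] by (intro ev_sub r E2) auto
  show ?thesis unfolding qS_def using s l by (subst E_SLr[OF _ i]) (auto simp: regV)
qed

lemma E_stS:
  assumes j: "E je = j" "j < n"
  shows "l \<le> NF ==> level_state l (K j) (fst (stS l je)) \<and>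
    E (snd (stS l je)) = (K j mod 2 ^ d) div 2 ^ rem l (K j)"
proof (induction l)
  case 0
  then show ?case using level0[OF E_hS[OF j] KH[OF j(2)]] by simp
next
  case (Suc l)
  obtain P B D Y where S: "stS l je = ((P, B, D), Y)" by (metis prod.exhaust)
  have l: "l < NF" using Suc.prems by simp
  have st: "level_state l (K j) (P, B, D)" and Y: "E Y = (K j mod 2 ^ d) div 2 ^ rem l (K j)"
    using Suc.IH Suc.prems S by auto
  have q: "E (qS l je) = code l (K j)" if "2 \<le> SZ l (K j)"
    using that j by (intro E_qS[OF l]) (auto simp: A_def)
  have s': "level_state (Suc l) (K j) (stp l P B D (qS l je))" by (rule E_stp[OF st l q])
  have k: "E (B \<ominus> P) = SZ l (K j)" using E_k[OF st] .
  let ?Y = "IfLess (B \<ominus> P) (Lit 2) Y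
        ((Y \<lless> (D \<ominus> nxD (B \<ominus> P) D)) \<oplus> (qS l je \<ominus> (P \<lless> (PN 10 \<oplus> Lit 1))))"
  have "E ?Y = (K j mod 2 ^ d) div 2 ^ rem (Suc l) (K j)"
  proof (cases "2 \<le> SZ l (K j)")
    case False
    then show ?thesis using k Y E2 by simp
  next
    case True
    let ?y = "K j mod 2 ^ d" let ?r = "rem l (K j)" let ?r' = "rem (Suc l) (K j)"
    have s: "E P = LO l (K j)" "E D = ?r" using st by (auto simp: level_state_def)
    have D': "E (nxD (B \<ominus> P) D) = ?r'" using E_nxD[OF k SZ_n s(2) rem_le] True by simp
    have dd: "E (D \<ominus> nxD (B \<ominus> P) D) = ?r - ?r'"
      by (rule ev_sub[OF rem_Suc_le rem_less s(2) D'])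
    have cw: "code l (K j) < 2 ^ w"
      using code_bounds(2)[OF True] mult_le_mono1[OF HI_n[of l "K j"], of "2 ^ (tau + 1)"] G nw by linarith
    have a: "E (P \<lless> (PN 10 \<oplus> Lit 1)) = LO l (K j) * 2 ^ (tau + 1)"
      using cw by (intro ev_shl s(1) E_shift1) (simp add: code_def)
    have b: "E (qS l je \<ominus> (P \<lless> (PN 10 \<oplus> Lit 1))) = code l (K j) - LO l (K j) * 2 ^ (tau + 1)"
      by (intro ev_sub q[OF True] a cw code_bounds(1)[OF True])
    have eq: "?y div 2 ^ ?r' = ?y div 2 ^ ?r * 2 ^ (?r - ?r') + dig l (K j)"
      using div_split[OF rem_Suc_le, of ?y l "K j"] dig_mod[of "K j" l] by (simp only:)
    have "?y div 2 ^ ?r' \<le> ?y" by (rule div_le_dividend)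
    also have "?y < 2 ^ d" by simp
    also have "(2::nat) ^ d < 2 ^ w" using dw by simp
    finally have lt: "?y div 2 ^ ?r' < 2 ^ w" .
    have "E ((Y \<lless> (D \<ominus> nxD (B \<ominus> P) D)) \<oplus> (qS l je \<ominus> (P \<lless> (PN 10 \<oplus> Lit 1)))) =
        ?y div 2 ^ ?r * 2 ^ (?r - ?r') + (code l (K j) - LO l (K j) * 2 ^ (tau + 1))"
      using lt eq by (intro ev_add ev_shl Y dd b) (auto simp: code_def simp del: rem.simps)
    then show ?thesis using k True E2 eq by (simp add: code_def del: rem.simps)
  qed
  then show ?case unfolding stS.simps S split using s' by simp
qed

lemma E_fin_select:
  assumes j: "E je = j" "j < n" and i: "E ie = i" "i * m1 \<le> K j div 2 ^ d"
    and lt: "K j - i * m1 * 2 ^ d < 2 ^ w"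
  shows "E (fin_select je ie (stS NF je)) = K j - i * m1 * 2 ^ d"
proof -
  obtain P B D Y where S: "stS NF je = ((P, B, D), Y)" by (metis prod.exhaust)
  let ?r = "rem NF (K j)" let ?y = "K j mod 2 ^ d"
  have st: "E D = ?r" and Y: "E Y = ?y div 2 ^ ?r"
    using E_stS[OF j, of NF] S by (auto simp: level_state_def)
  have "d < 2 ^ w" using dw less_exp[of w] by linarith
  then have dD: "E (PN 2 \<ominus> D) = d - ?r" using st PN2 rem_le by (intro ev_sub) auto
  have sl: "E (SLOT je \<ggreater> (PN 2 \<ominus> D)) = K j mod 2 ^ ?r"
    using ev_shr[OF E_SLOT[OF j] dD] slot_high[OF j(2)] by simp
  have ym: "?y mod 2 ^ ?r = K j mod 2 ^ ?r"
    using rem_le[of NF "K j"] by (intro mod_mod_cancel le_imp_power_dvd)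
  have ys: "?y div 2 ^ ?r * 2 ^ ?r + K j mod 2 ^ ?r = ?y" using ym by (metis div_mult_mod_eq)
  have hw: "K j div 2 ^ d < 2 ^ w" using KH[OF j(2)] org_le[of 0] Uw by linarith
  have im: "E (ie \<otimes> PN 1) = i * m1" using i hw PN2 by (intro ev_mul) auto
  have h: "E (hS je \<ominus> ie \<otimes> PN 1) = K j div 2 ^ d - i * m1"
    by (rule ev_sub[OF i(2) hw E_hS[OF j] im])
  have tot: "(K j div 2 ^ d - i * m1) * 2 ^ d + ?y = K j - i * m1 * 2 ^ d"
  proof -
    have "i * m1 * 2 ^ d \<le> K j div 2 ^ d * 2 ^ d" using i(2) by (rule mult_le_mono1)
    moreover have "K j div 2 ^ d * 2 ^ d + ?y = K j" by (rule div_mult_mod_eq)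
    ultimately show ?thesis unfolding diff_mult_distrib by linarith
  qed
  have yw: "?y < 2 ^ w" using tot lt by linarith
  have 1: "E ((Y \<lless> D) \<oplus> (SLOT je \<ggreater> (PN 2 \<ominus> D))) = ?y div 2 ^ ?r * 2 ^ ?r + K j mod 2 ^ ?r"
    using yw ys by (intro ev_add ev_shl Y st sl) auto
  have 2: "E ((hS je \<ominus> ie \<otimes> PN 1) \<lless> PN 2) = (K j div 2 ^ d - i * m1) * 2 ^ d"
    using tot lt by (intro ev_shl h PN2) linarith
  have "E (fin_select je ie (stS NF je)) = (K j div 2 ^ d - i * m1) * 2 ^ d + ?y"
    unfolding S fin_select_def split
    using tot lt 1 ys by (intro ev_add[OF _ 2]) auto
  then show ?thesis using tot by simp
qed

end

subsection \<open>Merging the sets\<close>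

text \<open>The stride \<open>B\<close> is \<open>m\<close> in the dense case. In the sparse case it
  is \<open>m\<close> rounded up to a multiple of \<open>2 ^ d\<close>, so that every set begins
  with a new head and the number of keys before it is found at the level of heads.\<close>

definition merged :: "nat => nat set list => nat set" where
  "merged B S = {i * B + x | i x. i < length S \<and> x \<in> S ! i}"

locale set_list =
  fixes m B :: nat and S :: "nat set list"
  assumes sub: "\<And>i. i < length S ==> S ! i \<subseteq> {..<m}" and mB: "m \<le> B" and m0: "0 < m"
begin

lemma in_merged: "i < length S ==> x < B ==> i * B + x \<in> merged B S \<longleftrightarrow> x \<in> S ! i"
proof
  assume i: "i < length S" and x: "x < B" and "i * B + x \<in> merged B S"
  then obtain i' x' where e: "i * B + x = i' * B + x'" "i' < length S" "x' \<in> S ! i'"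
    by (auto simp: merged_def)
  have "x' < B" using e sub[of i'] mB by auto
  then have "i = i' \<and> x = x'"
    using e(1) div_mod_add_less[OF x, of i] div_mod_add_less[of x' B i'] by metis
  then show "x \<in> S ! i" using e by simp
qed (auto simp: merged_def)

lemma merged_sub: "merged B S \<subseteq> {..<length S * B}"
proof
  fix y assume "y \<in> merged B S"
  then obtain i x where y: "y = i * B + x" "i < length S" "x \<in> S ! i" by (auto simp: merged_def)
  have "x < B" using y sub[of i] mB by auto
  then have "y < (i + 1) * B" using y by simp
  also have "... \<le> length S * B" using y by (intro mult_le_mono1) simp
  finally show "y \<in> {..<length S * B}" by simp
qed

lemma finite_merged: "finite (merged B S)"
  using merged_sub finite_subset by blast

lemma region_merged: "i < length S ==> {y. y < B \<and> i * B + y \<in> merged B S} = S ! i"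
  using in_merged[of i] sub[of i] mB by fastforce

lemma cnt_merged:
  "i < length S ==> x \<le> B ==> cnt (merged B S) (i * B + x) = cnt (merged B S) (i * B) + cnt (S ! i) x"
  using cnt_region[OF finite_merged, of x B "i * B"] region_merged by simp

lemma card_merged_step:
  "i < length S ==> cnt (merged B S) ((i + 1) * B) = cnt (merged B S) (i * B) + card (S ! i)"
proof -
  assume i: "i < length S"
  have "cnt (S ! i) B = card (S ! i)" using sub[OF i] mB by (intro cnt_bounded[of _ m]) auto
  then show ?thesis using cnt_merged[OF i, of B] by (simp add: add.commute)
qed

lemma sel_merged:
  assumes "i < length S" "r < card (S ! i)"
  shows "sel (merged B S) (cnt (merged B S) (i * B) + r) = i * B + sel (S ! i) r"
    "cnt (merged B S) (i * B) + r < card (merged B S)"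
  using sel_region[OF finite_merged, of r B "i * B"] region_merged[OF assms(1)] assms(2) by simp_all

lemma card_merged: "card (merged B S) = (\<Sum>i<length S. card (S ! i))"
proof -
  have "t \<le> length S ==> cnt (merged B S) (t * B) = (\<Sum>i<t. card (S ! i))" for t
    by (induction t) (use card_merged_step in \<open>auto simp: add.commute\<close>)
  then show ?thesis using cnt_bounded[OF merged_sub order_refl] by simp
qed

lemma set_rank_eq: "i < length S ==> x < m ==> set_rank x (S ! i) =
    (if i * B + x \<in> merged B S then int (cnt (merged B S) (i * B + x) - cnt (merged B S) (i * B)) else - 1)"
  using in_merged[of i x] cnt_merged[of i x] mB by (simp add: set_rank_def cnt_def)

lemma set_select_eq: "set_select j T = sel T (j - 1)"
  by (simp add: set_select_def sel_def)

lemma sel_less_m: "i < length S ==> r < card (S ! i) ==> sel (S ! i) r < m"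
proof -
  assume i: "i < length S" and r: "r < card (S ! i)"
  have "finite (S ! i)" using sub[OF i] finite_subset by blast
  then show ?thesis using sel_in[OF _ r] sub[OF i] by auto
qed

end

subsection \<open>The query programs\<close>

text \<open>Membership shows as a growth of the rank from one position to the next.\<close>

definition dense_rank :: exp where
  "dense_rank = IfLess (RANK (Reg 2 \<otimes> PN 1 \<oplus> Reg 1)) (RANK (Reg 2 \<otimes> PN 1 \<oplus> Reg 1 \<oplus> Lit 1))
     (RANK (Reg 2 \<otimes> PN 1 \<oplus> Reg 1) \<ominus> RANK (Reg 2 \<otimes> PN 1)) MINUS1"

definition dense_size :: exp where
  "dense_size = RANK ((Reg 1 \<oplus> Lit 1) \<otimes> PN 1) \<ominus> RANK (Reg 1 \<otimes> PN 1)"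

definition dense_select :: exp where
  "dense_select = SEL (RANK (Reg 2 \<otimes> PN 1) \<oplus> (Reg 1 \<ominus> Lit 1)) \<ominus> Reg 2 \<otimes> PN 1"

text \<open>Parameter 2 is the number \<open>d\<close> of bits in a slot. It is stored as 0 for
  dense instances and is positive for sparse ones, and thus tells the programs which encoding they
  are facing.\<close>

definition QRANK :: exp where "QRANK = IfLess (PN 2) (Lit 1) dense_rank sparse_rank"
definition QSIZE :: exp where "QSIZE = IfLess (PN 2) (Lit 1) dense_size sparse_size"
definition QSELECT :: exp where "QSELECT = IfLess (PN 2) (Lit 1) dense_select sparse_select"

definition answers_rank :: "nat => (nat => nat) => (nat => nat) => nat set list => nat => bool" where
  "answers_rank w M R S m \<longleftrightarrow> (R 1 < m \<longrightarrow> R 2 < length S \<longrightarrow>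
     int (ev w M R QRANK) = set_rank (R 1) (S ! R 2) mod 2 ^ w)"

definition answers_select :: "nat => (nat => nat) => (nat => nat) => nat set list => bool" where
  "answers_select w M R S \<longleftrightarrow> (R 2 < length S \<longrightarrow> R 1 \<in> {1..card (S ! R 2)} \<longrightarrow>
     ev w M R QSELECT = set_select (R 1) (S ! R 2))"

definition answers_size :: "nat => (nat => nat) => (nat => nat) => nat set list => bool" where
  "answers_size w M R S \<longleftrightarrow> (R 1 < length S \<longrightarrow> ev w M R QSIZE = card (S ! R 1))"

lemma minus_one_mod: "int (2 ^ w - 1) = (- 1) mod 2 ^ w"
  by (simp add: zmod_minus1 of_nat_diff)

lemma int_mod_exp: "a < 2 ^ w ==> int a mod 2 ^ w = int a"
  by (metis mod_less of_nat_mod of_nat_numeral of_nat_power)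

lemma (in fid) dense_answers:
  assumes sl: "set_list m m SS" and X: "X = merged m SS" and U: "U = length SS * m"
    and p: "ps ! 1 = m" "ps ! 2 = 0"
  shows "answers_rank w M R SS m" "answers_select w M R SS" "answers_size w M R SS"
proof -
  interpret set_list m m SS by (rule sl)
  have P1: "E (PN 1) = m" and P2: "E (PN 2) = 0" using PN p by simp_all
  have L1: "E (Lit 1) = 1" using E_lit[of 1] by simp
  have mul: "i * m + x \<le> U" if "i < length SS" "x \<le> m" for i x
  proof -
    have "(i + 1) * m \<le> U" unfolding U using that by (intro mult_le_mono1) simp
    then show ?thesis using that by simp
  qed
  have eim: "E (ie \<otimes> PN 1) = i * m" if "E ie = i" "i \<le> length SS" for ie i
  proof -
    have "i * m \<le> U" unfolding U using that by (intro mult_le_mono1) simp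
    then show ?thesis using that P1 Uw by (intro ev_mul) auto
  qed
  show "answers_rank w M R SS m"
    unfolding answers_rank_def
  proof (intro impI)
    assume x: "R 1 < m" and i: "R 2 < length SS"
    define k where "k = R 2 * m + R 1"
    have kU: "k + 1 \<le> U" unfolding k_def using mul[OF i, of "R 1 + 1"] x by simp
    have im: "E (Reg 2 \<otimes> PN 1) = R 2 * m" using i by (intro eim) auto
    have ek: "E (Reg 2 \<otimes> PN 1 \<oplus> Reg 1) = k"
      unfolding k_def using kU Uw k_def by (intro ev_add im) auto
    have ek1: "E (Reg 2 \<otimes> PN 1 \<oplus> Reg 1 \<oplus> Lit 1) = k + 1" using kU Uw by (intro ev_add ek L1) auto
    have r: "E (RANK (Reg 2 \<otimes> PN 1 \<oplus> Reg 1)) = cnt X k" "E (RANK (Reg 2 \<otimes> PN 1 \<oplus> Reg 1 \<oplus> Lit 1)) = cnt X (k + 1)"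
      "E (RANK (Reg 2 \<otimes> PN 1)) = cnt X (R 2 * m)"
      using E_RANK[OF ek] E_RANK[OF ek1] E_RANK[OF im] kU by (auto simp: k_def)
    have mono: "cnt X (R 2 * m) \<le> cnt X k" by (intro cnt_mono finX) (simp add: k_def)
    have s: "E (RANK (Reg 2 \<otimes> PN 1 \<oplus> Reg 1) \<ominus> RANK (Reg 2 \<otimes> PN 1)) = cnt X k - cnt X (R 2 * m)"
      using cnt_U[of k] Uw by (intro ev_sub mono r) auto
    have "E MINUS1 = 2 ^ w - 1" unfolding MINUS1_def using w16 by (simp add: take_bit_nat_eq_self)
    then have e: "E QRANK = (if k \<in> X then cnt X k - cnt X (R 2 * m) else 2 ^ w - 1)"
      unfolding QRANK_def dense_rank_def using P2 L1 r s cnt_Suc[OF finX, of k] by simp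
    have lt: "cnt X k - cnt X (R 2 * m) < 2 ^ w" using cnt_U[of k] Uw by linarith
    show "int (E QRANK) = set_rank (R 1) (SS ! R 2) mod 2 ^ w"
      unfolding set_rank_eq[OF i x] e X[symmetric] k_def[symmetric]
      using int_mod_exp[OF lt] minus_one_mod[of w] by (cases "k \<in> X") (simp_all only: if_True if_False)
  qed
  show "answers_select w M R SS"
    unfolding answers_select_def
  proof (intro impI)
    assume i: "R 2 < length SS" and j: "R 1 \<in> {1..card (SS ! R 2)}"
    define r where "r = R 1 - 1"
    have r: "r < card (SS ! R 2)" using j by (auto simp: r_def)
    note sm = sel_merged[OF i r, folded X]
    have jm: "R 1 < 2 ^ w"
    proof -
      have "card (SS ! R 2) \<le> card X" using card_merged_step[OF i] cnt_le_card[OF finite_merged]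
        unfolding X by (metis le_add2 le_trans)
      also have "card X \<le> U" using cnt_bounded[OF XU order_refl] cnt_U[of U] by simp
      finally show ?thesis using j Uw by auto
    qed
    have im: "E (Reg 2 \<otimes> PN 1) = R 2 * m" using i by (intro eim) auto
    have er: "E (Reg 1 \<ominus> Lit 1) = r" unfolding r_def using j jm by (intro ev_sub L1) auto
    have imU: "R 2 * m \<le> U" using mul[OF i, of 0] by simp
    have cX: "card X \<le> U" using cnt_bounded[OF XU order_refl] cnt_U[of U] by simp
    have a: "E (RANK (Reg 2 \<otimes> PN 1) \<oplus> (Reg 1 \<ominus> Lit 1)) = cnt X (R 2 * m) + r"
      using sm(2) cX Uw by (intro ev_add er E_RANK im imU) auto
    have sU: "sel X (cnt X (R 2 * m) + r) < U" using sel_in[OF finX sm(2)] XU by auto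
    have "E QSELECT = sel X (cnt X (R 2 * m) + r) - R 2 * m"
      unfolding QSELECT_def dense_select_def
      using P2 L1 ev_sub[OF _ _ E_SEL[OF a sm(2)] im] sm(1) sU Uw by simp
    then show "E QSELECT = set_select (R 1) (SS ! R 2)"
      using sm(1) by (simp add: set_select_eq r_def)
  qed
  show "answers_size w M R SS"
    unfolding answers_size_def
  proof (intro impI)
    assume i: "R 1 < length SS"
    have i1: "E (Reg 1 \<oplus> Lit 1) = R 1 + 1"
    proof (rule ev_add[OF _ _ L1])
      have "R 1 + 1 \<le> length SS" using i by simp
      also have "... \<le> U" unfolding U using m0 by simp
      finally show "R 1 + 1 < 2 ^ w" using Uw by (rule le_less_trans)
    qed simp
    have a: "E ((Reg 1 \<oplus> Lit 1) \<otimes> PN 1) = (R 1 + 1) * m" using i by (intro eim i1) simp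
    have b: "E (Reg 1 \<otimes> PN 1) = R 1 * m" using i by (intro eim) auto
    have le: "(R 1 + 1) * m \<le> U" "R 1 * m \<le> U" unfolding U using i by (intro mult_le_mono1; simp)+
    have "E QSIZE = cnt X ((R 1 + 1) * m) - cnt X (R 1 * m)"
      unfolding QSIZE_def dense_size_def
      using P2 L1 ev_sub[OF _ _ E_RANK[OF a le(1)] E_RANK[OF b le(2)]] card_merged_step[OF i]
        cnt_U[of "(R 1 + 1) * m"] Uw by (simp add: X)
    then show "E QSIZE = card (SS ! R 1)" using card_merged_step[OF i] by (simp add: X)
  qed
qed

lemma (in sparse) sparse_answers:
  assumes sl: "set_list m (m1 * 2 ^ d) SS" and K: "K = sel (merged (m1 * 2 ^ d) SS)"
    and n: "n = card (merged (m1 * 2 ^ d) SS)" and H: "length SS * m1 \<le> Hp"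
    and mw: "m < 2 ^ w" and d0: "0 < d"
  shows "answers_rank w M R SS m" "answers_select w M R SS" "answers_size w M R SS"
proof -
  let ?B = "m1 * 2 ^ d"
  interpret s: set_list m ?B SS by (rule sl)
  let ?Y = "merged ?B SS"
  have fY: "finite ?Y" by (rule s.finite_merged)
  have P2: "\<not> E (PN 2) < E (Lit 1)" using PN2 E2 d0 by simp
  have Kim: "K ` {..<n} = ?Y"
  proof
    show "K ` {..<n} \<subseteq> ?Y" unfolding K n using sel_in[OF fY] by auto
    show "?Y \<subseteq> K ` {..<n}"
    proof
      fix y assume "y \<in> ?Y"
      then obtain i where "i < card ?Y" "sel ?Y i = y" using sel_surj[OF fY] by blast
      then show "y \<in> K ` {..<n}" unfolding K n by auto
    qed
  qed
  have lo: "lo d (h * 2 ^ d) = cnt ?Y (h * 2 ^ d)" for h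
  proof -
    have "{x \<in> ?Y. x < h * 2 ^ d} = K ` {j. j < n \<and> K j div 2 ^ d < h * 2 ^ d div 2 ^ d}"
      unfolding Kim[symmetric] by (auto simp: div_less_iff_less_mult)
    moreover have "inj_on K {j. j < n \<and> K j div 2 ^ d < h * 2 ^ d div 2 ^ d}"
      by (rule linorder_inj_onI) (use keys_axioms[unfolded keys_def] in \<open>auto, metis less_irrefl\<close>)
    ultimately show ?thesis by (simp add: lo_def cnt_def card_image)
  qed
  have im: "E (ie \<otimes> PN 1) = i * m1" "i * m1 \<le> Hp" if "E ie = i" "i \<le> length SS" for ie i
  proof -
    show le: "i * m1 \<le> Hp" using that H mult_le_mono1[of i "length SS" m1] by linarith
    then have "i * m1 < 2 ^ w" using org_le[of 0] Uw by linarith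
    then show "E (ie \<otimes> PN 1) = i * m1" using that PN2 by (intro ev_mul) auto
  qed
  have st: "E (eST ie) = cnt ?Y (i * ?B)" if "E ie = i" "i \<le> length SS" for ie i
    using E_STA[OF im[OF that]] lo[of "i * m1"] by (simp add: mult.assoc)
  show "answers_size w M R SS"
    unfolding answers_size_def
  proof (intro impI)
    assume i: "R 1 < length SS"
    have m1: "0 < m1" using s.mB s.m0 by (cases m1) auto
    have i1: "E (Reg 1 \<oplus> Lit 1) = R 1 + 1"
    proof (rule ev_add[OF _ _ E2(2)])
      have "R 1 + 1 \<le> length SS" using i by simp
      also have "... \<le> length SS * m1" using m1 by simp
      also have "... \<le> U" using H org_le[of 0] by simp
      finally show "R 1 + 1 < 2 ^ w" using Uw by (rule le_less_trans)
    qed simp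
    have a: "E (eST (Reg 1 \<oplus> Lit 1)) = cnt ?Y ((R 1 + 1) * ?B)" using i by (intro st i1) simp
    have b: "E (eST (Reg 1)) = cnt ?Y (R 1 * ?B)" using i by (intro st) auto
    have c: "cnt ?Y ((R 1 + 1) * ?B) < 2 ^ w" using cnt_le_card[OF fY] n nw le_less_trans by blast
    have "E QSIZE = cnt ?Y ((R 1 + 1) * ?B) - cnt ?Y (R 1 * ?B)"
      unfolding QSIZE_def sparse_size_def using P2 ev_sub[OF _ c a b] s.card_merged_step[OF i] by simp
    then show "E QSIZE = card (SS ! R 1)" using s.card_merged_step[OF i] by simp
  qed
  show "answers_rank w M R SS m"
    unfolding answers_rank_def
  proof (intro impI)
    assume x: "R 1 < m" and i: "R 2 < length SS"
    define k where "k = R 2 * ?B + R 1"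
    have "(2::nat) ^ d < 2 ^ w" using dw by simp
    then have p: "E (Lit 1 \<lless> PN 2) = 1 * 2 ^ d" using PN2 E2 by (intro ev_shl) auto
    have kk: "k = R 2 * m1 * 2 ^ d + R 1" by (simp add: k_def mult.assoc)
    have kd: "k div 2 ^ d = R 2 * m1 + R 1 div 2 ^ d" "k mod 2 ^ d = R 1 mod 2 ^ d" unfolding kk by simp_all
    have y: "E (Reg 1 \<odot> (Lit 1 \<lless> PN 2)) = k mod 2 ^ d" using p kd by simp
    have "R 1 div 2 ^ d < m1" using x s.mB by (simp add: div_less_iff_less_mult)
    then have "R 2 * m1 + R 1 div 2 ^ d < (R 2 + 1) * m1" by simp
    also have "... \<le> length SS * m1" using i by (intro mult_le_mono1) simp
    finally have kH: "k div 2 ^ d < Hp" using H kd by simp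
    then have kw: "R 2 * m1 + R 1 div 2 ^ d < 2 ^ w" using org_le[of 0] Uw kd by linarith
    have h: "E (Reg 2 \<otimes> PN 1 \<oplus> (Reg 1 \<ggreater> PN 2)) = k div 2 ^ d"
      unfolding kd(1) using kw i by (intro ev_add ev_shr im(1) PN2) auto
    note Z = E_stR[OF h kH y, of NF]
    have s: "E (eST (Reg 2)) = cnt ?Y (R 2 * ?B)" using i by (intro st) auto
    have sl: "cnt ?Y (R 2 * ?B) \<le> LO NF k"
    proof -
      have "cnt ?Y (R 2 * ?B) = lo d (R 2 * m1 * 2 ^ d)" using lo[of "R 2 * m1"] by (simp only: mult.assoc)
      also have "... \<le> lo d k"
        unfolding lo_def by (intro card_mono) (use kd in auto)
      also have "... \<le> LO NF k" by (rule lo_refine[OF rem_le])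
      finally show ?thesis .
    qed
    note fr = E_fin_rank[OF Z y s sl]
    have QE: "E QRANK = E (fin_rank (Reg 1 \<odot> (Lit 1 \<lless> PN 2)) (eST (Reg 2))
       (stR NF (Reg 2 \<otimes> PN 1 \<oplus> (Reg 1 \<ggreater> PN 2)) (Reg 1 \<odot> (Lit 1 \<lless> PN 2))))"
      unfolding QRANK_def sparse_rank_def using P2 by simp
    show "int (E QRANK) = set_rank (R 1) (SS ! R 2) mod 2 ^ w"
    proof (cases "k \<in> ?Y")
      case True
      have c: "cnt ?Y k < n" using cnt_less_card[OF fY True] n by simp
      have "K (cnt ?Y k) = k" unfolding K using sel_cnt[OF fY True] .
      then have e: "E QRANK = cnt ?Y k - cnt ?Y (R 2 * ?B)" unfolding QE using fr(1)[OF _ c] by simp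
      have "cnt ?Y k - cnt ?Y (R 2 * ?B) < 2 ^ w" using c nw by linarith
      then show ?thesis unfolding s.set_rank_eq[OF i x] e k_def[symmetric] using True int_mod_exp
        by (simp only: if_True)
    next
      case False
      then have "E QRANK = 2 ^ w - 1" unfolding QE using fr(2) Kim by simp
      then show ?thesis unfolding s.set_rank_eq[OF i x] k_def[symmetric]
        using False minus_one_mod[of w] by (simp only: if_False)
    qed
  qed
  show "answers_select w M R SS"
    unfolding answers_select_def
  proof (intro impI)
    assume i: "R 2 < length SS" and j: "R 1 \<in> {1..card (SS ! R 2)}"
    define r where "r = R 1 - 1"
    have r: "r < card (SS ! R 2)" using j by (auto simp: r_def)
    note sm = s.sel_merged[OF i r]
    define p where "p = cnt ?Y (R 2 * ?B) + r"
    have pn: "p < n" using sm(2) n by (simp add: p_def)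
    have "R 1 \<le> p + 1" by (simp add: p_def r_def)
    then have jw: "R 1 < 2 ^ w" using pn nG nw by linarith
    have er: "E (Reg 1 \<ominus> Lit 1) = r" unfolding r_def using j jw by (intro ev_sub E2) auto
    have ep: "E (eST (Reg 2) \<oplus> (Reg 1 \<ominus> Lit 1)) = p"
      unfolding p_def using pn nw i p_def by (intro ev_add er st) auto
    have Kp: "K p = R 2 * m1 * 2 ^ d + sel (SS ! R 2) r"
      unfolding K p_def using sm(1) by (simp add: mult.assoc)
    have "E (fin_select (eST (Reg 2) \<oplus> (Reg 1 \<ominus> Lit 1)) (Reg 2) (stS NF (eST (Reg 2) \<oplus> (Reg 1 \<ominus> Lit 1))))
        = K p - R 2 * m1 * 2 ^ d"
    proof (rule E_fin_select[OF ep pn])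
      show "E (Reg 2) = R 2" by simp
      show "R 2 * m1 \<le> K p div 2 ^ d" unfolding Kp by simp
      show "K p - R 2 * m1 * 2 ^ d < 2 ^ w" unfolding Kp using s.sel_less_m[OF i r] mw by simp
    qed
    then show "E QSELECT = set_select (R 1) (SS ! R 2)"
      unfolding QSELECT_def sparse_select_def using P2 Kp by (simp add: s.set_select_eq r_def)
  qed
qed

section \<open>Registers read by the query expressions\<close>

lemma regs_below_RD: "regs_below r b ==> regs_below r p ==> regs_below r l ==> 0 < r ==> regs_below r (RD b p l)"
  by (simp add: RD_def rd_idx_def rd_shift_def low_mask_def)

lemma regs_below_PAR [simp]: "0 < r ==> regs_below r (PAR j)"
  by (simp add: PAR_def HQ_def HQ2_def HV_def regs_below_RD)

lemma regs_below_PN [simp]: "0 < r ==> regs_below r (PN j)"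
  by (simp add: PN_def)

lemma regs_below_ARR [simp]: "0 < r ==> regs_below r e ==> regs_below r (ARR k e)"
  by (simp add: ARR_def RDK_def HE_def HQ_def HQ2_def HV_def regs_below_RD)

lemma regs_below_RDK [simp]: "0 < r ==> regs_below r p ==> regs_below r l ==> regs_below r (RDK k p l)"
  by (simp add: RDK_def HE_def HQ_def HQ2_def HV_def regs_below_RD)

lemma regs_below_fid [simp]:
  "0 < r ==> regs_below r e ==> regs_below r (RANK e)"
  "0 < r ==> regs_below r e ==> regs_below r (SEL e)"
  by (simp_all add: RANK_def SEL_def eRk_def ePt_def eCI_def eBK_def eSB_def MF_def)

lemma regs_below_regions [simp]:
  "0 < r ==> regs_below r e ==> regs_below r (RKr k e)"
  "0 < r ==> regs_below r e ==> regs_below r (SLr k e)"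
  "0 < r ==> regs_below r e ==> regs_below r (LGk e)"
  by (simp_all add: RKr_def SLr_def ORG_def LGk_def MF_def)

lemma regs_below_stR:
  "0 < r ==> regs_below r h ==> regs_below r y ==>
    (case stR l h y of (P, B, D) => regs_below r P \<and> regs_below r B \<and> regs_below r D)"
proof (induction l)
  case (Suc l)
  then show ?case
    by (cases "stR l h y") (simp add: stp_def qR_def nxD_def eMin_def)
qed (simp add: STA_def)

lemma regs_below_stS:
  "0 < r ==> regs_below r j ==>
    (case stS l j of ((P, B, D), Y) => regs_below r P \<and> regs_below r B \<and> regs_below r D \<and> regs_below r Y)"
proof (induction l)
  case (Suc l)
  obtain P B D Y where "stS l j = ((P, B, D), Y)" by (metis prod.exhaust)
  then show ?case using Suc by (simp add: stp_def qS_def nxD_def eMin_def)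
qed (simp add: STA_def hS_def)

lemma regs_below_queries: "regs_below 3 QRANK" "regs_below 3 QSIZE" "regs_below 3 QSELECT"
proof -
  show "regs_below 3 QRANK"
    using regs_below_stR[of 3 "Reg 2 \<otimes> PN 1 \<oplus> (Reg 1 \<ggreater> PN 2)" "Reg 1 \<odot> (Lit 1 \<lless> PN 2)" NF]
    by (auto simp: QRANK_def dense_rank_def sparse_rank_def fin_rank_def MINUS1_def CND_def FKS_def FCND_def
        FSLT_def FCEL_def FKEY_def MSH_def FLD_def SLOT_def STA_def split: prod.splits)
  show "regs_below 3 QSIZE" by (simp add: QSIZE_def dense_size_def sparse_size_def STA_def)
  show "regs_below 3 QSELECT"
    using regs_below_stS[of 3 "eST (Reg 2) \<oplus> (Reg 1 \<ominus> Lit 1)" NF]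
    by (auto simp: QSELECT_def dense_select_def sparse_select_def fin_select_def SLOT_def STA_def hS_def
        split: prod.splits)
qed

subsection \<open>Small instances\<close>

lemma ev_one: "0 < w ==> ev w M R (Lit 1) = 1"
  by (intro ev_lit one_less_power) auto

text \<open>A case distinction by comparisons that turns the value of a register, capped at
  \<open>v + c\<close>, into an argument known when the program is built; \<open>tree\<close> does
  the same for a list of bits. Together they form programs that contain a table of all
  answers.\<close>

primrec chain :: "nat => nat => nat => (nat => exp) => exp" where
  "chain r 0 v G = G v"
| "chain r (Suc c) v G = IfLess (Lit v) (Reg r) (chain r c (v + 1) G) (G v)"

lemma ev_chain:
  "v \<le> R r ==> R r < 2 ^ w ==> ev w M R (chain r c v G) = ev w M R (G (min (R r) (v + c)))"
proof (induction c arbitrary: v)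
  case (Suc c)
  have v: "ev w M R (Lit v) = v" using Suc.prems by (intro ev_lit) simp
  show ?case
  proof (cases "v < R r")
    case True
    then have "ev w M R (chain r c (v + 1) G) = ev w M R (G (min (R r) (v + 1 + c)))"
      using Suc.prems by (intro Suc.IH) auto
    then show ?thesis using v True by simp
  next
    case False
    then have "min (R r) (v + Suc c) = v" using Suc.prems by simp
    then show ?thesis using v False by simp
  qed
qed (simp add: min_def)

lemma regs_below_chain: "r < k ==> (\<And>v. regs_below k (G v)) ==> regs_below k (chain r c v G)"
  by (induction c arbitrary: v) auto

primrec tree :: "exp list => (bool list => exp) => exp" where
  "tree [] F = F []"
| "tree (e # es) F = IfLess e (Lit 1) (tree es (\<lambda>bs. F (False # bs))) (tree es (\<lambda>bs. F (True # bs)))"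

lemma ev_tree: "0 < w ==> ev w M R (tree es F) = ev w M R (F (map (\<lambda>e. 1 \<le> ev w M R e) es))"
proof (induction es arbitrary: F)
  case (Cons e es)
  have "ev w M R (Lit 1) = 1" using Cons.prems by (rule ev_one)
  then show ?case using Cons by (auto simp: not_le)
qed simp

lemma regs_below_tree:
  "(\<And>e. e \<in> set es ==> regs_below k e) ==> (\<And>bs. regs_below k (F bs)) ==> regs_below k (tree es F)"
  by (induction es arbitrary: F) auto

text \<open>For a small word size \<open>v\<close> the position \<open>p\<close> of a bit need not
  fit into a word, since the addressable memory has \<open>v * 2 ^ v\<close> bits. Quotient and
  remainder are therefore computed when the program is built; \<open>bit_exp\<close> leaves this to
  the machine.\<close>

definition bit_const :: "nat => nat => exp" where
  "bit_const v p = Bin And (Ld (Lit (p div v)) \<ggreater> Lit (p mod v)) (Lit 1)"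

definition bit_exp :: "nat => exp" where
  "bit_exp p = Bin And (Ld (Lit p \<oslash> WS) \<ggreater> (Lit p \<odot> WS)) (Lit 1)"

lemma and_one_bit: "drop_bit k x AND 1 = of_bool (bit x k)" for x :: nat
  by (simp add: bit_iff_odd_drop_bit and_one_eq mod_2_eq_odd)

lemma ev_bit_const: "p < v * 2 ^ v ==> 0 < v ==>
    ev v M R (bit_const v p) = of_bool (bit (M (p div v)) (p mod v))"
proof -
  assume p: "p < v * 2 ^ v" and v: "0 < v"
  have "p div v < 2 ^ v" using p by (simp add: less_mult_imp_div_less mult.commute)
  moreover have "p mod v < 2 ^ v" using v mod_less_divisor[OF v, of p] less_exp[of v] by linarith
  ultimately have "ev v M R (Lit (p div v)) = p div v" "ev v M R (Lit (p mod v)) = p mod v"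
    by (blast intro: ev_lit)+
  moreover note ev_one[OF v, of M R]
  ultimately have "ev v M R (Lit (p div v)) = p div v" "ev v M R (Lit (p mod v)) = p mod v" "ev v M R (Lit 1) = 1"
    by blast+
  then show ?thesis unfolding bit_const_def using and_one_bit by simp
qed

lemma ev_bit_exp: "p < 2 ^ w ==> 0 < w ==> R 0 = w ==>
    ev w M R (bit_exp p) = of_bool (bit (M (p div w)) (p mod w))"
proof -
  assume p: "p < 2 ^ w" and w: "0 < w" and R: "R 0 = w"
  have "ev w M R (Lit p) = p" "ev w M R (Lit 1) = 1" using p w by (blast intro: ev_lit ev_one)+
  then show ?thesis unfolding bit_exp_def using and_one_bit R by simp
qed

text \<open>The unary prefix makes the string self-delimiting with respect to \<open>m\<close>,
  which the programs are not told.\<close>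

definition small_bits :: "nat => nat set list => bool list" where
  "small_bits m S = [False] @ replicate m True @ [False] @
     map (\<lambda>t. t mod m \<in> S ! (t div m)) [0..<length S * m]"

definition dec_m :: "bool list => nat" where
  "dec_m B = length (takeWhile id (drop 1 B))"

definition dec_set :: "bool list => nat => nat set" where
  "dec_set B i = {x. x < dec_m B \<and> B ! (dec_m B + 2 + (i * dec_m B + x))}"

lemma dec_small:
  assumes m: "0 < m" and sub: "\<And>i. i < length S ==> S ! i \<subseteq> {..<m}"
    and len: "length (small_bits m S) \<le> length B"
    and B: "\<And>p. p < length (small_bits m S) ==> B ! p = small_bits m S ! p"
    and i: "i < length S"
  shows "dec_set B i = S ! i"
proof -
  have "take (length (small_bits m S)) B = small_bits m S"
    using len B by (intro nth_equalityI) auto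
  then obtain C where C: "B = small_bits m S @ C" by (metis append_take_drop_id)
  have dm: "dec_m B = m"
    unfolding C dec_m_def small_bits_def by (simp add: takeWhile_append)
  have "(B ! (m + 2 + (i * m + x))) = (x \<in> S ! i)" if x: "x < m" for x
  proof -
    have "(i + 1) * m \<le> length S * m" using i by (intro mult_le_mono1) simp
    then have lt: "i * m + x < length S * m" using x by simp
    then have p: "m + 2 + (i * m + x) < length (small_bits m S)" by (simp add: small_bits_def)
    have "B ! (m + 2 + (i * m + x)) = small_bits m S ! (m + 2 + (i * m + x))" using B[OF p] .
    also have "... = ((i * m + x) mod m \<in> S ! ((i * m + x) div m))"
      using lt by (simp add: small_bits_def nth_append)
    finally show ?thesis using div_mod_add_less[OF x, of i] by simp
  qed
  then show ?thesis unfolding dec_set_def dm using sub[OF i] by auto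
qed

lemma length_small_bits: "length (small_bits m S) = m + 2 + length S * m"
  by (simp add: small_bits_def)

definition vexp :: "int => exp" where
  "vexp z = (if z < 0 then MINUS1 else Lit (nat z))"

lemma ev_vexp: "0 < w ==> z = - 1 \<or> 0 \<le> z \<and> z < 2 ^ w ==> int (ev w M R (vexp z)) = z mod 2 ^ w"
proof -
  assume w: "0 < w" and z: "z = - 1 \<or> 0 \<le> z \<and> z < 2 ^ w"
  show ?thesis
  proof (cases "z < 0")
    case True
    have "ev w M R MINUS1 = 2 ^ w - 1" unfolding MINUS1_def using w by (simp add: take_bit_nat_eq_self)
    then show ?thesis using True z minus_one_mod[of w] by (simp add: vexp_def)
  next
    case False
    then have "nat z < 2 ^ w" using z by (simp add: nat_less_iff)
    then have "ev w M R (Lit (nat z)) = nat z" by (rule ev_lit)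
    then show ?thesis using False z by (simp add: vexp_def)
  qed
qed

text \<open>A branch on the word size, capped at \<open>w1\<close>. With \<open>w = 1\<close> the
  addressable memory has two bits, too few for the string; but then \<open>m * s = 1\<close>, the
  only set is \<open>{0}\<close>, and each query has a constant answer \<open>c1\<close>. For the
  other sizes below \<open>w1\<close> the whole addressable memory is read. From \<open>w1\<close>
  on, the first bit of the string tells the two formats apart.\<close>

definition FULL :: "nat => (bool list => exp) => exp => exp => exp" where
  "FULL w1 F c1 Q = chain 0 (w1 - 1) 1 (\<lambda>v.
     if v = 1 then c1
     else if v < w1 then tree (map (bit_const v) [0..<v * 2 ^ v]) F
     else IfLess (bit_exp 0) (Lit 1) (tree (map bit_exp [0..<2 ^ w1]) F) Q)"

lemma FULL_small:
  assumes h: "holds_bits w bs M" and bs: "bs = small_bits m S" and R: "R 0 = w"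
    and w: "0 < w" and w1: "2 \<le> w1" and N: "length S * m < 2 ^ w" "length S * m < 2 ^ (w1 - 1)"
    and m: "0 < m" "0 < length S"
  shows "ev w M R (FULL w1 F c1 Q) = (if w = 1 then ev w M R c1
    else ev w M R (F (map (\<lambda>p. bit (M (p div w)) (p mod w)) [0..<if w < w1 then w * 2 ^ w else 2 ^ w1])))"
proof -
  let ?G = "\<lambda>v. if v = 1 then c1
     else if v < w1 then tree (map (bit_const v) [0..<v * 2 ^ v]) F
     else IfLess (bit_exp 0) (Lit 1) (tree (map bit_exp [0..<2 ^ w1]) F) Q"
  have e: "ev w M R (FULL w1 F c1 Q) = ev w M R (?G (min w w1))"
    unfolding FULL_def using ev_chain[of 1 R 0 w M "w1 - 1" ?G] R w w1 by simp
  show ?thesis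
  proof (cases "w < w1")
    case True
    show ?thesis
    proof (cases "w = 1")
      case False
      have "ev w M R (tree (map (bit_const w) [0..<w * 2 ^ w]) F) =
          ev w M R (F (map (\<lambda>p. bit (M (p div w)) (p mod w)) [0..<w * 2 ^ w]))"
        unfolding ev_tree[OF w] map_map comp_def
        by (rule arg_cong[of _ _ "\<lambda>B. ev w M R (F B)"], rule map_cong)
          (auto simp: ev_bit_const[OF _ w])
      then show ?thesis unfolding e using True False by simp
    qed (use e True in simp)
  next
    case False
    have w1': "(2::nat) ^ w1 \<le> 2 ^ w" using False by (intro power_increasing) auto
    have "bs ! 0 = False" "0 < length bs" unfolding bs by (auto simp: small_bits_def)
    then have "\<not> bit (M 0) 0" using h w by (auto simp: holds_bits_def)
    then have b0: "ev w M R (bit_exp 0) = 0" using ev_bit_exp[of 0 w R M] w R by simp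
    have l1: "ev w M R (Lit 1) = 1" by (rule ev_one[OF w])
    have be: "ev w M R (bit_exp p) = of_bool (bit (M (p div w)) (p mod w))" if "p < 2 ^ w1" for p
      using less_le_trans[OF that w1'] by (intro ev_bit_exp w R)
    have "ev w M R (tree (map bit_exp [0..<2 ^ w1]) F) =
        ev w M R (F (map (\<lambda>p. bit (M (p div w)) (p mod w)) [0..<2 ^ w1]))"
      unfolding ev_tree[OF w] map_map comp_def
      by (rule arg_cong[of _ _ "\<lambda>B. ev w M R (F B)"], rule map_cong)
        (auto simp: be)
    then show ?thesis unfolding e using False w1 b0 l1 by simp
  qed
qed

lemma FULL_large:
  assumes h: "holds_bits w bs M" and bs: "bs ! 0" "bs \<noteq> []" and R: "R 0 = w" and w1: "2 \<le> w1" "w1 \<le> w"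
  shows "ev w M R (FULL w1 F c1 Q) = ev w M R Q"
proof -
  have w: "0 < w" using w1 by simp
  have "bit (M 0) 0" using h bs w by (auto simp: holds_bits_def dest!: spec[of _ 0])
  then have b0: "ev w M R (bit_exp 0) = 1" using ev_bit_exp[of 0 w R M] w R by simp
  have l1: "ev w M R (Lit 1) = 1" by (rule ev_one[OF w])
  show ?thesis unfolding FULL_def using ev_chain[of 1 R 0 w M "w1 - 1"] R w w1 b0 l1 by simp
qed

lemma regs_below_FULL:
  "(\<And>B. regs_below 3 (F B)) ==> regs_below 3 c1 ==> regs_below 3 Q ==> regs_below 3 (FULL w1 F c1 Q)"
  unfolding FULL_def
  by (intro regs_below_chain) (auto intro!: regs_below_tree simp: bit_const_def bit_exp_def)

lemma small_decode:
  assumes h: "holds_bits w (small_bits m S) M" and w: "1 < w" and w1: "2 \<le> w1"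
    and N: "length S * m < 2 ^ w" "length S * m < 2 ^ (w1 - 1)" and m: "0 < m"
    and sub: "\<And>i. i < length S ==> S ! i \<subseteq> {..<m}" and i: "i < length S"
  shows "dec_set (map (\<lambda>p. bit (M (p div w)) (p mod w)) [0..<if w < w1 then w * 2 ^ w else 2 ^ w1]) i = S ! i"
proof (rule dec_small[OF m sub _ _ i])
  let ?l = "if w < w1 then w * 2 ^ w else 2 ^ w1"
  have "1 * m \<le> length S * m" using i by (intro mult_le_mono1) simp
  then have len: "length (small_bits m S) \<le> 2 * (length S * m) + 2" by (simp add: length_small_bits)
  show l: "length (small_bits m S) \<le> length (map (\<lambda>p. bit (M (p div w)) (p mod w)) [0..<?l])"
  proof (cases "w < w1")
    case True
    \<comment> \<open>From word size 2 on, the \<open>w * 2 ^ w\<close> addressable bits comprise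
      the whole string.\<close>
    have "2 * 2 ^ w \<le> w * 2 ^ w" using w by (intro mult_le_mono1) simp
    then have "length (small_bits m S) \<le> w * 2 ^ w" using len N(1) by linarith
    then show ?thesis using True by simp
  next
    case False
    have "(2::nat) ^ w1 = 2 * 2 ^ (w1 - 1)" using w1 by (cases w1) auto
    then show ?thesis using len N False by simp
  qed
  fix p assume p: "p < length (small_bits m S)"
  then show "map (\<lambda>p. bit (M (p div w)) (p mod w)) [0..<?l] ! p = small_bits m S ! p"
    using h l by (simp add: holds_bits_def split del: if_split)
qed

definition F_rank :: "nat => bool list => exp" where
  "F_rank w1 B = chain 1 (2 ^ w1) 0 (\<lambda>x. chain 2 (2 ^ w1) 0 (\<lambda>i. vexp (set_rank x (dec_set B i))))"

definition F_select :: "nat => bool list => exp" where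
  "F_select w1 B = chain 1 (2 ^ w1) 0 (\<lambda>x. chain 2 (2 ^ w1) 0 (\<lambda>i. vexp (int (set_select x (dec_set B i)))))"

definition F_size :: "nat => bool list => exp" where
  "F_size w1 B = chain 1 (2 ^ w1) 0 (\<lambda>i. vexp (int (card (dec_set B i))))"

definition P_RANK :: "nat => exp" where "P_RANK w1 = FULL w1 (F_rank w1) (Lit 0) QRANK"
definition P_SELECT :: "nat => exp" where "P_SELECT w1 = FULL w1 (F_select w1) (Lit 0) QSELECT"
definition P_SIZE :: "nat => exp" where "P_SIZE w1 = FULL w1 (F_size w1) (Lit 1) QSIZE"

lemma regs_below_P: "regs_below 3 (P_RANK w1)" "regs_below 3 (P_SELECT w1)" "regs_below 3 (P_SIZE w1)"
  unfolding P_RANK_def P_SELECT_def P_SIZE_def F_rank_def F_select_def F_size_def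
  by (intro regs_below_FULL regs_below_chain regs_below_queries; simp add: vexp_def MINUS1_def)+

lemma small_answers:
  assumes w1: "2 \<le> w1" and w: "length S * m < 2 ^ w" "0 < w" and N: "length S * m < 2 ^ (w1 - 1)"
    and m: "0 < m" and sub: "\<And>i. i < length S ==> S ! i \<subseteq> {..<m}"
    and ne: "0 < (\<Sum>i<length S. card (S ! i))"
    and t: "length (query_program (P_RANK w1)) \<le> t" "length (query_program (P_SELECT w1)) \<le> t"
      "length (query_program (P_SIZE w1)) \<le> t"
  shows "x < m ==> i < length S ==>
      answers w t (query_program (P_RANK w1)) (small_bits m S) [x, i] (set_rank x (S ! i))"
    "i < length S ==> j \<in> {1..card (S ! i)} ==>
      answers w t (query_program (P_SELECT w1)) (small_bits m S) [j, i] (int (set_select j (S ! i)))"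
    "i < length S ==> answers w t (query_program (P_SIZE w1)) (small_bits m S) [i] (int (card (S ! i)))"
proof -
  have sl: "set_list m m S" using sub m by unfold_locales auto
  interpret set_list m m S by (rule sl)
  have iN: "i * 1 \<le> length S * m" if "i < length S" for i using that m by (intro mult_mono) auto
  have xN: "1 * m \<le> length S * m" if "i < length S" for i using that by (intro mult_le_mono1) simp
  have N1: "(2::nat) ^ (w1 - 1) \<le> 2 ^ w1" by (intro power_increasing) auto
  have cm: "card (S ! i) \<le> m" if "i < length S" for i
    using card_mono[OF _ sub[OF that]] by simp
  have one: "m = 1" "length S = 1" "S ! 0 = {0}" if "w = 1"
  proof -
    have lS: "0 < length S" using ne by (cases S) auto
    have lm: "length S * m < 2" using w that by simp
    have "0 < length S * m" using m lS by simp
    then have "length S * m = 1" using lm by linarith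
    then show m1: "m = 1" and l1: "length S = 1" by simp_all
    have "S ! 0 \<subseteq> {0}" using sub[of 0] l1 m1 by auto
    moreover have "card (S ! 0) \<noteq> 0" using ne l1 by simp
    ultimately show "S ! 0 = {0}" by (metis card.empty subset_singleton_iff)
  qed
  {
    assume x: "x < m" and i: "i < length S"
    show "answers w t (query_program (P_RANK w1)) (small_bits m S) [x, i] (set_rank x (S ! i))"
    proof (rule answers_query_program[OF regs_below_P(1) t(1)])
      fix M assume h: "holds_bits w (small_bits m S) M"
      let ?R = "query_regs w [x, i]"
      have R: "?R 0 = w" "?R 1 = x" "?R 2 = i" by (auto simp: query_regs_def numeral_2_eq_2)
      let ?B = "map (\<lambda>p. bit (M (p div w)) (p mod w)) [0..<if w < w1 then w * 2 ^ w else 2 ^ w1]"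
      have e: "ev w M ?R (P_RANK w1) = (if w = 1 then ev w M ?R (Lit 0) else ev w M ?R (F_rank w1 ?B))"
        unfolding P_RANK_def using i by (intro FULL_small[where R = ?R and bs = "small_bits m S" and S = S and m = m, OF h refl R(1) w(2) w1 w(1) N m]) auto
      show "int (ev w M ?R (P_RANK w1)) = set_rank x (S ! i) mod 2 ^ w"
      proof (cases "w = 1")
        case True
        then show ?thesis using one[OF True] e x i by (simp add: set_rank_def)
      next
        case False
        have D: "dec_set ?B i = S ! i" using False w by (intro small_decode[OF h _ w1 w(1) N m sub i]) auto
        have xw: "x < 2 ^ w" "i < 2 ^ w" "x \<le> 2 ^ w1" "i \<le> 2 ^ w1"
          using x iN[OF i] xN[OF i] w N N1 by linarith+
        have "ev w M ?R (F_rank w1 ?B) = ev w M ?R (vexp (set_rank x (S ! i)))"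
          unfolding F_rank_def using xw R D by (simp add: ev_chain min_def del: map_map)
        moreover have "set_rank x (S ! i) = - 1 \<or> 0 \<le> set_rank x (S ! i) \<and> set_rank x (S ! i) < 2 ^ w"
        proof -
          have "card {y \<in> S ! i. y < x} \<le> x" using cnt_le[of "S ! i" x] by (simp add: cnt_def)
          then have "card {y \<in> S ! i. y < x} < 2 ^ w" using xw by linarith
          then show ?thesis by (simp add: set_rank_def flip: of_nat_power)
        qed
        ultimately show ?thesis using e False ev_vexp[OF w(2)] by simp
      qed
    qed
  }
  {
    assume i: "i < length S" and j: "j \<in> {1..card (S ! i)}"
    show "answers w t (query_program (P_SELECT w1)) (small_bits m S) [j, i] (int (set_select j (S ! i)))"
    proof (rule answers_query_program[OF regs_below_P(2) t(2)])
      fix M assume h: "holds_bits w (small_bits m S) M"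
      let ?R = "query_regs w [j, i]"
      have R: "?R 0 = w" "?R 1 = j" "?R 2 = i" by (auto simp: query_regs_def numeral_2_eq_2)
      let ?B = "map (\<lambda>p. bit (M (p div w)) (p mod w)) [0..<if w < w1 then w * 2 ^ w else 2 ^ w1]"
      have e: "ev w M ?R (P_SELECT w1) = (if w = 1 then ev w M ?R (Lit 0) else ev w M ?R (F_select w1 ?B))"
        unfolding P_SELECT_def using i by (intro FULL_small[where R = ?R and bs = "small_bits m S" and S = S and m = m, OF h refl R(1) w(2) w1 w(1) N m]) auto
      have sm: "set_select j (S ! i) < m"
        unfolding set_select_eq using j by (intro sel_less_m[OF i]) auto
      have sw: "set_select j (S ! i) < 2 ^ w" using sm xN[OF i] w by linarith
      show "int (ev w M ?R (P_SELECT w1)) = int (set_select j (S ! i)) mod 2 ^ w"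
      proof (cases "w = 1")
        case True
        then show ?thesis using one[OF True] e sm by simp
      next
        case False
        have D: "dec_set ?B i = S ! i" using False w by (intro small_decode[OF h _ w1 w(1) N m sub i]) auto
        have jm: "j \<le> m" using j cm[OF i] by auto
        have xw: "j < 2 ^ w" "i < 2 ^ w" "j \<le> 2 ^ w1" "i \<le> 2 ^ w1"
          using jm iN[OF i] xN[OF i] w N N1 by linarith+
        have "ev w M ?R (F_select w1 ?B) = ev w M ?R (vexp (int (set_select j (S ! i))))"
          unfolding F_select_def using xw R D by (simp add: ev_chain min_def del: map_map)
        then show ?thesis using e False ev_vexp[OF w(2), of "int (set_select j (S ! i))"] sw
          by (simp add: of_nat_less_iff flip: of_nat_power)
      qed
    qed
  }
  {
    assume i: "i < length S"
    show "answers w t (query_program (P_SIZE w1)) (small_bits m S) [i] (int (card (S ! i)))"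
    proof (rule answers_query_program[OF regs_below_P(3) t(3)])
      fix M assume h: "holds_bits w (small_bits m S) M"
      let ?R = "query_regs w [i]"
      have R: "?R 0 = w" "?R 1 = i" by (auto simp: query_regs_def)
      let ?B = "map (\<lambda>p. bit (M (p div w)) (p mod w)) [0..<if w < w1 then w * 2 ^ w else 2 ^ w1]"
      have e: "ev w M ?R (P_SIZE w1) = (if w = 1 then ev w M ?R (Lit 1) else ev w M ?R (F_size w1 ?B))"
        unfolding P_SIZE_def using i by (intro FULL_small[where R = ?R and bs = "small_bits m S" and S = S and m = m, OF h refl R(1) w(2) w1 w(1) N m]) auto
      show "int (ev w M ?R (P_SIZE w1)) = int (card (S ! i)) mod 2 ^ w"
      proof (cases "w = 1")
        case True
        then show ?thesis using one[OF True] e i by simp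
      next
        case False
        have D: "dec_set ?B i = S ! i" using False w by (intro small_decode[OF h _ w1 w(1) N m sub i]) auto
        have xw: "i < 2 ^ w" "i \<le> 2 ^ w1" "card (S ! i) < 2 ^ w"
          using cm[OF i] iN[OF i] xN[OF i] w N N1 by linarith+
        have "ev w M ?R (F_size w1 ?B) = ev w M ?R (vexp (int (card (S ! i))))"
          unfolding F_size_def using xw R D by (simp add: ev_chain min_def del: map_map)
        then show ?thesis using e False ev_vexp[OF w(2), of "int (card (S ! i))"] xw(3)
          by (simp add: of_nat_less_iff flip: of_nat_power)
      qed
    qed
  }
qed

subsection \<open>Parameters\<close>

definition KAP :: nat where "KAP = 5000"
definition GAM :: nat where "GAM = 2090"

text \<open>With \<open>nh\<close> in the role of \<open>n\<close>: \<open>pa\<close> is about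
  \<open>lg n\<close>, \<open>pb\<close> about \<open>lg (lg n)\<close>, \<open>pt\<close> is
  \<open>tau\<close>, \<open>pT\<close> is \<open>2 ^ tau\<close>, and blocks of \<open>pu\<close>
  bits give lookup tables of roughly the fourth root of \<open>n\<close>.\<close>

definition pa :: "nat => nat" where "pa nh = blen nh"
definition pb :: "nat => nat" where "pb nh = blen (pa nh)"
definition pt :: "nat => nat" where "pt nh = pb nh div KAP"
definition pT :: "nat => nat" where "pT nh = 2 ^ pt nh"
definition pg :: "nat => nat => nat" where "pg c nh = 2 ^ c * pT nh ^ GAM"
definition pu :: "nat => nat" where "pu nh = pa nh div 4 + 2"

text \<open>The unit in which the lower-order terms are measured; only constants and the
  contribution of \<open>lg (lg m)\<close> are kept apart.\<close>

definition slack :: "nat => real" where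
  "slack nh = real nh * (real (pt nh) + 1) / real (pT nh)"

lemma pa_pos: "0 < nh ==> 0 < pa nh" unfolding pa_def by (rule blen_pos)

lemma pb_pos: "0 < nh ==> 0 < pb nh" unfolding pb_def by (intro blen_pos pa_pos)

lemma exp_pa: "nh < 2 ^ pa nh" "0 < nh ==> 2 ^ pa nh \<le> 2 * nh"
  unfolding pa_def by (auto simp: less_exp_blen exp_blen_le)

lemma exp_pb: "pa nh < 2 ^ pb nh" "0 < nh ==> 2 ^ pb nh \<le> 2 * pa nh"
  unfolding pb_def by (auto simp: less_exp_blen intro!: exp_blen_le pa_pos)

lemma pb_less: "pb nh < KAP * (pt nh + 1)"
  unfolding pt_def using dividend_less_div_times[of KAP "pb nh"] by (simp add: KAP_def mult.commute)

lemma pT_pos: "0 < pT nh" "1 \<le> pT nh" by (simp_all add: pT_def)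

lemma pT_KAP: "0 < nh ==> pT nh ^ KAP \<le> 2 * pa nh"
proof -
  assume nh: "0 < nh"
  have "pT nh ^ KAP = 2 ^ (pt nh * KAP)" by (simp add: pT_def power_mult)
  also have "... \<le> 2 ^ pb nh" unfolding pt_def by (intro power_increasing) auto
  also have "... \<le> 2 * pa nh" by (rule exp_pb(2)[OF nh])
  finally show ?thesis .
qed

lemma pT_le: "0 < nh ==> pT nh \<le> 2 * pa nh"
  using power_increasing[of 1 KAP "pT nh"] pT_KAP[of nh] pT_pos[of nh] by (simp add: KAP_def)

lemma pg_pos: "1 \<le> pg c nh" "pT nh \<le> pg c nh" "2 ^ c \<le> pg c nh"
proof -
  have "1 \<le> pT nh ^ GAM" using pT_pos by simp
  moreover have "pT nh ^ 1 \<le> pT nh ^ GAM" using pT_pos by (intro power_increasing) (auto simp: GAM_def)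
  moreover have "1 * pT nh ^ GAM \<le> 2 ^ c * pT nh ^ GAM" by (intro mult_le_mono1) simp
  moreover have "2 ^ c * 1 \<le> 2 ^ c * pT nh ^ GAM" using pT_pos by (intro mult_le_mono2) simp
  ultimately show "1 \<le> pg c nh" "pT nh \<le> pg c nh" "2 ^ c \<le> pg c nh" unfolding pg_def by (simp_all only: mult_1 mult_1_right power_one_right)
qed

lemma pg_square: "0 < nh ==> (pg c nh * pT nh)\<^sup>2 \<le> 2 ^ (2 * c + 1) * pa nh"
proof -
  assume nh: "0 < nh"
  have "(pg c nh * pT nh)\<^sup>2 = 2 ^ (2 * c) * pT nh ^ (2 * GAM + 2)"
    unfolding pg_def by (simp add: power_mult_distrib power_add power2_eq_square mult_2)
  also have "... \<le> 2 ^ (2 * c) * pT nh ^ KAP"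
    using pT_pos by (intro mult_le_mono2 power_increasing) (auto simp: KAP_def GAM_def)
  also have "... \<le> 2 ^ (2 * c) * (2 * pa nh)" by (intro mult_le_mono2 pT_KAP nh)
  finally show ?thesis by simp
qed

text \<open>The reason is that \<open>a \<le> 16 * 2 ^ (a div 16)\<close>. It places the lookup
  tables, a power of \<open>lg n\<close> times \<open>2 ^ (a div 4)\<close>, far below
  \<open>n\<close>.\<close>

lemma pow8_bound: "a ^ 8 * 2 ^ (a div 4) \<le> 2 ^ 32 * (2::nat) ^ a"
proof -
  have "a \<le> 16 * (a div 16 + 1)" using dividend_less_div_times[of 16 a] by simp
  also have "... \<le> 16 * 2 ^ (a div 16)" by (intro mult_le_mono2) (simp add: Suc_leI)
  finally have "a ^ 8 \<le> (16 * 2 ^ (a div 16)) ^ 8" by (rule power_mono) simp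
  also have "... = 2 ^ 32 * 2 ^ (8 * (a div 16))" by (simp add: power_mult_distrib power_mult[symmetric] mult.commute)
  finally have "a ^ 8 * 2 ^ (a div 4) \<le> 2 ^ 32 * 2 ^ (8 * (a div 16)) * 2 ^ (a div 4)" by (rule mult_le_mono1)
  also have "... = 2 ^ 32 * 2 ^ (8 * (a div 16) + a div 4)" by (simp add: power_add)
  also have "... \<le> 2 ^ 32 * 2 ^ a"
  proof -
    have "8 * (a div 16) + a div 4 \<le> a" using div_times_less_eq_dividend[of a 16] div_times_less_eq_dividend[of a 4] by linarith
    then show ?thesis by (intro mult_le_mono2 power_increasing) auto
  qed
  finally show ?thesis .
qed

lemma small_terms: "0 < nh ==> pa nh ^ 7 * 2 ^ (pa nh div 4) * pT nh \<le> 2 ^ 34 * nh"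
proof -
  assume nh: "0 < nh"
  let ?a = "pa nh"
  have "?a ^ 7 * 2 ^ (?a div 4) * pT nh \<le> ?a ^ 7 * 2 ^ (?a div 4) * (2 * ?a)"
    by (intro mult_le_mono2 pT_le nh)
  also have "... = 2 * (?a ^ Suc 7 * 2 ^ (?a div 4))" by (simp only: power_Suc mult_ac)
  also have "... \<le> 2 * (2 ^ 32 * 2 ^ ?a)" using pow8_bound[of ?a] by (simp only: eval_nat_numeral BitM.simps mult_le_mono2)
  also have "... \<le> 2 * (2 ^ 32 * (2 * nh))" by (intro mult_le_mono2 exp_pa nh)
  finally show ?thesis by simp
qed

lemma small_real:
  assumes nh: "0 < nh" and x: "x \<le> real (pa nh ^ 7 * 2 ^ (pa nh div 4))"
  shows "x \<le> 2 ^ 34 * (real nh / real (pT nh))"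
proof -
  have "real (pa nh ^ 7 * 2 ^ (pa nh div 4)) * real (pT nh) \<le> 2 ^ 34 * real nh"
    using of_nat_mono[OF small_terms[OF nh], where 'a = real] by (simp only: of_nat_mult of_nat_power of_nat_numeral)
  then have "real (pa nh ^ 7 * 2 ^ (pa nh div 4)) \<le> 2 ^ 34 * real nh / real (pT nh)"
    using pT_pos[of nh] by (simp add: field_simps)
  then show ?thesis using x by simp
qed

lemma pa_power_le:
  assumes nh: "0 < nh" and i: "i \<le> 7"
  shows "real (pa nh) ^ i \<le> 2 ^ 34 * (real nh / real (pT nh))"
proof -
  have "pa nh ^ i \<le> pa nh ^ 7" using pa_pos[OF nh] i by (intro power_increasing) auto
  then have "pa nh ^ i * 1 \<le> pa nh ^ 7 * 2 ^ (pa nh div 4)" by (intro mult_le_mono) auto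
  then have "real (pa nh ^ i) \<le> real (pa nh ^ 7 * 2 ^ (pa nh div 4))" by (simp only: of_nat_le_iff mult_1_right)
  then show ?thesis using small_real[OF nh, of "real (pa nh ^ i)"] by simp
qed

lemma div_ge1: "1 \<le> (y::real) ==> 0 \<le> x ==> x / y \<le> x"
  using divide_left_mono[of 1 y x] by simp

lemma slack_ge: "real nh / real (pT nh) \<le> slack nh"
  unfolding slack_def by (intro divide_right_mono) (simp_all add: distrib_left)

lemma slack_le: "slack nh \<le> real nh"
proof -
  have "real (pt nh) + 1 \<le> real (pT nh)"
    using less_exp[of "pt nh"] unfolding pT_def by (metis Suc_leI of_nat_Suc of_nat_le_iff add.commute)
  then have "real nh * (real (pt nh) + 1) \<le> real nh * real (pT nh)" by (rule mult_left_mono) simp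
  then show ?thesis unfolding slack_def using pT_pos[of nh] by (simp add: divide_le_eq)
qed

definition fid_aux :: "nat => nat => nat => nat => nat => nat => nat" where
  "fid_aux U u sg b1 b2 cX = (let Q = nblocks U u; S = nsuper U u sg in
     2 * (S * blen U) + 2 * ((Q + 1) * blen (sg * u)) + 2 * (tsize u * blen u) +
     (cX div b1 + 2) * blen S + S * b1 * blen S + S * base2 u sg b2 * blen sg + S * (sg * b2) * blen sg)"

text \<open>Superblocks of \<open>lg n ^ 3\<close> blocks make absolute entries of
  \<open>O(lg n)\<close> bits affordable; entries relative to a superblock take
  \<open>O(lg (lg n))\<close> bits only. For select, the chunk lengths are \<open>lg n ^ 2\<close>
  over superblocks and \<open>g * T\<close> within a superblock.\<close>

lemma fid_aux_bound:
  fixes Cu Cx c :: nat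
  shows "\<exists>C. \<forall>nh U cX. 0 < nh \<longrightarrow> U \<le> Cu * (pg c nh * nh) \<longrightarrow> cX \<le> Cx * (pT nh * nh) \<longrightarrow>
    real (fid_aux U (pu nh) (pa nh ^ 3) (pa nh ^ 2) (pg c nh * pT nh) cX) \<le> C * slack nh"
proof -
  define Cg where "Cg = (2::nat) ^ (2 * c + 1)"
  define cU where "cU = blen (Cu * Cg) + 5"
  define K :: real where "K = 2 ^ 34"
  define k where "k = 6 * real KAP"
  define CV where "CV = 4 * (real Cu * real Cg) + 2 * real Cg * K"
  define C where "C = 3 * real cU * CV + 3 * k * CV + 2 * (192 * K) +
    (real Cx * real Cg * real cU + 2 * real cU * K) + k * (real Cu + 6 * K + 2 * CV)"
  have K0: "0 \<le> K" "0 \<le> k" "0 \<le> CV" by (simp_all add: K_def k_def CV_def)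
  show ?thesis
  proof (intro exI[of _ C] allI impI)
    fix nh U cX :: nat
    assume nh: "0 < nh" and U: "U \<le> Cu * (pg c nh * nh)" and cX: "cX \<le> Cx * (pT nh * nh)"
    define a b T z u where "a = pa nh" and "b = pb nh" and "T = pT nh" and "z = pg c nh * pT nh" and "u = pu nh"
    define A e t1 where "A = real a" and "e = real nh / real T" and "t1 = real (pt nh) + 1"
    have a1: "1 \<le> a" using pa_pos[OF nh] by (simp add: a_def)
    have A1: "1 \<le> A" using a1 by (simp add: A_def)
    have T1: "1 \<le> T" "T \<le> z"
      using pT_pos[of nh] mult_le_mono1[OF pg_pos(1)[of c nh], of T] by (auto simp: T_def z_def)
    have z1: "1 \<le> z" "1 \<le> real z" using T1 by auto
    have e0: "0 \<le> e" "1 \<le> t1" by (simp_all add: e_def t1_def)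
    have pw: "A ^ i \<le> K * e" if "i \<le> 7" for i
      unfolding A_def a_def K_def e_def T_def by (rule pa_power_le[OF nh that])
    have zz: "real z * real z \<le> real Cg * A"
      using of_nat_mono[OF pg_square[OF nh, of c], where 'a = real]
      by (simp add: z_def Cg_def A_def a_def power2_eq_square)
    have zA: "real z \<le> real Cg * A" using mult_right_mono[OF z1(2), of "real z"] zz by simp
    have Ur: "real U \<le> real Cu * (real z * e)"
      using of_nat_mono[OF U, where 'a = real] T1 by (simp add: z_def e_def T_def mult_ac)
    have u: "a \<le> 4 * u" "u \<le> 3 * a" "2 \<le> u" using a1 by (auto simp: u_def pu_def a_def)
    define Q S where "Q = nblocks U u" and "S = nsuper U u (a ^ 3)"
    define W V where "W = Q + a ^ 3" and "V = W * z"
    have SW: "S * a ^ 3 \<le> W"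
      unfolding S_def nsuper_def W_def Q_def add_mult_distrib using div_times_less_eq_dividend by simp
    have WV: "W \<le> V" using mult_le_mono2[OF z1(1), of W] by (simp add: V_def)
    have a3: "a ^ 1 \<le> a ^ 3" "a ^ 0 \<le> a ^ 3" using a1 by (intro power_increasing; simp)+
    have Sa: "S * a \<le> V" using le_trans[OF mult_le_mono2[OF a3(1), of S] SW] WV by simp
    \<comment> \<open>The critical term: the explicit tables for select take about \<open>z\<close>
      entries per block, and there are about \<open>U / lg n\<close> blocks with \<open>U\<close> of
      order \<open>z * e\<close>. This is why \<open>z ^ 2 = (g * T) ^ 2\<close> must be
      \<open>O(lg n)\<close>.\<close>
    have Ve: "real V \<le> CV * e"
    proof -
      have "real (U div u) \<le> real U / real u" by (rule of_nat_div_le_of_nat)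
      also have "... \<le> real U / (A / 4)" using u A1 by (intro divide_left_mono) (auto simp: A_def)
      finally have "real (U div u) * real z \<le> real U / (A / 4) * real z" by (rule mult_right_mono) simp
      also have "... = 4 * (real U * real z) / A" by simp
      also have "... \<le> 4 * (real Cu * e * (real Cg * A)) / A"
      proof (intro divide_right_mono mult_left_mono)
        have "real U * real z \<le> real Cu * (real z * e) * real z" using Ur by (rule mult_right_mono) simp
        also have "... = real Cu * e * (real z * real z)" by (simp add: mult_ac)
        also have "... \<le> real Cu * e * (real Cg * A)" using zz e0 by (intro mult_left_mono) auto
        finally show "real U * real z \<le> real Cu * e * (real Cg * A)" .
      qed (use A1 in auto)
      also have "... = 4 * (real Cu * real Cg) * e" using A1 by simp
      finally have "real V \<le> 4 * (real Cu * real Cg) * e + (1 + A ^ 3) * real z"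
        by (simp add: V_def W_def Q_def nblocks_def A_def algebra_simps)
      also have "(1 + A ^ 3) * real z \<le> (2 * A ^ 3) * (real Cg * A)"
        using zA A1 one_le_power[OF A1, of 3] by (intro mult_mono) auto
      also have "... = 2 * real Cg * A ^ 4" by (simp add: power4_eq_xxxx power3_eq_cube)
      also have "... \<le> 2 * real Cg * (K * e)" using pw[of 4] by (intro mult_left_mono) auto
      finally show ?thesis by (simp add: CV_def algebra_simps)
    qed
    have bU: "blen U + 3 \<le> cU * a"
    proof -
      have "pg c nh \<le> z" using mult_le_mono2[OF pT_pos(2)[of nh], of "pg c nh"] by (simp add: z_def)
      also have "z \<le> Cg * a" using zA by (simp add: A_def flip: of_nat_mult)
      finally have "Cu * (pg c nh * nh) \<le> Cu * (Cg * a * nh)" by (intro mult_le_mono2 mult_le_mono1)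
      then have "U \<le> Cu * Cg * (a * nh)" using U unfolding mult.assoc by (rule order_trans[rotated])
      then have "blen U \<le> blen (Cu * Cg * (a * nh))" by (rule blen_mono)
      also have "... \<le> blen (Cu * Cg) + (blen a + blen nh)" by (intro order_trans[OF blen_mult] add_left_mono blen_mult)
      also have "... \<le> blen (Cu * Cg) * a + (a + a)"
        using a1 blen_le_self[of a] by (intro add_le_mono) (auto simp: a_def pa_def)
      finally show ?thesis using a1 by (simp add: cU_def algebra_simps)
    qed
    have bS: "blen S \<le> cU * a"
    proof -
      have "S \<le> U + 2" unfolding S_def nsuper_def nblocks_def
        using div_le_dividend[of "U div u + 1" "a ^ 3"] div_le_dividend[of U u] by linarith
      then have "blen S \<le> blen (U + 2)" by (rule blen_mono)
      also have "... \<le> Suc (max (blen U) (blen 2))" by (rule blen_add)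
      also have "... \<le> blen U + 3" using blen_le[of 2 2] by simp
      finally show ?thesis using bU by simp
    qed
    have bu: "blen (x * a ^ 3) \<le> k * t1" if x: "x \<le> 3 * a" for x
    proof -
      have ab: "a < 2 ^ b" using exp_pb by (simp add: a_def b_def)
      have "x * a ^ 3 \<le> 3 * a * a ^ 3" using x by (rule mult_le_mono1)
      also have "... = 3 * a ^ 4" by (simp add: power4_eq_xxxx power3_eq_cube)
      also have "... < 4 * (2 ^ b) ^ 4" using power_strict_mono[OF ab, of 4] by simp
      also have "... = 2 ^ (4 * b + 2)" by (simp add: power_add power_mult[symmetric] mult.commute)
      finally have "blen (x * a ^ 3) \<le> 4 * b + 2" by (rule blen_le)
      also have "... \<le> 6 * (KAP * (pt nh + 1))" using pb_pos[OF nh] pb_less[of nh] by (simp add: b_def)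
      finally have "real (blen (x * a ^ 3)) \<le> real (6 * (KAP * (pt nh + 1)))" by (simp only: of_nat_le_iff)
      then show ?thesis by (simp add: k_def t1_def algebra_simps)
    qed
    have bsg: "blen (a ^ 3) \<le> k * t1" "blen (a ^ 3 * u) \<le> k * t1"
      using bu[of 1] bu[OF u(2)] a1 by (simp_all add: mult.commute)
    have kt: "0 \<le> k * t1" using K0 e0 by simp
    have et: "x * e \<le> x * (e * t1)" if "0 \<le> x" for x
      using that mult_left_mono[OF e0(2), of "x * e"] e0 by (simp add: mult_ac)
    have Vt: "x * real V \<le> x * CV * (e * t1)" if "0 \<le> x" for x
      using mult_left_mono[OF Ve that] et[of "x * CV"] that K0 by (simp add: mult.assoc)
    have Vk: "real V * (k * t1) \<le> k * CV * (e * t1)" using mult_right_mono[OF Ve kt] by (simp add: mult_ac)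
    have Vb: "real (V * y) \<le> k * CV * (e * t1)" if "y \<le> k * t1" for y :: nat
      using mult_left_mono[OF that, of "real V"] Vk by simp
    have r1: "real (S * blen U) \<le> real cU * real V"
    proof -
      have "S * blen U \<le> S * (cU * a)" using bU by (intro mult_le_mono2) simp
      also have "... = cU * (S * a)" by simp
      also have "... \<le> cU * V" using Sa by (rule mult_le_mono2)
      finally show ?thesis by (simp flip: of_nat_mult)
    qed
    have r2: "real ((Q + 1) * blen (a ^ 3 * u)) \<le> k * CV * (e * t1)"
    proof -
      have "Q + 1 \<le> V" using WV a3(2) by (simp add: W_def)
      then have "real ((Q + 1) * blen (a ^ 3 * u)) \<le> real (V * blen (a ^ 3 * u))"
        unfolding of_nat_le_iff by (rule mult_le_mono1)
      then show ?thesis using Vb[OF bsg(2)] by linarith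
    qed
    have r3: "real (tsize u * blen u) \<le> 192 * K * e"
    proof -
      have "tsize u * blen u \<le> (4 * a) * (4 * 2 ^ (a div 4)) * (4 * a) * (3 * a)"
        unfolding tsize_def using u a1 blen_le_self[of u]
        by (intro mult_le_mono) (auto simp: u_def pu_def a_def power_add)
      also have "... = 192 * (a ^ 3 * 2 ^ (a div 4))" by (simp add: power3_eq_cube)
      also have "... \<le> 192 * (a ^ 7 * 2 ^ (a div 4))"
        using a1 by (intro mult_le_mono2 mult_le_mono1 power_increasing) auto
      finally have "real (tsize u * blen u) \<le> real (192 * (a ^ 7 * 2 ^ (a div 4)))" by (simp only: of_nat_le_iff)
      also have "... = 192 * real (a ^ 7 * 2 ^ (a div 4))" by simp
      also have "... \<le> 192 * (K * e)"
        unfolding K_def e_def a_def T_def by (intro mult_left_mono small_real[OF nh]) auto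
      finally show ?thesis by simp
    qed
    have r4: "real ((cX div a ^ 2 + 2) * blen S) \<le> (real Cx * real Cg * real cU + 2 * real cU * K) * e"
    proof -
      have "real (cX div a ^ 2) \<le> real cX / A ^ 2" using of_nat_div_le_of_nat[of cX "a ^ 2"] by (simp add: A_def)
      also have "... \<le> real Cx * (real Cg * A * e) / A ^ 2"
      proof (rule divide_right_mono)
        have "real cX \<le> real Cx * (real T * real T * e)"
          using of_nat_mono[OF cX, where 'a = real] T1 by (simp add: e_def T_def)
        also have "... \<le> real Cx * (real z * real z * e)"
          using T1 e0 by (intro mult_left_mono mult_right_mono mult_mono) auto
        also have "... \<le> real Cx * (real Cg * A * e)" using zz e0 by (intro mult_left_mono mult_right_mono) auto
        finally show "real cX \<le> real Cx * (real Cg * A * e)" .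
      qed simp
      also have "... = real Cx * real Cg * e / A" using A1 by (simp add: field_simps power2_eq_square)
      finally have "real (cX div a ^ 2 + 2) \<le> real Cx * real Cg * e / A + 2" by simp
      moreover have "real (blen S) \<le> real cU * A" using bS by (simp add: A_def flip: of_nat_mult)
      ultimately have "real ((cX div a ^ 2 + 2) * blen S) \<le> (real Cx * real Cg * e / A + 2) * (real cU * A)"
        unfolding of_nat_mult using A1 e0 by (intro mult_mono) auto
      also have "... = real Cx * real Cg * real cU * e + 2 * real cU * A ^ 1" using A1 by (simp add: field_simps)
      also have "... \<le> real Cx * real Cg * real cU * e + 2 * real cU * (K * e)"
        using pw[of 1] by (intro add_left_mono mult_left_mono) auto
      finally show ?thesis by (simp add: algebra_simps)
    qed
    have r5: "real (S * a ^ 2 * blen S) \<le> real cU * real V"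
    proof -
      have "S * a ^ 2 * blen S \<le> S * a ^ 2 * (cU * a)" using bS by (rule mult_le_mono2)
      also have "... = cU * (S * a ^ 3)" by (simp add: power3_eq_cube power2_eq_square)
      also have "... \<le> cU * V" using SW WV by (intro mult_le_mono2) simp
      finally show ?thesis by (simp flip: of_nat_mult)
    qed
    have r6: "real (S * base2 u (a ^ 3) z * blen (a ^ 3)) \<le> k * (real Cu + 6 * K + 2 * CV) * (e * t1)"
    proof -
      have "S * (a ^ 3 * u) \<le> U + 6 * a ^ 4"
      proof -
        have "S * a ^ 3 * u \<le> W * u" using SW by (rule mult_le_mono1)
        also have "... = U div u * u + u + a ^ 3 * u" by (simp add: W_def Q_def nblocks_def algebra_simps)
        also have "... \<le> U + 2 * (a ^ 3 * u)"
          using add_mono[OF div_times_less_eq_dividend[of U u] mult_le_mono1[OF a3(2), of u]] by (simp add: mult.commute)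
        also have "... \<le> U + 2 * (a ^ 3 * (3 * a))" using u(2) by (intro add_left_mono mult_le_mono2)
        finally show ?thesis by (simp add: power4_eq_xxxx power3_eq_cube mult.assoc)
      qed
      then have s6: "real S * real (a ^ 3 * u) \<le> real U + 6 * A ^ 4"
        using of_nat_mono[where 'a = real] by (fastforce simp: A_def)
      have S1: "2 * real S \<le> 2 * real V" using le_trans[OF mult_le_mono2[OF a1, of S] Sa] by simp
      have "real (base2 u (a ^ 3) z) \<le> real (a ^ 3 * u) / real z + 2"
        unfolding base2_def using of_nat_div_le_of_nat[of "a ^ 3 * u" z, where 'a = real] by simp
      then have "real S * real (base2 u (a ^ 3) z) \<le> real S * (real (a ^ 3 * u) / real z + 2)"
        by (rule mult_left_mono) simp
      also have "... = real S * real (a ^ 3 * u) / real z + 2 * real S" by (simp add: algebra_simps)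
      also have "... \<le> (real U + 6 * A ^ 4) / real z + 2 * real V"
        using s6 S1 by (intro add_mono divide_right_mono) auto
      also have "(real U + 6 * A ^ 4) / real z \<le> real Cu * e + 6 * A ^ 4"
      proof -
        have "6 * A ^ 4 / real z \<le> 6 * A ^ 4" using z1 A1 by (intro div_ge1) auto
        moreover have "real U / real z \<le> real Cu * e" using Ur z1 by (simp add: divide_le_eq mult_ac)
        ultimately show ?thesis by (simp add: add_divide_distrib)
      qed
      also have "real Cu * e + 6 * A ^ 4 + 2 * real V \<le> (real Cu + 6 * K + 2 * CV) * e"
        using pw[of 4] Ve by (simp add: algebra_simps)
      finally have 1: "real S * real (base2 u (a ^ 3) z) \<le> (real Cu + 6 * K + 2 * CV) * e" by simp
      have "real (S * base2 u (a ^ 3) z * blen (a ^ 3)) \<le> ((real Cu + 6 * K + 2 * CV) * e) * (k * t1)"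
        unfolding of_nat_mult[of "S * base2 u (a ^ 3) z"] of_nat_mult[of S]
        using K0 e0 by (intro mult_mono[OF 1 bsg(1)]) auto
      then show ?thesis by (simp add: mult_ac)
    qed
    have r7: "real (S * (a ^ 3 * z) * blen (a ^ 3)) \<le> k * CV * (e * t1)"
    proof -
      have "S * (a ^ 3 * z) \<le> V" unfolding V_def mult.assoc[symmetric] using SW by (rule mult_le_mono1)
      then have "real (S * (a ^ 3 * z) * blen (a ^ 3)) \<le> real (V * blen (a ^ 3))"
        unfolding of_nat_le_iff by (rule mult_le_mono1)
      then show ?thesis using Vb[OF bsg(1)] by linarith
    qed
    have eq: "real (fid_aux U u (a ^ 3) (a ^ 2) z cX) =
        2 * real (S * blen U) + 2 * real ((Q + 1) * blen (a ^ 3 * u)) + 2 * real (tsize u * blen u) +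
        real ((cX div a ^ 2 + 2) * blen S) + real (S * a ^ 2 * blen S) +
        real (S * base2 u (a ^ 3) z * blen (a ^ 3)) + real (S * (a ^ 3 * z) * blen (a ^ 3))"
      unfolding fid_aux_def Let_def Q_def[symmetric] S_def[symmetric] by (simp only: of_nat_add of_nat_mult of_nat_numeral)
    have 3: "192 * K * e \<le> 192 * K * (e * t1)" using K0 by (intro et) simp
    have 4: "(real Cx * real Cg * real cU + 2 * real cU * K) * e \<le>
        (real Cx * real Cg * real cU + 2 * real cU * K) * (e * t1)" using K0 by (intro et) simp
    have C: "C * (e * t1) = 3 * (real cU * CV * (e * t1)) + 3 * (k * CV * (e * t1)) + 2 * (192 * K * (e * t1)) +
        (real Cx * real Cg * real cU + 2 * real cU * K) * (e * t1) + k * (real Cu + 6 * K + 2 * CV) * (e * t1)"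
      unfolding C_def by (simp only: distrib_right mult.assoc)
    have "real (fid_aux U u (a ^ 3) (a ^ 2) z cX) \<le> C * (e * t1)"
      unfolding eq C using r1 r2 order_trans[OF r3 3] order_trans[OF r4 4] r5 r6 r7 Vt[of "real cU"] by simp
    then show "real (fid_aux U (pu nh) (pa nh ^ 3) (pa nh ^ 2) (pg c nh * pT nh) cX) \<le> C * slack nh"
      by (simp add: slack_def e_def t1_def a_def z_def T_def u_def)
  qed
qed

subsection \<open>Size of the compressed bit vector\<close>

lemma clen_le_log:
  assumes c: "c \<le> u"
  shows "real (clen u c) \<le> log 2 (real (u choose c)) + 1"
proof (cases "u choose c = 1")
  case True
  then show ?thesis unfolding clen_def by (simp add: blen_le[of 0 0])
next
  case False
  define x where "x = (u choose c) - 1"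
  have p: "0 < u choose c" using c by simp
  then have x0: "0 < x" using False unfolding x_def by linarith
  have "2 ^ blen x \<le> 2 * x" by (rule exp_blen_le[OF x0])
  also have "... \<le> 2 * (u choose c)" by (simp add: x_def)
  finally have "real (2 ^ blen x) \<le> real (2 * (u choose c))" by (simp only: of_nat_le_iff)
  then have "log 2 (2 ^ blen x) \<le> log 2 (2 * real (u choose c))" using p by (subst log_le_cancel_iff) auto
  also have "... = 1 + log 2 (real (u choose c))" using p by (subst log_mult) auto
  finally show ?thesis unfolding clen_def x_def[symmetric] by simp
qed

lemma choose_mult_le: "(a choose b) * (a' choose b') \<le> (a + a') choose (b + b')"
proof -
  have "(a choose b) * (a' choose ((b + b') - b)) \<le> (\<Sum>k\<le>b + b'. (a choose k) * (a' choose ((b + b') - k)))"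
    by (rule member_le_sum) auto
  then show ?thesis by (simp add: vandermonde)
qed

text \<open>Vandermonde's inequality merges the binomial coefficients of consecutive blocks;
  rounding adds less than one bit per block, hence the last summand. Stating it for a segment allows
  regions of very different density to be charged separately.\<close>

lemma bptr_segment:
  assumes X: "finite X"
  shows "real (bptr X u (t + k)) \<le> real (bptr X u t) +
    log 2 (real ((k * u) choose (cnt X ((t + k) * u) - cnt X (t * u)))) + real k"
proof (induction k)
  case 0
  then show ?case by simp
next
  case (Suc k)
  let ?c = "cnt X ((t + k) * u) - cnt X (t * u)" and ?e = "bclass X u (t + k)"
  have m1: "cnt X (t * u) \<le> cnt X ((t + k) * u)" by (intro cnt_mono X mult_le_mono1) simp
  have c: "?c \<le> k * u" using cnt_diff_le[OF X, of "t * u" "(t + k) * u"] by (simp add: algebra_simps)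
  have e: "?e \<le> u" by (rule bclass_le[OF X])
  have s: "cnt X ((t + Suc k) * u) - cnt X (t * u) = ?c + ?e"
    using cnt_step[OF X, of "t + k" u] m1 by simp
  have p: "0 < real ((k * u) choose ?c)" "0 < real (u choose ?e)" using c e by simp_all
  have "log 2 (real ((k * u) choose ?c)) + log 2 (real (u choose ?e)) =
      log 2 (real ((k * u) choose ?c) * real (u choose ?e))" using p by (subst log_mult) auto
  also have "... \<le> log 2 (real ((Suc k * u) choose (?c + ?e)))"
  proof -
    have "real ((k * u) choose ?c) * real (u choose ?e) \<le> real ((Suc k * u) choose (?c + ?e))"
      using of_nat_mono[OF choose_mult_le[of "k * u" ?c u ?e], where 'a = real] by (simp add: add.commute)
    then show ?thesis using p by (subst log_le_cancel_iff) (auto intro: less_le_trans[OF mult_pos_pos])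
  qed
  finally have l: "log 2 (real ((k * u) choose ?c)) + log 2 (real (u choose ?e)) \<le>
      log 2 (real ((Suc k * u) choose (?c + ?e)))" .
  have "bptr X u (t + Suc k) = bptr X u (t + k) + clen u ?e" by (simp add: bptr_def)
  then show ?case using Suc clen_le_log[OF e] l unfolding s by simp
qed

lemma log2_add1_le: "0 \<le> x ==> log 2 (1 + x) \<le> 2 * x"
proof -
  assume x: "0 \<le> x"
  have l2: "1 / 2 \<le> ln (2::real)" using exp_half_le2 by (subst ln_ge_iff) auto
  have "ln (1 + x) \<le> x" using x by (rule ln_add_one_self_le_self)
  also have "... \<le> 2 * x * ln 2" using x mult_left_mono[OF l2, of "2 * x"] by simp
  finally show ?thesis by (simp add: log_def divide_le_eq)
qed

text \<open>One term of the binomial expansion of \<open>(1 + y) ^ M\<close> with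
  \<open>y = 2 ^ (- 2 * tau)\<close>: each element costs \<open>2 * tau\<close> bits, and the second
  summand is small because \<open>M\<close> will be of order \<open>n * 2 ^ tau\<close>.\<close>

lemma log_choose_region:
  "log 2 (real (M choose c)) \<le> 2 * real c * real tau + 2 * real M / (2 ^ tau)\<^sup>2"
proof (cases "c \<le> M")
  case False
  then have "M choose c = 0" by (simp add: binomial_eq_0)
  then have "log 2 (real (M choose c)) = 0" by (simp only:) (simp add: log_def)
  then show ?thesis by simp
next
  case True
  define y :: real where "y = 1 / (2 ^ tau)\<^sup>2"
  have y: "0 < y" by (simp add: y_def)
  have "real (M choose c) * y ^ c * 1 ^ (M - c) \<le> (\<Sum>k\<le>M. real (M choose k) * y ^ k * 1 ^ (M - k))"
    using True y by (intro member_le_sum) auto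
  then have "real (M choose c) * y ^ c \<le> (y + 1) ^ M" by (simp add: binomial_ring)
  then have "log 2 (real (M choose c) * y ^ c) \<le> log 2 ((1 + y) ^ M)"
    using y True by (subst log_le_cancel_iff) (auto simp: add.commute)
  also have "... = real M * log 2 (1 + y)" using y by (simp add: log_nat_power)
  also have "... \<le> real M * (2 * y)" using log2_add1_le[of y] y by (intro mult_left_mono) auto
  finally have 1: "log 2 (real (M choose c) * y ^ c) \<le> 2 * real M / (2 ^ tau)\<^sup>2" by (simp add: y_def mult.commute)
  have ly: "log 2 y = - (2 * real tau)" by (simp add: y_def log_divide log_nat_power)
  have "log 2 (real (M choose c) * y ^ c) = log 2 (real (M choose c)) + real c * log 2 y"
    using y True by (subst log_mult) (auto simp: log_nat_power)
  then show ?thesis using 1 ly by (simp add: algebra_simps)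
qed

section \<open>Binomial inequalities behind the space accounting\<close>

lemma choose_Suc_gap:
  assumes "Suc k * (r + 1) \<le> H"
  shows "(H choose k) * r \<le> H choose Suc k"
proof -
  have "Suc k * r \<le> H - k" using assms by (simp add: algebra_simps)
  then have "(H choose k) * (Suc k * r) \<le> (H choose k) * (H - k)" by (rule mult_le_mono2)
  also have "... = Suc k * (H choose Suc k)"
    using binomial_absorb_comp[of H k] binomial_absorption[of k H] by (simp only: mult.commute)
  finally have "Suc k * ((H choose k) * r) \<le> Suc k * (H choose Suc k)" by (simp only: mult_ac)
  then show ?thesis by (simp only: mult_le_cancel1)
qed

text \<open>This is the saving from repeated heads: a set of heads with \<open>e\<close> elements
  fewer has a smaller binomial coefficient by a factor of at least \<open>r ^ e\<close>, as
  consecutive quotients \<open>(H - k) / (k + 1)\<close> are at least \<open>r\<close>.\<close>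

lemma choose_gap: "(v + e) * (r + 1) \<le> H ==> (H choose v) * r ^ e \<le> H choose (v + e)"
proof (induction e)
  case (Suc e)
  have "(v + e) * (r + 1) \<le> (v + Suc e) * (r + 1)" by (intro mult_le_mono1) simp
  then have "(H choose v) * r ^ e * r \<le> (H choose (v + e)) * r"
    using Suc by (intro mult_le_mono1 Suc.IH) simp
  also have "... \<le> H choose Suc (v + e)" using Suc.prems by (intro choose_Suc_gap) simp
  finally show ?case by (simp add: mult_ac)
qed simp

text \<open>Choosing \<open>n\<close> distinct heads and \<open>D\<close> possible endings for each
  gives distinct sets of \<open>n\<close> keys, so separating heads from slots exceeds the entropy
  by nothing but the effect of rounding.\<close>

lemma choose_scale:
  assumes n: "n \<le> H" and D: "0 < D"
  shows "real (H choose n) * real D ^ n \<le> real ((H * D) choose n)"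
proof -
  have H: "H * 1 \<le> H * D" using D by (intro mult_le_mono2) simp
  have "real (H choose n) * real D ^ n = (\<Prod>i = 0..<n. real (H - i) / real (n - i) * real D)"
    unfolding binomial_altdef_of_nat[OF n] prod.distrib by simp
  also have "... \<le> (\<Prod>i = 0..<n. real (H * D - i) / real (n - i))"
  proof (rule prod_mono, intro conjI)
    fix i assume i: "i \<in> {0..<n}"
    have "(H - i) * D \<le> H * D - i"
      using mult_le_mono2[of 1 D i] D by (simp add: diff_mult_distrib diff_le_mono2)
    then have "real (H - i) * real D \<le> real (H * D - i)" by (metis of_nat_le_iff of_nat_mult)
    then show "real (H - i) / real (n - i) * real D \<le> real (H * D - i) / real (n - i)"
      using i by (simp add: divide_right_mono)
  qed simp
  also have "... = real ((H * D) choose n)" using le_trans[OF n, of "H * D"] H by (intro binomial_altdef_of_nat[symmetric]) simp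
  finally show ?thesis .
qed

text \<open>The price of rounding the universe up from \<open>N\<close> to \<open>N'\<close>,
  compared factor by factor.\<close>

lemma choose_ratio:
  assumes n: "n \<le> N" "N \<le> N'" and r: "0 \<le> r" "real N' - real N \<le> r * (real N - real n)"
  shows "real (N' choose n) \<le> real (N choose n) * (1 + r) ^ n"
proof -
  have "real (N' choose n) = (\<Prod>i = 0..<n. real (N' - i) / real (n - i))"
    using n by (simp add: binomial_altdef_of_nat)
  also have "... \<le> (\<Prod>i = 0..<n. real (N - i) / real (n - i) * (1 + r))"
  proof (rule prod_mono, intro conjI)
    fix i assume i: "i \<in> {0..<n}"
    have "r * (real N - real n) \<le> r * (real N - real i)" using r i by (intro mult_left_mono) auto
    then have "real (N' - i) \<le> real (N - i) * (1 + r)"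
      using r n i by (simp add: of_nat_diff algebra_simps)
    then show "real (N' - i) / real (n - i) \<le> real (N - i) / real (n - i) * (1 + r)"
      using i by (simp add: divide_right_mono)
  qed simp
  also have "... = real (N choose n) * (1 + r) ^ n"
    unfolding binomial_altdef_of_nat[OF n(1)] prod.distrib by simp
  finally show ?thesis .
qed

lemma log_choose_le: "0 < x ==> x \<le> y ==> log 2 (real x) \<le> log 2 (real y)"
  by (subst log_le_cancel_iff) auto

lemma bptr_dense:
  assumes XU: "X \<subseteq> {..<U}" and u: "0 < u"
  shows "real (bptr X u (nblocks U u)) \<le> log 2 (real (U choose card X)) + real (nblocks U u) + real u"
proof -
  have X: "finite X" using XU finite_subset by blast
  define k where "k = U div u"
  have kU: "k * u \<le> U" "U < (k + 1) * u" using dividend_less_div_times[OF u, of U] by (auto simp: k_def algebra_simps)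
  let ?c = "cnt X (k * u)"
  have cX: "?c \<le> card X" by (rule cnt_le_card[OF X])
  have "card X = cnt X U" using cnt_bounded[OF XU order_refl] by simp
  then have rest: "card X - ?c \<le> U - k * u" using cnt_diff_le[OF X kU(1)] by simp
  have "((k * u) choose ?c) * 1 \<le> ((k * u) choose ?c) * ((U - k * u) choose (card X - ?c))"
    using rest by (intro mult_le_mono2) (simp add: Suc_leI)
  also have "... \<le> U choose card X"
    using choose_mult_le[of "k * u" ?c "U - k * u" "card X - ?c"] kU cX by simp
  finally have "log 2 (real ((k * u) choose ?c)) \<le> log 2 (real (U choose card X))"
    using cnt_le[of X "k * u"] by (intro log_choose_le) auto
  moreover have "real (bptr X u k) \<le> log 2 (real ((k * u) choose ?c)) + real k"
    using bptr_segment[OF X, of u 0 k] by (simp add: bptr_def)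
  moreover have "bptr X u (nblocks U u) = bptr X u k + clen u (bclass X u k)"
    by (simp add: nblocks_def k_def bptr_def)
  moreover have "clen u (bclass X u k) \<le> u - 1" by (rule clen_le[OF u])
  ultimately show ?thesis by (simp add: nblocks_def k_def)
qed

lemma bptr_le_mult: "0 < u ==> bptr X u k \<le> k * (u - 1)"
proof -
  assume u: "0 < u"
  have "bptr X u k \<le> (\<Sum>i<k. u - 1)" unfolding bptr_def by (intro sum_mono clen_le u)
  then show ?thesis by simp
qed

text \<open>A bucket of \<open>k \<ge> 2\<close> keys with a common head contains
  \<open>k - 1\<close> repetitions of it, and \<open>k \<le> 2 * (k - 1)\<close>. In the proof, a
  start that shares its bucket is mapped to the next position, which is not a start. Later levels
  only lose positions.\<close>

lemma (in keys) card_A_le: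
  shows "card (starts {..<n} (\<lambda>j. K j div 2 ^ d)) = card ((\<lambda>j. K j div 2 ^ d) ` {..<n})"
    and "card (A l) \<le> 2 * (n - card ((\<lambda>j. K j div 2 ^ d) ` {..<n}))"
proof -
  let ?f = "\<lambda>j. K j div 2 ^ d" and ?N = "{..<n}"
  let ?St = "starts ?N ?f"
  interpret c: classes n ?N ?f "insert n ?St"
    by unfold_locales (auto intro: div_le_mono K_mono simp: starts_def)
  show v: "card ?St = card (?f ` ?N)" using card_image[OF c.inj_starts] c.image_starts by simp
  have St: "?St \<subseteq> ?N" by (auto simp: starts_def)
  have z: "card (?N - ?St) = n - card (?f ` ?N)"
    using card_Diff_subset[OF finite_subset[OF St] St] v by simp
  have A0: "A l \<subseteq> A 0"
  proof
    fix j assume "j \<in> A l"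
    then have "j < n" "2 \<le> SZ l (K j)" by (auto simp: A_def)
    moreover have "SZ l (K j) \<le> SZ 0 (K j)" using siz_refine[OF rem_le] by simp
    ultimately show "j \<in> A 0" by (simp add: A_def)
  qed
  have suc: "j + 1 \<in> ?N - ?St" if j: "j \<in> A 0 \<inter> ?St" for j
  proof -
    have jn: "j < n" and sz: "2 \<le> siz d (K j)" using j by (auto simp: A_def)
    have b: "lo d (K j) \<le> j" "j < hi d (K j)" using pos_in_bucket[OF jn] by auto
    have "lo d (K j) = j"
    proof (rule ccontr)
      assume "lo d (K j) \<noteq> j"
      then have l: "lo d (K j) < j" using b by simp
      then have "?f (lo d (K j)) = ?f j" using in_bucket[of "lo d (K j)" d "K j"] b jn by simp
      moreover have "\<forall>i\<in>?N. i < j \<longrightarrow> ?f i < ?f j" using j by (simp add: starts_def)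
      ultimately show False using l jn by auto
    qed
    then have h: "j + 1 < hi d (K j)" using sz by (simp add: siz_def)
    then have j1: "j + 1 < n" using hi_le less_le_trans by blast
    have "?f (j + 1) = ?f j" using in_bucket[OF j1, of d "K j"] h b by simp
    then have "j + 1 \<notin> ?St" using jn by (auto simp: starts_def dest!: bspec[of _ _ j])
    then show ?thesis using j1 by simp
  qed
  have "card (A 0 \<inter> ?St) = card ((\<lambda>j. j + 1) ` (A 0 \<inter> ?St))" by (simp add: card_image)
  also have "... \<le> card (?N - ?St)" using suc by (intro card_mono) auto
  finally have 1: "card (A 0 \<inter> ?St) \<le> n - card (?f ` ?N)" using z by simp
  have "card (A l) \<le> card ((A 0 \<inter> ?St) \<union> (?N - ?St))"
    using A0 by (intro card_mono) (auto simp: A_def)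
  also have "... \<le> card (A 0 \<inter> ?St) + card (?N - ?St)" by (rule card_Un_le)
  finally show "card (A l) \<le> 2 * (n - card (?f ` ?N))" using 1 z by simp
qed

text \<open>Regions consist of whole blocks, so each has a binomial bound of its own. If
  \<open>e\<close> keys repeat a head, the additional regions cost about
  \<open>e * tau * GAM\<close> bits by \<open>log_choose_region\<close>, which is just what
  \<open>choose_gap\<close> saves on the heads when their density is below \<open>1 / r\<close> with
  \<open>r \<ge> T ^ GAM\<close>.\<close>

lemma (in keys) bptr_sparse:
  assumes XR: "X = {x. x < U \<and> (if x < Hp then x \<in> (\<lambda>j. K j div 2 ^ d) ` {..<n}
      else (x - Hp) mod G \<in> reg ((x - Hp) div G))}"
    and UH: "U = Hp + (2 * NF + 1) * G" and Hp: "Hp = hb * u" and Gu: "G = gb * u" and u: "0 < u"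
    and nG: "n \<le> G" and nH: "n * (r + 1) \<le> Hp" and r: "(2 ^ tau) ^ GAM \<le> r"
    and regV: "\<And>l. l < NF ==> reg (2 * l) = (\<lambda>j. code l (K j)) ` A l"
    and regW: "\<And>l. l < NF ==> reg (2 * l + 1) = insert n (starts (A l) (\<lambda>j. code l (K j)))"
    and regW0: "reg (2 * NF) = {n..<G} \<union> starts {..<n} (\<lambda>j. K j div 2 ^ d)"
    and KH: "\<And>j. j < n ==> K j div 2 ^ d < Hp"
  shows "real (bptr X u (nblocks U u)) \<le> log 2 (real (Hp choose n)) + real (nblocks U u) +
      (2 * real NF + 1) * (2 * real tau + 2 * real G / (2 ^ tau)\<^sup>2)" (is ?entropy)
    and "bptr X u (nblocks U u) \<le> U" and "card X \<le> (2 * NF + 1) * (2 * n + 1) + n + G"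
proof -
  let ?f = "\<lambda>j. K j div 2 ^ d"
  define v where "v = card (?f ` {..<n})"
  define e where "e = n - v"
  have vn: "v \<le> n" unfolding v_def using card_image_le[of "{..<n}" ?f] by simp
  have XU: "X \<subseteq> {..<U}" using XR by auto
  have X: "finite X" using XU finite_subset by blast
  have cH: "cnt X Hp = v"
  proof -
    have "{x \<in> X. x < Hp} = ?f ` {..<n}" using KH UH by (auto simp: XR less_le_trans)
    then show ?thesis by (simp add: cnt_def v_def)
  qed
  define p where "p i = Hp + i * G" for i
  define cr where "cr i = cnt X (p (Suc i)) - cnt X (p i)" for i
  have pm: "p i \<le> p (Suc i)" for i by (simp add: p_def)
  have cm: "cnt X (p i) \<le> cnt X (p (Suc i))" for i by (rule cnt_mono[OF X pm])
  have cr: "cr i = card (reg i \<inter> {..<G})" if i: "i < 2 * NF + 1" for i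
  proof -
    have iU: "p (Suc i) \<le> U" unfolding UH p_def using i by (intro add_left_mono mult_le_mono1) simp
    have "{x \<in> X. p i \<le> x \<and> x < p (Suc i)} = (\<lambda>y. p i + y) ` (reg i \<inter> {..<G})"
    proof
      show "{x \<in> X. p i \<le> x \<and> x < p (Suc i)} \<subseteq> (\<lambda>y. p i + y) ` (reg i \<inter> {..<G})"
      proof
        fix x assume x: "x \<in> {x \<in> X. p i \<le> x \<and> x < p (Suc i)}"
        define y where "y = x - p i"
        have y: "x = p i + y" "y < G" using x by (auto simp: y_def p_def)
        have "x - Hp = y + i * G" using y by (simp add: p_def)
        then have "(x - Hp) mod G = y" "(x - Hp) div G = i" using y by (simp_all)
        moreover have "\<not> x < Hp" using y by (simp add: p_def)
        ultimately have "y \<in> reg i" using x XR by auto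
        then show "x \<in> (\<lambda>y. p i + y) ` (reg i \<inter> {..<G})" using y by auto
      qed
      show "(\<lambda>y. p i + y) ` (reg i \<inter> {..<G}) \<subseteq> {x \<in> X. p i \<le> x \<and> x < p (Suc i)}"
      proof
        fix x assume "x \<in> (\<lambda>y. p i + y) ` (reg i \<inter> {..<G})"
        then obtain y where y: "x = p i + y" "y \<in> reg i" "y < G" by auto
        have "x - Hp = y + i * G" using y by (simp add: p_def)
        then have "(x - Hp) mod G = y" "(x - Hp) div G = i" using y by simp_all
        moreover have "\<not> x < Hp" using y by (simp add: p_def)
        moreover have "x < p (Suc i)" using y by (simp add: p_def)
        ultimately show "x \<in> {x \<in> X. p i \<le> x \<and> x < p (Suc i)}" using y iU XR by auto
      qed
    qed
    then have "card {x \<in> X. p i \<le> x \<and> x < p (Suc i)} = card (reg i \<inter> {..<G})"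
      by (simp add: card_image)
    then show ?thesis using cnt_diff[OF X pm, of i] by (simp add: cr_def)
  qed
  have A: "card (A l) \<le> 2 * e" and finA: "finite (A l)" for l
    using card_A_le(2) by (auto simp: e_def v_def A_def)
  have crV: "cr (2 * l) \<le> 2 * e" if "l < NF" for l
  proof -
    have "cr (2 * l) \<le> card ((\<lambda>j. code l (K j)) ` A l)"
      using that finA by (subst cr) (auto simp: regV intro!: card_mono)
    also have "... \<le> card (A l)" by (rule card_image_le[OF finA])
    finally show ?thesis using A[of l] by simp
  qed
  have crW: "cr (2 * l + 1) \<le> 2 * e + 1" if "l < NF" for l
  proof -
    have "cr (2 * l + 1) \<le> card (insert n (A l))"
      using that finA by (subst cr) (auto simp: regW[simplified] starts_def intro!: card_mono)
    also have "... \<le> card (A l) + 1" using finA by (simp add: card_insert_if)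
    finally show ?thesis using A[of l] by simp
  qed
  \<comment> \<open>Almost every position is the start of a run of heads. Region
    \<open>2 * NF\<close> is therefore filled with ones above \<open>n\<close>: it then lacks only
    \<open>e\<close> elements, and by the symmetry of binomial coefficients it costs as much as a
    set of \<open>e\<close> elements.\<close>
  have crW0: "cr (2 * NF) = G - e" "e \<le> G"
  proof -
    let ?St = "starts {..<n} ?f"
    have St: "?St \<subseteq> {..<n}" by (auto simp: starts_def)
    have "reg (2 * NF) \<inter> {..<G} = {n..<G} \<union> ?St" unfolding regW0 using St nG by auto
    then have "cr (2 * NF) = card ({n..<G} \<union> ?St)" using cr[of "2 * NF"] by simp
    also have "... = (G - n) + v"
      using St finite_subset[OF St] card_A_le(1) by (subst card_Un_disjoint) (auto simp: v_def)
    finally show "cr (2 * NF) = G - e" using nG vn by (simp add: e_def)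
    show "e \<le> G" using nG by (simp add: e_def)
  qed
  have ph: "p i = (hb + i * gb) * u" for i by (simp add: p_def Hp Gu algebra_simps)
  have seg: "real (bptr X u (hb + k * gb)) \<le> log 2 (real (Hp choose v)) +
      (\<Sum>i<k. log 2 (real (G choose cr i))) + real (hb + k * gb)" for k
  proof (induction k)
    case 0
    show ?case using bptr_segment[OF X, of u 0 hb] cH by (simp add: bptr_def Hp)
  next
    case (Suc k)
    have "real (bptr X u (hb + k * gb + gb)) \<le> real (bptr X u (hb + k * gb)) +
        log 2 (real (G choose cr k)) + real gb"
      using bptr_segment[OF X, of u "hb + k * gb" gb] unfolding cr_def ph
      by (simp add: Gu add.assoc add.commute[of gb])
    then show ?case using Suc by (simp add: algebra_simps)
  qed
  define Q where "Q = hb + (2 * NF + 1) * gb"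
  have UQ: "U = Q * u" by (simp add: UH Q_def Hp Gu algebra_simps)
  then have nb: "nblocks U u = Suc Q" using u by (simp add: nblocks_def)
  have "bclass X u Q = 0"
    using cnt_bounded[OF XU, of "Q * u"] cnt_bounded[OF XU, of "(Q + 1) * u"] UQ by (simp add: bclass_def)
  then have last: "bptr X u (nblocks U u) = bptr X u Q"
    unfolding nb using blen_le[of 0 0] by (simp add: bptr_def clen_def)
  have "bptr X u Q \<le> Q * (u - 1)" by (rule bptr_le_mult[OF u])
  also have "... \<le> U" unfolding UQ by (intro mult_le_mono2) simp
  finally show "bptr X u (nblocks U u) \<le> U" unfolding last .
  define Z where "Z = 2 * real G / (2 ^ tau)\<^sup>2"
  have lc: "log 2 (real (G choose c)) \<le> 2 * real c * real tau + Z" for c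
    unfolding Z_def by (rule log_choose_region)
  have lcb: "log 2 (real (G choose c)) \<le> 2 * real b * real tau + Z" if "c \<le> b" for c b
  proof -
    have "real c * real tau \<le> real b * real tau" using that by (intro mult_right_mono) auto
    then show ?thesis using lc[of c] by simp
  qed
  have sums: "(\<Sum>i<2 * k. h i) = (\<Sum>l<k. h (2 * l) + h (2 * l + 1))" for h :: "nat => real" and k
    by (induction k) (simp_all add: add.assoc)
  have "(\<Sum>i<2 * NF + 1. log 2 (real (G choose cr i))) =
      (\<Sum>l<NF. log 2 (real (G choose cr (2 * l))) + log 2 (real (G choose cr (2 * l + 1)))) +
      log 2 (real (G choose cr (2 * NF)))"
    using sums[of "\<lambda>i. log 2 (real (G choose cr i))" NF] by simp
  also have "... \<le> (\<Sum>l<NF. (2 * real (2 * e) * real tau + Z) + (2 * real (2 * e + 1) * real tau + Z)) +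
      (2 * real e * real tau + Z)"
  proof (intro add_mono sum_mono)
    show "log 2 (real (G choose cr (2 * NF))) \<le> 2 * real e * real tau + Z"
      using lc[of e] crW0 binomial_symmetric[of e G] by simp
  qed (use crV crW lcb in \<open>simp_all only: lessThan_iff\<close>)
  also have "... = real e * real tau * (8 * real NF + 2) + 2 * real NF * real tau + (2 * real NF + 1) * Z"
    by (simp add: algebra_simps)
  \<comment> \<open>Each level has two regions with about \<open>2 * e\<close> elements at
    \<open>2 * tau\<close> bits, the last region counts for \<open>e\<close> elements.\<close>
  also have "8 * real NF + 2 = real GAM" by (simp add: NF_def GAM_def)
  finally have s2: "(\<Sum>i<2 * NF + 1. log 2 (real (G choose cr i))) \<le>
      real e * real tau * real GAM + 2 * real NF * real tau + (2 * real NF + 1) * Z" .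
  have "log 2 (real (Hp choose v)) + real e * real tau * real GAM \<le> log 2 (real (Hp choose n))"
  proof -
    have ve: "v + e = n" using vn by (simp add: e_def)
    have vH: "v \<le> Hp" using vn nH by (simp add: le_trans[OF _ nH] trans_le_add1)
    have "(Hp choose v) * ((2 ^ tau) ^ GAM) ^ e \<le> (Hp choose v) * r ^ e"
      using r by (intro mult_le_mono2 power_mono) auto
    also have "... \<le> Hp choose n" using choose_gap[of v e r Hp] nH ve by simp
    finally have "real ((Hp choose v) * ((2 ^ tau) ^ GAM) ^ e) \<le> real (Hp choose n)" by (simp only: of_nat_le_iff)
    then have le: "real (Hp choose v) * 2 ^ (tau * GAM * e) \<le> real (Hp choose n)" by (simp add: power_mult)
    have pos: "0 < real (Hp choose v)" using vH by simp
    have "log 2 (real (Hp choose v) * 2 ^ (tau * GAM * e)) \<le> log 2 (real (Hp choose n))"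
      by (subst log_le_cancel_iff[OF _ mult_pos_pos[OF pos] less_le_trans[OF mult_pos_pos[OF pos] le]]) (auto simp: le)
    moreover have "log 2 (real (Hp choose v) * 2 ^ (tau * GAM * e)) =
        log 2 (real (Hp choose v)) + real (tau * GAM * e)"
      using pos by (subst log_mult) (auto simp: log_nat_power)
    ultimately show ?thesis by (simp add: mult_ac)
  qed
  moreover have "real (bptr X u Q) \<le> log 2 (real (Hp choose v)) +
      (\<Sum>i<2 * NF + 1. log 2 (real (G choose cr i))) + real Q"
    unfolding Q_def by (rule seg)
  ultimately have "real (bptr X u Q) \<le> log 2 (real (Hp choose n)) + 2 * real NF * real tau +
      (2 * real NF + 1) * Z + real Q"
    using s2 by linarith
  moreover have "(2 * real NF + 1) * (2 * real tau + Z) = 4 * real NF * real tau + 2 * real tau + (2 * real NF + 1) * Z"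
    by (simp add: algebra_simps)
  moreover have "0 \<le> real NF * real tau" by simp
  ultimately have "real (bptr X u Q) \<le> log 2 (real (Hp choose n)) + real (Suc Q) + (2 * real NF + 1) * (2 * real tau + Z)"
    using of_nat_0_le_iff[of tau, where 'a = real] unfolding of_nat_Suc by linarith
  then show ?entropy unfolding last Z_def unfolding nb .
  have cp: "cnt X (p k) \<le> v + (\<Sum>i<k. cr i)" for k
  proof (induction k)
    case 0
    then show ?case using cH by (simp add: p_def)
  next
    case (Suc k)
    then show ?case using cm[of k] by (simp add: cr_def)
  qed
  have e2: "2 * e + 1 \<le> 2 * n + 1" by (simp add: e_def)
  have "cr i \<le> 2 * n + 1" if "i < 2 * NF" for i
  proof (cases "even i")
    case True
    then obtain l where "i = 2 * l" by blast
    then show ?thesis using crV[of l] that e2 by simp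
  next
    case False
    then obtain l where "i = 2 * l + 1" by (rule oddE)
    then show ?thesis using crW[of l] that e2 by simp
  qed
  then have "(\<Sum>i<2 * NF. cr i) \<le> (\<Sum>i<2 * NF. 2 * n + 1)" by (intro sum_mono) simp
  moreover have "card X = cnt X (p (2 * NF + 1))" using cnt_bounded[OF XU, of U] UH by (simp add: p_def)
  ultimately show "card X \<le> (2 * NF + 1) * (2 * n + 1) + n + G"
    using cp[of "2 * NF + 1"] crW0 vn by simp
qed

subsection \<open>Laying out the arrays\<close>

text \<open>The codes come last, so that no stored offset includes their length; position 4 is given
  to the slots of the keys instead. Positions 11 to 13 hold the other tables of the sparse
  case.\<close>

definition layout :: "nat set => nat => nat => nat => nat => nat => arr list => arr list" where
  "layout X U u sg b1 b2 D = (let F = fid_arrays X U u sg b1 b2 in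
     [F ! 0, F ! 1, F ! 2, F ! 3, D ! 0, F ! 5, F ! 6, F ! 7, F ! 8, F ! 9, F ! 10, D ! 1, D ! 2, D ! 3, F ! 4])"

lemma length_layout [simp]: "length (layout X U u sg b1 b2 D) = 15"
  by (simp add: layout_def Let_def)

lemma layout_nth_fid: "k < 11 ==> k \<noteq> 4 ==> layout X U u sg b1 b2 D ! k = fid_arrays X U u sg b1 b2 ! k"
proof -
  assume "k < 11" "k \<noteq> 4"
  then have "k \<in> {0,1,2,3,5,6,7,8,9,10}" by (auto simp: numeral_eq_Suc less_Suc_eq)
  then show ?thesis unfolding layout_def Let_def by (elim insertE emptyE) simp_all
qed

lemma layout_nth:
  "layout X U u sg b1 b2 D ! 4 = D ! 0" "layout X U u sg b1 b2 D ! 11 = D ! 1"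
  "layout X U u sg b1 b2 D ! 12 = D ! 2" "layout X U u sg b1 b2 D ! 13 = D ! 3"
  "layout X U u sg b1 b2 D ! 14 = fid_arrays X U u sg b1 b2 ! 4"
  by (simp_all add: layout_def Let_def)

lemma fid_arrays_sizes:
  "map arr_size (fid_arrays X U u sg b1 b2) = (let Q = nblocks U u; S = nsuper U u sg in
    [S * blen U, (Q + 1) * blen (sg * u), S * blen U, (Q + 1) * blen (sg * u), bptr X u Q, tsize u * blen u,
     tsize u * blen u, (card X div b1 + 2) * blen S, S * b1 * blen S, S * base2 u sg b2 * blen sg,
     S * (sg * b2) * blen sg])"
  by (simp add: fid_arrays_def Let_def arr_size_def)

lemma fid_arrays_widths:
  "map fst (fid_arrays X U u sg b1 b2) = (let S = nsuper U u sg in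
    [blen U, blen (sg * u), blen U, blen (sg * u), 1, blen u, blen u, blen S, blen S, blen sg, blen sg])"
  by (simp add: fid_arrays_def Let_def)

lemma length_fid_arrays: "length (fid_arrays X U u sg b1 b2) = 11"
  by (simp add: fid_arrays_def Let_def)

lemma arr_offs_layout:
  assumes D: "length D = 4"
  shows "arr_offs (layout X U u sg b1 b2 D) 14 = fid_aux U u sg b1 b2 (card X) + sum_list (map arr_size D)"
    "arr_offs (layout X U u sg b1 b2 D) 15 =
      fid_aux U u sg b1 b2 (card X) + sum_list (map arr_size D) + bptr X u (nblocks U u)"
proof -
  let ?F = "fid_arrays X U u sg b1 b2"
  obtain D0 D1 D2 D3 where Dl: "D = [D0, D1, D2, D3]"
    using D by (auto simp: numeral_eq_Suc length_Suc_conv)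
  have f: "arr_size (?F ! k) = map arr_size ?F ! k" if "k < 11" for k using that by (simp add: length_fid_arrays)
  note fs = f[of 0] f[of 1] f[of 2] f[of 3] f[of 4] f[of 5] f[of 6] f[of 7] f[of 8] f[of 9] f[of 10]
  show "arr_offs (layout X U u sg b1 b2 D) 14 = fid_aux U u sg b1 b2 (card X) + sum_list (map arr_size D)"
    "arr_offs (layout X U u sg b1 b2 D) 15 =
      fid_aux U u sg b1 b2 (card X) + sum_list (map arr_size D) + bptr X u (nblocks U u)"
    using fs[unfolded fid_arrays_sizes Let_def]
    by (simp_all add: arr_offs_def layout_def Let_def Dl fid_aux_def)
qed

lemma arr_offs_mono: "k \<le> l ==> arr_offs As k \<le> arr_offs As l"
proof -
  assume "k \<le> l"
  then have "take l As = take k As @ take (l - k) (drop k As)"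
    by (metis le_add_diff_inverse take_add)
  then show ?thesis by (simp add: arr_offs_def)
qed

lemma arr_size_le_offs: "k < l ==> l \<le> length As ==> arr_size (As ! k) \<le> arr_offs As l"
proof -
  assume k: "k < l" "l \<le> length As"
  then have "arr_offs As (Suc k) = arr_offs As k + arr_size (As ! k)"
    by (simp add: arr_offs_def take_Suc_conv_app_nth)
  then show ?thesis using arr_offs_mono[of "Suc k" l As] k by simp
qed

lemma set_all_params:
  assumes "x \<in> set (all_params As ps)"
  shows "x = 0 \<or> x \<in> set ps \<or> (\<exists>k < length As. x = arr_offs As k \<or> x = fst (As ! k))"
  using assms unfolding all_params_def Let_def by auto

definition hsize :: "nat => nat" where "hsize B = header_size (blen B div 4 + 1)"

text \<open>\<open>B\<close> bounds everything in the header and enters the space only through its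
  bit length. \<open>N\<close> bounds everything that has to be addressed and thereby makes any word
  size with \<open>N < 2 ^ w\<close> sufficient, provided that \<open>w \<ge> 16\<close>.\<close>

lemma fid_instance:
  fixes N B :: nat
  assumes XU: "X \<subseteq> {..<U}" and UN: "U \<le> N" and D: "length D = 4" and ps: "length ps = 16"
    and pars: "ps ! 3 = u" "ps ! 4 = sg" "ps ! 5 = b1" "ps ! 6 = b2" "ps ! 7 = base2 u sg b2"
    and Bps: "\<And>x. x \<in> set ps ==> x \<le> B" and B1: "1 \<le> B" and BN: "B \<le> N"
    and aux: "fid_aux U u sg b1 b2 (card X) + sum_list (map arr_size D) \<le> B"
    and Dw: "\<And>a. a \<in> set D ==> fst a \<le> arr_size a \<and> fst a \<le> blen N"
    and fit: "hsize B + (fid_aux U u sg b1 b2 (card X) + sum_list (map arr_size D)) \<le> N"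
    and sgu: "sg * u \<le> N" and u2: "2 \<le> u" "4 * u \<le> blen N + 8"
    and sg: "0 < sg" and b1: "0 < b1" and b2: "0 < b2" and ptr: "bptr X u (nblocks U u) \<le> U" and N4: "4 \<le> N"
  defines "As \<equiv> layout X U u sg b1 b2 D" and "q \<equiv> blen B div 4 + 1"
  shows "N < 2 ^ w ==> 16 \<le> w ==> R 0 = w ==> holds_bits w (mk_bits q ps As) M ==>
      fid w M R q ps As X U u sg b1 b2"
    and "length (mk_bits q ps As) = hsize B + (fid_aux U u sg b1 b2 (card X) + sum_list (map arr_size D)) +
      bptr X u (nblocks U u)"
    and "mk_bits q ps As ! 0" "mk_bits q ps As \<noteq> []"
proof -
  let ?aux = "fid_aux U u sg b1 b2 (card X) + sum_list (map arr_size D)"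
  have lA: "length As = 15" by (simp add: As_def)
  have np: "2 * length As + length ps \<le> NPAR" using ps lA by (simp add: NPAR_def)
  have o14: "arr_offs As 14 = ?aux" and o15: "arr_offs As 15 = ?aux + bptr X u (nblocks U u)"
    unfolding As_def using arr_offs_layout[OF D] by auto
  show "length (mk_bits q ps As) = hsize B + ?aux + bptr X u (nblocks U u)"
    using length_mk_bits[OF np, of q] o15 lA by (simp add: hsize_def q_def)
  show "mk_bits q ps As ! 0" "mk_bits q ps As \<noteq> []" by (simp_all add: mk_bits_def)
  let ?S = "nsuper U u sg"
  have SN: "?S \<le> N"
  proof -
    have "?S \<le> U div u + 2"
      unfolding nsuper_def nblocks_def using div_le_dividend[of "U div u + 1" sg] by simp
    also have "U div u \<le> U div 2" using u2 by (intro div_le_mono2) auto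
    finally show ?thesis using UN N4 by linarith
  qed
  have F: "fst (fid_arrays X U u sg b1 b2 ! k) = map fst (fid_arrays X U u sg b1 b2) ! k"
    "arr_size (fid_arrays X U u sg b1 b2 ! k) = map arr_size (fid_arrays X U u sg b1 b2) ! k" if "k < 11" for k
    using that by (simp_all add: length_fid_arrays)
  have sgN: "sg \<le> N" "u \<le> N"
    using le_trans[OF mult_le_mono2[of 1 u sg] sgu] le_trans[OF mult_le_mono1[of 1 sg u] sgu] u2 sg by simp_all
  have S1: "1 \<le> ?S" "1 \<le> nblocks U u" "1 \<le> tsize u" "1 \<le> base2 u sg b2"
    by (simp_all add: nsuper_def nblocks_def tsize_def base2_def Suc_le_eq)
  have pr: "x \<le> y * x" if "1 \<le> y" for x y :: nat using mult_le_mono1[OF that, of x] by simp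
  have wid: "fst (As ! k) \<le> blen N" "fst (As ! k) \<le> B" if k: "k < 15" for k
  proof -
    have kk: "k \<in> {4,11,12,13} \<or> k = 14 \<or> k \<in> {0,1,2,3,5,6,7,8,9,10}" using k by (auto simp: numeral_eq_Suc less_Suc_eq)
    have "fst (As ! k) \<le> blen N \<and> fst (As ! k) \<le> B"
    proof (cases "k \<in> {4,11,12,13}")
      case True
      then have "As ! k \<in> set D" unfolding As_def using D by (auto simp: layout_nth)
      moreover have "arr_size (As ! k) \<le> B"
        using arr_size_le_offs[of k 14 As] True lA o14 aux by auto
      ultimately show ?thesis using Dw by (meson le_trans)
    next
      case False
      show ?thesis
      proof (cases "k = 14")
        case True
        have "1 \<le> blen N" using blen_pos[of N] N4 by simp
        then show ?thesis unfolding As_def True layout_nth F[of 4, simplified] fid_arrays_widths Let_def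
          using B1 by simp
      next
        case k14: False
        then have k': "k \<in> {0,1,2,3,5,6,7,8,9,10}" using kk False by blast
        then have k'': "k < 11" "k \<noteq> 4" by auto
        have A: "As ! k = fid_arrays X U u sg b1 b2 ! k" unfolding As_def by (rule layout_nth_fid[OF k''])
        have "fst (As ! k) \<le> blen N"
          unfolding A F(1)[OF k''(1)] fid_arrays_widths Let_def using k' UN sgu sgN SN
          by (elim insertE emptyE) (simp_all add: blen_mono)
        moreover have "fst (As ! k) \<le> arr_size (As ! k)"
          unfolding A F(1)[OF k''(1)] F(2)[OF k''(1)] fid_arrays_widths fid_arrays_sizes Let_def using k' S1 sg b1 b2
          by (elim insertE emptyE) (simp_all add: pr Suc_leI del: One_nat_def)
        moreover have "arr_size (As ! k) \<le> B"
          using arr_size_le_offs[of k 14 As] k'' lA o14 aux by auto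
        ultimately show ?thesis by simp
      qed
    qed
    then show "fst (As ! k) \<le> blen N" "fst (As ! k) \<le> B" by auto
  qed
  show "fid w M R q ps As X U u sg b1 b2"
    if Nw: "N < 2 ^ w" and w: "16 \<le> w" and R: "R 0 = w" and h: "holds_bits w (mk_bits q ps As) M"
  proof -
    have bw: "blen N \<le> w" using Nw by (rule blen_le)
    have bB: "blen B \<le> w" using blen_mono[OF BN] bw by simp
    have Bq: "B < 2 ^ (4 * q)"
    proof -
      have "blen B \<le> 4 * q" unfolding q_def using dividend_less_div_times[of 4 "blen B"] by simp
      then show ?thesis using less_exp_blen[of B] power_increasing[of "blen B" "4 * q" "2::nat"] by (simp add: less_le_trans)
    qed
    show ?thesis
    proof unfold_locales
      show "2 * q + 2 \<le> w" using bB w dividend_less_div_times[of 4 "blen B"] div_times_less_eq_dividend[of "blen B" 4] unfolding q_def by simp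
      show "x < 2 ^ (4 * q) \<and> x < 2 ^ w" if x: "x \<in> set (all_params As ps)" for x
      proof -
        have "x \<le> B"
        proof -
          consider "x = 0" | "x \<in> set ps" | k where "k < 15" "x = arr_offs As k" | k where "k < 15" "x = fst (As ! k)"
            using set_all_params[OF x] lA by auto
          then show ?thesis
          proof cases
            case (3 k)
            then have "arr_offs As k \<le> arr_offs As 14" by (intro arr_offs_mono) simp
            then show ?thesis using 3 o14 aux by simp
          qed (use Bps wid(2) in auto)
        qed
        then show ?thesis using Bq BN Nw by auto
      qed
      show "header_size q + arr_offs As k < 2 ^ w \<and> arr_size (As ! k) < 2 ^ w \<and> fst (As ! k) \<le> w"
        if "k < length As" for k
      proof (intro conjI)
        have "arr_offs As k \<le> arr_offs As 14" using that lA by (intro arr_offs_mono) simp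
        then show "header_size q + arr_offs As k < 2 ^ w" using fit Nw o14 by (simp add: hsize_def q_def)
        show "arr_size (As ! k) < 2 ^ w"
        proof (cases "k = 14")
          case True
          then have "arr_size (As ! k) = bptr X u (nblocks U u)"
            unfolding As_def by (simp add: layout_nth fid_arrays_def Let_def arr_size_def)
          then show ?thesis using ptr UN Nw by simp
        next
          case False
          then show ?thesis using arr_size_le_offs[of k 14 As] that lA o14 aux BN Nw by auto
        qed
        show "fst (As ! k) \<le> w" using wid(1)[of k] that lA bw by simp
      qed
      show "U < 2 ^ w" using UN Nw by simp
      show "u \<le> w" using u2 bw w by simp
    qed (use h R np w ps pars XU u2 sg b1 b2 ptr lA in \<open>auto simp: q_def As_def layout_nth_fid layout_nth\<close>)
  qed
qed

subsection \<open>Asymptotics\<close>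

lemma Suc_square_le: "(t + 1)\<^sup>2 \<le> 4 * (2::nat) ^ t"
proof (induction t)
  case (Suc t)
  show ?case
  proof (cases "t \<le> 1")
    case True
    then have "t = 0 \<or> t = 1" by auto
    then show ?thesis by (elim disjE) (simp_all add: power2_eq_square)
  next
    case False
    then have "2 * t \<le> t * t" by (intro mult_le_mono1) simp
    then have "2 \<le> t * t" using False by linarith
    then have "(Suc t + 1)\<^sup>2 \<le> 2 * (t + 1)\<^sup>2" by (simp add: power2_eq_square algebra_simps)
    then show ?thesis using Suc by simp
  qed
qed simp

lemma slack_nonneg: "0 \<le> slack n"
  by (simp add: slack_def)

lemma slack_le_div: "slack n \<le> 4 * real n / (real (pt n) + 1)"
proof -
  let ?t = "pt n"
  have "real ((?t + 1)\<^sup>2) \<le> real (4 * 2 ^ ?t)" using Suc_square_le by (simp only: of_nat_le_iff)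
  then have 1: "(real ?t + 1) * (real ?t + 1) \<le> 4 * real (pT n)"
    by (simp add: pT_def power2_eq_square algebra_simps)
  have "slack n * (real ?t + 1) = real n * ((real ?t + 1) * (real ?t + 1)) / real (pT n)"
    by (simp add: slack_def)
  also have "... \<le> real n * (4 * real (pT n)) / real (pT n)"
    by (intro divide_right_mono mult_left_mono 1) auto
  also have "... = 4 * real n" using pT_pos[of n] by simp
  finally show ?thesis by (simp add: le_divide_eq)
qed

text \<open>In other words, \<open>tau\<close> tends to infinity with \<open>n\<close>, though
  extremely slowly.\<close>

lemma le_pt: "2 ^ (2 ^ (KAP * t)) \<le> n ==> t \<le> pt n"
proof -
  assume n: "2 ^ (2 ^ (KAP * t)) \<le> n"
  have lower: "k \<le> blen x" if "2 ^ k \<le> x" for k x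
  proof -
    have "(2::nat) ^ k < 2 ^ blen x" using that less_exp_blen[of x] by (rule le_less_trans)
    then show ?thesis using power_less_imp_less_exp[of "2::nat" k "blen x"] by simp
  qed
  have "KAP * t \<le> pb n" unfolding pb_def pa_def by (intro lower n)
  then show ?thesis unfolding pt_def by (simp add: KAP_def less_eq_div_iff_mult_less_eq mult.commute)
qed

lemma slack_eps: "0 < \<epsilon> ==> \<exists>n0. \<forall>n\<ge>n0. slack n \<le> \<epsilon> * real n"
proof -
  assume e: "0 < \<epsilon>"
  define t where "t = nat \<lceil>4 / \<epsilon>\<rceil>"
  have t: "4 / \<epsilon> \<le> real t" unfolding t_def by (rule real_nat_ceiling_ge)
  show ?thesis
  proof (intro exI allI impI)
    fix n :: nat assume "2 ^ (2 ^ (KAP * t)) \<le> n"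
    then have "t \<le> pt n" by (rule le_pt)
    then have "4 / \<epsilon> \<le> real (pt n) + 1" using t by linarith
    then have "4 \<le> \<epsilon> * (real (pt n) + 1)" using e by (simp add: divide_le_eq mult.commute)
    then have "4 * real n \<le> \<epsilon> * (real (pt n) + 1) * real n" by (rule mult_right_mono) simp
    then have "4 * real n / (real (pt n) + 1) \<le> \<epsilon> * real n" by (simp add: divide_le_eq mult_ac)
    then show "slack n \<le> \<epsilon> * real n" using slack_le_div[of n] by linarith
  qed
qed

text \<open>A version uniform in \<open>n \<le> N\<close>: the number of keys may stay bounded while
  the universe grows. In that case the trivial bound \<open>slack n \<le> n\<close>
  suffices.\<close>

lemma slack_small: "0 < \<epsilon> ==> \<exists>N0. \<forall>N\<ge>N0. \<forall>n\<le>N. slack n \<le> \<epsilon> * real N"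
proof -
  assume e: "0 < \<epsilon>"
  obtain n0 where n0: "\<And>n. n0 \<le> n ==> slack n \<le> \<epsilon> * real n" using slack_eps[OF e] by blast
  show ?thesis
  proof (intro exI allI impI)
    fix N n assume N: "nat \<lceil>real n0 / \<epsilon>\<rceil> \<le> N" and n: "n \<le> N"
    show "slack n \<le> \<epsilon> * real N"
    proof (cases "n0 \<le> n")
      case True
      have "\<epsilon> * real n \<le> \<epsilon> * real N" using n e by simp
      then show ?thesis using n0[OF True] by linarith
    next
      case False
      have "real n0 / \<epsilon> \<le> real N" using N by linarith
      then have "real n0 \<le> \<epsilon> * real N" using e by (simp add: divide_le_eq mult.commute)
      then show ?thesis using slack_le[of n] False by linarith
    qed
  qed
qed

lemma slack_eighth:
  assumes C: "1 \<le> C"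
  shows "\<exists>N0. \<forall>N\<ge>N0. \<forall>n\<le>N. \<forall>x::nat. real x \<le> C * slack n \<longrightarrow> 8 * x \<le> N"
proof -
  obtain N0 where N0: "\<And>N n. N0 \<le> N ==> n \<le> N ==> slack n \<le> 1 / (8 * C) * real N"
    using slack_small[of "1 / (8 * C)"] C by auto
  show ?thesis
  proof (intro exI[of _ N0] allI impI)
    fix N n x :: nat assume a: "N0 \<le> N" "n \<le> N" "real x \<le> C * slack n"
    have "C * slack n \<le> C * (1 / (8 * C) * real N)" using N0[OF a(1,2)] C by (intro mult_left_mono) auto
    also have "... = real N / 8" using C by simp
    finally have "8 * real x \<le> real N" using a(3) by simp
    then show "8 * x \<le> N" by linarith
  qed
qed

lemma slack_smallo: "slack \<in> o(\<lambda>n. real n)"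
proof (rule landau_o.smallI)
  fix c :: real assume "0 < c"
  then obtain n0 where n0: "\<forall>n\<ge>n0. slack n \<le> c * real n" using slack_eps by blast
  show "\<forall>\<^sub>F x in sequentially. norm (slack x) \<le> c * norm (real x)"
    using n0 slack_nonneg by (auto simp: eventually_sequentially)
qed

lemma slack_max: "slack (max n \<beta>) \<le> slack n + real \<beta>"
  using slack_le[of \<beta>] slack_nonneg[of n] by (auto simp: max_def)

text \<open>Polylogarithmic parameters must not exceed \<open>N\<close>, or they might not fit into
  a word. The square of the claim follows from \<open>a ^ 8 = O(N)\<close>, an instance of
  \<open>pow8_bound\<close>.\<close>

lemma pow4_le:
  assumes nh: "0 < nh" "nh \<le> N" and N: "C\<^sup>2 * 2 ^ 33 \<le> N"
  shows "C * pa nh ^ 4 \<le> N"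
proof -
  let ?a = "pa nh"
  have "?a ^ 8 * 1 \<le> ?a ^ 8 * 2 ^ (?a div 4)" by (intro mult_le_mono2) simp
  also have "... \<le> 2 ^ 32 * 2 ^ ?a" by (rule pow8_bound)
  also have "... \<le> 2 ^ 32 * (2 * N)" using exp_pa(2)[OF nh(1)] nh(2) by (intro mult_le_mono2) simp
  finally have "?a ^ 8 \<le> 2 ^ 33 * N" by simp
  then have "C\<^sup>2 * ?a ^ 8 \<le> C\<^sup>2 * (2 ^ 33 * N)" by (rule mult_le_mono2)
  also have "... \<le> N * N" using N mult_le_mono1[OF N, of N] by (simp add: mult.assoc)
  finally have "(C * ?a ^ 4)\<^sup>2 \<le> N\<^sup>2" by (simp add: power_mult_distrib power2_eq_square[of N] flip: power_mult)
  then show ?thesis by (simp add: power2_nat_le_eq_le)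
qed

subsection \<open>The dense case\<close>

definition good_bits :: "nat => nat => nat set list => bool list => bool" where
  "good_bits N m S bs \<longleftrightarrow> bs \<noteq> [] \<and> bs ! 0 \<and>
    (\<forall>w M (R :: nat => nat). N < 2 ^ w \<longrightarrow> 16 \<le> w \<longrightarrow> R 0 = w \<longrightarrow> holds_bits w bs M \<longrightarrow>
      answers_rank w M R S m \<and> answers_select w M R S \<and> answers_size w M R S)"

definition valid_sets :: "nat => nat => nat set list => bool" where
  "valid_sets m n S \<longleftrightarrow> 0 < m \<and> 0 < n \<and> (\<forall>i<length S. S ! i \<subseteq> {..<m}) \<and> (\<Sum>i<length S. card (S ! i)) = n"

text \<open>The chain of moduli starts from the bit length of \<open>d\<close>, which is about
  \<open>lg (lg m)\<close> and not bounded by any function of \<open>n\<close>. Choosing all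
  parameters for the maximum covers it and raises the error term by at most this amount
  (\<open>slack_max\<close>).\<close>

definition nhat :: "nat => nat => nat" where "nhat m n = max n (blen (blen m))"

lemma valid_sets_set_list: "valid_sets m n S ==> m \<le> B ==> set_list m B S"
  by unfold_locales (auto simp: valid_sets_def)

lemma valid_sets_le:
  assumes v: "valid_sets m n S"
  shows "n \<le> length S * m" "0 < length S" "m \<le> length S * m" "0 < nhat m n" "nhat m n \<le> length S * m"
proof -
  interpret set_list m m S using v by (rule valid_sets_set_list) simp
  have "card (merged m S) \<le> card {..<length S * m}" by (intro card_mono merged_sub) simp
  then show n: "n \<le> length S * m" using card_merged v by (simp add: valid_sets_def)
  have n0: "0 < n" using v by (simp add: valid_sets_def)
  then show s: "0 < length S" using n by (cases S) auto
  show m: "m \<le> length S * m" using s by (cases "length S") auto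
  show "0 < nhat m n" using n0 by (simp add: nhat_def)
  have "blen (blen m) \<le> length S * m" using blen_le_self le_trans m by blast
  then show "nhat m n \<le> length S * m" using n by (simp add: nhat_def)
qed

lemma pg_pT_le: "0 < nh ==> pg c nh * pT nh \<le> 2 ^ (2 * c + 1) * pa nh"
proof -
  assume nh: "0 < nh"
  have "1 * 1 \<le> pg c nh * pT nh" using pg_pos pT_pos by (intro mult_le_mono) auto
  then have "(pg c nh * pT nh) * 1 \<le> (pg c nh * pT nh) * (pg c nh * pT nh)" by (intro mult_le_mono2) simp
  also have "... \<le> 2 ^ (2 * c + 1) * pa nh" using pg_square[OF nh, of c] by (simp add: power2_eq_square)
  finally show ?thesis by simp
qed

lemma le_pow4: "0 < nh ==> pa nh \<le> pa nh ^ 4"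
  using pa_pos[of nh] power_increasing[of 1 4 "pa nh"] by simp

lemma small_params:
  assumes nh: "0 < nh"
  shows "2 \<le> pu nh" "4 * pu nh \<le> pa nh + 8" "pu nh \<le> 3 * pa nh" "pa nh ^ 3 * pu nh \<le> 3 * pa nh ^ 4"
    "pu nh \<le> 3 * pa nh ^ 4" "pa nh ^ 3 \<le> pa nh ^ 4" "pa nh ^ 2 \<le> pa nh ^ 4"
    "base2 (pu nh) (pa nh ^ 3) b2 \<le> 5 * pa nh ^ 4"
    "pg c nh * pT nh \<le> 2 ^ (2 * c + 1) * pa nh ^ 4"
proof -
  have a: "1 \<le> pa nh" using pa_pos[OF nh] by simp
  show "2 \<le> pu nh" "4 * pu nh \<le> pa nh + 8" by (simp_all add: pu_def)
  show u: "pu nh \<le> 3 * pa nh" using a unfolding pu_def by linarith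
  show "pu nh \<le> 3 * pa nh ^ 4" using u le_pow4[OF nh] by linarith
  have "pa nh ^ 3 * pu nh \<le> pa nh ^ 3 * (3 * pa nh)" using u by (rule mult_le_mono2)
  then show s: "pa nh ^ 3 * pu nh \<le> 3 * pa nh ^ 4" by (simp add: power4_eq_xxxx power3_eq_cube)
  show "pa nh ^ 3 \<le> pa nh ^ 4" "pa nh ^ 2 \<le> pa nh ^ 4" using a by (intro power_increasing; simp)+
  have "base2 (pu nh) (pa nh ^ 3) b2 \<le> pa nh ^ 3 * pu nh + 2" by (simp add: base2_def)
  then show "base2 (pu nh) (pa nh ^ 3) b2 \<le> 5 * pa nh ^ 4" using s one_le_power[OF a, of 4] by linarith
  have "pg c nh * pT nh \<le> 2 ^ (2 * c + 1) * pa nh" by (rule pg_pT_le[OF nh])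
  also have "... \<le> 2 ^ (2 * c + 1) * pa nh ^ 4" by (intro mult_le_mono2 le_pow4 nh)
  finally show "pg c nh * pT nh \<le> 2 ^ (2 * c + 1) * pa nh ^ 4" .
qed

lemma pa_le_slack: "0 < nh ==> real (pa nh) \<le> 2 ^ 34 * slack nh"
proof -
  assume nh: "0 < nh"
  have "real (pa nh) \<le> 2 ^ 34 * (real nh / real (pT nh))" using pa_power_le[OF nh, of 1] by simp
  also have "... \<le> 2 ^ 34 * slack nh" using slack_ge[of nh] by (rule mult_left_mono) simp
  finally show ?thesis .
qed

lemma hsize_le_N: "B \<le> N ==> 0 < N ==> 2400\<^sup>2 * 2 ^ 33 \<le> N ==> 4 * hsize B \<le> N"
proof -
  assume B: "B \<le> N" "0 < N" "2400\<^sup>2 * 2 ^ 33 \<le> N"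
  have "blen B \<le> blen N" by (rule blen_mono[OF B(1)])
  moreover have "1 \<le> blen N" using blen_pos[OF B(2)] by simp
  ultimately have "hsize B \<le> 600 * blen N"
    unfolding hsize_def header_size_def NPAR_def using div_le_dividend[of "blen B" 4] by simp
  also have "... \<le> 600 * pa N ^ 4" using le_pow4[OF B(2)] by (simp add: pa_def)
  finally show ?thesis using pow4_le[OF B(2) order_refl B(3)] by simp
qed

text \<open>Only the bit length counts, and there the factor \<open>d + 1\<close> contributes
  \<open>lg (lg m)\<close> and the remaining factors \<open>O(lg nh)\<close>.\<close>

definition par_bound :: "nat => nat => nat => nat" where
  "par_bound Cq d nh = Cq * ((d + 1) * (pa nh ^ 4 * nh\<^sup>2))"

lemma hsize_le_slack:
  assumes nh: "0 < nh" and B: "B \<le> par_bound Cq d nh"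
  shows "real (hsize B) \<le> 258 * (real (blen Cq) + real (blen (d + 1)) + 6 * (2 ^ 34 * slack nh)) + 260"
proof -
  let ?a = "pa nh"
  have pw: "blen (x ^ 4) \<le> 4 * blen x" for x
    using blen_mult[of "x * x * x" x] blen_mult[of "x * x" x] blen_mult[of x x] by (simp add: power4_eq_xxxx)
  have "blen B \<le> blen (par_bound Cq d nh)" by (rule blen_mono[OF B])
  also have "... \<le> blen Cq + (blen (d + 1) + (blen (?a ^ 4) + blen (nh\<^sup>2)))"
    unfolding par_bound_def by (intro order_trans[OF blen_mult] add_left_mono order_refl)
  also have "... \<le> blen Cq + (blen (d + 1) + (4 * ?a + 2 * ?a))"
  proof (intro add_left_mono add_mono)
    show "blen (?a ^ 4) \<le> 4 * ?a" using pw[of ?a] blen_le_self[of ?a] by simp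
    show "blen (nh\<^sup>2) \<le> 2 * ?a" using blen_mult[of nh nh] by (simp add: power2_eq_square pa_def)
  qed
  finally have b: "blen B \<le> blen Cq + blen (d + 1) + 6 * ?a" by simp
  \<comment> \<open>The factor 258 is \<open>2 + 4 * NPAR\<close>.\<close>
  have "hsize B \<le> 258 * blen B + 260"
    unfolding hsize_def header_size_def NPAR_def using div_le_dividend[of "blen B" 4] by simp
  then have "hsize B \<le> 258 * (blen Cq + blen (d + 1) + 6 * ?a) + 260" using b by simp
  then have "real (hsize B) \<le> real (258 * (blen Cq + blen (d + 1) + 6 * ?a) + 260)" by (simp only: of_nat_le_iff)
  also have "... = 258 * (real (blen Cq) + real (blen (d + 1)) + 6 * real ?a) + 260" by simp
  also have "... \<le> 258 * (real (blen Cq) + real (blen (d + 1)) + 6 * (2 ^ 34 * slack nh)) + 260"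
    using pa_le_slack[OF nh] by (intro add_mono mult_left_mono) auto
  finally show ?thesis .
qed

lemma par_bound_ge:
  assumes nh: "0 < nh" and x: "x \<le> Cq * ((d + 1) * (pa nh ^ i * nh ^ j))" and ij: "i \<le> 4" "j \<le> 2"
  shows "x \<le> par_bound Cq d nh"
proof -
  have "pa nh ^ i * nh ^ j \<le> pa nh ^ 4 * nh\<^sup>2"
    using pa_pos[OF nh] nh ij by (intro mult_le_mono power_increasing) auto
  then have "Cq * ((d + 1) * (pa nh ^ i * nh ^ j)) \<le> par_bound Cq d nh"
    unfolding par_bound_def by (intro mult_le_mono2)
  then show ?thesis using x by simp
qed

lemma param_limit:
  assumes nh: "0 < nh" and aux: "real aux \<le> C1 * slack nh" and n: "n \<le> nh"
    and Cq: "nat \<lceil>C1\<rceil> + 1 \<le> Cq" and N: "aux + n * d \<le> N"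
  shows "aux + n * d \<le> min N (par_bound Cq d nh)"
proof (rule min.boundedI[OF N], rule par_bound_ge[OF nh, where i = 0 and j = 1])
  have "C1 * slack nh \<le> real (nat \<lceil>C1\<rceil>) * real nh"
    using slack_le slack_nonneg by (intro mult_mono real_nat_ceiling_ge) auto
  then have "real aux \<le> real (nat \<lceil>C1\<rceil> * nh)" using aux by simp
  then have "aux \<le> nat \<lceil>C1\<rceil> * nh" by (simp only: of_nat_le_iff)
  then have "aux + n * d \<le> nat \<lceil>C1\<rceil> * nh + nh * d" using n by (intro add_mono mult_le_mono1)
  also have "... = (nat \<lceil>C1\<rceil> + d) * nh" by (simp only: distrib_right mult.commute[of nh d])
  also have "... \<le> ((nat \<lceil>C1\<rceil> + 1) * (d + 1)) * nh"
  proof (rule mult_le_mono1)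
    have "x + d \<le> (x + 1) * (d + 1)" for x :: nat by simp
    then show "nat \<lceil>C1\<rceil> + d \<le> (nat \<lceil>C1\<rceil> + 1) * (d + 1)" .
  qed
  also have "... \<le> Cq * (d + 1) * nh" using Cq by (intro mult_le_mono1)
  finally show "aux + n * d \<le> Cq * ((d + 1) * (pa nh ^ 0 * nh ^ 1))" unfolding mult.assoc by simp
qed auto

text \<open>Rounding costs one bit per block in \<open>bptr_dense\<close> and
  \<open>bptr_sparse\<close>. The directory has at least one bit per block and so absorbs this
  term.\<close>

lemma nblocks_le_aux: "0 < sg ==> 0 < u ==> nblocks U u \<le> fid_aux U u sg b1 b2 cX"
proof -
  assume "0 < sg" "0 < u"
  then have "1 \<le> blen (sg * u)" using blen_pos[of "sg * u"] by simp
  then have "(nblocks U u + 1) * 1 \<le> (nblocks U u + 1) * blen (sg * u)" by (rule mult_le_mono2)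
  then show ?thesis unfolding fid_aux_def Let_def mult_1_right by linarith
qed

lemma dense_large:
  "\<exists>C N0. \<forall>m n S. valid_sets m n S \<longrightarrow> N0 \<le> length S * m \<longrightarrow> length S * m < 2 * n * pg c (nhat m n) \<longrightarrow>
    (\<exists>bs. good_bits (length S * m) m S bs \<and>
      real (length bs) \<le> log 2 (real ((length S * m) choose n)) + C * (slack (nhat m n) + 1))"
proof -
  define Cg where "Cg = (2::nat) ^ (2 * c + 1)"
  obtain C0 where C0: "\<And>nh U cX. 0 < nh ==> U \<le> 2 * (pg c nh * nh) ==> cX \<le> 1 * (pT nh * nh) ==>
      real (fid_aux U (pu nh) (pa nh ^ 3) (pa nh ^ 2) (pg c nh * pT nh) cX) \<le> C0 * slack nh"
    using fid_aux_bound[of 2 c 1] by blast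
  define C1 where "C1 = max C0 1"
  have C1: "1 \<le> C1" "C0 \<le> C1" by (simp_all add: C1_def)
  obtain N1 where N1: "\<And>N nh x. N1 \<le> N ==> nh \<le> N ==> real x \<le> C1 * slack nh ==> 8 * x \<le> N"
    using slack_eighth[OF C1(1)] by blast
  define Cq where "Cq = nat \<lceil>C1\<rceil> + 1 + 2 * Cg + 5"
  define C4 where "C4 = Cg + 9"
  \<comment> \<open>From here on the directories take at most \<open>N / 8\<close> bits, the
    polylogarithmic parameters stay below \<open>N\<close>, and the header takes at most
    \<open>N / 4\<close> bits.\<close>
  define N0 where "N0 = max N1 (max (C4\<^sup>2 * 2 ^ 33) (2400\<^sup>2 * 2 ^ 33))"
  define C where "C = 258 * (real (blen Cq) + 1 + 6 * 2 ^ 34) + 260 + 2 * C1 + 3 * 2 ^ 34"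
  show ?thesis
  proof (intro exI[of _ C] exI[of _ N0] allI impI)
    fix m n S
    assume v: "valid_sets m n S" and NN: "N0 \<le> length S * m" and small: "length S * m < 2 * n * pg c (nhat m n)"
    define N nh where "N = length S * m" and "nh = nhat m n"
    note vl = valid_sets_le[OF v, folded N_def nh_def]
    have nh: "0 < nh" and nhN: "nh \<le> N" using vl by auto
    have N0: "N1 \<le> N" "C4\<^sup>2 * 2 ^ 33 \<le> N" "2400\<^sup>2 * 2 ^ 33 \<le> N" using NN by (auto simp: N0_def N_def)
    define a u g T X where "a = pa nh" and "u = pu nh" and "g = pg c nh" and "T = pT nh" and "X = merged m S"
    note sp = small_params[OF nh, folded a_def u_def]
    have gT: "g * T \<le> Cg * a ^ 4" using sp(9)[of c] by (simp add: g_def T_def Cg_def)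
    have a1: "1 \<le> a" using pa_pos[OF nh] by (simp add: a_def)
    have a4: "C4 * a ^ 4 \<le> N" unfolding a_def by (rule pow4_le[OF nh nhN N0(2)])
    have a4': "k * a ^ 4 \<le> N" if "k \<le> C4" for k using mult_le_mono1[OF that, of "a ^ 4"] a4 by (rule le_trans)
    have a41: "1 \<le> a ^ 4" using a1 by simp
    interpret sl: set_list m m S using v by (rule valid_sets_set_list) simp
    have cX: "card X = n" unfolding X_def using sl.card_merged v by (simp add: valid_sets_def)
    have XU: "X \<subseteq> {..<N}" unfolding X_def N_def by (rule sl.merged_sub)
    have nn: "n \<le> nh" by (simp add: nh_def nhat_def)
    have UN: "N \<le> 2 * (g * nh)"
    proof -
      have "N \<le> 2 * n * g" using small unfolding N_def nh_def g_def by simp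
      also have "... \<le> 2 * nh * g" using nn by simp
      finally show ?thesis by (simp add: mult_ac)
    qed
    define aux where "aux = fid_aux N u (a ^ 3) (a ^ 2) (g * T) n"
    have auxs: "real aux \<le> C1 * slack nh"
    proof -
      have "n \<le> 1 * (T * nh)" using le_trans[OF nn, of "T * nh"] pT_pos(1)[of nh] by (simp add: T_def)
      then have "real aux \<le> C0 * slack nh"
        unfolding aux_def using C0[OF nh UN[unfolded g_def]] by (simp add: a_def u_def g_def T_def)
      also have "... \<le> C1 * slack nh" using C1 slack_nonneg by (intro mult_right_mono) auto
      finally show ?thesis .
    qed
    have aux8: "8 * aux \<le> N" by (rule N1[OF N0(1) nhN auxs])
    define B where "B = min N (par_bound Cq 0 nh)"
    have le_B: "x \<le> B" if "x \<le> N" "x \<le> Cq * ((0 + 1) * (a ^ i * nh ^ j))" "i \<le> 4" "j \<le> 2" for x i j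
      using par_bound_ge[OF nh, of x Cq 0 i j] that by (simp add: B_def a_def)
    have CqC: "2 * Cg + 5 \<le> Cq" "1 \<le> Cq" by (simp_all add: Cq_def)
    have Bp: "k * a ^ 4 \<le> B" if "k \<le> Cg + 5" for k
    proof (rule le_B[where i = 4 and j = 0])
      show "k * a ^ 4 \<le> N" using that by (intro a4') (simp add: C4_def)
      show "k * a ^ 4 \<le> Cq * ((0 + 1) * (a ^ 4 * nh ^ 0))" using that CqC by simp
    qed auto
    have Bm: "m \<le> B"
    proof (rule le_B[where i = 4 and j = 1])
      show "m \<le> N" using vl by simp
      have "m \<le> 2 * (g * 1 * nh)" using vl(3) UN by simp
      also have "... \<le> 2 * (g * T * nh)" unfolding T_def by (intro mult_le_mono2 mult_le_mono1 pT_pos)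
      also have "... \<le> 2 * (Cg * a ^ 4 * nh)" using gT by (intro mult_le_mono2 mult_le_mono1)
      also have "... \<le> Cq * (a ^ 4 * nh)" unfolding mult.assoc[symmetric] using CqC by (intro mult_le_mono1) simp
      finally show "m \<le> Cq * ((0 + 1) * (a ^ 4 * nh ^ 1))" by simp
    qed auto
    have Baux: "aux \<le> B"
    proof -
      have "nat \<lceil>C1\<rceil> + 1 \<le> Cq" unfolding Cq_def by linarith
      then show ?thesis unfolding B_def using param_limit[OF nh auxs nn, of Cq 0 N] aux8 by simp
    qed
    \<comment> \<open>Four empty arrays take the places that only sparse instances fill.\<close>
    define D :: "arr list" where "D = replicate 4 (0, 0, \<lambda>_. 0)"
    define ps where "ps = [0, m, 0, u, a ^ 3, a ^ 2, g * T, base2 u (a ^ 3) (g * T)] @ replicate 8 0"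
    have D4: "length D = 4" by (simp add: D_def)
    have Ds: "sum_list (map arr_size D) = 0" by (simp add: D_def arr_size_def numeral_eq_Suc)
    have pl: "length ps = 16" by (simp add: ps_def)
    have pn: "ps ! 3 = u" "ps ! 4 = a ^ 3" "ps ! 5 = a ^ 2" "ps ! 6 = g * T" "ps ! 7 = base2 u (a ^ 3) (g * T)"
      "ps ! 1 = m" "ps ! 2 = 0" by (simp_all add: ps_def)
    have Bps: "x \<le> B" if "x \<in> set ps" for x
    proof -
      have "x = 0 \<or> x = m \<or> x = u \<or> x = a ^ 3 \<or> x = a ^ 2 \<or> x = g * T \<or> x = base2 u (a ^ 3) (g * T)"
        using that by (auto simp: ps_def)
      then show ?thesis
        using Bm sp(5-8) gT Bp[of 3] Bp[of 1] Bp[of 5] Bp[of Cg] by (elim disjE) (auto intro: order_trans)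
    qed
    have B1: "1 \<le> B" using Bm v by (simp add: valid_sets_def)
    have BN: "B \<le> N" by (simp add: B_def)
    have h4: "4 * hsize B \<le> N" using hsize_le_N[OF BN _ N0(3)] nh nhN by simp
    \<comment> \<open>Every block saves one bit by \<open>clen_le\<close>. There are at least
      \<open>u\<close> whole blocks, so the savings pay for the additional one.\<close>
    have ptr: "bptr X u (nblocks N u) \<le> N"
    proof -
      have u2: "0 < u" using sp(1) by simp
      have "u * u \<le> N"
      proof -
        have "u * u \<le> (3 * a) * (3 * a)" using sp(3) by (rule mult_le_mono[OF _ sp(3)])
        also have "... = 9 * a ^ 2" by (simp add: power2_eq_square)
        also have "... \<le> 9 * a ^ 4" using sp(7) by simp
        finally show ?thesis using a4'[of 9] by (simp add: C4_def)
      qed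
      then have k: "u \<le> N div u" using u2 by (simp add: less_eq_div_iff_mult_less_eq)
      have "bptr X u (nblocks N u) \<le> (N div u + 1) * (u - 1)" unfolding nblocks_def by (rule bptr_le_mult[OF u2])
      also have "... \<le> N div u * (u - 1) + N div u" using k by simp
      also have "... = N div u * u" using u2 by (cases u) auto
      also have "... \<le> N" by simp
      finally show ?thesis .
    qed
    have N4: "4 \<le> N" using N0(3) by simp
    have blN: "pa nh \<le> blen N" unfolding pa_def by (rule blen_mono[OF nhN])
    have Dw: "fst y \<le> arr_size y \<and> fst y \<le> blen N" if "y \<in> set D" for y using that by (simp add: D_def)
    have g0: "0 < g * T" using pg_pos(1)[of c nh] pT_pos(1)[of nh] by (simp add: g_def T_def)
    have fit: "hsize B + (fid_aux N u (a ^ 3) (a ^ 2) (g * T) (card X) + sum_list (map arr_size D)) \<le> N"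
      using h4 aux8 unfolding cX Ds aux_def by simp
    have sgu: "a ^ 3 * u \<le> N" using sp(4) a4'[of 3] by (simp add: C4_def)
    have u8: "4 * u \<le> blen N + 8" using sp(2) blN by (simp add: a_def)
    have auxB: "fid_aux N u (a ^ 3) (a ^ 2) (g * T) (card X) + sum_list (map arr_size D) \<le> B"
      using Baux unfolding cX Ds aux_def by simp
    have a3: "0 < a ^ 3" "0 < a ^ 2" using a1 by simp_all
    note inst = fid_instance[OF XU order_refl D4 pl pn(1-5) Bps B1 BN auxB Dw fit sgu sp(1) u8 a3 g0 ptr N4]
    define bs where "bs = mk_bits (blen B div 4 + 1) ps (layout X N u (a ^ 3) (a ^ 2) (g * T) D)"
    have "good_bits N m S bs"
      unfolding good_bits_def
    proof (intro conjI allI impI)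
      show "bs \<noteq> []" "bs ! 0" unfolding bs_def using inst(3,4) by auto
      fix w and M R :: "nat => nat" assume w: "N < 2 ^ w" "16 \<le> w" "R 0 = w" "holds_bits w bs M"
      interpret f: fid w M R "blen B div 4 + 1" ps "layout X N u (a ^ 3) (a ^ 2) (g * T) D" X N u "a ^ 3" "a ^ 2" "g * T"
        using inst(1) w unfolding bs_def by blast
      show "answers_rank w M R S m" "answers_select w M R S" "answers_size w M R S"
        using f.dense_answers[OF sl.set_list_axioms X_def N_def pn(6,7)] by auto
    qed
    moreover have "real (length bs) \<le> log 2 (real (N choose n)) + C * (slack nh + 1)"
    proof -
      have u0: "0 < u" using sp(1) by simp
      have lb: "length bs = hsize B + aux + bptr X u (nblocks N u)"
        unfolding bs_def using inst(2) by (simp add: cX Ds aux_def)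
      have b1: "blen (0 + 1) = 1" using blen_pos[of 1] blen_le[of 1 1] by simp
      have h: "real (hsize B) \<le> 258 * (real (blen Cq) + 1 + 6 * (2 ^ 34 * slack nh)) + 260"
        using hsize_le_slack[OF nh, of B Cq 0] b1 by (simp add: B_def)
      have bp: "real (bptr X u (nblocks N u)) \<le> log 2 (real (N choose n)) + real (nblocks N u) + real u"
        using bptr_dense[OF XU u0] cX by simp
      have nb: "real (nblocks N u) \<le> real aux"
        unfolding aux_def using nblocks_le_aux[OF a3(1) u0] by simp
      have uu: "real u \<le> 3 * (2 ^ 34 * slack nh)" using sp(3) pa_le_slack[OF nh] by (simp add: a_def)
      have s0: "0 \<le> slack nh" by (rule slack_nonneg)
      have e: "C * (slack nh + 1) = 258 * (real (blen Cq) + 1 + 6 * (2 ^ 34 * slack nh)) + 260 +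
          2 * (C1 * slack nh) + 3 * (2 ^ 34 * slack nh) +
          ((258 * (real (blen Cq) + 1) + 260) * slack nh + 258 * 6 * 2 ^ 34 + 2 * C1 + 3 * 2 ^ 34)"
        by (simp add: C_def algebra_simps)
      have "0 \<le> (258 * (real (blen Cq) + 1) + 260) * slack nh + 258 * 6 * 2 ^ 34 + 2 * C1 + 3 * 2 ^ 34"
        using s0 C1 by simp
      then show ?thesis unfolding e lb using h bp nb uu auxs by simp
    qed
    ultimately show "\<exists>bs. good_bits (length S * m) m S bs \<and>
        real (length bs) \<le> log 2 (real ((length S * m) choose n)) + C * (slack (nhat m n) + 1)"
      unfolding N_def nh_def by blast
  qed
qed

subsection \<open>The sparse case\<close>

text \<open>A threshold between 8 and 16 times \<open>pa nh\<close>: large enough for the global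
  moduli to leave at most \<open>Th\<close> bits (\<open>num0\<close>), and small enough for shared
  moduli of \<open>O(lg (lg n))\<close> bits.\<close>

definition pTh :: "nat => nat" where "pTh nh = 2 ^ (pb nh + 3)"

lemma pt_le_pb: "pt nh \<le> pb nh"
  by (simp add: pt_def)

lemma table_entry_le: "2 * (pTh nh * (pT nh * (pTh nh)\<^sup>2)) + 8 < 2 ^ (4 * pb nh + 11)"
proof -
  have "pTh nh * (pT nh * (pTh nh)\<^sup>2) = 2 ^ (3 * pb nh + 9 + pt nh)"
    unfolding pTh_def pT_def power2_eq_square by (simp flip: power_add)
  also have "... \<le> 2 ^ (4 * pb nh + 9)" using pt_le_pb[of nh] by (intro power_increasing) auto
  finally have "pTh nh * (pT nh * (pTh nh)\<^sup>2) \<le> 2 ^ (4 * pb nh + 9)" .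
  moreover have "(2::nat) ^ 9 \<le> 2 ^ (4 * pb nh + 9)" by (intro power_increasing) auto
  moreover have "(2::nat) ^ (4 * pb nh + 11) = 4 * 2 ^ (4 * pb nh + 9)" by (simp add: power_add)
  ultimately show ?thesis by simp
qed

lemma table_entry_pow4: "0 < nh ==> 2 * (pTh nh * (pT nh * (pTh nh)\<^sup>2)) + 8 \<le> 32768 * pa nh ^ 4"
proof -
  assume nh: "0 < nh"
  have "(2::nat) ^ (4 * pb nh + 11) = 2048 * (2 ^ pb nh) ^ 4" by (simp add: power_add power_mult[symmetric] mult.commute)
  also have "... \<le> 2048 * (2 * pa nh) ^ 4" using exp_pb(2)[OF nh] by (intro mult_le_mono2 power_mono) auto
  also have "... = 32768 * pa nh ^ 4" by (simp add: power_mult_distrib)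
  finally show ?thesis using table_entry_le[of nh] by simp
qed

lemma exp_add_8: "2 * 2 ^ (k + 4) + 8 < (2::nat) ^ (k + 6)"
proof -
  define z where "z = (2::nat) ^ k"
  have "0 < z" by (simp add: z_def)
  then show ?thesis unfolding power_add z_def[symmetric] by simp
qed

lemma num0:
  assumes n: "0 < n" "n \<le> nh" and d: "blen d \<le> nh"
  shows "2 * (blen (2 * (d * n\<^sup>2) + 8) * n\<^sup>2) + 8 < 2 ^ pTh nh"
proof -
  let ?a = "pa nh"
  have nh: "nh < 2 ^ ?a" "0 < nh" using exp_pa n by auto
  have a1: "1 \<le> ?a" using pa_pos[OF nh(2)] by simp
  have "blen (d * n\<^sup>2) \<le> blen d + 2 * blen n"
    using blen_mult[of d "n * n"] blen_mult[of n n] by (simp add: power2_eq_square)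
  moreover have "blen n \<le> ?a" unfolding pa_def by (rule blen_mono[OF n(2)])
  moreover have "blen (2 * (d * n\<^sup>2) + 8) \<le> Suc (max (blen (2 * (d * n\<^sup>2))) (blen 8))" by (rule blen_add)
  moreover have "blen (2 * (d * n\<^sup>2)) \<le> 2 + blen (d * n\<^sup>2)" using blen_mult[of 2 "d * n\<^sup>2"] blen_le[of 2 2] by simp
  moreover have "blen 8 \<le> 4" by (rule blen_le) simp
  ultimately have "blen (2 * (d * n\<^sup>2) + 8) \<le> nh + 2 * ?a + 7" using d by simp
  also have "... \<le> 16 * 2 ^ ?a" using nh less_exp[of ?a] one_le_power[of "2::nat" ?a] by linarith
  finally have b: "blen (2 * (d * n\<^sup>2) + 8) \<le> 16 * 2 ^ ?a" .
  have "n\<^sup>2 \<le> (2 ^ ?a)\<^sup>2" using nh n by (intro power_mono) auto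
  then have "blen (2 * (d * n\<^sup>2) + 8) * n\<^sup>2 \<le> 16 * 2 ^ ?a * (2 ^ ?a)\<^sup>2" by (rule mult_le_mono[OF b])
  also have "... = 2 ^ (4 + ?a + ?a * 2)" unfolding power_mult power_add by simp
  also have "4 + ?a + ?a * 2 = 3 * ?a + 4" by simp
  finally have "2 * (blen (2 * (d * n\<^sup>2) + 8) * n\<^sup>2) + 8 \<le> 2 * 2 ^ (3 * ?a + 4) + 8" by simp
  also have "... < 2 ^ (3 * ?a + 6)" using exp_add_8[of "3 * ?a"] by simp
  also have "... \<le> 2 ^ pTh nh"
  proof -
    have "?a + 1 \<le> 2 ^ pb nh" using exp_pb(1)[of nh] by simp
    then have "3 * ?a + 6 \<le> pTh nh" unfolding pTh_def power_add using a1 by simp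
    then show ?thesis by (intro power_increasing) auto
  qed
  finally show ?thesis .
qed

text \<open>The second modulus of a small bucket is about \<open>k ^ 2\<close> times the bit length
  of a shared modulus. This length is \<open>O(tau + 1)\<close>, since \<open>lg (lg n)\<close> is
  less than \<open>KAP * (tau + 1)\<close>; even a bucket of two keys has room for it.\<close>

lemma num1:
  assumes k: "2 \<le> k"
  shows "2 * (blen (2 * (pTh nh * (pT nh * (pTh nh)\<^sup>2)) + 8) * k\<^sup>2) + 8 < 2 ^ (NX * (clg k + pt nh))"
proof -
  let ?l = "clg k" and ?t = "pt nh"
  have l: "k \<le> 2 ^ ?l" "1 \<le> ?l" using clg[OF k] by auto
  have "blen (2 * (pTh nh * (pT nh * (pTh nh)\<^sup>2)) + 8) \<le> 4 * pb nh + 11" by (rule blen_le[OF table_entry_le])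
  also have "... \<le> 20011 * (?t + 1)" using pb_less[of nh] by (simp add: KAP_def)
  also have "... \<le> 2 ^ 15 * 2 ^ ?t" using less_exp[of ?t] by (intro mult_le_mono) (simp_all add: Suc_leI)
  finally have b: "blen (2 * (pTh nh * (pT nh * (pTh nh)\<^sup>2)) + 8) \<le> 2 ^ 15 * 2 ^ ?t" .
  have "k\<^sup>2 \<le> (2 ^ ?l)\<^sup>2" using l by (intro power_mono) auto
  then have "blen (2 * (pTh nh * (pT nh * (pTh nh)\<^sup>2)) + 8) * k\<^sup>2 \<le> 2 ^ 15 * 2 ^ ?t * (2 ^ ?l)\<^sup>2"
    by (rule mult_le_mono[OF b])
  also have "... = 2 ^ (15 + ?t + ?l * 2)" unfolding power_mult power_add by simp
  also have "15 + ?t + ?l * 2 = 15 + ?t + 2 * ?l" by simp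
  finally have "2 * (blen (2 * (pTh nh * (pT nh * (pTh nh)\<^sup>2)) + 8) * k\<^sup>2) + 8 \<le> 2 * 2 ^ (15 + ?t + 2 * ?l) + 8" by simp
  also have "... < 2 ^ (17 + ?t + 2 * ?l)"
    using exp_add_8[of "11 + ?t + 2 * ?l"] by (simp add: add_ac)
  also have "... \<le> 2 ^ (NX * (?l + ?t))"
    using l by (intro power_increasing) (auto simp: NX_def)
  finally show ?thesis .
qed

definition extra :: "nat => nat => nat" where
  "extra nh n = (n div pa nh + 2) * blen (clg n + 1) + (clg n + 1) * pa nh * blen (clg n + 1) +
    (n div pT nh + 1) * blen (2 * (pTh nh * (pT nh * (pTh nh)\<^sup>2)) + 8)"

lemma clg_bounds:
  assumes "0 < n" "n \<le> nh"
  shows "clg n \<le> pa nh" "blen (clg n + 1) \<le> 2 * pb nh" "blen (clg n + 1) \<le> 2 * pa nh"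
proof -
  have nh: "0 < nh" using assms by simp
  show c: "clg n \<le> pa nh" unfolding clg_def pa_def using assms by (intro blen_mono) simp
  have "clg n + 1 < 2 ^ (pb nh + 1)" using c exp_pb(1)[of nh] by simp
  then have "blen (clg n + 1) \<le> pb nh + 1" by (rule blen_le)
  then show "blen (clg n + 1) \<le> 2 * pb nh" using pb_pos[OF nh] by simp
  show "blen (clg n + 1) \<le> 2 * pa nh" using blen_le_self[of "clg n + 1"] c pa_pos[OF nh] by simp
qed

lemma extra_bound: "\<exists>C. \<forall>nh n. 0 < n \<longrightarrow> n \<le> nh \<longrightarrow> real (extra nh n) \<le> C * slack nh"
proof -
  define K :: real where "K = 2 ^ 34"
  define k where "k = real KAP"
  define C where "C = (2 + 2 * K) * (2 * k) + 4 * K + (1 + K) * (15 * k)"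
  have K0: "0 \<le> K" "0 \<le> k" by (simp_all add: K_def k_def)
  show ?thesis
  proof (intro exI[of _ C] allI impI)
    fix nh n :: nat assume n: "0 < n" "n \<le> nh"
    have nh: "0 < nh" using n by simp
    define a b T where "a = pa nh" and "b = pb nh" and "T = pT nh"
    define e where "e = real nh / real T"
    define t1 where "t1 = real (pt nh) + 1"
    have e0: "0 \<le> e" by (simp add: e_def)
    have t1: "1 \<le> t1" by (simp add: t1_def)
    have T1: "1 \<le> T" using pT_pos by (simp add: T_def)
    have a1: "1 \<le> a" using pa_pos[OF nh] by (simp add: a_def)
    have sl: "slack nh = e * t1" by (simp add: slack_def e_def t1_def T_def)
    have pw: "real (a ^ i) \<le> K * e" if "i \<le> 7" for i
      unfolding of_nat_power a_def K_def e_def T_def by (rule pa_power_le[OF nh that])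
    have one: "1 \<le> K * e" using pw[of 0] by simp
    have b: "real b \<le> k * t1"
    proof -
      have "b \<le> KAP * (pt nh + 1)" using pb_less[of nh] by (simp add: b_def)
      then have "real b \<le> real (KAP * (pt nh + 1))" by (simp only: of_nat_le_iff)
      then show ?thesis by (simp add: t1_def k_def algebra_simps)
    qed
    have b1: "1 \<le> b" using pb_pos[OF nh] by (simp add: b_def)
    note cb = clg_bounds[OF n, folded a_def b_def]
    have 1: "real ((n div a + 2) * blen (clg n + 1)) \<le> ((2 + 2 * K) * e) * (2 * k * t1)"
    proof -
      have "real (n div a) \<le> real n / real a" by (rule of_nat_div_le_of_nat)
      also have "... \<le> real nh / (real T / 2)"
        using n pT_le[OF nh] T1 by (intro frac_le) (auto simp: T_def a_def)
      also have "... = 2 * e" by (simp add: e_def)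
      finally have "real (n div a + 2) \<le> (2 + 2 * K) * e" using one by (simp add: algebra_simps)
      moreover have "real (blen (clg n + 1)) \<le> 2 * k * t1" using cb(2) b by linarith
      ultimately show ?thesis unfolding of_nat_mult using K0 e0 by (intro mult_mono) auto
    qed
    have 2: "real ((clg n + 1) * a * blen (clg n + 1)) \<le> 4 * (K * e)"
    proof -
      have "(clg n + 1) * a * blen (clg n + 1) \<le> (2 * a) * a * (2 * a)"
        using cb a1 by (intro mult_le_mono) auto
      also have "... = 4 * a ^ 3" by (simp add: power3_eq_cube)
      finally have "real ((clg n + 1) * a * blen (clg n + 1)) \<le> real (4 * a ^ 3)" by (simp only: of_nat_le_iff)
      then show ?thesis using pw[of 3] by simp
    qed
    have 3: "real ((n div T + 1) * blen (2 * (pTh nh * (T * (pTh nh)\<^sup>2)) + 8)) \<le> ((1 + K) * e) * (15 * k * t1)"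
    proof -
      have "real (n div T) \<le> real n / real T" by (rule of_nat_div_le_of_nat)
      also have "... \<le> e" unfolding e_def using n by (intro divide_right_mono) auto
      finally have "real (n div T + 1) \<le> (1 + K) * e" using one by (simp add: algebra_simps)
      moreover have "blen (2 * (pTh nh * (T * (pTh nh)\<^sup>2)) + 8) \<le> 4 * b + 11"
        unfolding T_def b_def by (rule blen_le[OF table_entry_le])
      then have "real (blen (2 * (pTh nh * (T * (pTh nh)\<^sup>2)) + 8)) \<le> 15 * k * t1" using b b1 by linarith
      ultimately show ?thesis unfolding of_nat_mult[of "n div T + 1"] using K0 e0 by (intro mult_mono) auto
    qed
    have 4: "4 * (K * e) \<le> 4 * K * (e * t1)"
      using t1 e0 K0 mult_left_mono[of 1 t1 "4 * K * e"] by (simp add: mult_ac)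
    have "C * (e * t1) = ((2 + 2 * K) * e) * (2 * k * t1) + 4 * K * (e * t1) + ((1 + K) * e) * (15 * k * t1)"
      by (simp add: C_def algebra_simps)
    then show "real (extra nh n) \<le> C * slack nh"
      unfolding sl extra_def a_def[symmetric] T_def[symmetric] of_nat_add using 1 2 3 4 by linarith
  qed
qed

text \<open>Heads and slots together cost the entropy plus the effect of rounding. The universe of
  each set is rounded up to a multiple of \<open>D\<close> and the heads to whole blocks, so
  \<open>N\<close> grows by \<open>(s + u) * D\<close>, relative to \<open>N\<close> by
  \<open>(s + u) / (n * g)\<close>. This is where the number of sets must be \<open>O(n)\<close>:
  the loss \<open>4 * s / g\<close> is then \<open>o(n)\<close>.\<close>

lemma sparse_entropy:
  fixes N n s u g D Hp :: nat
  assumes n: "0 < n" and g: "0 < g" and ng: "D * (n * g) \<le> N" and N2: "2 * (n * g) \<le> N" and D: "0 < D"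
    and HN: "N \<le> Hp * D" and HpD: "Hp * D \<le> N + (s + u) * D" and nH: "n \<le> Hp"
  shows "real n * log 2 (real D) + log 2 (real (Hp choose n)) \<le>
    log 2 (real (N choose n)) + 4 * (real s + real u) / real g"
proof -
  have "2 * (n * 1) \<le> 2 * (n * g)" using g by (intro mult_le_mono2) simp
  then have nN: "2 * n \<le> N" using N2 unfolding mult_1_right by (rule le_trans)
  have N0: "0 < real N" using nN n by simp
  define \<rho> where "\<rho> = 2 * (real s + real u) * real D / real N"
  have r0: "0 \<le> \<rho>" by (simp add: \<rho>_def)
  have r: "real (Hp * D) - real N \<le> \<rho> * (real N - real n)"
  proof -
    have "real (Hp * D) \<le> real (N + (s + u) * D)" using HpD by (simp only: of_nat_le_iff)
    then have "real (Hp * D) - real N \<le> (real s + real u) * real D" by simp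
    also have "... = \<rho> * (real N / 2)" using N0 by (simp add: \<rho>_def)
    also have "... \<le> \<rho> * (real N - real n)" using r0 nN by (intro mult_left_mono) auto
    finally show ?thesis .
  qed
  have pos: "0 < real (Hp choose n)" "0 < real (N choose n)" using nH nN by simp_all
  have D0: "0 < real D" using D by simp
  have "real n * log 2 (real D) + log 2 (real (Hp choose n)) = log 2 (real (Hp choose n) * real D ^ n)"
    using pos D0 by (subst log_mult) (auto simp: log_nat_power)
  also have "... \<le> log 2 (real (N choose n) * (1 + \<rho>) ^ n)"
  proof -
    have "real (Hp choose n) * real D ^ n \<le> real ((Hp * D) choose n)" by (rule choose_scale[OF nH D])
    also have "... \<le> real (N choose n) * (1 + \<rho>) ^ n" using nN HN r0 r by (intro choose_ratio) auto
    finally show ?thesis using pos D0 r0 by (subst log_le_cancel_iff) auto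
  qed
  also have "... = log 2 (real (N choose n)) + real n * log 2 (1 + \<rho>)"
    using pos r0 by (subst log_mult) (auto simp: log_nat_power)
  also have "... \<le> log 2 (real (N choose n)) + real n * (2 * \<rho>)"
    using log2_add1_le[OF r0] by (intro add_left_mono mult_left_mono) auto
  also have "real n * (2 * \<rho>) \<le> 4 * (real s + real u) / real g"
  proof -
    have "real (D * (n * g)) \<le> real N" using ng by (simp only: of_nat_le_iff)
    then have "real n * real D / real N \<le> 1 / real g" using N0 g by (simp add: field_simps)
    then have "4 * (real s + real u) * (real n * real D / real N) \<le> 4 * (real s + real u) * (1 / real g)"
      by (rule mult_left_mono) simp
    then show ?thesis by (simp add: \<rho>_def mult_ac)
  qed
  finally show ?thesis by simp
qed

text \<open>The choice of \<open>d\<close> puts \<open>2 ^ d\<close> within a factor 2 below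
  \<open>N / (n * g)\<close>; it is positive because \<open>N\<close> is at least
  \<open>2 * n * g\<close>. The condition on \<open>Kc\<close> limits the rounding of the sets to
  \<open>N / 32\<close>. With \<open>2 ^ 13 * T \<le> g\<close> the 523 regions of about
  \<open>2 * n * T\<close> positions remain a small fraction of \<open>N\<close>, so that heads and
  regions together fit into \<open>N\<close> positions.\<close>

lemma sparse_geometry:
  fixes m s n g nh u Kc T c :: nat
  assumes m: "0 < m" and n: "0 < n" and s: "0 < s" and sK: "s \<le> Kc * n" and N2: "2 * n * g \<le> s * m"
    and g: "2 ^ c * T \<le> g" "0 < T" and c: "13 \<le> c" "32 * Kc \<le> 2 ^ c"
  defines "N \<equiv> s * m"
  defines "d \<equiv> blen (N div (n * g)) - 1"
  defines "m1 \<equiv> m div 2 ^ d + 1"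
  shows "1 \<le> d" "2 ^ d * (n * g) \<le> N" "N < 2 ^ (d + 1) * (n * g)" "m \<le> m1 * 2 ^ d"
    "n * g \<le> s * m1" "s * m1 \<le> 2 * (n * g) + s" "N \<le> s * m1 * 2 ^ d" "s * m1 * 2 ^ d \<le> N + s * 2 ^ d"
    "64 * (s * m1) \<le> 33 * N" "16384 * (n * T) \<le> N" "4 * (n * d) \<le> N" "2 ^ d \<le> m" "2 ^ (d + 1) \<le> N" "4 \<le> g"
proof -
  have c13: "8192 \<le> (2::nat) ^ c" using power_increasing[OF c(1), of "2::nat"] by simp
  have gT: "8192 * T \<le> g" using mult_le_mono1[OF c13, of T] g(1) by (rule le_trans)
  then show g4: "4 \<le> g" using g(2) by simp
  have g2: "2 ^ c \<le> g" using le_trans[OF mult_le_mono2[of 1 T "2 ^ c"] g(1)] g(2) by simp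
  have ng: "0 < n * g" using n g4 by simp
  define x where "x = N div (n * g)"
  have x2: "2 \<le> x" unfolding x_def N_def using N2 ng by (simp add: less_eq_div_iff_mult_less_eq mult_ac)
  have bx: "2 \<le> blen x"
  proof (rule ccontr)
    assume "\<not> 2 \<le> blen x"
    then have "x < 2 ^ 1" by (subst blen_le_iff[symmetric]) simp
    then show False using x2 by simp
  qed
  have d1: "blen x = d + 1" using bx by (simp add: d_def x_def)
  show d: "1 \<le> d" using d1 bx by simp
  have "2 ^ (d + 1) \<le> 2 * x" using exp_blen_le[of x] x2 d1 by simp
  then have dx: "2 ^ d \<le> x" by simp
  have xd: "x < 2 ^ (d + 1)" using less_exp_blen[of x] d1 by simp
  have "2 ^ d * (n * g) \<le> x * (n * g)" using dx by (rule mult_le_mono1)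
  also have "... \<le> N" by (simp add: x_def)
  finally show dN: "2 ^ d * (n * g) \<le> N" .
  have "N < (x + 1) * (n * g)" unfolding x_def using dividend_less_div_times[OF ng, of N] by simp
  also have "... \<le> 2 ^ (d + 1) * (n * g)" using xd by (intro mult_le_mono1) simp
  finally show Nd: "N < 2 ^ (d + 1) * (n * g)" .
  define D where "D = (2::nat) ^ d"
  have D2: "2 \<le> D" unfolding D_def using power_increasing[OF d, of "2::nat"] by simp
  have D0: "0 < D" using D2 by simp
  have mD: "m < m1 * D" unfolding m1_def D_def[symmetric] using dividend_less_div_times[OF D0, of m] by simp
  then show "m \<le> m1 * 2 ^ d" by (simp add: D_def)
  have m1D: "m1 * D \<le> m + D" unfolding m1_def D_def[symmetric] by simp
  have "s * m \<le> s * (m1 * D)" using mD by simp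
  then show NH: "N \<le> s * m1 * 2 ^ d" by (simp add: N_def D_def mult.assoc)
  have "s * (m1 * D) \<le> s * (m + D)" using m1D by (rule mult_le_mono2)
  then show HN: "s * m1 * 2 ^ d \<le> N + s * 2 ^ d" by (simp add: N_def D_def algebra_simps)
  have "D * (n * g) \<le> D * (s * m1)" using le_trans[OF dN NH] unfolding D_def[symmetric] mult.commute[of D] .
  then show "n * g \<le> s * m1" using D0 by (simp only: mult_le_cancel1)
  have "D * (s * m1) \<le> D * (2 * (n * g) + s)"
    using HN Nd by (simp add: D_def algebra_simps)
  then show "s * m1 \<le> 2 * (n * g) + s" using D0 by (simp only: mult_le_cancel1)
  have KD: "32 * (Kc * n * D) \<le> N"
  proof -
    have "32 * (Kc * n * D) = (32 * Kc) * (n * D)" by simp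
    also have "... \<le> g * (n * D)" using c(2) g2 by (intro mult_le_mono1) simp
    also have "... \<le> N" using dN by (simp add: D_def mult_ac)
    finally show ?thesis .
  qed
  have sD: "32 * (s * D) \<le> N"
  proof -
    have "32 * (s * D) \<le> 32 * (Kc * n * D)" using sK by (intro mult_le_mono2 mult_le_mono1)
    then show ?thesis using KD by (rule le_trans)
  qed
  have "2 * (s * m1) \<le> D * (s * m1)" using D2 by (rule mult_le_mono1)
  also have "... \<le> N + s * D" using HN by (simp add: D_def mult_ac)
  finally show "64 * (s * m1) \<le> 33 * N" using sD by linarith
  have "16384 * (n * T) = 2 * (n * (8192 * T))" by simp
  also have "... \<le> 2 * (n * g)" using gT by (intro mult_le_mono2)
  also have "... \<le> N" using N2 by (simp add: N_def mult_ac)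
  finally show "16384 * (n * T) \<le> N" .
  have "4 * (n * d) \<le> g * (n * D)" using g4 less_exp[of d] unfolding D_def by (intro mult_le_mono) auto
  also have "... \<le> N" using dN by (simp add: D_def mult_ac)
  finally show "4 * (n * d) \<le> N" .
  have K0: "0 < Kc" using s sK by (cases Kc) auto
  have "Kc * n * D \<le> s * m" using KD by (simp add: N_def)
  also have "... \<le> Kc * n * m" using sK by (rule mult_le_mono1)
  finally have "D \<le> m" using K0 n by simp
  then show "2 ^ d \<le> m" by (simp add: D_def)
  have "2 * (D * 1) \<le> g * (D * n)" using g4 n by (intro mult_le_mono) auto
  also have "... \<le> N" using dN by (simp add: D_def mult_ac)
  finally show "2 ^ (d + 1) \<le> N" by (simp add: D_def)
qed

lemma sparse_large:
  fixes c Kc :: nat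
  assumes c: "13 \<le> c" "32 * Kc \<le> 2 ^ c"
  shows "\<exists>C N0. \<forall>m n S. valid_sets m n S \<longrightarrow> length S \<le> Kc * n \<longrightarrow> N0 \<le> length S * m \<longrightarrow>
    2 * n * pg c (nhat m n) \<le> length S * m \<longrightarrow>
    (\<exists>bs. good_bits (length S * m) m S bs \<and>
      real (length bs) \<le> log 2 (real ((length S * m) choose n)) +
        C * (slack (nhat m n) + real (blen (blen m)) + 1))"
proof -
  define Cg where "Cg = (2::nat) ^ (2 * c + 1)"
  \<comment> \<open>In units of \<open>g * nh\<close> the heads take at most
    \<open>2 + Kc + 3\<close> and each of the \<open>2 * NF + 1 = 523\<close> regions at most 6, so
    3143 = 5 + 523 * 6. In the same way 1576 = 523 * 3 + 1 + 6 bounds the number of ones in units of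
    \<open>T * nh\<close>.\<close>
  define Cu where "Cu = Kc + 3143"
  obtain C0 where C0: "\<And>nh U cX. 0 < nh ==> U \<le> Cu * (pg c nh * nh) ==> cX \<le> 1576 * (pT nh * nh) ==>
      real (fid_aux U (pu nh) (pa nh ^ 3) (pa nh ^ 2) (pg c nh * pT nh) cX) \<le> C0 * slack nh"
    using fid_aux_bound[of Cu c 1576] by blast
  obtain C2 where C2: "\<And>nh n. 0 < n ==> n \<le> nh ==> real (extra nh n) \<le> C2 * slack nh"
    using extra_bound by blast
  define C1 where "C1 = max (C0 + C2) (max C0 1)"
  have C1: "1 \<le> C1" "C0 + C2 \<le> C1" "C0 \<le> C1" by (simp_all add: C1_def)
  obtain N1 where N1: "\<And>N nh x. N1 \<le> N ==> nh \<le> N ==> real x \<le> C1 * slack nh ==> 8 * x \<le> N"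
    using slack_eighth[OF C1(1)] by blast
  define Cq where "Cq = nat \<lceil>C1\<rceil> + 1 + Cu * Cg + Cg + 40000"
  define C4 where "C4 = Cg + 40000"
  define N0 where "N0 = max N1 (max (C4\<^sup>2 * 2 ^ 33) (2400\<^sup>2 * 2 ^ 33))"
  define E :: real where "E = 2 ^ 34"
  define CE where "CE = 4 * real Kc + 12 * E + 523 * (4 * E + 4 + 8 * E)"
  define C where "C = 258 * (real (blen Cq) + 1 + 6 * E) + 260 + 2 * C1 + CE"
  show ?thesis
  proof (intro exI[of _ C] exI[of _ N0] allI impI)
    fix m n S
    assume v: "valid_sets m n S" and sK: "length S \<le> Kc * n" and NN: "N0 \<le> length S * m"
      and large: "2 * n * pg c (nhat m n) \<le> length S * m"
    define N nh s where "N = length S * m" and "nh = nhat m n" and "s = length S"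
    note vl = valid_sets_le[OF v, folded N_def nh_def s_def]
    have Ns: "N = s * m" by (simp add: N_def s_def)
    have nh: "0 < nh" and nhN: "nh \<le> N" using vl by auto
    have m0: "0 < m" and n0: "0 < n" using v by (auto simp: valid_sets_def)
    have N0: "N1 \<le> N" "C4\<^sup>2 * 2 ^ 33 \<le> N" "2400\<^sup>2 * 2 ^ 33 \<le> N" using NN by (auto simp: N0_def N_def)
    define a b u g T Th tau where "a = pa nh" and "b = pb nh" and "u = pu nh" and "g = pg c nh" and "T = pT nh"
      and "Th = pTh nh" and "tau = pt nh"
    have T: "T = 2 ^ tau" by (simp add: T_def tau_def pT_def)
    note sp = small_params[OF nh, folded a_def u_def]
    have gT: "g * T \<le> Cg * a ^ 4" using sp(9)[of c] by (simp add: g_def T_def Cg_def)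
    have T1: "1 \<le> T" using pT_pos by (simp add: T_def)
    have g1: "1 \<le> g" "T \<le> g" using pg_pos by (simp_all add: g_def T_def)
    have ga: "g \<le> Cg * a ^ 4" using le_trans[OF mult_le_mono2[OF T1, of g] gT] by simp
    have a1: "1 \<le> a" using pa_pos[OF nh] by (simp add: a_def)
    have a4: "C4 * a ^ 4 \<le> N" unfolding a_def by (rule pow4_le[OF nh nhN N0(2)])
    have a4': "k * a ^ 4 \<le> N" if "k \<le> C4" for k using mult_le_mono1[OF that, of "a ^ 4"] a4 by (rule le_trans)
    have aa4: "a \<le> a ^ 4" unfolding a_def by (rule le_pow4[OF nh])
    have a41: "1 \<le> a ^ 4" using a1 by simp
    have nn: "n \<le> nh" and bn: "blen (blen m) \<le> nh" by (simp_all add: nh_def nhat_def)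
    have ah: "a \<le> nh" unfolding a_def pa_def by (rule blen_le_self)
    have gg: "g = 2 ^ c * T ^ GAM" by (simp add: g_def pg_def T_def)
    have gc: "2 ^ c * T \<le> g"
      unfolding gg using power_increasing[of 1 GAM T] T1 by (intro mult_le_mono2) (simp add: GAM_def)
    have N2: "2 * n * g \<le> s * m" using large by (simp add: g_def nh_def s_def)
    have sK': "s \<le> Kc * n" using sK by (simp add: s_def)
    have T0: "0 < T" using T1 by simp
    define d where "d = blen (N div (n * g)) - 1"
    define m1 where "m1 = m div 2 ^ d + 1"
    note geo = sparse_geometry[OF m0 n0 vl(2) sK' N2 gc T0 c, folded Ns, folded d_def, folded m1_def]
    define H where "H = s * m1"
    \<comment> \<open>Heads and regions are rounded up to whole blocks, as
      \<open>bptr_sparse\<close> demands. The added 1 makes \<open>Hp\<close> strictly larger than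
      \<open>H\<close>.\<close>
    define hb where "hb = H div u + 1"
    define Hp where "Hp = hb * u"
    define gb where "gb = (n * 2 ^ (tau + 1) + 1) div u + 1"
    define G where "G = gb * u"
    define U where "U = Hp + (2 * NF + 1) * G"
    have u0: "0 < u" using sp(1) by simp
    have Hp: "H < Hp" "Hp \<le> H + u" unfolding Hp_def hb_def using dividend_less_div_times[OF u0, of H] by auto
    have G: "n * 2 ^ (tau + 1) + 1 \<le> G" "G \<le> 2 * (n * T) + 1 + u"
      unfolding G_def gb_def T using dividend_less_div_times[OF u0, of "n * 2 ^ (tau + 1) + 1"]
      by (auto simp: algebra_simps intro: order_trans[OF div_times_less_eq_dividend])
    have U523: "U = Hp + 523 * G" by (simp add: U_def NF_def)
    have ua: "u \<le> 3 * a ^ 4" by (rule sp(5))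
    have UN: "U \<le> N"
    proof -
      have "64 * H \<le> 33 * N" "16384 * (n * T) \<le> N" using geo(9,10) by (simp_all add: H_def)
      moreover have "40000 * a ^ 4 \<le> N" by (rule a4') (simp add: C4_def)
      ultimately show ?thesis unfolding U523 using Hp(2) G(2) ua a41 by linarith
    qed
    have Uc: "U \<le> Cu * (g * nh)"
    proof -
      define y where "y = g * nh"
      have y: "n * g \<le> y" "nh \<le> y" "n * T \<le> y"
        unfolding y_def using nn g1 by (auto simp: mult.commute intro: mult_le_mono)
      have "s \<le> Kc * y" using sK' le_trans[OF nn y(2)] by (meson le_trans mult_le_mono2)
      moreover have "u \<le> 3 * y" using sp(3) ah y(2) by linarith
      moreover have "1 \<le> y" using y(2) nh by linarith
      moreover have "H \<le> 2 * y + s" using geo(6) y(1) by (simp add: H_def)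
      ultimately have "U \<le> Kc * y + 3143 * y" unfolding U523 using Hp(2) G(2) y(3) by linarith
      then show ?thesis by (simp add: Cu_def y_def algebra_simps)
    qed
    define Bk where "Bk = m1 * 2 ^ d"
    interpret sl: set_list m Bk S using v by (rule valid_sets_set_list) (simp add: Bk_def geo(4))
    define Y where "Y = merged Bk S"
    define K where "K = sel Y"
    have fY: "finite Y" unfolding Y_def by (rule sl.finite_merged)
    have cY: "card Y = n" unfolding Y_def using sl.card_merged v by (simp add: valid_sets_def)
    interpret k: keys n d tau K
      by unfold_locales (use sel_mono_strict[OF fY] cY in \<open>auto simp: K_def\<close>)
    have KH: "K j div 2 ^ d < Hp" if "j < n" for j
    proof -
      have "K j \<in> Y" unfolding K_def using sel_in[OF fY] that cY by simp
      then have "K j < H * 2 ^ d" unfolding Y_def using sl.merged_sub by (auto simp: H_def s_def Bk_def mult.assoc)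
      then have "K j div 2 ^ d < H" by (rule less_mult_imp_div_less)
      then show ?thesis using Hp(1) by simp
    qed
    define reg where "reg r = (if r = 2 * NF then {n..<G} \<union> starts {..<n} (\<lambda>j. K j div 2 ^ d)
      else if even r then (\<lambda>j. k.code (r div 2) (K j)) ` k.A (r div 2)
      else insert n (starts (k.A (r div 2)) (\<lambda>j. k.code (r div 2) (K j))))" for r
    have regV: "reg (2 * l) = (\<lambda>j. k.code l (K j)) ` k.A l" if "l < NF" for l using that by (simp add: reg_def)
    have regW: "reg (2 * l + 1) = insert n (starts (k.A l) (\<lambda>j. k.code l (K j)))" if "l < NF" for l
    proof -
      have "2 * l + 1 \<noteq> 2 * NF" by presburger
      then show ?thesis by (simp add: reg_def)
    qed
    have regW0: "reg (2 * NF) = {n..<G} \<union> starts {..<n} (\<lambda>j. K j div 2 ^ d)" by (simp add: reg_def)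
    define X where "X = {x. x < U \<and> (if x < Hp then x \<in> (\<lambda>j. K j div 2 ^ d) ` {..<n}
      else (x - Hp) mod G \<in> reg ((x - Hp) div G))}"
    have XU: "X \<subseteq> {..<U}" by (auto simp: X_def)
    have nG: "n \<le> G"
    proof -
      have "n * 1 \<le> n * 2 ^ (tau + 1)" by (intro mult_le_mono2) simp
      then show ?thesis using G(1) unfolding mult_1_right by linarith
    qed
    have nHp: "n * ((g - 1) + 1) \<le> Hp" using geo(5) Hp(1) g1 by (simp add: H_def)
    have rG: "(2 ^ tau) ^ GAM \<le> g - 1"
    proof -
      have c2: "(2::nat) ^ 1 \<le> 2 ^ c" using c(1) by (intro power_increasing) auto
      have "2 * T ^ GAM \<le> g" unfolding gg using c2 by (intro mult_le_mono1) simp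
      moreover have "1 \<le> T ^ GAM" using T1 by (rule one_le_power)
      ultimately show ?thesis unfolding T by linarith
    qed
    note bps = k.bptr_sparse[OF X_def U_def Hp_def G_def u0 nG nHp rG regV regW regW0 KH]
    have cX: "card X \<le> 1576 * (T * nh)"
    proof -
      define z where "z = T * nh"
      have z: "nh \<le> z" "n * T \<le> z" unfolding z_def using nn T1 by (auto simp: mult.commute intro: mult_le_mono)
      have "card X \<le> 523 * (2 * n + 1) + n + G" using bps(3) by (simp add: NF_def)
      moreover have "u \<le> 3 * z" using sp(3) ah z(1) by linarith
      moreover have "1 \<le> z" "n \<le> z" using z(1) nh nn by linarith+
      ultimately have "card X \<le> 1576 * z" using G(2) z(2) by simp
      then show ?thesis by (simp add: z_def)
    qed
    have bd: "d + 1 \<le> blen m"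
    proof (rule ccontr)
      assume "\<not> d + 1 \<le> blen m"
      then have "m < 2 ^ d" by (subst blen_le_iff[symmetric]) simp
      then show False using geo(12) by simp
    qed
    have bbd: "blen (d + 1) \<le> blen (blen m)" by (rule blen_mono[OF bd])
    have bbd': "blen d \<le> nh" using blen_mono[of d "d + 1"] bbd bn by simp
    obtain p0 p0q p1 free where
        p: "0 < p0" "p0 \<le> 2 ^ d" "p0 \<le> 2 * (d * n\<^sup>2) + 8" "0 < p0q" "p0q \<le> 2 ^ blen p0"
          "p0q \<le> 2 * (blen p0 * n\<^sup>2) + 8"
        and p1: "\<And>i. p1 i \<le> 2 * (Th * (T * Th\<^sup>2)) + 8"
        and free: "\<And>j. j < n ==> free j < 2 ^ (d - k.rem NF (K j))"
        and finds: "\<And>j. j < n ==> 2 \<le> k.SZ NF (K j) ==> k.slot_found Th T p0 p0q p1 free j"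
    proof -
      have n0': "2 * (blen (2 * (d * n\<^sup>2) + 8) * n\<^sup>2) + 8 < 2 ^ Th"
        unfolding Th_def by (rule num0[OF n0 nn bbd'])
      have n1': "2 * (blen (2 * (Th * (T * Th\<^sup>2)) + 8) * kk\<^sup>2) + 8 < 2 ^ (NX * (clg kk + tau))" if "2 \<le> kk" for kk
        unfolding Th_def T_def tau_def by (rule num1[OF that])
      show ?thesis using k.survivors_data[OF n0' n1' T0] that by blast
    qed
    define D :: "arr list" where "D = [(d, n, \<lambda>j. K j mod 2 ^ k.rem NF (K j) * 2 ^ (d - k.rem NF (K j)) + free j),
      (blen (clg n + 1), 1 * (n div a + 2), mf_base (\<lambda>_ k. clg (min k n)) a (n div a + 2)),
      (blen (clg n + 1), 1 * ((clg n + 1) * a), mf_expl (\<lambda>_ k. clg (min k n)) a (n div a + 2) (clg n + 1)),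
      (blen (2 * (Th * (T * Th\<^sup>2)) + 8), n div T + 1, p1)]"
    define ps where "ps = [n, m1, d, u, a ^ 3, a ^ 2, g * T, base2 u (a ^ 3) (g * T), Hp, G, tau, p0, p0q, T, Th, a]"
    have D4: "length D = 4" by (simp add: D_def)
    have Ds: "sum_list (map arr_size D) = n * d + extra nh n"
      by (simp add: D_def arr_size_def extra_def a_def T_def Th_def)
    have pl: "length ps = 16" by (simp add: ps_def)
    have pn: "ps ! 3 = u" "ps ! 4 = a ^ 3" "ps ! 5 = a ^ 2" "ps ! 6 = g * T" "ps ! 7 = base2 u (a ^ 3) (g * T)"
      by (simp_all add: ps_def)
    define fa where "fa = fid_aux U u (a ^ 3) (a ^ 2) (g * T) (card X)"
    define aux where "aux = fa + extra nh n"
    have fas: "real fa \<le> C0 * slack nh"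
      unfolding fa_def using C0[OF nh Uc[unfolded g_def] cX[unfolded T_def]] by (simp add: a_def u_def g_def T_def)
    have auxs: "real aux \<le> C1 * slack nh"
    proof -
      have "real aux \<le> (C0 + C2) * slack nh" unfolding aux_def using fas C2[OF n0 nn] by (simp add: distrib_right)
      also have "... \<le> C1 * slack nh" using C1 slack_nonneg by (intro mult_right_mono) auto
      finally show ?thesis .
    qed
    have aux8: "8 * aux \<le> N" by (rule N1[OF N0(1) nhN auxs])
    have nd: "4 * (n * d) \<le> N" by (rule geo(11))
    define B where "B = min N (par_bound Cq d nh)"
    have le_B: "x \<le> B" if "x \<le> N" "x \<le> Cq * ((d + 1) * (a ^ i * nh ^ j))" "i \<le> 4" "j \<le> 2" for x i j
      using par_bound_ge[OF nh, of x Cq d i j] that by (simp add: B_def a_def)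
    have CqC: "Cg + 40000 \<le> Cq" "Cu * Cg \<le> Cq" "nat \<lceil>C1\<rceil> + 1 \<le> Cq" "1 \<le> Cq"
      unfolding Cq_def by linarith+
    have Bp: "k * a ^ 4 \<le> B" if "k \<le> Cg + 40000" for k
    proof (rule le_B[where i = 4 and j = 0])
      show "k * a ^ 4 \<le> N" using that by (intro a4') (simp add: C4_def)
      have "k * a ^ 4 \<le> Cq * ((d + 1) * a ^ 4)" unfolding mult.assoc[symmetric]
        using that CqC mult_le_mono[of k Cq 1 "d + 1"] by (intro mult_le_mono1) simp
      then show "k * a ^ 4 \<le> Cq * ((d + 1) * (a ^ 4 * nh ^ 0))" by simp
    qed auto
    have BU: "U \<le> B"
    proof (rule le_B[where i = 4 and j = 1])
      show "U \<le> N" by (rule UN)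
      have "U \<le> Cu * (Cg * a ^ 4 * nh)" using Uc ga by (meson le_trans mult_le_mono1 mult_le_mono2)
      also have "... = (Cu * Cg) * (1 * (a ^ 4 * nh))" by (simp add: mult_ac)
      also have "... \<le> Cq * ((d + 1) * (a ^ 4 * nh))" using CqC by (intro mult_le_mono) auto
      finally show "U \<le> Cq * ((d + 1) * (a ^ 4 * nh ^ 1))" by simp
    qed auto
    have Baux: "aux + n * d \<le> B"
      unfolding B_def using aux8 nd by (intro param_limit[OF nh auxs nn CqC(3)]) linarith
    have B2: "x \<le> B" if "x \<le> N" "x \<le> 2 * ((d + 1) * n\<^sup>2) + 8" for x
    proof (rule le_B[OF that(1), where i = 0 and j = 2])
      have "n\<^sup>2 \<le> nh\<^sup>2" using nn by (intro power_mono) auto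
      then have "(d + 1) * n\<^sup>2 \<le> (d + 1) * nh\<^sup>2" by (rule mult_le_mono2)
      moreover have "1 * 1 \<le> (d + 1) * nh\<^sup>2" using nh by (intro mult_le_mono) auto
      ultimately have "x \<le> 10 * ((d + 1) * nh\<^sup>2)" using that(2) by linarith
      also have "... \<le> Cq * ((d + 1) * nh\<^sup>2)" using CqC(1) by (intro mult_le_mono1) simp
      finally show "x \<le> Cq * ((d + 1) * (a ^ 0 * nh ^ 2))" by simp
    qed auto
    have Bd: "d \<le> B"
    proof (rule le_B[where i = 0 and j = 0])
      show "d \<le> N" using geo(13) less_exp[of "d + 1"] by linarith
      show "d \<le> Cq * ((d + 1) * (a ^ 0 * nh ^ 0))" using mult_le_mono1[OF CqC(4), of "d + 1"] by simp
    qed auto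
    have Bn: "n \<le> B"
    proof (rule le_B[where i = 0 and j = 1])
      show "n \<le> N" using vl by simp
      have "1 * (1 * n) \<le> Cq * ((d + 1) * nh)" using CqC(4) nn by (intro mult_le_mono) auto
      then show "n \<le> Cq * ((d + 1) * (a ^ 0 * nh ^ 1))" by simp
    qed auto
    have bp0: "blen p0 \<le> d + 1"
    proof (rule blen_le)
      have "(2::nat) ^ d < 2 ^ (d + 1)" by simp
      then show "p0 < 2 ^ (d + 1)" using p(2) by (rule le_less_trans[rotated])
    qed
    have p0N: "p0 \<le> N" "p0q \<le> N"
    proof -
      have "p0 \<le> 2 ^ (d + 1)" using p(2) power_increasing[of d "d + 1" "2::nat"] by simp
      then show "p0 \<le> N" using geo(13) by (rule le_trans)
      have "p0q \<le> 2 ^ (d + 1)" using p(5) power_increasing[OF bp0, of "2::nat"] by simp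
      then show "p0q \<le> N" using geo(13) by (rule le_trans)
    qed
    have Bp0: "p0 \<le> B" "p0q \<le> B"
    proof -
      have "d * n\<^sup>2 \<le> (d + 1) * n\<^sup>2" by simp
      then have "p0 \<le> 2 * ((d + 1) * n\<^sup>2) + 8" using p(3) by linarith
      then show "p0 \<le> B" by (rule B2[OF p0N(1)])
      have "blen p0 * n\<^sup>2 \<le> (d + 1) * n\<^sup>2" using bp0 by (rule mult_le_mono1)
      then have "p0q \<le> 2 * ((d + 1) * n\<^sup>2) + 8" using p(6) by linarith
      then show "p0q \<le> B" by (rule B2[OF p0N(2)])
    qed
    have T2a: "T \<le> 2 * a ^ 4" using pT_le[OF nh] aa4 by (simp add: T_def a_def)
    have Tha: "Th \<le> 16 * a ^ 4" using exp_pb(2)[OF nh] aa4 by (simp add: Th_def pTh_def power_add a_def)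
    have tT: "tau \<le> T" unfolding T using less_exp[of tau] by simp
    have m1H: "m1 \<le> Hp" using Hp(1) vl(2) by (cases s) (auto simp: H_def)
    have Bps: "x \<le> B" if "x \<in> set ps" for x
    proof -
      have "x \<in> {n, m1, d, Hp, G, p0, p0q} \<or> x \<in> {u, a ^ 3, a ^ 2, g * T, base2 u (a ^ 3) (g * T), tau, T, Th, a}"
        using that by (auto simp: ps_def)
      then show ?thesis
      proof
        assume "x \<in> {n, m1, d, Hp, G, p0, p0q}"
        moreover have "Hp \<le> B" "G \<le> B" using BU unfolding U523 by simp_all
        ultimately show ?thesis using Bn Bd Bp0 m1H by auto
      next
        assume "x \<in> {u, a ^ 3, a ^ 2, g * T, base2 u (a ^ 3) (g * T), tau, T, Th, a}"
        moreover have "1 * a ^ 4 \<le> B" "3 * a ^ 4 \<le> B" "5 * a ^ 4 \<le> B" "Cg * a ^ 4 \<le> B" "2 * a ^ 4 \<le> B" "16 * a ^ 4 \<le> B"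
          using Bp[of 1] Bp[of 3] Bp[of 5] Bp[of Cg] Bp[of 2] Bp[of 16] by auto
        moreover have "tau \<le> 2 * a ^ 4" using tT T2a by simp
        ultimately show ?thesis using sp(5-7) sp(8)[of "g * T"] gT T2a Tha aa4 by (elim insertE emptyE; linarith)
      qed
    qed
    have B1: "1 \<le> B" using Bn n0 by simp
    have BN: "B \<le> N" by (simp add: B_def)
    have h4: "4 * hsize B \<le> N" using hsize_le_N[OF BN _ N0(3)] nh nhN by simp
    have N4: "4 \<le> N" using N0(3) by simp
    have blN: "a \<le> blen N" unfolding a_def pa_def by (rule blen_mono[OF nhN])
    have Dw: "fst y \<le> arr_size y \<and> fst y \<le> blen N" if "y \<in> set D" for y
    proof -
      have pr: "x \<le> z * x" if "1 \<le> z" for x z :: nat using mult_le_mono1[OF that, of x] by simp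
      have "d < blen N"
      proof (rule ccontr)
        assume "\<not> d < blen N"
        then have "N < 2 ^ d" by (subst blen_le_iff[symmetric]) simp
        then show False using geo(13) by simp
      qed
      moreover have "blen (clg n + 1) \<le> blen N"
      proof (rule blen_mono)
        have "clg n + 1 \<le> 2 * a ^ 4" using clg_bounds(1)[OF n0 nn] aa4 a41 by (simp add: a_def)
        then show "clg n + 1 \<le> N" using a4'[of 2] by (simp add: C4_def)
      qed
      moreover have "blen (2 * (Th * (T * Th\<^sup>2)) + 8) \<le> blen N"
      proof (rule blen_mono)
        have "2 * (Th * (T * Th\<^sup>2)) + 8 \<le> 32768 * a ^ 4" unfolding Th_def T_def a_def by (rule table_entry_pow4[OF nh])
        then show "2 * (Th * (T * Th\<^sup>2)) + 8 \<le> N" using a4'[of 32768] by (simp add: C4_def)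
      qed
      ultimately show ?thesis using that n0 a1 pr[of n] pr[of "n div a + 2"] pr[of "(clg n + 1) * a"] pr[of "n div T + 1"]
        by (auto simp: D_def arr_size_def)
    qed
    have g0: "0 < g * T" using g1 T1 by simp
    have tot: "fid_aux U u (a ^ 3) (a ^ 2) (g * T) (card X) + sum_list (map arr_size D) = aux + n * d"
      unfolding Ds aux_def fa_def by simp
    have fit: "hsize B + (fid_aux U u (a ^ 3) (a ^ 2) (g * T) (card X) + sum_list (map arr_size D)) \<le> N"
      using h4 aux8 nd unfolding tot by linarith
    have sgu: "a ^ 3 * u \<le> N" using sp(4) a4'[of 3] by (simp add: C4_def)
    have u8: "4 * u \<le> blen N + 8" using sp(2) blN by simp
    have auxB: "fid_aux U u (a ^ 3) (a ^ 2) (g * T) (card X) + sum_list (map arr_size D) \<le> B"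
      using Baux unfolding tot .
    have a3: "0 < a ^ 3" "0 < a ^ 2" using a1 by simp_all
    note inst = fid_instance[OF XU UN D4 pl pn Bps B1 BN auxB Dw fit sgu sp(1) u8 a3 g0 bps(2) N4]
    define q As where "q = blen B div 4 + 1" and "As = layout X U u (a ^ 3) (a ^ 2) (g * T) D"
    define bs where "bs = mk_bits q ps As"
    have "good_bits N m S bs"
      unfolding good_bits_def
    proof (intro conjI allI impI)
      show "bs \<noteq> []" "bs ! 0" unfolding bs_def q_def As_def using inst(3,4) by auto
      fix w and M R :: "nat => nat" assume w: "N < 2 ^ w" "16 \<le> w" "R 0 = w" "holds_bits w bs M"
      interpret f: fid w M R q ps As X U u "a ^ 3" "a ^ 2" "g * T"
        using inst(1) w unfolding bs_def q_def As_def by blast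
      interpret sp: sparse w M R q ps As X U u "a ^ 3" "a ^ 2" "g * T" n d tau K Hp G Th T a m1 p0 p0q p1 free reg
      proof unfold_locales
        have "(2::nat) ^ d < 2 ^ (d + 1)" by simp
        also have "... \<le> N" by (rule geo(13))
        finally have "(2::nat) ^ d < 2 ^ w" using w(1) by (rule less_trans)
        then show "d < w" by (rule power_less_imp_less_exp[rotated]) simp
        show "p0 < 2 ^ w" using p0N(1) w(1) by simp
      qed (fact X_def U_def G(1) regV regW regW0 KH free finds p1 n0 T0 p(1,4) |
          use a1 in \<open>simp add: ps_def As_def layout_nth D_def\<close>)+
      have "m \<le> N" using vl by simp
      then have mw: "m < 2 ^ w" using w(1) by simp
      have Hp': "length S * m1 \<le> Hp" using Hp(1) by (simp add: H_def s_def)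
      have d0: "0 < d" using geo(1) by simp
      show "answers_rank w M R S m" "answers_select w M R S" "answers_size w M R S"
        using sp.sparse_answers[OF sl.set_list_axioms[unfolded Bk_def] K_def[unfolded Y_def Bk_def]
          cY[symmetric, unfolded Y_def Bk_def] Hp' mw d0] by auto
    qed
    moreover have "real (length bs) \<le> log 2 (real (N choose n)) + C * (slack nh + real (blen (blen m)) + 1)"
    proof -
      define e where "e = real nh / real T"
      define sl where "sl = slack nh"
      have e_sl: "e \<le> sl" unfolding e_def sl_def T_def by (rule slack_ge)
      have aE: "real a \<le> E * sl" unfolding a_def E_def sl_def by (rule pa_le_slack[OF nh])
      have lb: "length bs = hsize B + (aux + n * d) + bptr X u (nblocks U u)"
        unfolding bs_def q_def As_def using inst(2) by (simp add: tot)
      have h: "real (hsize B) \<le> 258 * (real (blen Cq) + real (blen (blen m)) + 6 * (E * sl)) + 260"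
      proof -
        have "real (hsize B) \<le> 258 * (real (blen Cq) + real (blen (d + 1)) + 6 * (2 ^ 34 * slack nh)) + 260"
          by (rule hsize_le_slack[OF nh]) (simp add: B_def)
        also have "... \<le> 258 * (real (blen Cq) + real (blen (blen m)) + 6 * (2 ^ 34 * slack nh)) + 260"
          using of_nat_mono[OF bbd, where 'a = real] by (intro add_mono mult_left_mono order_refl) auto
        finally show ?thesis unfolding E_def sl_def .
      qed
      have bp: "real (bptr X u (nblocks U u)) \<le> log 2 (real (Hp choose n)) + real (nblocks U u) +
          523 * (2 * real tau + 2 * real G / (2 ^ tau)\<^sup>2)" using bps(1) by (simp add: NF_def)
      have nb: "real (nblocks U u) \<le> C1 * sl"
      proof -
        have "real (nblocks U u) \<le> real fa" unfolding fa_def using nblocks_le_aux[OF a3(1) u0] by simp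
        also have "... \<le> C0 * sl" using fas by (simp add: sl_def)
        also have "... \<le> C1 * sl" unfolding sl_def using C1 slack_nonneg by (intro mult_right_mono) auto
        finally show ?thesis .
      qed
      have ent: "real n * real d + log 2 (real (Hp choose n)) \<le> log 2 (real (N choose n)) + 4 * (real s + real u) / real g"
      proof -
        have "0 < g" using g1 by simp
        moreover have "2 * (n * g) \<le> N" using N2 Ns by (simp add: mult_ac)
        moreover have "N \<le> Hp * 2 ^ d" using le_trans[OF geo(7) mult_le_mono1[of "s * m1" Hp "2 ^ d"]] Hp(1) by (simp add: H_def)
        moreover have "Hp * 2 ^ d \<le> N + (s + u) * 2 ^ d"
        proof -
          have "Hp * 2 ^ d \<le> (H + u) * 2 ^ d" using Hp(2) by (rule mult_le_mono1)
          then show ?thesis using geo(8) by (simp add: H_def algebra_simps)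
        qed
        moreover have "n \<le> Hp"
        proof -
          have "n * 1 \<le> n * ((g - 1) + 1)" by (intro mult_le_mono2) simp
          then show ?thesis using nHp by simp
        qed
        ultimately have "real n * log 2 (real (2 ^ d)) + log 2 (real (Hp choose n)) \<le>
            log 2 (real (N choose n)) + 4 * (real s + real u) / real g"
          using n0 geo(2) by (intro sparse_entropy[where D = "2 ^ d"]) auto
        then show ?thesis by (simp add: log_nat_power)
      qed
      have sg: "4 * (real s + real u) / real g \<le> (4 * real Kc + 12 * E) * sl"
      proof -
        have "real s / real g \<le> real (Kc * n) / real T"
          using sK' g1 T1 by (intro frac_le of_nat_0_le_iff of_nat_mono) auto
        also have "... \<le> real Kc * e" unfolding e_def using nn by (simp add: divide_right_mono mult_left_mono)
        also have "... \<le> real Kc * sl" using e_sl by (rule mult_left_mono) simp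
        finally have 1: "real s / real g \<le> real Kc * sl" .
        have "real u / real g \<le> real u" using g1 by (intro div_ge1) auto
        also have "... \<le> 3 * real a" using sp(3) by simp
        finally have 2: "real u / real g \<le> 3 * (E * sl)" using aE by linarith
        have "4 * (real s + real u) / real g = 4 * (real s / real g) + 4 * (real u / real g)"
          by (simp add: add_divide_distrib)
        moreover have "(4 * real Kc + 12 * E) * sl = 4 * (real Kc * sl) + 4 * (3 * (E * sl))" by (simp add: algebra_simps)
        ultimately show ?thesis using 1 2 by linarith
      qed
      have tt: "2 * real tau \<le> 4 * E * sl"
      proof -
        have "tau \<le> 2 * a" using tT pT_le[OF nh] by (simp add: T_def a_def)
        then show ?thesis using aE by simp
      qed
      have GG: "2 * real G / (2 ^ tau)\<^sup>2 \<le> (4 + 8 * E) * sl"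
      proof -
        have T': "(2 ^ tau)\<^sup>2 = real T * real T" by (simp add: T power2_eq_square)
        have TT: "1 \<le> real T * real T" using T1 by (simp add: mult_ge1_I)
        have "G \<le> 2 * (n * T) + 4 * a" using G(2) sp(3) a1 by linarith
        then have "real G \<le> 2 * (real n * real T) + 4 * real a" by (simp flip: of_nat_mult)
        then have "2 * real G / (real T * real T) \<le> (4 * (real n * real T) + 8 * real a) / (real T * real T)"
          by (intro divide_right_mono) auto
        also have "... = 4 * (real n / real T) + 8 * real a / (real T * real T)"
          using T1 by (simp add: add_divide_distrib)
        also have "... \<le> 4 * e + 8 * real a"
        proof -
          have "real n / real T \<le> e" unfolding e_def using nn by (intro divide_right_mono) auto
          moreover have "8 * real a / (real T * real T) \<le> 8 * real a" using TT by (intro div_ge1) auto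
          ultimately show ?thesis by linarith
        qed
        also have "... \<le> 4 * sl + 8 * (E * sl)" using e_sl aE by linarith
        finally show ?thesis unfolding T' by (simp add: algebra_simps)
      qed
      define \<beta> where "\<beta> = real (blen (blen m))"
      have s0: "0 \<le> sl" "0 \<le> \<beta>" "0 \<le> E" unfolding sl_def \<beta>_def E_def by (simp_all add: slack_nonneg)
      have CE0: "0 \<le> CE" unfolding CE_def using s0 by simp
      have "real (length bs) = real (hsize B) + real aux + real n * real d + real (bptr X u (nblocks U u))"
        unfolding lb by simp
      also have "... \<le> 258 * (real (blen Cq) + \<beta> + 6 * (E * sl)) + 260 + C1 * sl + C1 * sl +
          log 2 (real (N choose n)) + (4 * real Kc + 12 * E) * sl + 523 * (4 * E * sl + (4 + 8 * E) * sl)"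
      proof -
        have sum: "h + x + y + z \<le> h' + x' + q' + L' + r' + z'"
          if "h \<le> h'" "x \<le> x'" "z \<le> L + q + zz" "q \<le> q'" "y + L \<le> L' + r" "r \<le> r'" "zz \<le> z'"
          for h h' x x' y z z' q q' L L' r r' zz :: real
          using that by linarith
        have "523 * (2 * real tau + 2 * real G / (2 ^ tau)\<^sup>2) \<le> 523 * (4 * E * sl + (4 + 8 * E) * sl)"
          by (intro mult_left_mono add_mono tt GG) simp
        from sum[OF h auxs bp nb ent sg this] show ?thesis unfolding \<beta>_def sl_def .
      qed
      also have "... = log 2 (real (N choose n)) +
          (258 * real (blen Cq) + 260 + 258 * \<beta> + (258 * 6 * E + 2 * C1 + CE) * sl)"
        by (simp add: CE_def algebra_simps)
      also have "... \<le> log 2 (real (N choose n)) + C * (sl + \<beta> + 1)"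
      proof -
        define k0 where "k0 = 258 * real (blen Cq) + 260"
        define k2 where "k2 = 258 * 6 * E + 2 * C1 + CE"
        have k: "0 \<le> k0" "0 \<le> k2" unfolding k0_def k2_def using s0 C1 CE0 by simp_all
        have Ce: "C = k0 + 258 + k2" unfolding C_def k0_def k2_def by simp
        have "k0 * 1 \<le> k0 * (sl + \<beta> + 1)" using k s0 by (intro mult_left_mono) auto
        moreover have "258 * \<beta> \<le> 258 * (sl + \<beta> + 1)" using s0 by simp
        moreover have "k2 * sl \<le> k2 * (sl + \<beta> + 1)" using k s0 by (intro mult_left_mono) auto
        ultimately show ?thesis unfolding Ce k0_def[symmetric] k2_def[symmetric] distrib_right[of _ _ "sl + \<beta> + 1"] by linarith
      qed
      finally show ?thesis unfolding sl_def \<beta>_def .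
    qed
    ultimately show "\<exists>bs. good_bits (length S * m) m S bs \<and>
        real (length bs) \<le> log 2 (real ((length S * m) choose n)) +
          C * (slack (nhat m n) + real (blen (blen m)) + 1)"
      unfolding N_def nh_def by blast
  qed
qed

section \<open>From correct expressions to programs, and the final bound\<close>

lemma good_bits_answers:
  assumes g: "good_bits (length S * m) m S bs" and v: "valid_sets m n S"
    and w1: "16 \<le> w1" "w1 \<le> w" and w: "length S * m < 2 ^ w"
    and t: "length (query_program (P_RANK w1)) \<le> t" "length (query_program (P_SELECT w1)) \<le> t"
      "length (query_program (P_SIZE w1)) \<le> t"
  shows "x < m ==> i < length S ==> answers w t (query_program (P_RANK w1)) bs [x, i] (set_rank x (S ! i))"
    "i < length S ==> j \<in> {1..card (S ! i)} ==>
      answers w t (query_program (P_SELECT w1)) bs [j, i] (int (set_select j (S ! i)))"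
    "i < length S ==> answers w t (query_program (P_SIZE w1)) bs [i] (int (card (S ! i)))"
proof -
  interpret set_list m m S using v by (rule valid_sets_set_list) simp
  have bs: "bs ! 0" "bs \<noteq> []" using g by (auto simp: good_bits_def)
  have w16: "16 \<le> w" "2 \<le> w1" using w1 by auto
  have ans: "answers_rank w M (query_regs w as) S m" "answers_select w M (query_regs w as) S"
    "answers_size w M (query_regs w as) S" if "holds_bits w bs M" for M as
    using g w w16(1) that by (auto simp: good_bits_def query_regs_def)
  have R: "query_regs w as 0 = w" for as by (simp add: query_regs_def)
  have mw: "m < 2 ^ w" using valid_sets_le(3)[OF v] w by (rule le_less_trans)
  have cm: "card (S ! i) \<le> m" if "i < length S" using card_mono[OF _ sub[OF that]] by simp
  show "answers w t (query_program (P_RANK w1)) bs [x, i] (set_rank x (S ! i))" if "x < m" "i < length S"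
  proof (rule answers_query_program[OF regs_below_P(1) t(1)])
    fix M assume h: "holds_bits w bs M"
    show "int (ev w M (query_regs w [x, i]) (P_RANK w1)) = set_rank x (S ! i) mod 2 ^ w"
      unfolding P_RANK_def FULL_large[where R = "query_regs w [x, i]", OF h bs R w16(2) w1(2)]
      using ans(1)[OF h, of "[x, i]"] that by (simp add: answers_rank_def query_regs_def numeral_2_eq_2)
  qed
  show "answers w t (query_program (P_SELECT w1)) bs [j, i] (int (set_select j (S ! i)))"
    if i: "i < length S" and j: "j \<in> {1..card (S ! i)}"
  proof (rule answers_query_program[OF regs_below_P(2) t(2)])
    fix M assume h: "holds_bits w bs M"
    have "set_select j (S ! i) < m" unfolding set_select_eq using j by (intro sel_less_m[OF i]) auto
    then have "int (set_select j (S ! i)) mod 2 ^ w = int (set_select j (S ! i))"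
      using mw by (intro int_mod_exp) simp
    then show "int (ev w M (query_regs w [j, i]) (P_SELECT w1)) = int (set_select j (S ! i)) mod 2 ^ w"
      unfolding P_SELECT_def FULL_large[where R = "query_regs w [j, i]", OF h bs R w16(2) w1(2)]
      using ans(2)[OF h, of "[j, i]"] i j by (simp add: answers_select_def query_regs_def numeral_2_eq_2)
  qed
  show "answers w t (query_program (P_SIZE w1)) bs [i] (int (card (S ! i)))" if i: "i < length S"
  proof (rule answers_query_program[OF regs_below_P(3) t(3)])
    fix M assume h: "holds_bits w bs M"
    have "int (card (S ! i)) mod 2 ^ w = int (card (S ! i))" using cm[OF i] mw by (intro int_mod_exp) simp
    then show "int (ev w M (query_regs w [i]) (P_SIZE w1)) = int (card (S ! i)) mod 2 ^ w"
      unfolding P_SIZE_def FULL_large[where R = "query_regs w [i]", OF h bs R w16(2) w1(2)]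
      using ans(3)[OF h, of "[i]"] i by (simp add: answers_size_def query_regs_def)
  qed
qed

lemma blen_le_log: "0 < x ==> real (blen x) \<le> log 2 (real x) + 1"
proof -
  assume x: "0 < x"
  have "real (2 ^ blen x) \<le> real (2 * x)" using exp_blen_le[OF x] by (simp only: of_nat_le_iff)
  then have "log 2 (2 ^ blen x) \<le> log 2 (2 * real x)" using x by (subst log_le_cancel_iff) auto
  also have "... = 1 + log 2 (real x)" using x by (subst log_mult) auto
  finally show ?thesis by simp
qed

lemma blen_blen_le:
  assumes m: "0 < m"
  shows "real (blen (blen m)) \<le> log 2 (log 2 (real m)) + 2" "0 \<le> log 2 (log 2 (real m))"
proof -
  have "real (blen (blen m)) \<le> log 2 (log 2 (real m)) + 2 \<and> 0 \<le> log 2 (log 2 (real m))"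
  \<comment> \<open>For \<open>m = 1\<close> the term \<open>log 2 (log 2 m)\<close> is
    \<open>log 2 0\<close>, which is 0 by convention.\<close>
  proof (cases "m = 1")
    case True
    have "blen 1 \<le> 1" by (rule blen_le) simp
    then have "blen (blen 1) \<le> 1" using blen_le_self[of "blen 1"] by simp
    then show ?thesis by (simp add: True log_def)
  next
    case False
    then have m2: "2 \<le> m" using m by simp
    then have l1: "1 \<le> log 2 (real m)" by (subst le_log_iff) auto
    have "real (blen m) \<le> 2 * log 2 (real m)" using blen_le_log[OF m] l1 by simp
    then have "log 2 (real (blen m)) \<le> log 2 (2 * log 2 (real m))"
      using blen_pos[OF m] l1 by (subst log_le_cancel_iff) auto
    also have "... = 1 + log 2 (log 2 (real m))" using l1 by (subst log_mult) auto
    finally show ?thesis using blen_le_log[OF blen_pos[OF m]] l1 by simp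
  qed
  then show "real (blen (blen m)) \<le> log 2 (log 2 (real m)) + 2" "0 \<le> log 2 (log 2 (real m))" by auto
qed

lemma const_smallo: "(\<lambda>_. k) \<in> o(\<lambda>n. real n)"
proof (rule landau_o.smallI)
  fix c :: real assume c: "0 < c"
  show "\<forall>\<^sub>F n in sequentially. norm k \<le> c * norm (real n)"
    unfolding eventually_sequentially
  proof (intro exI allI impI)
    fix n assume "nat \<lceil>\<bar>k\<bar> / c\<rceil> \<le> n"
    then have "\<bar>k\<bar> / c \<le> real n" by linarith
    then show "norm k \<le> c * norm (real n)" using c by (simp add: divide_le_eq mult.commute)
  qed
qed

lemma word_size_ok_less:
  assumes "word_size_ok c N w" "0 < N"
  shows "N < 2 ^ w" "0 < w"
proof -
  have "log 2 (real N) < real w" using assms by (simp add: word_size_ok_def)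
  then have "real N < 2 powr real w" using assms(2) by (subst (asm) log_less_iff) auto
  then have "real N < real (2 ^ w)" by (simp add: powr_realpow)
  then show N: "N < 2 ^ w" by (simp only: of_nat_less_iff)
  show "0 < w" using N assms(2) by (cases w) auto
qed

definition serves :: "nat => nat => nat => bool list => nat => nat => nat set list => bool" where
  "serves w t w1 bs m s S \<longleftrightarrow>
    (\<forall>x < m. \<forall>i < s. answers w t (query_program (P_RANK w1)) bs [x, i] (set_rank x (S ! i))) \<and>
    (\<forall>i < s. \<forall>j \<in> {1..card (S ! i)}.
       answers w t (query_program (P_SELECT w1)) bs [j, i] (int (set_select j (S ! i)))) \<and>
    (\<forall>i < s. answers w t (query_program (P_SIZE w1)) bs [i] (int (card (S ! i))))"

theorem theorem6p1:
  fixes K :: real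
  assumes "K > 0"
  shows "\<exists>(f :: nat => real) (C :: real).
    f \<in> o(\<lambda>n. real n) \<and>
    (\<forall>c :: real. \<exists>(P_rank :: program) (P_select :: program) (P_size :: program) (t :: nat).
      \<forall>(m :: nat) (n :: nat) (s :: nat) (S :: nat set list).
        m \<ge> 1 \<and> n \<ge> 1 \<and> s \<ge> 1 \<and> real s \<le> K * real n \<and>
        length S = s \<and> (\<forall>i < s. S ! i \<subseteq> {..<m}) \<and> (\<Sum>i < s. card (S ! i)) = n \<longrightarrow>
        (\<exists>bs :: bool list.
          real (length bs)
            \<le> of_int (info_bound n (m * s)) + f n + C * log 2 (log 2 (real m)) \<and>
          (\<forall>w :: nat. word_size_ok c (m * s) w \<longrightarrow>
            (\<forall>x < m. \<forall>i < s. answers w t P_rank bs [x, i] (set_rank x (S ! i))) \<and>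
            (\<forall>i < s. \<forall>j \<in> {1..card (S ! i)}.
               answers w t P_select bs [j, i] (int (set_select j (S ! i)))) \<and>
            (\<forall>i < s. answers w t P_size bs [i] (int (card (S ! i)))))))"
proof -
  define Kc where "Kc = nat \<lceil>K\<rceil>"
  define c where "c = 13 + 32 * Kc"
  have c1: "13 \<le> c" by (simp add: c_def)
  have "32 * Kc \<le> c" by (simp add: c_def)
  also have "c \<le> 2 ^ c" using less_exp[of c] by simp
  finally have c2: "32 * Kc \<le> 2 ^ c" .
  obtain Cd Nd where dense: "\<And>m n S. valid_sets m n S ==> Nd \<le> length S * m ==>
      length S * m < 2 * n * pg c (nhat m n) ==> \<exists>bs. good_bits (length S * m) m S bs \<and>
      real (length bs) \<le> log 2 (real ((length S * m) choose n)) + Cd * (slack (nhat m n) + 1)"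
    using dense_large[of c] by blast
  obtain Cs Ns where sparse: "\<And>m n S. valid_sets m n S ==> length S \<le> Kc * n ==> Ns \<le> length S * m ==>
      2 * n * pg c (nhat m n) \<le> length S * m ==> \<exists>bs. good_bits (length S * m) m S bs \<and>
      real (length bs) \<le> log 2 (real ((length S * m) choose n)) +
        Cs * (slack (nhat m n) + real (blen (blen m)) + 1)"
    using sparse_large[OF c1 c2] by blast
  define C where "C = max (max Cd Cs) 1"
  \<comment> \<open>Instances with \<open>N < 2 ^ (w1 - 1)\<close> are answered by tables. For all
    others \<open>N\<close> exceeds both \<open>Nd\<close> and \<open>Ns\<close>, and any admissible
    word size is at least \<open>w1\<close>, hence at least 16.\<close>
  define w1 where "w1 = Nd + Ns + 17"
  \<comment> \<open>The constant covers the strings of the tabulated instances and the additive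
    constants of the other cases.\<close>
  define f where "f n = C * slack n + (5 * C + 2 * 2 ^ w1 + 2)" for n
  have C: "0 \<le> C" "Cd \<le> C" "Cs \<le> C" "C \<noteq> 0" by (auto simp: C_def)
  have "(\<lambda>n. C * slack n) \<in> o(\<lambda>n. real n)"
    using landau_o.small.cmult_in_iff[OF C(4)] slack_smallo by blast
  then have fo: "f \<in> o(\<lambda>n. real n)" unfolding f_def by (intro sum_in_smallo const_smallo)
  define t where "t = length (query_program (P_RANK w1)) + length (query_program (P_SELECT w1)) +
    length (query_program (P_SIZE w1))"
  have t: "length (query_program (P_RANK w1)) \<le> t" "length (query_program (P_SELECT w1)) \<le> t"
    "length (query_program (P_SIZE w1)) \<le> t" by (simp_all add: t_def)
  have main: "\<exists>bs. real (length bs) \<le> of_int (info_bound n (m * s)) + f n + 2 * C * log 2 (log 2 (real m)) \<and>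
      (\<forall>w. word_size_ok cw (m * s) w \<longrightarrow> serves w t w1 bs m s S)"
    if a: "m \<ge> 1 \<and> n \<ge> 1 \<and> s \<ge> 1 \<and> real s \<le> K * real n \<and>
      length S = s \<and> (\<forall>i < s. S ! i \<subseteq> {..<m}) \<and> (\<Sum>i < s. card (S ! i)) = n" for cw m n s S
  proof -
    have v: "valid_sets m n S" using a by (auto simp: valid_sets_def)
    have s: "s = length S" and m: "0 < m" and n: "0 < n" using a by auto
    define N where "N = length S * m"
    have Nm: "m * s = N" by (simp add: N_def s)
    note vl = valid_sets_le[OF v, folded N_def]
    have N0: "0 < N" using vl(1) n by simp
    have p: "1 \<le> N choose n" using vl(1) by (simp add: Suc_leI)
    have lp: "0 \<le> log 2 (real (N choose n))" using of_nat_mono[OF p, where 'a = real] by (subst zero_le_log_cancel_iff) linarith+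
    have ib: "log 2 (real (N choose n)) \<le> of_int (info_bound n (m * s))"
      unfolding info_bound_def Nm by (rule le_of_int_ceiling)
    note LL = blen_blen_le[OF m]
    have s0: "0 \<le> slack n" by (rule slack_nonneg)
    show ?thesis
    proof (cases "N < 2 ^ (w1 - 1)")
      case True
      have "length (small_bits m S) \<le> 2 * N + 2" using vl(3) by (simp add: length_small_bits N_def)
      also have "... \<le> 2 * 2 ^ w1 + 2" using less_le_trans[OF True power_increasing[of "w1 - 1" w1 "2::nat"]] by simp
      finally have "real (length (small_bits m S)) \<le> real (2 * 2 ^ w1 + 2)" by (simp only: of_nat_le_iff)
      then have l: "real (length (small_bits m S)) \<le> 2 * 2 ^ w1 + 2" by simp
      have "0 \<le> 2 * C * log 2 (log 2 (real m))" using C LL(2) by simp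
      moreover have "0 \<le> C * slack n" using C s0 by simp
      ultimately have len: "real (length (small_bits m S)) \<le>
          of_int (info_bound n (m * s)) + f n + 2 * C * log 2 (log 2 (real m))"
        using l lp ib C unfolding f_def by linarith
      have ne: "0 < (\<Sum>i<length S. card (S ! i))" and sub: "\<And>i. i < length S ==> S ! i \<subseteq> {..<m}"
        using v by (auto simp: valid_sets_def)
      have w2: "2 \<le> w1" by (simp add: w1_def)
      show ?thesis
      proof (rule exI[of _ "small_bits m S"], rule conjI[OF len], intro allI impI)
        fix w assume ok: "word_size_ok cw (m * s) w"
        have w: "length S * m < 2 ^ w" "0 < w"
          using word_size_ok_less[OF ok] N0 unfolding Nm by (simp_all add: N_def)
        note sa = small_answers[OF w2 w True[unfolded N_def] m sub ne t]
        show "serves w t w1 (small_bits m S) m s S" unfolding s serves_def using sa by blast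
      qed
    next
      case False
      have "N1 \<le> N" if "N1 \<le> w1 - 1" for N1
      proof -
        have "w1 - 1 < 2 ^ (w1 - 1)" by (rule less_exp)
        then show ?thesis using that False by linarith
      qed
      then have NN: "Nd \<le> length S * m" "Ns \<le> length S * m" by (auto simp: w1_def N_def)
      have sK: "length S \<le> Kc * n"
      proof -
        have "real (length S) \<le> K * real n" using a s by simp
        also have "... \<le> real Kc * real n" unfolding Kc_def by (intro mult_right_mono real_nat_ceiling_ge) simp
        finally have "real (length S) \<le> real (Kc * n)" by simp
        then show ?thesis by (simp only: of_nat_le_iff)
      qed
      define \<beta> where "\<beta> = real (blen (blen m))"
      have b0: "0 \<le> \<beta>" by (simp add: \<beta>_def)
      have "\<exists>bs. good_bits N m S bs \<and>
          real (length bs) \<le> log 2 (real (N choose n)) + C * (slack (nhat m n) + \<beta> + 1)"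
      proof (cases "length S * m < 2 * n * pg c (nhat m n)")
        case True
        obtain bs where bs: "good_bits N m S bs"
          "real (length bs) \<le> log 2 (real (N choose n)) + Cd * (slack (nhat m n) + 1)"
          using dense[OF v NN(1) True] by (auto simp: N_def)
        have "Cd * (slack (nhat m n) + 1) \<le> C * (slack (nhat m n) + \<beta> + 1)"
          using C b0 slack_nonneg[of "nhat m n"] by (intro mult_mono) auto
        then show ?thesis using bs by (intro exI[of _ bs]) auto
      next
        case False
        then have l: "2 * n * pg c (nhat m n) \<le> length S * m" by simp
        obtain bs where bs: "good_bits N m S bs"
          "real (length bs) \<le> log 2 (real (N choose n)) + Cs * (slack (nhat m n) + \<beta> + 1)"
          using sparse[OF v sK NN(2) l] by (auto simp: N_def \<beta>_def)
        have "Cs * (slack (nhat m n) + \<beta> + 1) \<le> C * (slack (nhat m n) + \<beta> + 1)"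
          using C b0 slack_nonneg[of "nhat m n"] by (intro mult_right_mono) auto
        then show ?thesis using bs by (intro exI[of _ bs]) auto
      qed
      then obtain bs where bs: "good_bits N m S bs"
        "real (length bs) \<le> log 2 (real (N choose n)) + C * (slack (nhat m n) + \<beta> + 1)" by blast
      \<comment> \<open>\<open>lg (lg m)\<close> enters twice, through \<open>nhat\<close> and
        through the header; the summand 5 is 2 * 2 + 1 from \<open>blen_blen_le\<close>. This is the
        origin of the factor \<open>2 * C\<close>.\<close>
      have "C * (slack (nhat m n) + \<beta> + 1) \<le> C * (slack n + 2 * log 2 (log 2 (real m)) + 5)"
        using slack_max[of n "blen (blen m)"] LL(1) C by (intro mult_left_mono) (auto simp: nhat_def \<beta>_def)
      also have "... = C * slack n + 5 * C + 2 * C * log 2 (log 2 (real m))" by (simp add: algebra_simps)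
      also have "... \<le> f n + 2 * C * log 2 (log 2 (real m))" unfolding f_def by simp
      finally have len: "real (length bs) \<le>
          of_int (info_bound n (m * s)) + f n + 2 * C * log 2 (log 2 (real m))"
        using bs(2) ib by linarith
      show ?thesis
      proof (rule exI[of _ bs], rule conjI[OF len], intro allI impI)
        fix w assume ok: "word_size_ok cw (m * s) w"
        have w: "length S * m < 2 ^ w"
          using word_size_ok_less[OF ok] N0 unfolding Nm by (simp add: N_def)
        have "(2::nat) ^ (w1 - 1) < 2 ^ w" using False w unfolding N_def by linarith
        then have "w1 - 1 < w" by (rule power_less_imp_less_exp[rotated]) simp
        then have ww: "16 \<le> w1" "w1 \<le> w" by (auto simp: w1_def)
        note ga = good_bits_answers[OF bs(1)[unfolded N_def] v ww w t]
        show "serves w t w1 bs m s S" unfolding s serves_def using ga by blast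
      qed
    qed
  qed
  show ?thesis
    by (rule exI[of _ f], rule exI[of _ "2 * C"], intro conjI fo allI,
        rule exI[of _ "query_program (P_RANK w1)"], rule exI[of _ "query_program (P_SELECT w1)"],
        rule exI[of _ "query_program (P_SIZE w1)"], rule exI[of _ t], intro allI impI)
      (rule main[unfolded serves_def])
qed

end
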